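(* Let $(G,F,\mathcal{C})$ be a framework, and let $H$ and $\eta_F$ satisfy (E1)–(E7). Let $\eta$ be a homeomorphic embedding of $G$ in $H$ extending $\eta_F$. Then for every $\eta$-bridge $B$ there exists $C\in\mathcal{C}$ such that $e\in E(C)$ for every $\eta$-attachment $e$ of $B$.
   Context: All graphs finite and simple; paths/circuits have no repeated vertices; the ends of a path are its first and last vertices and its end-edges its first and last edges. $G\setminus E'$ deletes the edge set $E'$ (keeping vertices). A sequence of vertices/edges of a path or circuit $C$ is "in order" if met in that order traversing $C$ (from an end if $C$ is a path, from some start if a circuit). $\delta_H(X)$ is the set of edges with exactly one end in $X$; a cubic graph is cyclically $k$-connected if it has girth $\ge k$ and $|\delta(X)|\ge k$ whenever both $X$ and its complement contain the vertex set of a circuit. Homeomorphic embedding $\eta$ of $G$ in $H$: injective vertex map; each edge $e=v_1v_2$ maps to a path $\eta(e)$ with ends $\eta(v_1),\eta(v_2)$; for distinct edges no edge or internal vertex of $\eta(e_1)$ is in $\eta(e_2)$; $\eta(v)\in\eta(e)$ iff $v$ is an end of $e$. $\eta(G)$ is the union of the images. An $\eta$-bridge is a connected subgraph $B$ of $H$ with no edge in $\eta(G)$ that is either a single edge with both ends in $V(\eta(G))$, or consists of all edges with at least one end in $V(K)$ (with their ends) for some component $K$ of $H\setminus V(\eta(G))$. An edge $e$ of $G$ is an $\eta$-attachment of $B$ if $\eta(e)$ and $B$ share a vertex. If $F$ is a subgraph of $G'$ and $\zeta$ is a homeomorphic embedding of $F$ in $H$, an embedding $\eta$ of $G'$ extends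 $\zeta$ if $\eta(e)=\zeta(e)$, $\eta(v)=\zeta(v)$ for all $e\in E(F)$, $v\in V(F)$. Framework: a triple $(G,F,\mathcal{C})$, $G$ cubic, $F\subseteq G$, $\mathcal{C}$ a set of subgraphs of $G\setminus E(F)$, such that (with $e,f$ twinned meaning distinct edges lying in $C_1\cap C_2$ for distinct $C_1,C_2\in\mathcal{C}$): (F1) each member is an induced subgraph of $G\setminus E(F)$ with $\ge3$ edges that is a path or circuit; (F2) every edge of $G\setminus E(F)$ is in some member, and any two edges with a common end not in $V(F)$ lie in a common member; (F3) if $C_1\ne C_2$ and $v\in V(C_1\cap C_2)$ then $V(C_1\cap C_2)=\{v\}$, or $v$ is incident with an edge of $C_1\cap C_2$, or $v\in V(F)$; (F4) if $C_1$ is a path, every member containing an end-edge of $C_1$ is a path, and if $C_2\ne C_1$ is also a path then every component of $C_1\cap C_2$ contains an end of $C_1$ and every edge of $C_1\cap C_2$ is an end-edge of $C_1$; (F5) a circuit $C\in\mathcal{C}$ has $|V(C\cap F)|\le1$ with each such vertex of degree 1 in $F$, and for a path $C\in\mathcal{C}$ every vertex of $C\cap F$ is an end of $C$ of degree 0 or 2 in $F$; (F6) if $e,f$ are twinned and $e\in E(C)$, $C\in\mathcal{C}$, then $|V(C)|\le6$ and either ($f\in E(C)$, $C$ a circuit, $e,f$ have a common end in $V(F)$, and no path of $\mathcal{C}$ contains a vertex of $e$ or $f$) or ($f\in E(C)$, $C$ a path with end-edges $e,f$, $C\cap F$ null) or ($f\notin E(C)$, $C$ a path with 3 edges, $e$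 an end-edge of $C$, no end of $e$ in $V(F)$); (F7) if $C\in\mathcal{C}$ is a path of length five with twinned end-edges $e,f$, then every path $C'\in\mathcal{C}\setminus\{C\}$ containing $e$ has $\le4$ edges, and, letting $C$ have vertices $v_0,\dots,v_5$ in order, some $C'\in\mathcal{C}$ has end-edges $e,f$ and ends $v_0,v_4$. Operations: for distinct edges $ab,cd$ of a cubic graph $G$, $G+(ab,cd)$ deletes $ab,cd$ and adds new vertices $x,y$ (its "new vertices", in this order) and edges $xa,xb,yc,yd,xy$; iterations are written $G+(e,f)+(g,h)$. For distinct edges $ab,cd,ef$ with $a,\dots,f$ distinct, $G+(ab,cd,ef)$ deletes them and adds new vertices $x,y,z,w$ and edges $xa,xb,yc,yd,ze,zf,wx,wy,wz$. Edges $ab,cd$ are diverse (in a graph) if $a,b,c,d$ are distinct and neither of $a,b$ is adjacent to $c$ or $d$. A trinity is a set of three distinct edges $\{e,f,g\}$ of $G$ such that no member of $\mathcal{C}$ contains all three but each pair is contained in some member; it is diverse if every two of its edges are diverse in $G\setminus E(F)$. Two edges of $G\setminus E(F)$ are distant if they are diverse in $G$ and not twinned. Let $J$ be $F$ with its degree-one vertices (in $F$) deleted; an embedding $\eta$ of a cubic $G'\supseteq J$ respects $\eta_F$ if it extends the restriction of $\eta_F$ to $J$. Cross extensions of $G$ over $C\in\mathcal{C}$: (first kind) $G+(e,g)+(f,h)$ where $e,f,g,h$ are distinct edges of $C$ in order, $e,g$ distant and $f,h$ distant; (second kind) $G+(e,uv)+(uy,f)$ where $e,uv,f$ are distinct edges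 of $C$ with either $e,u,v,f$ in order or $f,e,u,v$ in order, $e,uv$ distant and $uv,f$ distant, and $x,y$ the new vertices of $G+(e,uv)$; (third kind) $G+(u_1v_1,u_2v_2)+(xv_1,yv_2)$ where $u_1v_1,u_2v_2$ are distant edges of $C$ with $u_1,v_1,u_2,v_2$ in order and $x,y$ the new vertices of $G+(u_1v_1,u_2v_2)$. Conditions, for a framework $(G,F,\mathcal{C})$, a cubic graph $H$, and a homeomorphic embedding $\eta_F$ of $F$ in $H$: (E1) $H$ is cubic and cyclically four-connected, and cyclically five-connected if $(G,F,\mathcal{C})$ has any twinned edges; and $\eta_F(e)$ has exactly one edge for each $e\in E(F)$. (E2) For distinct $e,f\in E(G)\setminus E(F)$: if some homeomorphic embedding of $G+(e,f)$ in $H$ respects $\eta_F$, then some $C\in\mathcal{C}$ contains $e,f$. (E3) For every diverse trinity $\{e,f,g\}$ there is no homeomorphic embedding of $G+(e,f,g)$ in $H$ extending $\eta_F$. (E4) Let $v$ have degree one in $F$, incident with $g\in E(F)$, and let $C_1,C_2$ be the two members of $\mathcal{C}$ containing $v$. For all $e_1\in E(C_1)\setminus E(C_2)$ and $e_2\in E(C_2)\setminus E(C_1)$ with no common end, there is no homeomorphic embedding of $G+(e_1,g)+(e_2,vy)$ in $H$ respecting $\eta_F$, where $x,y$ are the new vertices of $G+(e_1,g)$. (E5) Let $v$ have degree one in $F$, incident with $g\in E(F)$; let $u$ be a neighbour of $v$ in $G\setminus E(F)$, let $C_0$ be the member of $\mathcal{C}$ containing $u$ but not $v$ (it is unique), and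 let $u$ have neighbours $v,w_1,w_2$. Let $G'=G+(uw_1,g)$ with new vertices $x_1,y_1$, and $G''=G'+(uw_2,vy_1)$ with new vertices $x_2,y_2$. Let $i\in\{1,2\}$, $e=ux_i$, and let $f$ be an edge of $C_0$ not incident with $w_1$ or $w_2$ and with no end adjacent to $w_i$. There is no homeomorphic embedding of $G''+(e,f)$ in $H$ respecting $\eta_F$. (E6) For each $C\in\mathcal{C}$ and every cross extension $G'$ of $G$ over $C$ of the first, second or third kind, there is no homeomorphic embedding of $G'$ in $H$ extending $\eta_F$. (E7) Let $C\in\mathcal{C}$ be a path with $|E(C)|=5$, vertices $v_0,\dots,v_5$ in order, with $v_0v_1$ and $v_4v_5$ twinned. Let $G_1=G+(v_0v_1,v_4v_5)$ with new vertices $x_1,y_1$; $G_2=G_1+(v_1v_2,y_1v_5)$ with new vertices $x_2,y_2$; $G_3=G_2+(v_0x_1,y_2v_5)$. There is no homeomorphic embedding of $G_3$ in $H$ extending $\eta_F$. *)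

theory Defs
  imports Main "HOL-Library.Sublist" "HOL-Library.Infinite_Typeclass"
begin

section \<open>Finite simple graphs\<close>

datatype 'a graph = Graph (verts: "'a set") (edges: "'a set set")

definition simple_graph :: "'a graph \<Rightarrow> bool" where
  "simple_graph G \<longleftrightarrow> finite (verts G) \<and> (\<forall>e\<in>edges G. e \<subseteq> verts G \<and> card e = 2)"

definition subgraph :: "'a graph \<Rightarrow> 'a graph \<Rightarrow> bool" where
  "subgraph K G \<longleftrightarrow> verts K \<subseteq> verts G \<and> edges K \<subseteq> edges G \<and> (\<forall>e\<in>edges K. e \<subseteq> verts K)"

definition induced_subgraph :: "'a graph \<Rightarrow> 'a graph \<Rightarrow> bool" where
  "induced_subgraph K G \<longleftrightarrow> subgraph K G \<and> (\<forall>e\<in>edges G. e \<subseteq> verts K \<longrightarrow> e \<in> edges K)"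

definition degree :: "'a graph \<Rightarrow> 'a \<Rightarrow> nat" where
  "degree G v = card {e \<in> edges G. v \<in> e}"

definition adjacent :: "'a graph \<Rightarrow> 'a \<Rightarrow> 'a \<Rightarrow> bool" where
  "adjacent G u v \<longleftrightarrow> {u, v} \<in> edges G"

text \<open>Cubic graphs are taken to be non-null; other graphs may be null.\<close>

definition cubic :: "'a graph \<Rightarrow> bool" where
  "cubic G \<longleftrightarrow> simple_graph G \<and> verts G \<noteq> {} \<and> (\<forall>v\<in>verts G. degree G v = 3)"

definition delete_edges :: "'a graph \<Rightarrow> 'a set set \<Rightarrow> 'a graph" where
  "delete_edges G D = Graph (verts G) (edges G - D)"

definition delete_verts :: "'a graph \<Rightarrow> 'a set \<Rightarrow> 'a graph" where
  "delete_verts G X = Graph (verts G - X) {e \<in> edges G. e \<inter> X = {}}"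

definition graph_inter :: "'a graph \<Rightarrow> 'a graph \<Rightarrow> 'a graph" where
  "graph_inter G K = Graph (verts G \<inter> verts K) (edges G \<inter> edges K)"

definition connected_graph :: "'a graph \<Rightarrow> bool" where
  "connected_graph G \<longleftrightarrow> verts G \<noteq> {} \<and>
     (\<forall>u\<in>verts G. \<forall>v\<in>verts G. (u, v) \<in> {(a, b). adjacent G a b}\<^sup>*)"

definition component :: "'a graph \<Rightarrow> 'a graph \<Rightarrow> bool" where
  "component K G \<longleftrightarrow> subgraph K G \<and> connected_graph K \<and>
     (\<forall>K'. subgraph K' G \<longrightarrow> connected_graph K' \<longrightarrow> subgraph K K' \<longrightarrow> K' = K)"

text \<open>Edges \<open>e\<close> and \<open>f\<close> are diverse if their four ends are distinct and no end of \<open>e\<close> is adjacent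
  to an end of \<open>f\<close>.\<close>

definition diverse :: "'a graph \<Rightarrow> 'a set \<Rightarrow> 'a set \<Rightarrow> bool" where
  "diverse G e f \<longleftrightarrow> e \<in> edges G \<and> f \<in> edges G \<and> e \<inter> f = {} \<and>
     (\<forall>a\<in>e. \<forall>c\<in>f. \<not> adjacent G a c)"


section \<open>Paths and circuits\<close>

text \<open>A path is a graph; \<open>path_listing vs P\<close> says that \<open>vs\<close> lists its vertices from one end to the
  other. A path with at least one edge has exactly two listings, reverse to each other. A circuit
  has one listing for every choice of a first vertex and a direction.\<close>

definition consecutive_pairs :: "'a list \<Rightarrow> 'a set set" where
  "consecutive_pairs vs = {{vs ! i, vs ! Suc i} | i. Suc i < length vs}"

definition path_listing :: "'a list \<Rightarrow> 'a graph \<Rightarrow> bool" where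
  "path_listing vs P \<longleftrightarrow> vs \<noteq> [] \<and> distinct vs \<and> P = Graph (set vs) (consecutive_pairs vs)"

definition circuit_listing :: "'a list \<Rightarrow> 'a graph \<Rightarrow> bool" where
  "circuit_listing vs P \<longleftrightarrow> 3 \<le> length vs \<and> distinct vs \<and>
     P = Graph (set vs) (insert {last vs, hd vs} (consecutive_pairs vs))"

definition is_path :: "'a graph \<Rightarrow> bool" where
  "is_path P \<longleftrightarrow> (\<exists>vs. path_listing vs P)"

definition is_circuit :: "'a graph \<Rightarrow> bool" where
  "is_circuit P \<longleftrightarrow> (\<exists>vs. circuit_listing vs P)"

definition ends :: "'a graph \<Rightarrow> 'a set" where
  "ends P = {v. \<exists>vs. path_listing vs P \<and> (v = hd vs \<or> v = last vs)}"

definition end_edges :: "'a graph \<Rightarrow> 'a set set" where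
  "end_edges P = {e. \<exists>vs. path_listing vs P \<and> 2 \<le> length vs \<and>
     (e = {vs ! 0, vs ! 1} \<or> e = {vs ! (length vs - 2), vs ! (length vs - 1)})}"

definition internal_verts :: "'a graph \<Rightarrow> 'a set" where
  "internal_verts P = verts P - ends P"

text \<open>Sequences that are in order may mix vertices and edges; a traversal meets vertices and edges
  alternately. A traversal of a circuit may start at any vertex or edge.\<close>

datatype 'a elem = Vertex 'a | Edge "'a set"

fun walk_elems :: "'a list \<Rightarrow> 'a elem list" where
  "walk_elems [] = []"
| "walk_elems [v] = [Vertex v]"
| "walk_elems (v # w # vs) = Vertex v # Edge {v, w} # walk_elems (w # vs)"

definition traversal :: "'a graph \<Rightarrow> 'a elem list \<Rightarrow> bool" where
  "traversal C s \<longleftrightarrow>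
     (\<exists>vs. path_listing vs C \<and> s = walk_elems vs) \<or>
     (\<exists>vs n. circuit_listing vs C \<and> s = rotate n (walk_elems vs @ [Edge {last vs, hd vs}]))"

definition in_order :: "'a graph \<Rightarrow> 'a elem list \<Rightarrow> bool" where
  "in_order C xs \<longleftrightarrow> (\<exists>s. traversal C s \<and> subseq xs s)"


section \<open>Cyclic connectivity\<close>

definition cut :: "'a graph \<Rightarrow> 'a set \<Rightarrow> 'a set set" where
  "cut H X = {e \<in> edges H. card (e \<inter> X) = 1}"

definition cyclically_connected :: "nat \<Rightarrow> 'a graph \<Rightarrow> bool" where
  "cyclically_connected k H \<longleftrightarrow> cubic H \<and>
     (\<forall>C. subgraph C H \<longrightarrow> is_circuit C \<longrightarrow> k \<le> card (edges C)) \<and>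
     (\<forall>X \<subseteq> verts H.
        (\<exists>C. subgraph C H \<and> is_circuit C \<and> verts C \<subseteq> X) \<longrightarrow>
        (\<exists>C. subgraph C H \<and> is_circuit C \<and> verts C \<subseteq> verts H - X) \<longrightarrow>
        k \<le> card (cut H X))"


section \<open>Homeomorphic embeddings and bridges\<close>

datatype ('a, 'b) embedding = Embedding (vmap: "'a \<Rightarrow> 'b") (emap: "'a set \<Rightarrow> 'b graph")

definition hom_embedding :: "('a, 'b) embedding \<Rightarrow> 'a graph \<Rightarrow> 'b graph \<Rightarrow> bool" where
  "hom_embedding \<eta> G H \<longleftrightarrow>
     inj_on (vmap \<eta>) (verts G) \<and> vmap \<eta> ` verts G \<subseteq> verts H \<and>
     (\<forall>e\<in>edges G. is_path (emap \<eta> e) \<and> subgraph (emap \<eta> e) H \<and> ends (emap \<eta> e) = vmap \<eta> ` e) \<and>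
     (\<forall>e\<in>edges G. \<forall>f\<in>edges G. e \<noteq> f \<longrightarrow>
        edges (emap \<eta> e) \<inter> edges (emap \<eta> f) = {} \<and>
        internal_verts (emap \<eta> e) \<inter> verts (emap \<eta> f) = {}) \<and>
     (\<forall>v\<in>verts G. \<forall>e\<in>edges G. vmap \<eta> v \<in> verts (emap \<eta> e) \<longleftrightarrow> v \<in> e)"

definition image_graph :: "('a, 'b) embedding \<Rightarrow> 'a graph \<Rightarrow> 'b graph" where
  "image_graph \<eta> G = Graph (vmap \<eta> ` verts G \<union> (\<Union>e\<in>edges G. verts (emap \<eta> e)))
                         (\<Union>e\<in>edges G. edges (emap \<eta> e))"

text \<open>\<open>extends \<eta> \<zeta> F\<close>: the embedding \<open>\<eta>\<close> extends the embedding \<open>\<zeta>\<close> of \<open>F\<close>.\<close>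

definition extends :: "('a, 'b) embedding \<Rightarrow> ('a, 'b) embedding \<Rightarrow> 'a graph \<Rightarrow> bool" where
  "extends \<eta> \<zeta> F \<longleftrightarrow> (\<forall>e\<in>edges F. emap \<eta> e = emap \<zeta> e) \<and> (\<forall>v\<in>verts F. vmap \<eta> v = vmap \<zeta> v)"

definition bridge :: "('a, 'b) embedding \<Rightarrow> 'a graph \<Rightarrow> 'b graph \<Rightarrow> 'b graph \<Rightarrow> bool" where
  "bridge \<eta> G H B \<longleftrightarrow>
     subgraph B H \<and> connected_graph B \<and> edges B \<inter> edges (image_graph \<eta> G) = {} \<and>
     ((\<exists>e. B = Graph e {e} \<and> e \<subseteq> verts (image_graph \<eta> G)) \<or>
      (\<exists>K. component K (delete_verts H (verts (image_graph \<eta> G))) \<and>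
           B = (let D = {e \<in> edges H. e \<inter> verts K \<noteq> {}} in Graph (\<Union>D) D)))"

definition attachment :: "('a, 'b) embedding \<Rightarrow> 'a graph \<Rightarrow> 'b graph \<Rightarrow> 'a set \<Rightarrow> bool" where
  "attachment \<eta> G B e \<longleftrightarrow> e \<in> edges G \<and> verts (emap \<eta> e) \<inter> verts B \<noteq> {}"


section \<open>Adding vertices and edges\<close>

text \<open>\<open>plus2 G e f x y G'\<close> says that \<open>G'\<close> is \<open>G + (e, f)\<close> with new vertices \<open>x\<close> (subdividing \<open>e\<close>)
  and \<open>y\<close> (subdividing \<open>f\<close>), in this order. It is a relation because the new vertices may be any
  vertices not in \<open>G\<close>; such vertices exist when the finite graph \<open>G\<close> has vertices in an infinite
  type. Likewise \<open>plus3 G e f g G'\<close> says that \<open>G'\<close> is \<open>G + (e, f, g)\<close> for some choice of the new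
  vertices.\<close>

definition plus2 ::
    "'a graph \<Rightarrow> 'a set \<Rightarrow> 'a set \<Rightarrow> 'a \<Rightarrow> 'a \<Rightarrow> 'a graph \<Rightarrow> bool" where
  "plus2 G e f x y G' \<longleftrightarrow>
     e \<in> edges G \<and> f \<in> edges G \<and> e \<noteq> f \<and> x \<notin> verts G \<and> y \<notin> verts G \<and> x \<noteq> y \<and>
     G' = Graph (verts G \<union> {x, y})
       ((edges G - {e, f}) \<union> {{x, a} | a. a \<in> e} \<union> {{y, c} | c. c \<in> f} \<union> {{x, y}})"

definition plus3 ::
    "'a graph \<Rightarrow> 'a set \<Rightarrow> 'a set \<Rightarrow> 'a set \<Rightarrow> 'a graph \<Rightarrow> bool" where
  "plus3 G e f g G' \<longleftrightarrow>
     e \<in> edges G \<and> f \<in> edges G \<and> g \<in> edges G \<and>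
     e \<inter> f = {} \<and> e \<inter> g = {} \<and> f \<inter> g = {} \<and>
     (\<exists>x y z w. distinct [x, y, z, w] \<and> {x, y, z, w} \<inter> verts G = {} \<and>
        G' = Graph (verts G \<union> {x, y, z, w})
          ((edges G - {e, f, g}) \<union> {{x, a} | a. a \<in> e} \<union> {{y, a} | a. a \<in> f} \<union> {{z, a} | a. a \<in> g}
            \<union> {{w, x}, {w, y}, {w, z}}))"


section \<open>Frameworks\<close>

definition twinned :: "'a graph set \<Rightarrow> 'a set \<Rightarrow> 'a set \<Rightarrow> bool" where
  "twinned \<C> e f \<longleftrightarrow> e \<noteq> f \<and>
     (\<exists>C1\<in>\<C>. \<exists>C2\<in>\<C>. C1 \<noteq> C2 \<and> {e, f} \<subseteq> edges (graph_inter C1 C2))"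

definition F1 :: "'a graph \<Rightarrow> 'a graph \<Rightarrow> 'a graph set \<Rightarrow> bool" where
  "F1 G F \<C> \<longleftrightarrow> (\<forall>C\<in>\<C>. induced_subgraph C (delete_edges G (edges F)) \<and>
     3 \<le> card (edges C) \<and> (is_path C \<or> is_circuit C))"

definition F2 :: "'a graph \<Rightarrow> 'a graph \<Rightarrow> 'a graph set \<Rightarrow> bool" where
  "F2 G F \<C> \<longleftrightarrow>
     (\<forall>e\<in>edges (delete_edges G (edges F)). \<exists>C\<in>\<C>. e \<in> edges C) \<and>
     (\<forall>e\<in>edges G. \<forall>f\<in>edges G. (\<exists>v. v \<in> e \<and> v \<in> f \<and> v \<notin> verts F) \<longrightarrow>
        (\<exists>C\<in>\<C>. e \<in> edges C \<and> f \<in> edges C))"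

definition F3 :: "'a graph \<Rightarrow> 'a graph set \<Rightarrow> bool" where
  "F3 F \<C> \<longleftrightarrow> (\<forall>C1\<in>\<C>. \<forall>C2\<in>\<C>. C1 \<noteq> C2 \<longrightarrow>
     (\<forall>v\<in>verts (graph_inter C1 C2).
        verts (graph_inter C1 C2) = {v} \<or>
        (\<exists>e\<in>edges (graph_inter C1 C2). v \<in> e) \<or> v \<in> verts F))"

definition F4 :: "'a graph set \<Rightarrow> bool" where
  "F4 \<C> \<longleftrightarrow> (\<forall>C1\<in>\<C>. is_path C1 \<longrightarrow>
     (\<forall>C2\<in>\<C>. edges C2 \<inter> end_edges C1 \<noteq> {} \<longrightarrow> is_path C2) \<and>
     (\<forall>C2\<in>\<C>. C2 \<noteq> C1 \<longrightarrow> is_path C2 \<longrightarrow>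
        (\<forall>K. component K (graph_inter C1 C2) \<longrightarrow> verts K \<inter> ends C1 \<noteq> {}) \<and>
        edges (graph_inter C1 C2) \<subseteq> end_edges C1))"

definition F5 :: "'a graph \<Rightarrow> 'a graph set \<Rightarrow> bool" where
  "F5 F \<C> \<longleftrightarrow> (\<forall>C\<in>\<C>.
     (is_circuit C \<longrightarrow> card (verts (graph_inter C F)) \<le> 1 \<and>
        (\<forall>v\<in>verts (graph_inter C F). degree F v = 1)) \<and>
     (is_path C \<longrightarrow> (\<forall>v\<in>verts (graph_inter C F). v \<in> ends C \<and> degree F v \<in> {0, 2})))"

definition F6 :: "'a graph \<Rightarrow> 'a graph set \<Rightarrow> bool" where
  "F6 F \<C> \<longleftrightarrow> (\<forall>e f. twinned \<C> e f \<longrightarrow> (\<forall>C\<in>\<C>. e \<in> edges C \<longrightarrow>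
     card (verts C) \<le> 6 \<and>
     ((f \<in> edges C \<and> is_circuit C \<and> (\<exists>v\<in>verts F. v \<in> e \<and> v \<in> f) \<and>
         (\<forall>P\<in>\<C>. is_path P \<longrightarrow> verts P \<inter> (e \<union> f) = {})) \<or>
      (f \<in> edges C \<and> is_path C \<and> end_edges C = {e, f} \<and> verts (graph_inter C F) = {}) \<or>
      (f \<notin> edges C \<and> is_path C \<and> card (edges C) = 3 \<and> e \<in> end_edges C \<and> e \<inter> verts F = {}))))"

text \<open>In \<open>F7\<close> the vertices of \<open>C\<close> can be numbered in order from either end, and the condition is
  required for both numberings; likewise either end-edge can play the role of \<open>e\<close>.\<close>

definition F7 :: "'a graph set \<Rightarrow> bool" where
  "F7 \<C> \<longleftrightarrow> (\<forall>C\<in>\<C>. \<forall>e f.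
     is_path C \<and> card (edges C) = 5 \<and> end_edges C = {e, f} \<and> twinned \<C> e f \<longrightarrow>
     (\<forall>C'\<in>\<C> - {C}. is_path C' \<longrightarrow> e \<in> edges C' \<longrightarrow> card (edges C') \<le> 4) \<and>
     (\<forall>v0 v1 v2 v3 v4 v5. path_listing [v0, v1, v2, v3, v4, v5] C \<longrightarrow>
        (\<exists>C'\<in>\<C>. is_path C' \<and> end_edges C' = {e, f} \<and> ends C' = {v0, v4})))"

definition framework :: "'a graph \<Rightarrow> 'a graph \<Rightarrow> 'a graph set \<Rightarrow> bool" where
  "framework G F \<C> \<longleftrightarrow> cubic G \<and> subgraph F G \<and>
     (\<forall>C\<in>\<C>. subgraph C (delete_edges G (edges F))) \<and>
     F1 G F \<C> \<and> F2 G F \<C> \<and> F3 F \<C> \<and> F4 \<C> \<and> F5 F \<C> \<and> F6 F \<C> \<and> F7 \<C>"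

definition trinity :: "'a graph \<Rightarrow> 'a graph set \<Rightarrow> 'a set \<Rightarrow> 'a set \<Rightarrow> 'a set \<Rightarrow> bool" where
  "trinity G \<C> e f g \<longleftrightarrow>
     {e, f, g} \<subseteq> edges G \<and> distinct [e, f, g] \<and>
     \<not> (\<exists>C\<in>\<C>. {e, f, g} \<subseteq> edges C) \<and>
     (\<exists>C\<in>\<C>. {e, f} \<subseteq> edges C) \<and> (\<exists>C\<in>\<C>. {e, g} \<subseteq> edges C) \<and> (\<exists>C\<in>\<C>. {f, g} \<subseteq> edges C)"

definition diverse_trinity ::
    "'a graph \<Rightarrow> 'a graph \<Rightarrow> 'a graph set \<Rightarrow> 'a set \<Rightarrow> 'a set \<Rightarrow> 'a set \<Rightarrow> bool" where
  "diverse_trinity G F \<C> e f g \<longleftrightarrow> trinity G \<C> e f g \<and>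
     diverse (delete_edges G (edges F)) e f \<and>
     diverse (delete_edges G (edges F)) e g \<and>
     diverse (delete_edges G (edges F)) f g"

definition distant ::
    "'a graph \<Rightarrow> 'a graph \<Rightarrow> 'a graph set \<Rightarrow> 'a set \<Rightarrow> 'a set \<Rightarrow> bool" where
  "distant G F \<C> e f \<longleftrightarrow>
     e \<in> edges (delete_edges G (edges F)) \<and> f \<in> edges (delete_edges G (edges F)) \<and>
     diverse G e f \<and> \<not> twinned \<C> e f"

definition delete_leaves :: "'a graph \<Rightarrow> 'a graph" where
  "delete_leaves F = delete_verts F {v \<in> verts F. degree F v = 1}"

definition respects_embedding :: "('a, 'b) embedding \<Rightarrow> ('a, 'b) embedding \<Rightarrow> 'a graph \<Rightarrow> bool" where
  "respects_embedding \<eta> \<eta>\<^sub>F F \<longleftrightarrow> extends \<eta> \<eta>\<^sub>F (delete_leaves F)"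


section \<open>Cross extensions\<close>

definition cross_extension1 ::
    "'a graph \<Rightarrow> 'a graph \<Rightarrow> 'a graph set \<Rightarrow> 'a graph \<Rightarrow> 'a graph \<Rightarrow> bool" where
  "cross_extension1 G F \<C> C G' \<longleftrightarrow>
     (\<exists>e f g h x y x' y' G1.
        {e, f, g, h} \<subseteq> edges C \<and> distinct [e, f, g, h] \<and>
        in_order C [Edge e, Edge f, Edge g, Edge h] \<and>
        distant G F \<C> e g \<and> distant G F \<C> f h \<and>
        plus2 G e g x y G1 \<and> plus2 G1 f h x' y' G')"

definition cross_extension2 ::
    "'a graph \<Rightarrow> 'a graph \<Rightarrow> 'a graph set \<Rightarrow> 'a graph \<Rightarrow> 'a graph \<Rightarrow> bool" where
  "cross_extension2 G F \<C> C G' \<longleftrightarrow>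
     (\<exists>e u v f x y x' y' G1.
        {e, {u, v}, f} \<subseteq> edges C \<and> distinct [e, {u, v}, f] \<and>
        (in_order C [Edge e, Vertex u, Vertex v, Edge f] \<or>
         in_order C [Edge f, Edge e, Vertex u, Vertex v]) \<and>
        distant G F \<C> e {u, v} \<and> distant G F \<C> {u, v} f \<and>
        plus2 G e {u, v} x y G1 \<and> plus2 G1 {u, y} f x' y' G')"

definition cross_extension3 ::
    "'a graph \<Rightarrow> 'a graph \<Rightarrow> 'a graph set \<Rightarrow> 'a graph \<Rightarrow> 'a graph \<Rightarrow> bool" where
  "cross_extension3 G F \<C> C G' \<longleftrightarrow>
     (\<exists>u1 v1 u2 v2 x y x' y' G1.
        {{u1, v1}, {u2, v2}} \<subseteq> edges C \<and>
        in_order C [Vertex u1, Vertex v1, Vertex u2, Vertex v2] \<and>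
        distant G F \<C> {u1, v1} {u2, v2} \<and>
        plus2 G {u1, v1} {u2, v2} x y G1 \<and> plus2 G1 {x, v1} {y, v2} x' y' G')"


section \<open>The conditions on the framework, \<open>H\<close> and \<open>\<eta>\<^sub>F\<close>\<close>

definition E1 ::
    "'a graph \<Rightarrow> 'a graph set \<Rightarrow> 'b graph \<Rightarrow> ('a, 'b) embedding \<Rightarrow> bool" where
  "E1 F \<C> H \<eta>\<^sub>F \<longleftrightarrow> cubic H \<and> cyclically_connected 4 H \<and>
     ((\<exists>e f. twinned \<C> e f) \<longrightarrow> cyclically_connected 5 H) \<and>
     (\<forall>e\<in>edges F. card (edges (emap \<eta>\<^sub>F e)) = 1)"

definition E2 ::
    "'a graph \<Rightarrow> 'a graph \<Rightarrow> 'a graph set \<Rightarrow> 'b graph \<Rightarrow> ('a, 'b) embedding \<Rightarrow> bool" where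
  "E2 G F \<C> H \<eta>\<^sub>F \<longleftrightarrow>
     (\<forall>e\<in>edges G - edges F. \<forall>f\<in>edges G - edges F. e \<noteq> f \<longrightarrow>
        (\<exists>x y G' \<eta>. plus2 G e f x y G' \<and> hom_embedding \<eta> G' H \<and> respects_embedding \<eta> \<eta>\<^sub>F F) \<longrightarrow>
        (\<exists>C\<in>\<C>. e \<in> edges C \<and> f \<in> edges C))"

definition E3 ::
    "'a graph \<Rightarrow> 'a graph \<Rightarrow> 'a graph set \<Rightarrow> 'b graph \<Rightarrow> ('a, 'b) embedding \<Rightarrow> bool" where
  "E3 G F \<C> H \<eta>\<^sub>F \<longleftrightarrow>
     (\<forall>e f g. diverse_trinity G F \<C> e f g \<longrightarrow>
        \<not> (\<exists>G' \<eta>. plus3 G e f g G' \<and> hom_embedding \<eta> G' H \<and> extends \<eta> \<eta>\<^sub>F F))"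

text \<open>In \<open>E4\<close> a framework has exactly two members containing \<open>v\<close>; they may be named \<open>C1\<close> and \<open>C2\<close>
  in either order.\<close>

definition E4 ::
    "'a graph \<Rightarrow> 'a graph \<Rightarrow> 'a graph set \<Rightarrow> 'b graph \<Rightarrow> ('a, 'b) embedding \<Rightarrow> bool" where
  "E4 G F \<C> H \<eta>\<^sub>F \<longleftrightarrow>
     (\<forall>v g. v \<in> verts F \<and> degree F v = 1 \<and> g \<in> edges F \<and> v \<in> g \<longrightarrow>
        (\<forall>C1\<in>\<C>. \<forall>C2\<in>\<C>. C1 \<noteq> C2 \<and> v \<in> verts C1 \<and> v \<in> verts C2 \<longrightarrow>
           (\<forall>e1\<in>edges C1 - edges C2. \<forall>e2\<in>edges C2 - edges C1. e1 \<inter> e2 = {} \<longrightarrow>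
              \<not> (\<exists>x y x' y' G1 G' \<eta>. plus2 G e1 g x y G1 \<and> plus2 G1 e2 {v, y} x' y' G' \<and>
                    hom_embedding \<eta> G' H \<and> respects_embedding \<eta> \<eta>\<^sub>F F))))"

definition E5 ::
    "'a graph \<Rightarrow> 'a graph \<Rightarrow> 'a graph set \<Rightarrow> 'b graph \<Rightarrow> ('a, 'b) embedding \<Rightarrow> bool" where
  "E5 G F \<C> H \<eta>\<^sub>F \<longleftrightarrow>
     (\<forall>v g u C0 w1 w2.
        v \<in> verts F \<and> degree F v = 1 \<and> g \<in> edges F \<and> v \<in> g \<and>
        adjacent (delete_edges G (edges F)) u v \<and>
        C0 \<in> \<C> \<and> u \<in> verts C0 \<and> v \<notin> verts C0 \<and>
        distinct [v, w1, w2] \<and> {w. adjacent G u w} = {v, w1, w2} \<longrightarrow>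
        (\<forall>x1 y1 G' x2 y2 G''.
           plus2 G {u, w1} g x1 y1 G' \<and> plus2 G' {u, w2} {v, y1} x2 y2 G'' \<longrightarrow>
           (\<forall>(x, w)\<in>{(x1, w1), (x2, w2)}. \<forall>f\<in>edges C0.
              w1 \<notin> f \<and> w2 \<notin> f \<and> (\<forall>a\<in>f. \<not> adjacent G a w) \<longrightarrow>
              \<not> (\<exists>x' y' G''' \<eta>. plus2 G'' {u, x} f x' y' G''' \<and>
                    hom_embedding \<eta> G''' H \<and> respects_embedding \<eta> \<eta>\<^sub>F F))))"

definition E6 ::
    "'a graph \<Rightarrow> 'a graph \<Rightarrow> 'a graph set \<Rightarrow> 'b graph \<Rightarrow> ('a, 'b) embedding \<Rightarrow> bool" where
  "E6 G F \<C> H \<eta>\<^sub>F \<longleftrightarrow>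
     (\<forall>C\<in>\<C>. \<forall>G'.
        cross_extension1 G F \<C> C G' \<or> cross_extension2 G F \<C> C G' \<or> cross_extension3 G F \<C> C G' \<longrightarrow>
        \<not> (\<exists>\<eta>. hom_embedding \<eta> G' H \<and> extends \<eta> \<eta>\<^sub>F F))"

definition E7 ::
    "'a graph \<Rightarrow> 'a graph \<Rightarrow> 'a graph set \<Rightarrow> 'b graph \<Rightarrow> ('a, 'b) embedding \<Rightarrow> bool" where
  "E7 G F \<C> H \<eta>\<^sub>F \<longleftrightarrow>
     (\<forall>C\<in>\<C>. \<forall>v0 v1 v2 v3 v4 v5.
        path_listing [v0, v1, v2, v3, v4, v5] C \<and> twinned \<C> {v0, v1} {v4, v5} \<longrightarrow>
        \<not> (\<exists>x1 y1 G1 x2 y2 G2 x3 y3 G3 \<eta>.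
              plus2 G {v0, v1} {v4, v5} x1 y1 G1 \<and>
              plus2 G1 {v1, v2} {y1, v5} x2 y2 G2 \<and>
              plus2 G2 {v0, x1} {y2, v5} x3 y3 G3 \<and>
              hom_embedding \<eta> G3 H \<and> extends \<eta> \<eta>\<^sub>F F))"

end

theory Submission
  imports Defs
begin

text \<open>
  In a cubic graph edge-disjoint linkages are vertex-disjoint, so every rerouting is done with
  edge-disjoint connections, and paths are extracted only once, when an embedding is assembled.
  If the attachments of a bridge lie in no common member, then three of them form a trinity, and the
  bridge yields an embedding of \<open>G\<close> with a claw attached to these three edges. Disjoint edges of the
  trinity are diverse (then (E3) applies) or are joined by an edge on which a pentagon of the image
  can be rerouted. Otherwise the three edges can be chosen as \<open>f\<close>, \<open>h\<close>, \<open>k\<close> with \<open>f\<close>, \<open>h\<close> and a third edge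
  \<open>e\<close> at one vertex and \<open>e\<close>, \<open>k\<close> twinned. If \<open>e\<close>, \<open>k\<close> end a path, a pentagon is rerouted again. If they
  meet in a vertex of \<open>F\<close>, the claw and this corner form a cluster with four legs; by cyclic
  5-connectivity some path leaves the cluster without using a leg, and it lands on an edge \<open>j\<close> of \<open>G\<close>.
  A finite table lists the routings inside the cluster that are available however the path leaves it,
  and each choice of \<open>j\<close> then contradicts (E2), (E4) or (E5).
\<close>

text \<open>The obstacle is that a path leaving a cluster need not stay clear of the legs: it may
  hit one. The cluster then swallows that leg up to the point hit, and the next edge leaving the
  enlarged region may start on the swallowed piece. No single routing survives this. What survives
  is a finite list of types, a type being a set of routings that are all available at once: hitting
  a leg turns one type of the list into another, and checking this is a finite computation on lists
  of numbers. Fewer legs than the cyclic connectivity cannot separate, so the region grows until a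
  path reaches the rest of the image. Two clusters are treated in this way. If the three attachments
  have a common vertex, the claw forms a cluster with three legs, for which cyclic 4-connectivity is
  enough; the edge reached takes the place of one of the three. The twinned corner has four legs,
  and (E1) grants cyclic 5-connectivity because twinned edges exist. Its fourth leg is an edge of
  \<open>F\<close>, whose image is a single edge, so that this leg cannot be hit before its far
  end.\<close>

section \<open>Connections and edge-disjoint linkages\<close>

definition conn :: "'b set set \<Rightarrow> 'b \<Rightarrow> 'b \<Rightarrow> bool" where
  "conn T = (\<lambda>p q. {p, q} \<in> T)\<^sup>*\<^sup>*"

lemma conn_refl [simp]: "conn T p p"
  by (simp add: conn_def)

lemma conn_edge: "{p, q} \<in> T \<Longrightarrow> conn T p q"
  by (auto simp: conn_def)

lemma conn_trans: "conn T p q \<Longrightarrow> conn T q r \<Longrightarrow> conn T p r"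
  unfolding conn_def by (rule rtranclp_trans)

lemma conn_sym: "conn T p q \<Longrightarrow> conn T q p"
proof -
  have "symp (\<lambda>p q. {p, q} \<in> T)" by (simp add: symp_def insert_commute)
  then show "conn T p q \<Longrightarrow> conn T q p"
    unfolding conn_def by (metis symp_rtranclp sympD)
qed

lemma conn_mono: "conn T p q \<Longrightarrow> T \<subseteq> T' \<Longrightarrow> conn T' p q"
  unfolding conn_def by (smt (verit) predicate2I rev_predicate2D rtranclp_mono subsetD)

text \<open>The pairs form a list so that a connection can be named by its position; reroutings are
  then described by lists of numbers. Only edge sets are kept disjoint, and a pair of equal vertices
  may be joined by the empty set.\<close>

definition linked :: "'b set set \<Rightarrow> ('b \<times> 'b) list \<Rightarrow> bool" where
  "linked A L \<longleftrightarrow> (\<exists>T. (\<forall>i<length L. T i \<subseteq> A \<and> conn (T i) (fst (L ! i)) (snd (L ! i))) \<and>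
     (\<forall>i<length L. \<forall>j<length L. i \<noteq> j \<longrightarrow> T i \<inter> T j = {}))"

lemma linkedE:
  assumes "linked A L"
  obtains T where "\<And>i. i < length L \<Longrightarrow> T i \<subseteq> A"
    "\<And>i. i < length L \<Longrightarrow> conn (T i) (fst (L ! i)) (snd (L ! i))"
    "\<And>i j. i < length L \<Longrightarrow> j < length L \<Longrightarrow> i \<noteq> j \<Longrightarrow> T i \<inter> T j = {}"
proof -
  obtain T where "(\<forall>i<length L. T i \<subseteq> A \<and> conn (T i) (fst (L ! i)) (snd (L ! i))) \<and>
     (\<forall>i<length L. \<forall>j<length L. i \<noteq> j \<longrightarrow> T i \<inter> T j = {})"
    using assms unfolding linked_def ..
  then show thesis by (intro that[of T]) simp_all
qed

lemma linkedI:
  assumes "\<And>i. i < length L \<Longrightarrow> T i \<subseteq> A"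
    "\<And>i. i < length L \<Longrightarrow> conn (T i) (fst (L ! i)) (snd (L ! i))"
    "\<And>i j. i < length L \<Longrightarrow> j < length L \<Longrightarrow> i \<noteq> j \<Longrightarrow> T i \<inter> T j = {}"
  shows "linked A L"
  unfolding linked_def using assms by (intro exI[of _ T] conjI allI impI) simp_all

fun walk :: "('b \<times> 'b) list \<Rightarrow> 'b \<Rightarrow> nat list \<Rightarrow> 'b \<Rightarrow> bool" where
  "walk L p [] q \<longleftrightarrow> p = q"
| "walk L p (i # is) q \<longleftrightarrow> i < length L \<and>
     (fst (L ! i) = p \<and> walk L (snd (L ! i)) is q \<or> snd (L ! i) = p \<and> walk L (fst (L ! i)) is q)"

fun routes :: "('b \<times> 'b) list \<Rightarrow> nat list list \<Rightarrow> ('b \<times> 'b) list \<Rightarrow> bool" where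
  "routes L [] [] \<longleftrightarrow> True"
| "routes L (is # Is) (pq # L') \<longleftrightarrow> walk L (fst pq) is (snd pq) \<and> routes L Is L'"
| "routes L _ _ \<longleftrightarrow> False"

lemma routes_nth:
  "routes L Is L' \<Longrightarrow> length Is = length L' \<and> (\<forall>k<length L'. walk L (fst (L' ! k)) (Is ! k) (snd (L' ! k)))"
  by (induction L Is L' rule: routes.induct) (auto simp: nth_Cons split: nat.splits)

lemma walk_bound: "walk L p is q \<Longrightarrow> i \<in> set is \<Longrightarrow> i < length L"
  by (induction "is" arbitrary: p) auto

lemma walk_conn:
  assumes "walk L p is q" "\<And>i. i \<in> set is \<Longrightarrow> conn (T i) (fst (L ! i)) (snd (L ! i))"
  shows "conn (\<Union>i\<in>set is. T i) p q"
  using assms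
proof (induction "is" arbitrary: p)
  case (Cons i "is")
  obtain r where r: "conn (T i) p r" "walk L r is q"
    using Cons.prems by (auto dest: conn_sym)
  have "conn (\<Union>i\<in>set (i # is). T i) p r" using r(1) by (rule conn_mono) auto
  moreover have "conn (\<Union>i\<in>set (i # is). T i) r q"
    using Cons.IH[OF r(2)] Cons.prems(2) by (auto intro: conn_mono)
  ultimately show ?case by (rule conn_trans)
qed auto

lemma distinct_concat_nth_disjoint:
  assumes "distinct (concat Is)" "k < length Is" "l < length Is" "k \<noteq> l"
  shows "set (Is ! k) \<inter> set (Is ! l) = {}"
  using assms
proof (induction Is arbitrary: k l)
  case (Cons a Is)
  then show ?case by (cases k; cases l) (force dest: nth_mem)+
qed auto

text \<open>Since all the numbers are distinct, no old connection is used twice, and the unions of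
  edge sets along the walks stay disjoint. Whether one linkage yields another thus becomes a
  computation on numbers in which the graph does not appear.\<close>

lemma linked_route:
  assumes "linked A L" "routes L Is L'" "distinct (concat Is)"
  shows "linked A L'"
proof -
  obtain T where T: "\<And>i. i < length L \<Longrightarrow> T i \<subseteq> A"
    "\<And>i. i < length L \<Longrightarrow> conn (T i) (fst (L ! i)) (snd (L ! i))"
    "\<And>i j. i < length L \<Longrightarrow> j < length L \<Longrightarrow> i \<noteq> j \<Longrightarrow> T i \<inter> T j = {}"
    by (fact linkedE[OF assms(1)])
  have R: "length Is = length L'"
    "\<And>k. k < length L' \<Longrightarrow> walk L (fst (L' ! k)) (Is ! k) (snd (L' ! k))"
    using routes_nth[OF assms(2)] by auto
  have bd: "i < length L" if "k < length L'" "i \<in> set (Is ! k)" for k i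
    using walk_bound[OF R(2)[OF that(1)] that(2)] .
  let ?T = "\<lambda>k. \<Union>i\<in>set (Is ! k). T i"
  show ?thesis
  proof (rule linkedI[of _ ?T])
    show "?T k \<subseteq> A" if "k < length L'" for k
      using T(1)[OF bd[OF that]] by (simp add: UN_least)
    show "conn (?T k) (fst (L' ! k)) (snd (L' ! k))" if "k < length L'" for k
      by (rule walk_conn[OF R(2)[OF that]]) (use T(2)[OF bd[OF that]] in simp)
    show "?T k \<inter> ?T l = {}" if kl: "k < length L'" "l < length L'" "k \<noteq> l" for k l
  proof (rule equals0I)
    fix x assume "x \<in> ?T k \<inter> ?T l"
    then obtain i j where ij: "i \<in> set (Is ! k)" "j \<in> set (Is ! l)" "x \<in> T i" "x \<in> T j" by blast
    have "set (Is ! k) \<inter> set (Is ! l) = {}"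
      using distinct_concat_nth_disjoint[OF assms(3), of k l] R(1) kl by simp
    then have "i \<noteq> j" using ij by blast
    then have "T i \<inter> T j = {}" using T(3) bd[OF kl(1) ij(1)] bd[OF kl(2) ij(2)] by simp
    then show False using ij by blast
    qed
  qed
qed

lemma linked_mono:
  assumes "linked A L" "A \<subseteq> A'" shows "linked A' L"
proof -
  obtain T where T: "\<And>i. i < length L \<Longrightarrow> T i \<subseteq> A"
    "\<And>i. i < length L \<Longrightarrow> conn (T i) (fst (L ! i)) (snd (L ! i))"
    "\<And>i j. i < length L \<Longrightarrow> j < length L \<Longrightarrow> i \<noteq> j \<Longrightarrow> T i \<inter> T j = {}"
    by (fact linkedE[OF assms(1)])
  show ?thesis
    by (rule linkedI[of _ T]) (use order_trans[OF T(1) assms(2)] T in simp_all)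
qed

lemma linked_append:
  assumes "linked A L" "linked A' L'" "A \<inter> A' = {}"
  shows "linked (A \<union> A') (L @ L')"
proof -
  obtain T where T: "\<And>i. i < length L \<Longrightarrow> T i \<subseteq> A"
    "\<And>i. i < length L \<Longrightarrow> conn (T i) (fst (L ! i)) (snd (L ! i))"
    "\<And>i j. i < length L \<Longrightarrow> j < length L \<Longrightarrow> i \<noteq> j \<Longrightarrow> T i \<inter> T j = {}"
    by (fact linkedE[OF assms(1)])
  obtain T' where T': "\<And>i. i < length L' \<Longrightarrow> T' i \<subseteq> A'"
    "\<And>i. i < length L' \<Longrightarrow> conn (T' i) (fst (L' ! i)) (snd (L' ! i))"
    "\<And>i j. i < length L' \<Longrightarrow> j < length L' \<Longrightarrow> i \<noteq> j \<Longrightarrow> T' i \<inter> T' j = {}"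
    by (fact linkedE[OF assms(2)])
  let ?T = "\<lambda>i. if i < length L then T i else T' (i - length L)"
  show ?thesis
  proof (rule linkedI[of _ ?T])
    show "?T i \<subseteq> A \<union> A'" if "i < length (L @ L')" for i
      using that T(1)[of i] T'(1)[of "i - length L"] by (cases "i < length L") (simp_all add: less_diff_conv2 le_supI1 le_supI2)
    show "conn (?T i) (fst ((L @ L') ! i)) (snd ((L @ L') ! i))" if "i < length (L @ L')" for i
      using that T(2)[of i] T'(2)[of "i - length L"] by (cases "i < length L") (simp_all add: nth_append less_diff_conv2)
    show "?T i \<inter> ?T j = {}" if "i < length (L @ L')" "j < length (L @ L')" "i \<noteq> j" for i j
    proof -
      consider "i < length L" "j < length L" | "i < length L" "\<not> j < length L"
        | "\<not> i < length L" "j < length L" | "\<not> i < length L" "\<not> j < length L" by blast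
      then show ?thesis
      proof cases
        case 1 then show ?thesis using T(3) that by simp
      next
        case 2
        then have "T i \<subseteq> A" "T' (j - length L) \<subseteq> A'" using T(1)[of i] T'(1)[of "j - length L"] that by (simp_all add: less_diff_conv2)
        then show ?thesis using assms(3) 2 by auto
      next
        case 3
        then have "T j \<subseteq> A" "T' (i - length L) \<subseteq> A'" using T(1)[of j] T'(1)[of "i - length L"] that by (simp_all add: less_diff_conv2)
        then show ?thesis using assms(3) 3 by auto
      next
        case 4
        then have "i - length L \<noteq> j - length L" using that(3) by linarith
        then show ?thesis using T'(3)[of "i - length L" "j - length L"] 4 that by (simp add: less_diff_conv2)
      qed
    qed
  qed
qed

lemma linked_Nil [simp]: "linked A []"
  by (simp add: linked_def)

lemma linked_single: "conn T p q \<Longrightarrow> T \<subseteq> A \<Longrightarrow> linked A [(p, q)]"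
  by (rule linkedI[of _ "\<lambda>_. T"]) simp_all

lemma linked_Cons:
  "conn T p q \<Longrightarrow> linked A L \<Longrightarrow> T \<inter> A = {} \<Longrightarrow> linked (T \<union> A) ((p, q) # L)"
  using linked_append[of T "[(p, q)]" A L] linked_single[of T p q T] by simp

lemma linked_snoc:
  "conn T p q \<Longrightarrow> linked A L \<Longrightarrow> A \<inter> T = {} \<Longrightarrow> linked (A \<union> T) (L @ [(p, q)])"
  using linked_append[of A L T "[(p, q)]"] linked_single[of T p q T] by simp

subsection \<open>Paths and circuits\<close>

lemma consecutive_pairs_simps [simp]:
  "consecutive_pairs [] = {}" "consecutive_pairs [x] = {}"
  by (auto simp: consecutive_pairs_def)

lemma consecutive_pairs_Cons [simp]:
  "consecutive_pairs (x # y # zs) = insert {x, y} (consecutive_pairs (y # zs))"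
  unfolding consecutive_pairs_def
proof (intro set_eqI iffI; clarsimp)
  fix i assume a: "\<forall>j. {(x # y # zs) ! i, (y # zs) ! i} = {(y # zs) ! j, zs ! j} \<longrightarrow> \<not> j < length zs"
    "i < Suc (length zs)"
  show "{(x # y # zs) ! i, (y # zs) ! i} = {x, y}"
    using a(1)[rule_format, of "i - 1"] a(2) by (cases i) auto
next
  fix e assume "e = {x, y} \<or> (\<exists>i. e = {(y # zs) ! i, zs ! i} \<and> i < length zs)"
  then show "\<exists>i. e = {(x # y # zs) ! i, (y # zs) ! i} \<and> i < Suc (length zs)"
  proof
    assume "e = {x, y}" then show ?thesis by (intro exI[of _ 0]) auto
  next
    assume "\<exists>i. e = {(y # zs) ! i, zs ! i} \<and> i < length zs"
    then obtain i where "e = {(y # zs) ! i, zs ! i}" "i < length zs" by auto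
    then show ?thesis by (intro exI[of _ "Suc i"]) auto
  qed
qed

lemma consecutive_pairs_append:
  "consecutive_pairs (xs @ y # zs) = consecutive_pairs (xs @ [y]) \<union> consecutive_pairs (y # zs)"
proof (induction xs)
  case (Cons x xs)
  then show ?case by (cases xs) auto
qed auto

lemma consecutive_pairs_subset: "e \<in> consecutive_pairs vs \<Longrightarrow> e \<subseteq> set vs"
  by (auto simp: consecutive_pairs_def)

lemma consecutive_pairs_rev: "consecutive_pairs (rev vs) = consecutive_pairs vs"
proof (induction vs)
  case (Cons x vs)
  show ?case
  proof (cases vs)
    case (Cons y zs)
    have "consecutive_pairs (rev (x # vs)) = consecutive_pairs (rev zs @ y # [x])" using Cons by simp
    also have "\<dots> = consecutive_pairs (rev zs @ [y]) \<union> {{y, x}}"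
      by (simp add: consecutive_pairs_append[of "rev zs" y "[x]"])
    finally show ?thesis using Cons.IH Cons by (auto simp: insert_commute)
  qed auto
qed auto

lemma conn_consecutive_pairs: "vs \<noteq> [] \<Longrightarrow> conn (consecutive_pairs vs) (hd vs) (last vs)"
proof (induction vs)
  case (Cons x vs)
  show ?case
  proof (cases vs)
    case (Cons y zs)
    have "conn (consecutive_pairs (x # vs)) x y" unfolding Cons by (rule conn_edge) simp
    moreover have "conn (consecutive_pairs (x # vs)) y (last vs)"
      using Cons.IH Cons by (auto intro: conn_mono)
    ultimately show ?thesis using Cons by (auto intro: conn_trans)
  qed auto
qed auto

lemma consecutive_pairs_at:
  assumes "distinct (as @ v # bs)"
  shows "{e \<in> consecutive_pairs (as @ v # bs). v \<in> e} =
    (if as = [] then {} else {{last as, v}}) \<union> (if bs = [] then {} else {{v, hd bs}})"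
proof -
  have 1: "{e \<in> consecutive_pairs (v # bs). v \<in> e} = (if bs = [] then {} else {{v, hd bs}})"
    if "distinct (v # bs)" for bs
  proof (cases bs)
    case (Cons a list)
    have "v \<notin> e" if "e \<in> consecutive_pairs (a # list)" for e
      using consecutive_pairs_subset[OF that] \<open>distinct (v # bs)\<close> Cons by auto
    then show ?thesis using Cons by auto
  qed auto
  have 2: "{e \<in> consecutive_pairs (as @ [v]). v \<in> e} = (if as = [] then {} else {{last as, v}})"
  proof -
    have "{e \<in> consecutive_pairs (v # rev as). v \<in> e} = (if as = [] then {} else {{v, hd (rev as)}})"
      using 1[of "rev as"] assms by auto
    then show ?thesis using consecutive_pairs_rev[of "as @ [v]"] by (auto simp: hd_rev insert_commute)
  qed
  have "{e \<in> consecutive_pairs (as @ v # bs). v \<in> e} =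
    {e \<in> consecutive_pairs (as @ [v]). v \<in> e} \<union> {e \<in> consecutive_pairs (v # bs). v \<in> e}"
    unfolding consecutive_pairs_append[of as v bs] by blast
  then show ?thesis using 1[of bs] 2 assms by simp
qed

lemma path_listing_rev: "path_listing vs P \<Longrightarrow> path_listing (rev vs) P"
  by (simp add: path_listing_def consecutive_pairs_rev)

text \<open>Having exactly one edge at \<open>v\<close> is a property of the graph and not of the
  listing. This is what makes \<open>ends\<close> computable from any one listing.\<close>

lemma path_listing_end_iff:
  assumes "path_listing vs P" "2 \<le> length vs" "v \<in> set vs"
  shows "v = hd vs \<or> v = last vs \<longleftrightarrow> card {e \<in> edges P. v \<in> e} = 1"
    and "\<exists>e\<in>edges P. v \<in> e"
proof -
  obtain as bs where s: "vs = as @ v # bs" using assms(3) by (meson split_list)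
  have d: "distinct (as @ v # bs)" and e: "edges P = consecutive_pairs vs"
    using assms(1) s by (auto simp: path_listing_def)
  have E: "{e \<in> edges P. v \<in> e} =
    (if as = [] then {} else {{last as, v}}) \<union> (if bs = [] then {} else {{v, hd bs}})"
    using consecutive_pairs_at[OF d] e s by simp
  have "as \<noteq> [] \<or> bs \<noteq> []" using assms(2) s by auto
  then show "\<exists>e\<in>edges P. v \<in> e" using E by (auto split: if_splits)
  have "last as \<noteq> hd bs" if "as \<noteq> []" "bs \<noteq> []"
    using d that by (metis IntI distinct_append empty_iff hd_in_set last_in_set list.set_intros(2))
  then have "as \<noteq> [] \<Longrightarrow> bs \<noteq> [] \<Longrightarrow> {last as, v} \<noteq> {v, hd bs}"
    by (auto simp: doubleton_eq_iff)
  then have "card {e \<in> edges P. v \<in> e} = 1 \<longleftrightarrow> as = [] \<or> bs = []"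
    unfolding E using \<open>as \<noteq> [] \<or> bs \<noteq> []\<close> by auto
  moreover have "as = [] \<longleftrightarrow> v = hd vs" using s d by (cases as) auto
  moreover have "bs = [] \<longleftrightarrow> v = last vs" using s d by (cases bs rule: rev_cases) auto
  ultimately show "v = hd vs \<or> v = last vs \<longleftrightarrow> card {e \<in> edges P. v \<in> e} = 1" by auto
qed

lemma path_listing_card_edges:
  assumes "path_listing vs P" shows "card (edges P) = length vs - 1" "finite (edges P)"
proof -
  have "distinct vs \<Longrightarrow> card (consecutive_pairs vs) = length vs - 1 \<and> finite (consecutive_pairs vs)" for vs :: "'a list"
  proof (induction vs)
    case (Cons x vs)
    then show ?case
    proof (cases vs)
      case (Cons y zs)
      have "{x, y} \<notin> consecutive_pairs vs" using Cons.prems Cons by (auto dest: consecutive_pairs_subset)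
      then show ?thesis using Cons.IH Cons.prems Cons by auto
    qed auto
  qed auto
  then show "card (edges P) = length vs - 1" "finite (edges P)" using assms by (auto simp: path_listing_def)
qed

lemma path_listing_length_unique:
  "path_listing vs P \<Longrightarrow> path_listing ws P \<Longrightarrow> length vs = length ws"
  using distinct_card[of vs] distinct_card[of ws] by (auto simp: path_listing_def)

lemma ends_path_listing:
  assumes "path_listing vs P" shows "ends P = {hd vs, last vs}"
proof -
  have "v \<in> {hd vs, last vs}" if ws: "path_listing ws P" "v = hd ws \<or> v = last ws" for ws v
  proof (cases "2 \<le> length vs")
    case True
    then have l: "2 \<le> length ws" using path_listing_length_unique[OF assms ws(1)] by simp
    have sv: "set ws = set vs" using ws(1) assms by (auto simp: path_listing_def)
    have "v \<in> set ws" using ws l by (cases ws) (auto simp: path_listing_def)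
    then have "card {e \<in> edges P. v \<in> e} = 1" using path_listing_end_iff(1)[OF ws(1) l] ws(2) by blast
    then show ?thesis
      using path_listing_end_iff(1)[OF assms True] sv \<open>v \<in> set ws\<close> by blast
  next
    \<comment> \<open>A path of one vertex has no edges to count, but its vertex set already
      determines the end.\<close>
    case False
    have "vs \<noteq> []" using assms by (simp add: path_listing_def)
    then have "length vs = 1" using False by (simp add: Suc_leI le_antisym)
    then obtain x where "vs = [x]" by (auto simp: length_Suc_conv)
    moreover have "set ws = set vs" and n: "ws \<noteq> []" using ws(1) assms by (auto simp: path_listing_def)
    moreover have "v \<in> set ws" using ws(2) hd_in_set[OF n] last_in_set[OF n] by blast
    ultimately show ?thesis by simp
  qed
  then show ?thesis using assms unfolding ends_def by blast
qed

text \<open>Induction along the walk; when the next vertex already lies on the path, the path is cut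
  back to it.\<close>

lemma conn_path:
  assumes "conn T p q"
  shows "\<exists>vs. vs \<noteq> [] \<and> distinct vs \<and> hd vs = p \<and> last vs = q \<and> consecutive_pairs vs \<subseteq> T"
  using assms unfolding conn_def
proof (induction rule: rtranclp_induct)
  case base
  show ?case by (intro exI[of _ "[p]"]) auto
next
  case (step q r)
  then obtain vs where vs: "vs \<noteq> []" "distinct vs" "hd vs = p" "last vs = q" "consecutive_pairs vs \<subseteq> T"
    by auto
  show ?case
  proof (cases "r \<in> set vs")
    case True
    then obtain as bs where s: "vs = as @ r # bs" by (meson split_list)
    show ?thesis
      using vs s consecutive_pairs_append[of as r bs]
      by (intro exI[of _ "as @ [r]"]) (auto simp: hd_append)
  next
    case False
    have "consecutive_pairs (vs @ [r]) = consecutive_pairs (butlast vs @ last vs # [r])"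
      using vs(1) by (cases vs rule: rev_cases) auto
    also have "\<dots> = consecutive_pairs vs \<union> {{q, r}}"
      unfolding consecutive_pairs_append[of "butlast vs" "last vs" "[r]"] append_butlast_last_id[OF vs(1)]
      using vs(4) by simp
    finally have "consecutive_pairs (vs @ [r]) \<subseteq> T" using vs(5) step.hyps by auto
    then show ?thesis using vs False
      by (intro exI[of _ "vs @ [r]"]) (auto simp: hd_append)
  qed
qed

lemma is_path_listing:
  assumes "is_path P" "ends P = {a, b}"
  shows "\<exists>vs. path_listing vs P \<and> hd vs = a \<and> last vs = b"
proof -
  obtain vs where vs: "path_listing vs P" using assms(1) by (auto simp: is_path_def)
  then have "{hd vs, last vs} = {a, b}" using assms(2) ends_path_listing by metis
  then consider "hd vs = a" "last vs = b" | "hd vs = b" "last vs = a" by (auto simp: doubleton_eq_iff)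
  then show ?thesis
  proof cases
    case 1 then show ?thesis using vs by blast
  next
    case 2
    have "vs \<noteq> []" using vs by (simp add: path_listing_def)
    then have "hd (rev vs) = a" "last (rev vs) = b" using 2 by (simp_all add: hd_rev last_rev)
    then show ?thesis using path_listing_rev[OF vs] by blast
  qed
qed

lemma consecutive_pairs_card: "distinct vs \<Longrightarrow> e \<in> consecutive_pairs vs \<Longrightarrow> card e = 2"
  by (induction vs rule: induct_list012) auto

text \<open>The two pieces have only \<open>u\<close> in common, and an edge has two
  vertices.\<close>

lemma consecutive_pairs_disjoint:
  assumes d: "distinct (as @ u # bs)"
  shows "consecutive_pairs (as @ [u]) \<inter> consecutive_pairs (u # bs) = {}"
proof (rule equals0I)
  fix e assume e: "e \<in> consecutive_pairs (as @ [u]) \<inter> consecutive_pairs (u # bs)"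
  then have "e \<subseteq> set (as @ [u])" "e \<subseteq> set (u # bs)" using consecutive_pairs_subset by blast+
  then have "e \<subseteq> {u}" using d by auto
  then have "card e \<le> card {u}" by (intro card_mono) auto
  then show False using consecutive_pairs_card[of "as @ [u]" e] d e by auto
qed

lemma path_split:
  assumes "is_path P" "ends P = {a, b}" "u \<in> verts P"
  shows "\<exists>T1 T2. T1 \<inter> T2 = {} \<and> T1 \<union> T2 = edges P \<and> conn T1 a u \<and> conn T2 u b"
proof -
  obtain vs where vs: "path_listing vs P" "hd vs = a" "last vs = b" using is_path_listing[OF assms(1,2)] by blast
  have "u \<in> set vs" using assms(3) vs(1) by (simp add: path_listing_def)
  then obtain as bs where s: "vs = as @ u # bs" by (meson split_list)
  have d: "distinct (as @ u # bs)" using vs(1) s by (simp add: path_listing_def)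
  let ?T1 = "consecutive_pairs (as @ [u])" and ?T2 = "consecutive_pairs (u # bs)"
  have "?T1 \<inter> ?T2 = {}" by (rule consecutive_pairs_disjoint[OF d])
  moreover have "?T1 \<union> ?T2 = edges P" using vs(1) s consecutive_pairs_append[of as u bs] by (simp add: path_listing_def)
  moreover have "conn ?T1 a u" using conn_consecutive_pairs[of "as @ [u]"] vs(2) s by (cases as) auto
  moreover have "conn ?T2 u b" using conn_consecutive_pairs[of "u # bs"] vs(3) s by (cases bs) auto
  ultimately show ?thesis by blast
qed

lemma path_conn: "is_path P \<Longrightarrow> ends P = {a, b} \<Longrightarrow> conn (edges P) a b"
  using path_split[of P a b b] is_path_listing[of P a b]
  by (metis conn_consecutive_pairs graph.sel(2) path_listing_def)

lemma path_at_end: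
  assumes "is_path P" "ends P = {a, b}" "a \<noteq> b" "v \<in> verts P"
  shows "\<exists>e\<in>edges P. v \<in> e"
    and "v \<notin> {a, b} \<Longrightarrow> \<exists>e\<in>edges P. \<exists>f\<in>edges P. e \<noteq> f \<and> v \<in> e \<and> v \<in> f"
proof -
  obtain vs where vs: "path_listing vs P" "hd vs = a" "last vs = b" using is_path_listing[OF assms(1,2)] by blast
  have l: "2 \<le> length vs"
  proof (rule ccontr)
    assume "\<not> 2 \<le> length vs"
    moreover have "vs \<noteq> []" using vs(1) by (simp add: path_listing_def)
    ultimately have "length vs = 1" by (simp add: Suc_leI le_antisym not_less_eq_eq)
    then show False using vs assms(3) by (cases vs) auto
  qed
  have v: "v \<in> set vs" using assms(4) vs(1) by (simp add: path_listing_def)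
  show ex: "\<exists>e\<in>edges P. v \<in> e" using path_listing_end_iff(2)[OF vs(1) l v] .
  assume "v \<notin> {a, b}"
  then have n: "card {e \<in> edges P. v \<in> e} \<noteq> 1" using path_listing_end_iff(1)[OF vs(1) l v] vs(2,3) by blast
  obtain e where e: "e \<in> edges P" "v \<in> e" using ex by blast
  have "{e \<in> edges P. v \<in> e} \<noteq> {e}"
  proof
    assume "{e \<in> edges P. v \<in> e} = {e}"
    then have "card {e \<in> edges P. v \<in> e} = card {e}" by (rule arg_cong)
    then show False using n by simp
  qed
  then obtain f where "f \<in> edges P" "v \<in> f" "f \<noteq> e" using e by blast
  then show "\<exists>e\<in>edges P. \<exists>f\<in>edges P. e \<noteq> f \<and> v \<in> e \<and> v \<in> f" using e by blast
qed

lemma ends_subset_verts: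
  assumes "is_path P" shows "ends P \<subseteq> verts P"
proof -
  obtain vs where vs: "path_listing vs P" using assms by (auto simp: is_path_def)
  have "vs \<noteq> []" "verts P = set vs" using vs by (simp_all add: path_listing_def)
  then show ?thesis using ends_path_listing[OF vs] by simp
qed

section \<open>Cubic graphs and the assembly of embeddings\<close>

lemma simple_edgeE:
  assumes "simple_graph G" "e \<in> edges G"
  obtains a b where "e = {a, b}" "a \<noteq> b" "a \<in> verts G" "b \<in> verts G"
  using assms by (auto simp: simple_graph_def card_2_iff)

lemma cubic_finite:
  assumes "cubic H" shows "finite (verts H)" "finite (edges H)"
proof -
  show "finite (verts H)" using assms by (simp add: cubic_def simple_graph_def)
  moreover have "edges H \<subseteq> Pow (verts H)" using assms by (auto simp: cubic_def simple_graph_def)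
  ultimately show "finite (edges H)" by (meson finite_Pow_iff finite_subset)
qed

lemma cubic_at: "cubic H \<Longrightarrow> v \<in> verts H \<Longrightarrow> card {e \<in> edges H. v \<in> e} = 3"
  by (simp add: cubic_def degree_def)

text \<open>The source of all vertex-disjointness below: two edge-disjoint paths crossing at an
  interior vertex would need four edges there.\<close>

lemma cubic_four_edges:
  assumes "cubic H" "{a, b, c, d} \<subseteq> edges H" "v \<in> a" "v \<in> b" "v \<in> c" "v \<in> d"
  shows "\<not> distinct [a, b, c, d]"
proof
  assume d: "distinct [a, b, c, d]"
  have "v \<in> verts H" using assms by (auto simp: cubic_def simple_graph_def)
  have "card {a, b, c, d} \<le> card {e \<in> edges H. v \<in> e}"
    by (rule card_mono) (use assms cubic_finite[OF assms(1)] in auto)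
  then show False using d cubic_at[OF assms(1) \<open>v \<in> verts H\<close>] by auto
qed

lemma cubic_edges_at:
  assumes "cubic H" "v \<in> verts H"
  obtains a b c where "distinct [a, b, c]" "{e \<in> edges H. v \<in> e} = {a, b, c}"
  using cubic_at[OF assms] by (auto simp: card_3_iff)

text \<open>The three edges at a vertex of \<open>G\<close> already use all three edges of
  \<open>H\<close> at its image, so no further path can pass through it (\<open>key\<close>). Two
  paths with a common vertex that is no branch vertex would use four edges there
  (\<open>int\<close>).\<close>

lemma hom_embeddingI:
  assumes H: "cubic H" and G: "cubic G"
    and inj: "inj_on \<nu> (verts G)" and im: "\<nu> ` verts G \<subseteq> verts H"
    and P: "\<And>e. e \<in> edges G \<Longrightarrow> is_path (P e) \<and> subgraph (P e) H \<and> ends (P e) = \<nu> ` e"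
    and dis: "\<And>e f. e \<in> edges G \<Longrightarrow> f \<in> edges G \<Longrightarrow> e \<noteq> f \<Longrightarrow> edges (P e) \<inter> edges (P f) = {}"
  shows "hom_embedding (Embedding \<nu> P) G H"
proof -
  have sG: "simple_graph G" using G by (simp add: cubic_def)
  have E: "\<exists>a b. e = {a, b} \<and> a \<noteq> b \<and> \<nu> a \<noteq> \<nu> b \<and> a \<in> verts G \<and> b \<in> verts G" if "e \<in> edges G" for e
    using simple_edgeE[OF sG that] inj by (metis inj_on_contraD)
  have sub: "edges (P e) \<subseteq> edges H" if "e \<in> edges G" for e using P[OF that] by (simp add: subgraph_def)
  have one: "\<exists>h\<in>edges (P e). w \<in> h" if ew: "e \<in> edges G" "w \<in> verts (P e)" for e w
  proof -
    obtain a b where "e = {a, b}" "\<nu> a \<noteq> \<nu> b" using E[OF ew(1)] by blast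
    then show ?thesis using path_at_end(1)[of "P e" "\<nu> a" "\<nu> b" w] P[OF ew(1)] ew(2) by auto
  qed
  have two: "\<exists>h\<in>edges (P e). \<exists>g\<in>edges (P e). h \<noteq> g \<and> w \<in> h \<and> w \<in> g"
    if ew: "e \<in> edges G" "w \<in> verts (P e)" "w \<notin> \<nu> ` e" for e w
  proof -
    obtain a b where "e = {a, b}" "\<nu> a \<noteq> \<nu> b" using E[OF ew(1)] by blast
    then show ?thesis using path_at_end(2)[of "P e" "\<nu> a" "\<nu> b" w] P[OF ew(1)] ew(2,3) by auto
  qed
  have key: "v \<in> e" if v: "v \<in> verts G" "e \<in> edges G" "\<nu> v \<in> verts (P e)" for v e
  proof (rule ccontr)
    assume n: "v \<notin> e"
    obtain a b c where abc: "distinct [a, b, c]" "{e \<in> edges G. v \<in> e} = {a, b, c}"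
      using cubic_edges_at[OF G v(1)] by blast
    have abcG: "a \<in> edges G" "b \<in> edges G" "c \<in> edges G" "v \<in> a" "v \<in> b" "v \<in> c" using abc(2) by blast+
    have vP: "\<nu> v \<in> verts (P d)" if "d \<in> edges G" "v \<in> d" for d
      using P[OF that(1)] ends_subset_verts[of "P d"] that(2) by auto
    obtain h1 where h1: "h1 \<in> edges (P a)" "\<nu> v \<in> h1" using one[OF abcG(1) vP] abcG by blast
    obtain h2 where h2: "h2 \<in> edges (P b)" "\<nu> v \<in> h2" using one[OF abcG(2) vP] abcG by blast
    obtain h3 where h3: "h3 \<in> edges (P c)" "\<nu> v \<in> h3" using one[OF abcG(3) vP] abcG by blast
    obtain h4 where h4: "h4 \<in> edges (P e)" "\<nu> v \<in> h4" using one[OF v(2,3)] by blast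
    have ne: "e \<noteq> a" "e \<noteq> b" "e \<noteq> c" using n abcG by auto
    have "h1 \<noteq> h2" "h1 \<noteq> h3" "h2 \<noteq> h3" "h1 \<noteq> h4" "h2 \<noteq> h4" "h3 \<noteq> h4"
      using dis[OF abcG(1,2)] dis[OF abcG(1,3)] dis[OF abcG(2,3)] dis[OF v(2) abcG(1) ne(1)]
        dis[OF v(2) abcG(2) ne(2)] dis[OF v(2) abcG(3) ne(3)] abc(1) h1(1) h2(1) h3(1) h4(1) by auto
    moreover have "{h1, h2, h3, h4} \<subseteq> edges H" using h1 h2 h3 h4 sub abcG v(2) by blast
    ultimately show False using cubic_four_edges[OF H, of h1 h2 h3 h4 "\<nu> v"] h1 h2 h3 h4 by simp
  qed
  have int: "internal_verts (P e) \<inter> verts (P f) = {}" if ef: "e \<in> edges G" "f \<in> edges G" "e \<noteq> f" for e f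
  proof (rule equals0I)
    fix w assume w: "w \<in> internal_verts (P e) \<inter> verts (P f)"
    then have we: "w \<in> verts (P e)" "w \<notin> \<nu> ` e" "w \<in> verts (P f)"
      using P[OF ef(1)] by (auto simp: internal_verts_def)
    have "w \<notin> \<nu> ` f"
    proof
      assume "w \<in> \<nu> ` f"
      then obtain v where "v \<in> f" "w = \<nu> v" by blast
      moreover then have "v \<in> verts G" using E[OF ef(2)] by blast
      ultimately show False using key[of v e] we ef(1) by blast
    qed
    then obtain h g h' g' where hg: "h \<in> edges (P e)" "g \<in> edges (P e)" "h \<noteq> g" "w \<in> h" "w \<in> g"
      "h' \<in> edges (P f)" "g' \<in> edges (P f)" "h' \<noteq> g'" "w \<in> h'" "w \<in> g'"
      using two[OF ef(1) we(1,2)] two[OF ef(2) we(3)] by blast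
    have "{h, g, h', g'} \<subseteq> edges H" using hg sub ef by blast
    moreover have "h \<noteq> h'" "h \<noteq> g'" "g \<noteq> h'" "g \<noteq> g'" using dis[OF ef] hg by blast+
    ultimately show False using cubic_four_edges[OF H, of h g h' g' w] hg by simp
  qed
  have onv: "\<nu> v \<in> verts (P e)" if "v \<in> e" "e \<in> edges G" for v e
    using P[OF that(2)] ends_subset_verts[of "P e"] that(1) by auto
  show ?thesis unfolding hom_embedding_def embedding.sel
  proof (intro conjI ballI impI)
    fix v e assume "v \<in> verts G" "e \<in> edges G"
    then show "\<nu> v \<in> verts (P e) \<longleftrightarrow> v \<in> e" using key onv by blast
  qed (use inj im P dis int in auto)
qed

text \<open>\<open>Old\<close> consists of the edges whose given images are kept. \<open>N\<close>
  orients all other edges so that they can be matched with the pairs of a linkage, and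
  \<open>A\<close> is the part of \<open>H\<close> that the kept images leave free.\<close>

lemma glue:
  assumes H: "cubic H" and G: "cubic G"
    and inj: "inj_on \<nu> (verts G)" and im: "\<nu> ` verts G \<subseteq> verts H"
    and Old: "Old \<subseteq> edges G"
    and P: "\<And>e. e \<in> Old \<Longrightarrow> is_path (P e) \<and> subgraph (P e) H \<and> ends (P e) = \<nu> ` e"
    and dis: "\<And>e f. e \<in> Old \<Longrightarrow> f \<in> Old \<Longrightarrow> e \<noteq> f \<Longrightarrow> edges (P e) \<inter> edges (P f) = {}"
    and N: "(\<lambda>(i, j). {i, j}) ` set N = edges G - Old"
    and L: "linked A (map (map_prod \<nu> \<nu>) N)" and A: "A \<subseteq> edges H"
    and AP: "\<And>e. e \<in> Old \<Longrightarrow> edges (P e) \<inter> A = {}"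
  shows "\<exists>\<eta>. hom_embedding \<eta> G H \<and> vmap \<eta> = \<nu> \<and> (\<forall>e\<in>Old. emap \<eta> e = P e)"
proof -
  have sG: "simple_graph G" using G by (simp add: cubic_def)
  obtain T where T0: "\<And>i. i < length (map (map_prod \<nu> \<nu>) N) \<Longrightarrow> T i \<subseteq> A"
    "\<And>i. i < length (map (map_prod \<nu> \<nu>) N) \<Longrightarrow>
      conn (T i) (fst (map (map_prod \<nu> \<nu>) N ! i)) (snd (map (map_prod \<nu> \<nu>) N ! i))"
    "\<And>i j. i < length (map (map_prod \<nu> \<nu>) N) \<Longrightarrow> j < length (map (map_prod \<nu> \<nu>) N) \<Longrightarrow> i \<noteq> j \<Longrightarrow>
      T i \<inter> T j = {}"
    by (fact linkedE[OF L])
  have T: "\<And>i. i < length N \<Longrightarrow> T i \<subseteq> A"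
    "\<And>i. i < length N \<Longrightarrow> conn (T i) (\<nu> (fst (N ! i))) (\<nu> (snd (N ! i)))"
    "\<And>i j. i < length N \<Longrightarrow> j < length N \<Longrightarrow> i \<noteq> j \<Longrightarrow> T i \<inter> T j = {}"
    using T0 by simp_all
  have "\<exists>Q. \<exists>i<length N. e = {fst (N ! i), snd (N ! i)} \<and> is_path Q \<and> subgraph Q H \<and> ends Q = \<nu> ` e \<and> edges Q \<subseteq> T i"
    if e: "e \<in> edges G - Old" for e
  proof -
    obtain i where i: "i < length N" "e = {fst (N ! i), snd (N ! i)}"
      using e unfolding N[symmetric] by (auto simp: in_set_conv_nth split: prod.splits)
    obtain a b where ab: "e = {a, b}" "a \<noteq> b" "a \<in> verts G" "b \<in> verts G"
      using simple_edgeE[OF sG, of e] e by blast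
    let ?p = "\<nu> (fst (N ! i))" and ?q = "\<nu> (snd (N ! i))"
    have "fst (N ! i) \<noteq> snd (N ! i)" "fst (N ! i) \<in> verts G" "snd (N ! i) \<in> verts G"
      using i(2) ab by (auto simp: doubleton_eq_iff)
    then have pq: "?p \<noteq> ?q" using inj by (meson inj_on_contraD)
    obtain vs where vs: "vs \<noteq> []" "distinct vs" "hd vs = ?p" "last vs = ?q" "consecutive_pairs vs \<subseteq> T i"
      using conn_path[OF T(2)[OF i(1)]] by blast
    let ?Q = "Graph (set vs) (consecutive_pairs vs)"
    have l: "path_listing vs ?Q" using vs by (simp add: path_listing_def)
    have en: "ends ?Q = {?p, ?q}" using ends_path_listing[OF l] vs by simp
    have pth: "is_path ?Q" using l by (auto simp: is_path_def)
    have eH: "consecutive_pairs vs \<subseteq> edges H" using vs(5) T(1)[OF i(1)] A by blast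
    have "v \<in> verts H" if v: "v \<in> set vs" for v
    proof -
      obtain h where "h \<in> consecutive_pairs vs" "v \<in> h" using path_at_end(1)[OF pth en pq, of v] v by auto
      then show ?thesis using eH H by (auto simp: cubic_def simple_graph_def)
    qed
    then have "subgraph ?Q H" using eH by (auto simp: subgraph_def dest: consecutive_pairs_subset)
    then show ?thesis using i pth en vs(5) by (intro exI[of _ ?Q] exI[of _ i]) auto
  qed
  then obtain Q where Q: "\<And>e. e \<in> edges G - Old \<Longrightarrow> \<exists>i<length N. e = {fst (N ! i), snd (N ! i)} \<and>
      is_path (Q e) \<and> subgraph (Q e) H \<and> ends (Q e) = \<nu> ` e \<and> edges (Q e) \<subseteq> T i"
    by metis
  let ?P = "\<lambda>e. if e \<in> Old then P e else Q e"
  have "hom_embedding (Embedding \<nu> ?P) G H"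
  proof (rule hom_embeddingI[OF H G inj im])
    show "is_path (?P e) \<and> subgraph (?P e) H \<and> ends (?P e) = \<nu> ` e" if "e \<in> edges G" for e
      using P[of e] Q[of e] that by (cases "e \<in> Old") auto
    have QA: "edges (Q e) \<subseteq> A" if "e \<in> edges G - Old" for e
      using Q[OF that] T(1) by blast
    show "edges (?P e) \<inter> edges (?P f) = {}" if ef: "e \<in> edges G" "f \<in> edges G" "e \<noteq> f" for e f
    proof -
      consider "e \<in> Old" "f \<in> Old" | "e \<in> Old" "f \<notin> Old" | "e \<notin> Old" "f \<in> Old" | "e \<notin> Old" "f \<notin> Old"
        by blast
      then show ?thesis
      proof cases
        case 1 then show ?thesis using dis[OF 1 ef(3)] by simp
      next
        case 2 then show ?thesis using AP[OF 2(1)] QA[of f] ef(2) by auto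
      next
        case 3 then show ?thesis using AP[OF 3(2)] QA[of e] ef(1) by auto
      next
        case 4
        obtain i where i: "i < length N" "e = {fst (N ! i), snd (N ! i)}" "edges (Q e) \<subseteq> T i"
          using Q[of e] 4 ef by blast
        obtain j where j: "j < length N" "f = {fst (N ! j), snd (N ! j)}" "edges (Q f) \<subseteq> T j"
          using Q[of f] 4 ef by blast
        have "i \<noteq> j" using i(2) j(2) ef(3) by auto
        then have "T i \<inter> T j = {}" using T(3) i(1) j(1) by blast
        then show ?thesis using i(3) j(3) 4 by auto
      qed
    qed
  qed
  then show ?thesis by (intro exI[of _ "Embedding \<nu> ?P"]) auto
qed

section \<open>Circuits forced by small cuts\<close>

text \<open>All neighbours of the first vertex of a longest path lie on that path, and one of them
  beyond the second vertex closes a circuit.\<close>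

lemma min_degree_circuit:
  assumes fin: "finite V" and "V \<noteq> {}" and E: "\<And>e. e \<in> E \<Longrightarrow> e \<subseteq> V \<and> card e = 2"
    and deg: "\<And>v. v \<in> V \<Longrightarrow> \<exists>e\<in>E. \<exists>f\<in>E. e \<noteq> f \<and> v \<in> e \<and> v \<in> f"
  shows "\<exists>C. is_circuit C \<and> verts C \<subseteq> V \<and> edges C \<subseteq> E"
proof -
  let ?Q = "\<lambda>vs. vs \<noteq> [] \<and> distinct vs \<and> set vs \<subseteq> V \<and> consecutive_pairs vs \<subseteq> E"
  obtain v where "v \<in> V" using assms(2) by blast
  then have Qv: "?Q [v]" by simp
  have le: "\<forall>vs. ?Q vs \<longrightarrow> length vs \<le> card V"
  proof (intro allI impI)
    fix vs assume "?Q vs"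
    then show "length vs \<le> card V" using card_mono[OF fin, of "set vs"] distinct_card[of vs] by simp
  qed
  let ?S = "length ` {vs. ?Q vs}"
  have "[v] \<in> {vs. ?Q vs}" using Qv by (rule CollectI)
  then have "?S \<noteq> {}" by blast
  moreover have "?S \<subseteq> {..card V}" using le by auto
  then have "finite ?S" by (rule finite_subset) simp
  ultimately have S: "finite ?S" "?S \<noteq> {}" by blast+
  obtain vs where vs: "?Q vs" "length vs = Max ?S" using Max_in[OF S] by auto
  have mx: "length ws \<le> length vs" if "?Q ws" for ws
    unfolding vs(2) using that by (intro Max_ge[OF S(1)] imageI) simp
  note vs = vs(1)
  define x where "x = hd vs"
  have xV: "x \<in> V" using vs by (auto simp: x_def)
  have nb: "\<exists>y. e = {x, y} \<and> y \<noteq> x \<and> y \<in> set vs" if ex: "e \<in> E" "x \<in> e" for e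
  proof -
    obtain y where y: "e = {x, y}" "y \<noteq> x" using E[OF ex(1)] ex(2) by (auto simp: card_2_iff)
    have "y \<in> set vs"
    proof (rule ccontr)
      assume "y \<notin> set vs"
      moreover have "consecutive_pairs (y # vs) = insert {y, x} (consecutive_pairs vs)"
        using vs by (cases vs) (auto simp: x_def)
      ultimately have "?Q (y # vs)" using vs y ex E[OF ex(1)] by (auto simp: insert_commute)
      then show False using mx[of "y # vs"] by simp
    qed
    then show ?thesis using y by blast
  qed
  obtain e f where ef: "e \<in> E" "f \<in> E" "e \<noteq> f" "x \<in> e" "x \<in> f" using deg[OF xV] by blast
  obtain y where y: "e = {x, y}" "y \<noteq> x" "y \<in> set vs" using nb[OF ef(1,4)] by blast
  obtain z where z: "f = {x, z}" "z \<noteq> x" "z \<in> set vs" using nb[OF ef(2,5)] by blast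
  have yz: "y \<noteq> z" using ef(3) y z by auto
  \<comment> \<open>At most one of the two neighbours is the second vertex of the path. The other
    one is preceded by at least two vertices, which gives the circuit length at least three.\<close>
  have "\<exists>y as bs. vs = as @ y # bs \<and> {x, y} \<in> E \<and> 2 \<le> length as"
  proof -
    obtain ws where ws: "vs = x # ws" using vs by (cases vs) (auto simp: x_def)
    have in_ws: "y \<in> set ws" "z \<in> set ws" using y z ws by auto
    then obtain w ws' where ws': "ws = w # ws'" by (cases ws) auto
    have "y \<in> set ws' \<or> z \<in> set ws'" using in_ws ws' yz by auto
    then obtain u where u: "u \<in> set ws'" "{x, u} \<in> E" using ef y z by auto
    then obtain as bs where "ws' = as @ u # bs" by (meson split_list)
    then show ?thesis using ws ws' u by (intro exI[of _ u] exI[of _ "x # w # as"] exI[of _ bs]) auto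
  qed
  then obtain u as bs where u: "vs = as @ u # bs" "{x, u} \<in> E" "2 \<le> length as" by blast
  let ?ws = "as @ [u]"
  let ?C = "Graph (set ?ws) (insert {last ?ws, hd ?ws} (consecutive_pairs ?ws))"
  have "hd ?ws = x" using u by (cases as) (auto simp: x_def)
  moreover have "consecutive_pairs ?ws \<subseteq> E" using vs u consecutive_pairs_append[of as u bs] by auto
  moreover have "circuit_listing ?ws ?C" using vs u by (auto simp: circuit_listing_def)
  ultimately show ?thesis using u vs
    by (intro exI[of _ ?C]) (auto simp: is_circuit_def insert_commute)
qed

text \<open>Deleting a vertex of degree at most one preserves the inequality between vertices and
  edges; if there is no such vertex, the minimum degree is two.\<close>

lemma many_edges_circuit:
  assumes "finite V" "V \<noteq> {}" "\<And>e. e \<in> E \<Longrightarrow> e \<subseteq> V \<and> card e = 2" "card V \<le> card E"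
  shows "\<exists>C. is_circuit C \<and> verts C \<subseteq> V \<and> edges C \<subseteq> E"
  using assms
proof (induction "card V" arbitrary: V E)
  case 0
  then show ?case by simp
next
  case (Suc n)
  have finE: "finite E" using Suc.prems(1,3) by (meson finite_Pow_iff finite_subset PowI subsetI)
  show ?case
  proof (cases "\<forall>v\<in>V. \<exists>e\<in>E. \<exists>f\<in>E. e \<noteq> f \<and> v \<in> e \<and> v \<in> f")
    case True
    then show ?thesis using min_degree_circuit[of V E] Suc.prems by blast
  next
    case False
    then obtain v where v: "v \<in> V" "\<And>e f. e \<in> E \<Longrightarrow> f \<in> E \<Longrightarrow> v \<in> e \<Longrightarrow> v \<in> f \<Longrightarrow> e = f" by blast
    let ?E = "{e \<in> E. v \<notin> e}" and ?D = "{e \<in> E. v \<in> e}"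
    have "card ?D \<le> 1" using v(2) by (simp add: card_le_Suc0_iff_eq finE)
    moreover have "E = ?E \<union> ?D" by blast
    then have "card E = card ?E + card ?D" using card_Un_disjoint[of ?E ?D] finE by auto
    ultimately have cE: "card (V - {v}) \<le> card ?E" using Suc.prems(1,4) v(1) by simp
    have "card E \<noteq> 0" using Suc.hyps(2) Suc.prems(4) by auto
    then obtain e where "e \<in> E" by fastforce
    then have "2 \<le> card V" using Suc.prems(3)[of e] card_mono[OF Suc.prems(1), of e] by simp
    then have "0 < card (V - {v})" using v(1) Suc.prems(1) by simp
    then have "V - {v} \<noteq> {}" by force
    moreover have "n = card (V - {v})" using Suc.hyps(2) v(1) Suc.prems(1) by simp
    moreover have "e \<subseteq> V - {v} \<and> card e = 2" if "e \<in> ?E" for e using Suc.prems(3) that by blast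
    ultimately have "\<exists>C. is_circuit C \<and> verts C \<subseteq> V - {v} \<and> edges C \<subseteq> ?E"
      using Suc.hyps(1)[of "V - {v}" ?E] Suc.prems(1) cE by simp
    then show ?thesis by blast
  qed
qed

lemma card_filter_sum: "finite A \<Longrightarrow> card {x \<in> A. P x} = (\<Sum>x\<in>A. if P x then 1 else 0)"
  unfolding card_eq_sum by (rule sum.inter_filter)

text \<open>Counting incidences gives 3 |X| <= 2 |E(X)| + |cut|, so a cut of at most |X| edges
  leaves at least |X| edges inside \<open>X\<close>.\<close>

lemma cubic_small_cut_circuit:
  assumes H: "cubic H" and X: "X \<subseteq> verts H" "X \<noteq> {}" and c: "card (cut H X) \<le> card X"
  shows "\<exists>C. subgraph C H \<and> is_circuit C \<and> verts C \<subseteq> X"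
proof -
  let ?I = "{e \<in> edges H. e \<subseteq> X}"
  have fin: "finite X" "finite (edges H)" using X(1) cubic_finite[OF H] finite_subset by auto
  have c2: "card e = 2" if "e \<in> edges H" for e using H that by (simp add: cubic_def simple_graph_def)
  have fe: "finite e" if "e \<in> edges H" for e using c2[OF that] card.infinite by fastforce
  have "3 * card X = (\<Sum>v\<in>X. card {e \<in> edges H. v \<in> e})"
    using cubic_at[OF H] X(1) by (simp add: subset_iff)
  also have "\<dots> = (\<Sum>v\<in>X. \<Sum>e\<in>edges H. if v \<in> e then 1 else 0)"
    by (simp only: card_filter_sum[OF fin(2)])
  also have "\<dots> = (\<Sum>e\<in>edges H. \<Sum>v\<in>X. if v \<in> e then 1 else 0)" by (rule sum.swap)
  also have "\<dots> = (\<Sum>e\<in>edges H. card (e \<inter> X))"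
  proof (rule sum.cong)
    fix e
    have "e \<inter> X = {v \<in> X. v \<in> e}" by blast
    then show "(\<Sum>v\<in>X. if v \<in> e then 1 else 0) = card (e \<inter> X)" by (simp only: card_filter_sum[OF fin(1)])
  qed simp
  also have "\<dots> \<le> (\<Sum>e\<in>edges H. 2 * (if e \<subseteq> X then 1 else 0) + (if card (e \<inter> X) = 1 then 1 else 0))"
  proof (rule sum_mono)
    fix e assume e: "e \<in> edges H"
    have le: "card (e \<inter> X) \<le> 2" using card_mono[OF fe[OF e], of "e \<inter> X"] c2[OF e] by simp
    have "e \<subseteq> X" if "card (e \<inter> X) = 2" using that c2[OF e] fe[OF e] card_subset_eq[of e "e \<inter> X"] by auto
    then show "card (e \<inter> X) \<le> 2 * (if e \<subseteq> X then 1 else 0) + (if card (e \<inter> X) = 1 then 1 else 0)"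
      using le by fastforce
  qed
  also have "\<dots> = 2 * card ?I + card (cut H X)"
    unfolding sum.distrib sum_distrib_left[symmetric] cut_def by (simp only: card_filter_sum[OF fin(2)])
  finally have "card X \<le> card ?I" using c by simp
  then obtain C where C: "is_circuit C" "verts C \<subseteq> X" "edges C \<subseteq> ?I"
    using many_edges_circuit[of X ?I] fin(1) X(2) c2 by blast
  have "e \<subseteq> verts C" if "e \<in> edges C" for e
  proof -
    obtain vs where vs: "circuit_listing vs C" using C(1) by (auto simp: is_circuit_def)
    then have "vs \<noteq> []" by (auto simp: circuit_listing_def)
    then show ?thesis using vs that hd_in_set[of vs] last_in_set[of vs] consecutive_pairs_subset[of e vs]
      by (auto simp: circuit_listing_def)
  qed
  then have "subgraph C H" using C X(1) by (auto simp: subgraph_def)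
  then show ?thesis using C by blast
qed

lemma cut_Compl:
  assumes "cubic H" shows "cut H (verts H - X) = cut H X"
proof -
  have "card (e \<inter> (verts H - X)) = 1 \<longleftrightarrow> card (e \<inter> X) = 1" if e: "e \<in> edges H" for e
  proof -
    have c: "card e = 2" "e \<subseteq> verts H" using assms e by (auto simp: cubic_def simple_graph_def)
    then have "finite e" using card.infinite by fastforce
    then have "card e = card (e \<inter> X) + card (e - X)" using card_Diff_subset_Int[of e X] card_mono[of e "e \<inter> X"] by simp
    moreover have "e \<inter> (verts H - X) = e - X" using c by blast
    ultimately show ?thesis using c by auto
  qed
  then show ?thesis by (auto simp: cut_def)
qed

text \<open>Cyclic connectivity in a usable form: instead of a circuit on each side, only lower
  bounds on the sizes of the two sides have to be supplied.\<close>

lemma cyclically_connected_cut: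
  assumes "cyclically_connected k H" "X \<subseteq> verts H" "X \<noteq> {}" "verts H - X \<noteq> {}"
    "card (cut H X) \<le> card X" "card (cut H X) \<le> card (verts H - X)"
  shows "k \<le> card (cut H X)"
proof -
  have H: "cubic H" using assms(1) by (simp add: cyclically_connected_def)
  show ?thesis
    using assms(1,2,4,6) cubic_small_cut_circuit[OF H assms(2,3,5)]
      cubic_small_cut_circuit[OF H, of "verts H - X"] cut_Compl[OF H, of X]
    unfolding cyclically_connected_def by auto
qed

section \<open>Growing a region until a path leaves it\<close>

definition meeting :: "'b graph \<Rightarrow> 'b set \<Rightarrow> 'b set set" where
  "meeting H X = {e \<in> edges H. e \<inter> X \<noteq> {}}"

lemma meeting_mono: "X \<subseteq> X' \<Longrightarrow> meeting H X \<subseteq> meeting H X'"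
  by (auto simp: meeting_def)

lemma linked_snoc_edge: "linked A L \<Longrightarrow> {p, q} \<notin> A \<Longrightarrow> linked (A \<union> {{p, q}}) (L @ [(p, q)])"
  by (rule linked_snoc[OF conn_edge]) auto

text \<open>\<open>X\<close> is what has been swallowed so far. Leg \<open>i\<close> crosses from
  \<open>X\<close> to the head of tail \<open>i\<close>; the tail runs outside \<open>X\<close> and
  meets the target \<open>Z\<close> in its last vertex only. A tail of one vertex means that the leg
  itself ends in \<open>Z\<close>.\<close>

definition region :: "'b graph \<Rightarrow> nat \<Rightarrow> 'b set \<Rightarrow> 'b set \<Rightarrow> 'b list list \<Rightarrow> 'b set list \<Rightarrow> bool" where
  "region H n Z X ts ls \<longleftrightarrow> X \<subseteq> verts H \<and> Z \<inter> X = {} \<and> length ts = n \<and> length ls = n \<and>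
     (\<forall>i<n. ts ! i \<noteq> [] \<and> distinct (ts ! i) \<and> set (ts ! i) \<inter> X = {} \<and> set (ts ! i) \<subseteq> verts H \<and>
        consecutive_pairs (ts ! i) \<subseteq> edges H \<and> set (butlast (ts ! i)) \<inter> Z = {} \<and> last (ts ! i) \<in> Z \<and>
        ls ! i \<in> edges H \<and> (\<exists>q\<in>X. ls ! i = {q, hd (ts ! i)})) \<and>
     (\<forall>i<n. \<forall>j<n. i \<noteq> j \<longrightarrow> set (ts ! i) \<inter> set (ts ! j) = {})"

lemma regionD:
  assumes "region H n Z X ts ls" "i < n"
  shows "ts ! i \<noteq> []" "distinct (ts ! i)" "set (ts ! i) \<inter> X = {}" "set (ts ! i) \<subseteq> verts H"
    "consecutive_pairs (ts ! i) \<subseteq> edges H" "set (butlast (ts ! i)) \<inter> Z = {}" "last (ts ! i) \<in> Z"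
    "ls ! i \<in> edges H" "\<exists>q\<in>X. ls ! i = {q, hd (ts ! i)}"
    "j < n \<Longrightarrow> i \<noteq> j \<Longrightarrow> set (ts ! i) \<inter> set (ts ! j) = {}"
  using assms unfolding region_def by blast+

lemma regionD':
  assumes "region H n Z X ts ls"
  shows "X \<subseteq> verts H" "Z \<inter> X = {}" "length ts = n" "length ls = n"
  using assms unfolding region_def by blast+

text \<open>An edge leaving \<open>X\<close> that is no leg is a possible exit. \<open>Ty\<close>
  records which routings exist inside \<open>X\<close> from the heads of the tails to the outer end
  \<open>u\<close> of that exit.\<close>

definition typed :: "'b graph \<Rightarrow> ('b set \<Rightarrow> 'b list \<Rightarrow> 'b \<Rightarrow> bool) \<Rightarrow> 'b set \<Rightarrow> 'b list list \<Rightarrow> 'b set list \<Rightarrow> bool" where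
  "typed H Ty X ts ls \<longleftrightarrow>
     (\<forall>p u. {p, u} \<in> edges H \<longrightarrow> p \<in> X \<longrightarrow> u \<notin> X \<longrightarrow> {p, u} \<notin> set ls \<longrightarrow> Ty X (map hd ts) u)"

lemma typedD:
  "typed H Ty X ts ls \<Longrightarrow> {p, u} \<in> edges H \<Longrightarrow> p \<in> X \<Longrightarrow> u \<notin> X \<Longrightarrow> {p, u} \<notin> set ls \<Longrightarrow> Ty X (map hd ts) u"
  unfolding typed_def by blast

text \<open>The closure properties mirror the ways in which a routing can be updated:
  \<open>ext\<close> prolongs the exit by an edge, \<open>extp\<close> moves a port along its tail,
  and \<open>land\<close> handles an exit that hits tail \<open>i\<close> at \<open>u\<close> while
  the new exit leaves that tail at \<open>t\<close>, between the old port and \<open>u\<close>. Only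
  tails with index in \<open>I\<close> may be hit in this way.\<close>

locale growth =
  fixes H :: "'b graph" and n k :: nat and I :: "nat set"
    and Ty :: "'b set \<Rightarrow> 'b list \<Rightarrow> 'b \<Rightarrow> bool"
  assumes cyc: "cyclically_connected k H" and nk: "0 < n" "n < k"
    and mono: "\<And>X X' ps u. Ty X ps u \<Longrightarrow> X \<subseteq> X' \<Longrightarrow> Ty X' ps u"
    and ext: "\<And>X X' ps u w. Ty X ps u \<Longrightarrow> X \<subseteq> X' \<Longrightarrow> {u, w} \<in> meeting H X' - meeting H X \<Longrightarrow> Ty X' ps w"
    and extp: "\<And>X X' ps u i q T. Ty X ps u \<Longrightarrow> X \<subseteq> X' \<Longrightarrow> i < n \<Longrightarrow> length ps = n \<Longrightarrow> conn T (ps ! i) q \<Longrightarrow>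
      T \<subseteq> meeting H X' - meeting H X \<Longrightarrow> Ty X' (ps[i := q]) u"
    and land: "\<And>X X' ps u i t q w. Ty X ps u \<Longrightarrow> X \<subseteq> X' \<Longrightarrow> i \<in> I \<Longrightarrow> i < n \<Longrightarrow> length ps = n \<Longrightarrow>
      t \<in> X' - X \<Longrightarrow> u \<in> X' - X \<Longrightarrow> t \<noteq> u \<Longrightarrow>
      linked (meeting H X' - meeting H X) [(ps ! i, t), (t, u), (u, q), (t, w)] \<Longrightarrow> Ty X' (ps[i := q]) w"
begin

lemma H: "cubic H"
  using cyc by (simp add: cyclically_connected_def)

text \<open>Otherwise every edge of the cut is one of the \<open>n\<close> legs, and
  \<open>n < k\<close>. The size bounds on \<open>X\<close> and \<open>Z\<close> supply what
  \<open>cyclically_connected_cut\<close> asks of the two sides.\<close>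

lemma exit_exists:
  assumes R: "region H n Z X ts ls" and c: "n \<le> card X" "n \<le> card Z" and Z: "Z \<subseteq> verts H"
  shows "\<exists>p u. {p, u} \<in> edges H \<and> p \<in> X \<and> u \<notin> X \<and> {p, u} \<notin> set ls"
proof (rule ccontr)
  assume no: "\<not> ?thesis"
  have "e \<in> set ls" if e: "e \<in> cut H X" for e
  proof -
    have e': "e \<in> edges H" "card (e \<inter> X) = 1" using e by (auto simp: cut_def)
    have "simple_graph H" using H by (simp add: cubic_def)
    then obtain a b where ab: "e = {a, b}" "a \<noteq> b" using simple_edgeE[OF _ e'(1)] by metis
    have "a \<in> X \<and> b \<notin> X \<or> b \<in> X \<and> a \<notin> X"
      using e'(2) ab by (cases "a \<in> X"; cases "b \<in> X") auto
    then show ?thesis using no e'(1) ab by (metis insert_commute)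
  qed
  then have "card (cut H X) \<le> card (set ls)" by (intro card_mono) auto
  also have "\<dots> \<le> n" using card_length[of ls] regionD'(4)[OF R] by simp
  finally have le: "card (cut H X) \<le> n" .
  have fin: "finite (verts H)" using cubic_finite[OF H] by blast
  have ZX: "Z \<subseteq> verts H - X" using Z regionD'(2)[OF R] by blast
  then have cz: "n \<le> card (verts H - X)" using c(2) card_mono[OF finite_Diff[OF fin] ZX] by linarith
  have "0 < card X" "0 < card (verts H - X)" using c(1) cz nk(1) by linarith+
  then have "X \<noteq> {}" "verts H - X \<noteq> {}" by (metis card.empty less_irrefl)+
  then have "k \<le> card (cut H X)"
    using cyclically_connected_cut[OF cyc regionD'(1)[OF R]] le c(1) cz by simp
  then show False using le nk(2) by simp
qed

text \<open>An exit has hit tail \<open>i\<close> at \<open>u\<close>. The tail is swallowed up to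
  \<open>u\<close>, and the port moves to the vertex after \<open>u\<close>. Exits of the new region
  start in the old one, on the swallowed segment, or at \<open>u\<close>.\<close>

lemma land_step:
  assumes R: "region H n Z X ts ls" and ty: "typed H Ty X ts ls"
    and i: "i < n" "i \<in> I" and s: "ts ! i = as @ u # bs" and "bs \<noteq> []"
    and d: "{p, u} \<in> edges H" "p \<in> X" "{p, u} \<notin> set ls"
  defines "X' \<equiv> X \<union> set as \<union> {u}" and "ts' \<equiv> ts[i := bs]" and "ls' \<equiv> ls[i := {u, hd bs}]"
  shows "region H n Z X' ts' ls'" "typed H Ty X' ts' ls'"
proof -
  note r = regionD[OF R i(1)]
  obtain q cs where bs: "bs = q # cs" using \<open>bs \<noteq> []\<close> by (cases bs) auto
  have dis: "distinct (as @ u # q # cs)" using r(2) s bs by simp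
  have notX: "x \<notin> X" if "x \<in> set (as @ u # q # cs)" for x using r(3) s bs that by auto
  have cp: "consecutive_pairs (ts ! i) = consecutive_pairs (as @ [u]) \<union> insert {u, q} (consecutive_pairs bs)"
    using s bs consecutive_pairs_append[of as u bs] by simp
  have uq: "{u, q} \<in> edges H" using cp r(5) by blast
  have len: "length ts = n" "length ls = n" using regionD'[OF R] by auto
  have bl: "butlast (ts ! i) = as @ u # butlast bs" "last (ts ! i) = last bs"
    using s bs by (simp_all add: butlast_append)
  have uX: "u \<notin> X" using notX by simp
  show R': "region H n Z X' ts' ls'"
    unfolding region_def
  proof (intro conjI allI impI)
    show "X' \<subseteq> verts H" using regionD'(1)[OF R] r(4) s by (auto simp: X'_def)
    show "Z \<inter> X' = {}" using regionD'(2)[OF R] r(6) bl by (auto simp: X'_def)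
    show "length ts' = n" "length ls' = n" using len by (simp_all add: ts'_def ls'_def)
  next
    fix j assume j: "j < n"
    note rj = regionD[OF R j]
    have ii: "set (ts ! i) \<inter> set (ts ! j) = {}" if "j \<noteq> i" using regionD(10)[OF R i(1) j] that by blast
    have ts'j: "ts' ! j = (if j = i then bs else ts ! j)" and ls'j: "ls' ! j = (if j = i then {u, q} else ls ! j)"
      using j len bs by (simp_all add: ts'_def ls'_def nth_list_update)
    have bs3: "set bs \<subseteq> verts H" "distinct bs" "bs \<noteq> []" "set bs \<inter> X' = {}" "consecutive_pairs bs \<subseteq> edges H"
      using r(4) s dis bs notX cp r(5) by (auto simp: X'_def)
    show "ts' ! j \<noteq> []" "distinct (ts' ! j)" "set (ts' ! j) \<subseteq> verts H" "consecutive_pairs (ts' ! j) \<subseteq> edges H"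
      unfolding ts'j using rj bs3 by simp_all
    have "set (ts ! j) \<inter> X' = {}" if "j \<noteq> i"
      using rj(3) ii[OF that] s by (auto simp: X'_def)
    then show "set (ts' ! j) \<inter> X' = {}" unfolding ts'j using bs3 by simp
    show "set (butlast (ts' ! j)) \<inter> Z = {}" "last (ts' ! j) \<in> Z"
      unfolding ts'j using rj(6,7) r(6,7) bl by auto
    show "ls' ! j \<in> edges H" unfolding ls'j using rj(8) uq by simp
    have "u \<in> X'" "X \<subseteq> X'" "hd bs = q" using bs by (auto simp: X'_def)
    then show "\<exists>q\<in>X'. ls' ! j = {q, hd (ts' ! j)}"
      unfolding ls'j ts'j using rj(9) by auto
  next
    fix j j' assume j: "j < n" "j' < n" "j \<noteq> j'"
    have "set (ts' ! l) \<subseteq> set (ts ! l)" if "l < n" for l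
      using that len s by (cases "l = i") (auto simp: ts'_def)
    then show "set (ts' ! j) \<inter> set (ts' ! j') = {}" using regionD(10)[OF R j(1,2,3)] j by blast
  qed
  have hds: "map hd ts' = (map hd ts)[i := q]" using bs by (simp add: ts'_def map_update)
  have XX': "X \<subseteq> X'" by (auto simp: X'_def)
  have mt: "e \<in> meeting H X' - meeting H X" if "e \<in> edges H" "e \<inter> X' \<noteq> {}" "e \<inter> X = {}" for e
    using that by (auto simp: meeting_def)
  have cpX: "consecutive_pairs (as @ [u]) \<subseteq> meeting H X' - meeting H X"
  proof
    fix e assume e: "e \<in> consecutive_pairs (as @ [u])"
    have "e \<subseteq> set (as @ [u])" by (rule consecutive_pairs_subset[OF e])
    moreover have "card e = 2" using consecutive_pairs_card[OF _ e] dis by simp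
    then have "e \<noteq> {}" by auto
    ultimately have "e \<inter> X' \<noteq> {}" "e \<inter> X = {}" using notX by (auto simp: X'_def)
    then show "e \<in> meeting H X' - meeting H X" using e cp r(5) mt by blast
  qed
  have uqX: "{u, q} \<in> meeting H X' - meeting H X"
    using uq notX by (intro mt) (auto simp: X'_def)
  have d12: "consecutive_pairs (as @ [u]) \<inter> {{u, q}} = {}"
    using dis consecutive_pairs_subset[of "{u, q}" "as @ [u]"] by auto
  have hdas: "hd (ts ! i) = hd (as @ [u])" using s by (cases as) auto
  show "typed H Ty X' ts' ls'"
    unfolding typed_def hds
  proof (intro allI impI)
    fix p' u' assume e: "{p', u'} \<in> edges H" "p' \<in> X'" "u' \<notin> X'" "{p', u'} \<notin> set ls'"
    consider "p' \<in> X" | "p' \<in> set as" | "p' = u" using e(2) by (auto simp: X'_def)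
    then show "Ty X' ((map hd ts)[i := q]) u'"
    proof cases
      \<comment> \<open>An old exit stays an exit; only port \<open>i\<close> moves, along the
        swallowed segment and on to \<open>q\<close>.\<close>
      case 1
      have "{p', u'} \<notin> set ls"
      proof
        assume "{p', u'} \<in> set ls"
        then obtain j where j: "j < n" "{p', u'} = ls ! j" using len(2) by (auto simp: in_set_conv_nth)
        show False
        proof (cases "j = i")
          case True
          obtain q0 where "q0 \<in> X" "ls ! i = {q0, hd (ts ! i)}" using r(9) by blast
          moreover have "hd (ts ! i) \<in> X'" unfolding hdas by (cases as) (auto simp: X'_def)
          ultimately show False using j True e(3) XX' by (auto simp: doubleton_eq_iff)
        next
          case False
          then have "ls' ! j = ls ! j" by (simp add: ls'_def)
          then show False using j e(4) len by (metis length_list_update ls'_def nth_mem)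
        qed
      qed
      then have t0: "Ty X (map hd ts) u'" using typedD[OF ty e(1)] 1 e(3) XX' by blast
      let ?T = "consecutive_pairs (as @ [u]) \<union> {{u, q}}"
      have "conn ?T (hd (as @ [u])) u"
        using conn_consecutive_pairs[of "as @ [u]"] by (auto intro: conn_mono)
      then have c: "conn ?T (map hd ts ! i) q"
        using i(1) len hdas conn_edge[of u q ?T] by (auto intro: conn_trans)
      have "?T \<subseteq> meeting H X' - meeting H X" using cpX uqX by blast
      then show ?thesis
        using extp[OF t0 XX' i(1) _ c] len by simp
    next
      \<comment> \<open>The new exit starts at \<open>p'\<close> on the swallowed segment. The tail
        then supplies the connections from the old port to \<open>p'\<close>, from \<open>p'\<close>
        to \<open>u\<close> and from \<open>u\<close> to \<open>q\<close>, and the exit edge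
        supplies the fourth one required by \<open>land\<close>.\<close>
      case 2
      obtain a1 a2 where as: "as = a1 @ p' # a2" using 2 by (meson split_list)
      have t0: "Ty X (map hd ts) u" by (rule typedD[OF ty d(1,2) uX d(3)])
      let ?A1 = "consecutive_pairs (a1 @ [p'])" and ?A2 = "consecutive_pairs (p' # a2 @ [u])"
      have A12: "?A1 \<union> ?A2 = consecutive_pairs (as @ [u])"
        using as consecutive_pairs_append[of a1 p' "a2 @ [u]"] by simp
      have l1: "linked ?A1 [(hd (as @ [u]), p')]"
        using conn_consecutive_pairs[of "a1 @ [p']"] as by (intro linked_single[of ?A1]) (cases a1; auto)+
      have l2: "conn ?A2 p' u" using conn_consecutive_pairs[of "p' # a2 @ [u]"] by simp
      have "?A1 \<inter> ?A2 = {}" using consecutive_pairs_disjoint[of a1 p' "a2 @ [u]"] dis as by auto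
      then have l3: "linked (consecutive_pairs (as @ [u])) [(hd (as @ [u]), p'), (p', u)]"
        using linked_snoc[OF l2 l1] A12 by simp
      have l4: "linked (consecutive_pairs (as @ [u]) \<union> {{u, q}}) [(hd (as @ [u]), p'), (p', u), (u, q)]"
        using linked_snoc_edge[OF l3, of u q] d12 by simp
      have "{p', u'} \<notin> consecutive_pairs (as @ [u]) \<union> {{u, q}}"
      proof
        assume "{p', u'} \<in> consecutive_pairs (as @ [u]) \<union> {{u, q}}"
        moreover have "{p', u'} \<notin> consecutive_pairs (as @ [u])"
          using consecutive_pairs_subset[of "{p', u'}" "as @ [u]"] e(3) by (auto simp: X'_def)
        ultimately show False using 2 dis by (auto simp: doubleton_eq_iff)
      qed
      then have l5: "linked (consecutive_pairs (as @ [u]) \<union> {{u, q}} \<union> {{p', u'}})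
          [(hd (as @ [u]), p'), (p', u), (u, q), (p', u')]"
        using linked_snoc_edge[OF l4, of p' u'] by simp
      have "{p', u'} \<in> meeting H X' - meeting H X"
        using e 2 notX by (intro mt) (auto simp: X'_def)
      then have "consecutive_pairs (as @ [u]) \<union> {{u, q}} \<union> {{p', u'}} \<subseteq> meeting H X' - meeting H X"
        using cpX uqX by blast
      then have lk: "linked (meeting H X' - meeting H X) [(hd (as @ [u]), p'), (p', u), (u, q), (p', u')]"
        by (rule linked_mono[OF l5])
      have hd: "map hd ts ! i = hd (as @ [u])" using i(1) len hdas by simp
      have "p' \<in> X' - X" "u \<in> X' - X" "p' \<noteq> u" using 2 dis notX uX by (auto simp: X'_def)
      then show ?thesis
        using land[OF t0 XX' i(2,1)] lk len unfolding hd by simp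
    next
      \<comment> \<open>No exit starts at \<open>u\<close>: its three edges lead to
        \<open>p\<close>, to \<open>q\<close>, and back along the tail, or along the leg if
        \<open>as\<close> is empty.\<close>
      case 3
      obtain pr where pr: "{pr, u} \<in> edges H" "pr \<noteq> q" "{pr, u} \<noteq> {p, u}" "pr \<in> X'"
      proof (cases as rule: rev_cases)
        case Nil
        obtain q0 where q0: "q0 \<in> X" "ls ! i = {q0, u}" using r(9) s Nil by auto
        show ?thesis
          using q0 r(8) d(3) i(1) len notX[of q] XX' nth_mem[of i ls] by (intro that[of q0]) auto
      next
        case (snoc as' a)
        have "{a, u} \<in> consecutive_pairs (as @ [u])"
          using snoc consecutive_pairs_append[of as' a "[u]"] by auto
        then show ?thesis
          using cp r(5) d(2) notX[of a] notX[of u] snoc dis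
          by (intro that[of a]) (auto simp: doubleton_eq_iff X'_def)
      qed
      have "q \<noteq> p" "q \<noteq> u" "u \<noteq> p" using notX[of q] uX d(2) dis by auto
      moreover have "q \<notin> X'" using notX[of q] dis by (auto simp: X'_def)
      ultimately have "{u', u} \<noteq> {pr, u}" "{u', u} \<noteq> {p, u}" "{u', u} \<noteq> {q, u}" "{p, u} \<noteq> {q, u}" "{pr, u} \<noteq> {q, u}"
        using e 3 pr d(2) XX' bs i(1) len set_update_memI[of i ls "{u, hd bs}"]
        by (auto simp: doubleton_eq_iff ls'_def insert_commute)
      moreover have "{{u', u}, {pr, u}, {p, u}, {q, u}} \<subseteq> edges H"
        using e(1) 3 pr(1) d(1) uq by (auto simp: insert_commute)
      ultimately show ?thesis
        using cubic_four_edges[OF H, of "{u', u}" "{pr, u}" "{p, u}" "{q, u}" u] pr(3) by auto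
    qed
  qed
qed

text \<open>Tails only lose initial segments. Keeping them suffixes of the original tails ensures
  that what is left still lies on the original legs.\<close>

definition grown :: "'b set \<Rightarrow> 'b set \<Rightarrow> 'b list list \<Rightarrow> bool" where
  "grown Z X ts \<longleftrightarrow> (\<exists>X' ts' ls' p u. region H n Z X' ts' ls' \<and> X \<subseteq> X' \<and> p \<in> X' \<and> u \<in> Z \<and>
    {p, u} \<in> edges H \<and> {p, u} \<notin> set ls' \<and> Ty X' (map hd ts') u \<and> (\<forall>i<n. suffix (ts' ! i) (ts ! i)))"

lemma grown_mono:
  assumes "grown Z X' ts'" "X \<subseteq> X'" "\<And>i. i < n \<Longrightarrow> suffix (ts' ! i) (ts ! i)"
  shows "grown Z X ts"
proof -
  obtain X'' ts'' ls'' p u where g: "region H n Z X'' ts'' ls''" "X' \<subseteq> X''" "p \<in> X''" "u \<in> Z"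
    "{p, u} \<in> edges H" "{p, u} \<notin> set ls''" "Ty X'' (map hd ts'') u" "\<forall>i<n. suffix (ts'' ! i) (ts' ! i)"
    using assms(1) unfolding grown_def by (elim exE conjE)
  have "\<forall>i<n. suffix (ts'' ! i) (ts ! i)" using g(8) assms(3) suffix_order.trans by blast
  moreover have "X \<subseteq> X''" using assms(2) g(2) by (rule order_trans)
  ultimately show ?thesis unfolding grown_def using g(1,3-7)
    by (intro exI[of _ X''] exI[of _ ts''] exI[of _ ls''] exI[of _ p] exI[of _ u] conjI)
qed

text \<open>Induction on the number of vertices outside \<open>X\<close>. The end of an exit is in
  \<open>Z\<close>, which finishes the proof, or on a tail, which \<open>land_step\<close> handles,
  or elsewhere, in which case it is added to \<open>X\<close>. A tail of one vertex lies in
  \<open>Z\<close> and so is never hit before the end.\<close>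

theorem grow:
  assumes "region H n Z X ts ls" "typed H Ty X ts ls" "n \<le> card X" "n \<le> card Z" "Z \<subseteq> verts H"
    and "\<And>i. i < n \<Longrightarrow> i \<notin> I \<Longrightarrow> length (ts ! i) = 1"
  shows "grown Z X ts"
  using assms
proof (induction "card (verts H - X)" arbitrary: X ts ls rule: less_induct)
  case less
  note R = less.prems(1) and ty = less.prems(2)
  have fin: "finite (verts H)" using cubic_finite[OF H] by blast
  obtain p u where d: "{p, u} \<in> edges H" "p \<in> X" "u \<notin> X" "{p, u} \<notin> set ls"
    using exit_exists[OF R less.prems(3-5)] by blast
  have uH: "u \<in> verts H" using d(1) H by (auto simp: cubic_def simple_graph_def)
  have Xf: "finite X" using regionD'(1)[OF R] fin finite_subset by blast
  have dec: "card (verts H - X') < card (verts H - X)" if "X \<subseteq> X'" "u \<in> X'" for X'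
    using that uH d(3) fin by (intro psubset_card_mono) auto
  have cX': "n \<le> card X'" if "X \<subseteq> X'" "X' \<subseteq> verts H" for X'
    using card_mono[of X' X] that less.prems(3) finite_subset[OF that(2) fin] by linarith
  consider "u \<in> Z" | i where "u \<notin> Z" "i < n" "u \<in> set (ts ! i)" | "u \<notin> Z" "\<forall>i<n. u \<notin> set (ts ! i)" by blast
  then show ?case
  proof cases
    case 1
    then show ?thesis unfolding grown_def using R d typedD[OF ty d(1,2,3,4)]
      by (intro exI[of _ X] exI[of _ ts] exI[of _ ls] exI[of _ p] exI[of _ u]) simp
  next
    case 2
    obtain as bs where s: "ts ! i = as @ u # bs" using 2(3) by (meson split_list)
    have bs: "bs \<noteq> []" using 2(1) s regionD(7)[OF R 2(2)] by auto
    have iI: "i \<in> I"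
    proof (rule ccontr)
      assume "i \<notin> I"
      then have "length (ts ! i) = 1" by (rule less.prems(6)[OF 2(2)])
      then show False using s bs by simp
    qed
    let ?X = "X \<union> set as \<union> {u}" and ?ts = "ts[i := bs]" and ?ls = "ls[i := {u, hd bs}]"
    note L = land_step[OF R ty 2(2) iI s bs d(1,2,4)]
    have len: "length (?ts ! j) = 1" if "j < n" "j \<notin> I" for j
      using less.prems(6)[OF that] that iI by (cases "j = i") auto
    have g: "grown Z ?X ?ts"
      by (rule less.hyps[OF dec L cX' less.prems(4,5) len]) (use regionD'(1)[OF L(1)] in auto)
    have sf: "suffix (?ts ! j) (ts ! j)" if "j < n" for j
      using s that regionD'(3)[OF R] by (cases "j = i") (auto simp: suffix_def)
    show ?thesis by (rule grown_mono[OF g _ sf]) auto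
  next
    case 3
    let ?X = "X \<union> {u}"
    have R': "region H n Z ?X ts ls"
      unfolding region_def
    proof (intro conjI allI impI)
      show "?X \<subseteq> verts H" "Z \<inter> ?X = {}" "length ts = n" "length ls = n"
        using regionD'[OF R] uH 3(1) by auto
    next
      fix j assume j: "j < n"
      note r = regionD[OF R j]
      show "ts ! j \<noteq> []" "distinct (ts ! j)" "set (ts ! j) \<inter> ?X = {}" "set (ts ! j) \<subseteq> verts H"
        "consecutive_pairs (ts ! j) \<subseteq> edges H" "set (butlast (ts ! j)) \<inter> Z = {}" "last (ts ! j) \<in> Z" "ls ! j \<in> edges H"
        using r 3 j by auto
      show "\<exists>q\<in>?X. ls ! j = {q, hd (ts ! j)}" using r(9) by auto
    next
      fix j j' assume "j < n" "j' < n" "j \<noteq> j'"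
      then show "set (ts ! j) \<inter> set (ts ! j') = {}" by (rule regionD(10)[OF R])
    qed
    have t0: "Ty X (map hd ts) u" by (rule typedD[OF ty d])
    have ty': "typed H Ty ?X ts ls"
      unfolding typed_def
    proof (intro allI impI)
      fix p' u' assume e: "{p', u'} \<in> edges H" "p' \<in> ?X" "u' \<notin> ?X" "{p', u'} \<notin> set ls"
      show "Ty ?X (map hd ts) u'"
      proof (cases "p' \<in> X")
        case True
        show ?thesis by (rule mono[OF typedD[OF ty e(1) True _ e(4)]]) (use e(3) in auto)
      next
        case False
        then have "p' = u" using e(2) by simp
        then show ?thesis using e d(3) by (intro ext[OF t0]) (auto simp: meeting_def)
      qed
    qed
    have g: "grown Z ?X ts"
      by (rule less.hyps[OF dec R' ty' cX' less.prems(4-6)]) (use regionD'(1)[OF R'] in auto)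
    show ?thesis by (rule grown_mono[OF g]) auto
  qed
qed

end

section \<open>Patterns, types and their tables\<close>

text \<open>A pattern \<open>(m, P)\<close> is a small graph with edge list \<open>P\<close> on
  numbers: 0 to 3 are the ports, 4 is the exit, and the \<open>m\<close> numbers from 5 on are
  branch vertices with distinct images. Larger numbers may occur as anonymous points on
  connections.\<close>

type_synonym pattern = "nat \<times> (nat \<times> nat) list"

text \<open>Every connection starts at a branch vertex and each port or exit ends at most one
  connection. Moving a port therefore lengthens a single connection, at its second end.\<close>

definition okp :: "pattern \<Rightarrow> bool" where
  "okp p \<longleftrightarrow> list_all (\<lambda>(i, j). 5 \<le> i \<and> i < 5 + fst p \<and> j < 5 + fst p) (snd p) \<and>
     distinct (filter (\<lambda>j. j < 5) (map snd (snd p)))"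

text \<open>Positions of ports and exit are prescribed by \<open>\<sigma>\<close>; they may lie
  outside \<open>X\<close> and may coincide. Only the branch vertices are confined to
  \<open>X\<close> and kept distinct.\<close>

definition real :: "'b graph \<Rightarrow> 'b set \<Rightarrow> pattern \<Rightarrow> (nat \<Rightarrow> 'b) \<Rightarrow> bool" where
  "real H X p \<sigma> \<longleftrightarrow> (\<exists>\<rho>. (\<forall>l<5. \<rho> l = \<sigma> l) \<and> inj_on \<rho> {5..<5 + fst p} \<and> \<rho> ` {5..<5 + fst p} \<subseteq> X \<and>
     linked (meeting H X) (map (map_prod \<rho> \<rho>) (snd p)))"

text \<open>Here \<open>5 + n\<close> is the foot of the new exit, \<open>6 + n\<close> the point at
  which the old exit hits the tail, and \<open>7 + n\<close> the old position of port
  \<open>i\<close>. The last one is not counted as a branch vertex, because the new exit may start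
  right there and the two positions then coincide.\<close>

definition land :: "nat \<Rightarrow> pattern \<Rightarrow> pattern" where
  "land i p = (let n = fst p in (n + 2,
     map (\<lambda>(a, b). (a, if b = i then 7 + n else if b = 4 then 6 + n else b)) (snd p) @
     [(7 + n, 5 + n), (5 + n, 6 + n), (6 + n, i), (5 + n, 4)]))"

text \<open>The pattern seen when an exit starts in the interior of connection \<open>k\<close>: the
  new node \<open>5 + n\<close> splits this connection and carries the exit.\<close>

definition sub :: "nat \<Rightarrow> pattern \<Rightarrow> pattern" where
  "sub k p = (let n = fst p; P = snd p in
     (n + 1, P[k := (fst (P ! k), 5 + n)] @ [(5 + n, snd (P ! k)), (5 + n, 4)]))"

text \<open>A certificate that \<open>p\<close> contains a subdivision of \<open>q\<close> with the
  same ports and exit: \<open>ms\<close> names the branch vertices of \<open>p\<close> that serve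
  for \<open>q\<close>, and \<open>Is\<close> the disjoint walks that serve as its
  connections.\<close>

definition check :: "pattern \<Rightarrow> pattern \<Rightarrow> nat list \<Rightarrow> nat list list \<Rightarrow> bool" where
  "check p q ms Is \<longleftrightarrow> length ms = fst q \<and> distinct ms \<and> list_all (\<lambda>m. 5 \<le> m \<and> m < 5 + fst p) ms \<and>
     distinct (concat Is) \<and>
     routes (snd p) Is (map (\<lambda>(i, j). (if i < 5 then i else ms ! (i - 5), if j < 5 then j else ms ! (j - 5))) (snd q))"

lemma realE:
  assumes "real H X p \<sigma>"
  obtains \<rho> where "\<forall>l<5. \<rho> l = \<sigma> l" "inj_on \<rho> {5..<5 + fst p}" "\<rho> ` {5..<5 + fst p} \<subseteq> X"
    "linked (meeting H X) (map (map_prod \<rho> \<rho>) (snd p))"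
  using assms unfolding real_def by (elim exE conjE)

lemma real_mono:
  assumes "real H X p \<sigma>" "X \<subseteq> X'" shows "real H X' p \<sigma>"
proof -
  obtain \<rho> where \<rho>: "\<forall>l<5. \<rho> l = \<sigma> l" "inj_on \<rho> {5..<5 + fst p}" "\<rho> ` {5..<5 + fst p} \<subseteq> X"
    "linked (meeting H X) (map (map_prod \<rho> \<rho>) (snd p))"
    by (fact realE[OF assms(1)])
  show ?thesis
    unfolding real_def
    by (intro exI[of _ \<rho>] conjI \<rho>(1,2) order_trans[OF \<rho>(3) assms(2)] linked_mono[OF \<rho>(4) meeting_mono[OF assms(2)]])
qed

lemma walk_map: "walk L p is q \<Longrightarrow> walk (map (map_prod \<rho> \<rho>) L) (\<rho> p) is (\<rho> q)"
proof (induction "is" arbitrary: p)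
  case (Cons i "is")
  then have i: "i < length L" by simp
  have f: "fst (map (map_prod \<rho> \<rho>) L ! i) = \<rho> (fst (L ! i))" "snd (map (map_prod \<rho> \<rho>) L ! i) = \<rho> (snd (L ! i))"
    using i by simp_all
  consider "fst (L ! i) = p" "walk L (snd (L ! i)) is q" | "snd (L ! i) = p" "walk L (fst (L ! i)) is q"
    using Cons.prems by auto
  then show ?case
  proof cases
    case 1
    then show ?thesis unfolding walk.simps(2) f using i Cons.IH[OF 1(2)] by simp
  next
    case 2
    then show ?thesis unfolding walk.simps(2) f using i Cons.IH[OF 2(2)] by simp
  qed
qed simp

lemma routes_map: "routes L Is L' \<Longrightarrow> routes (map (map_prod \<rho> \<rho>) L) Is (map (map_prod \<rho> \<rho>) L')"
  by (induction L Is L' rule: routes.induct) (auto dest: walk_map simp del: walk.simps)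

lemma real_check:
  assumes "real H X p \<sigma>" "check p q ms Is"
  shows "real H X q \<sigma>"
proof -
  obtain \<rho> where \<rho>: "\<forall>l<5. \<rho> l = \<sigma> l" "inj_on \<rho> {5..<5 + fst p}" "\<rho> ` {5..<5 + fst p} \<subseteq> X"
    "linked (meeting H X) (map (map_prod \<rho> \<rho>) (snd p))"
    by (fact realE[OF assms(1)])
  note c = assms(2)[unfolded check_def]
  define m where "m i = (if i < 5 then i else ms ! (i - 5))" for i :: nat
  have mr: "m i \<in> {5..<5 + fst p}" if "i \<in> {5..<5 + fst q}" for i
    using c that by (auto simp: m_def list_all_iff)
  have mi: "inj_on m {5..<5 + fst q}"
  proof (rule inj_onI)
    fix i j assume "i \<in> {5..<5 + fst q}" "j \<in> {5..<5 + fst q}" "m i = m j"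
    moreover from this have "i - 5 = j - 5" using c by (auto simp: m_def nth_eq_iff_index_eq)
    ultimately show "i = j" by auto
  qed
  have "routes (snd p) Is (map (map_prod m m) (snd q))"
    using c by (simp add: m_def map_prod_def)
  then have "linked (meeting H X) (map (map_prod \<rho> \<rho>) (map (map_prod m m) (snd q)))"
    using linked_route[OF \<rho>(4) routes_map] c by blast
  moreover have "map (map_prod \<rho> \<rho>) (map (map_prod m m) (snd q)) = map (map_prod (\<rho> \<circ> m) (\<rho> \<circ> m)) (snd q)"
    by (auto simp: map_prod_def)
  ultimately have "linked (meeting H X) (map (map_prod (\<rho> \<circ> m) (\<rho> \<circ> m)) (snd q))" by (simp only:)
  moreover have "\<forall>l<5. (\<rho> \<circ> m) l = \<sigma> l" using \<rho>(1) by (simp add: m_def)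
  moreover have "inj_on (\<rho> \<circ> m) {5..<5 + fst q}"
    using mi \<rho>(2) mr by (intro comp_inj_on) (auto intro: inj_on_subset)
  moreover have "(\<rho> \<circ> m) ` {5..<5 + fst q} \<subseteq> X" using \<rho>(3) mr by fastforce
  ultimately show ?thesis unfolding real_def by (intro exI[of _ "\<rho> \<circ> m"] conjI)
qed

lemma distinct_filter_nth:
  "distinct (filter Q xs) \<Longrightarrow> k < length xs \<Longrightarrow> l < length xs \<Longrightarrow> xs ! k = xs ! l \<Longrightarrow> Q (xs ! k) \<Longrightarrow> k = l"
proof (induction xs arbitrary: k l)
  case (Cons x xs)
  show ?case
  proof (cases k)
    case 0
    show ?thesis
    proof (cases l)
      case (Suc l')
      then have "x \<in> set (filter Q xs)" using Cons.prems 0 by (auto intro: nth_mem)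
      then show ?thesis using Cons.prems 0 by auto
    qed (simp add: 0)
  next
    case (Suc k')
    show ?thesis
    proof (cases l)
      case 0
      then have "x \<in> set (filter Q xs)" using Cons.prems Suc nth_mem[of k' xs] by auto
      then show ?thesis using Cons.prems 0 Suc by auto
    next
      case (Suc l')
      have "distinct (filter Q xs)" using Cons.prems(1) by (auto split: if_splits)
      then have "k' = l'" using Cons.IH[of k' l'] Cons.prems \<open>k = Suc k'\<close> Suc by simp
      then show ?thesis using Suc \<open>k = Suc k'\<close> by simp
    qed
  qed
qed simp

text \<open>Only the connection ending at number \<open>l\<close> is lengthened, by the fresh edges
  in \<open>T\<close>; the last two assumptions make it unique and keep \<open>l\<close> from being
  a first end.\<close>

lemma linked_ext:
  assumes "linked A L" and c: "conn T (\<sigma> l) q" and T: "T \<inter> A = {}"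
    and L: "L = map (map_prod \<rho> \<rho>) P" and \<rho>: "\<rho> l = \<sigma> l"
    and P: "\<And>i j. (i, j) \<in> set P \<Longrightarrow> i \<noteq> l"
      "\<And>k k'. k < length P \<Longrightarrow> k' < length P \<Longrightarrow> snd (P ! k) = l \<Longrightarrow> snd (P ! k') = l \<Longrightarrow> k = k'"
  shows "linked (A \<union> T) (map (map_prod (\<rho>(l := q)) (\<rho>(l := q))) P)"
proof -
  obtain S where S: "\<And>i. i < length L \<Longrightarrow> S i \<subseteq> A"
    "\<And>i. i < length L \<Longrightarrow> conn (S i) (fst (L ! i)) (snd (L ! i))"
    "\<And>i j. i < length L \<Longrightarrow> j < length L \<Longrightarrow> i \<noteq> j \<Longrightarrow> S i \<inter> S j = {}"
    by (fact linkedE[OF assms(1)])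
  have len: "length L = length P" using L by simp
  let ?S = "\<lambda>k. S k \<union> (if snd (P ! k) = l then T else {})"
  show ?thesis
  proof (rule linkedI[of _ ?S], unfold length_map)
    fix k assume k: "k < length P"
    show "?S k \<subseteq> A \<union> T" using S(1)[of k] k len by auto
    have nl: "fst (P ! k) \<noteq> l" using P(1)[of "fst (P ! k)" "snd (P ! k)"] k by simp
    have c0: "conn (?S k) (\<rho> (fst (P ! k))) (\<rho> (snd (P ! k)))"
      using S(2)[of k] k len L by (auto elim: conn_mono)
    show "conn (?S k) (fst (map (map_prod (\<rho>(l := q)) (\<rho>(l := q))) P ! k))
       (snd (map (map_prod (\<rho>(l := q)) (\<rho>(l := q))) P ! k))"
    proof (cases "snd (P ! k) = l")
      case True
      have "conn (?S k) (\<sigma> l) q" using c True by (auto elim: conn_mono)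
      then show ?thesis using conn_trans[OF c0] True \<rho> nl k by simp
    next
      case False
      then show ?thesis using c0 nl k by simp
    qed
  next
    fix k k' assume k: "k < length P" "k' < length P" "k \<noteq> k'"
    have "S k \<inter> S k' = {}" "S k \<subseteq> A" "S k' \<subseteq> A" using S k len by auto
    moreover have "\<not> (snd (P ! k) = l \<and> snd (P ! k') = l)" using P(2) k by blast
    ultimately show "?S k \<inter> ?S k' = {}" using T by (auto split: if_splits)
  qed
qed

lemma okp_leaf:
  assumes "okp p" "l < 5"
  shows "(i, j) \<in> set (snd p) \<Longrightarrow> i \<noteq> l"
    and "k < length (snd p) \<Longrightarrow> k' < length (snd p) \<Longrightarrow> snd (snd p ! k) = l \<Longrightarrow> snd (snd p ! k') = l \<Longrightarrow> k = k'"
proof -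
  show "(i, j) \<in> set (snd p) \<Longrightarrow> i \<noteq> l"
    using assms by (auto simp: okp_def list_all_iff)
  assume k: "k < length (snd p)" "k' < length (snd p)" "snd (snd p ! k) = l" "snd (snd p ! k') = l"
  have d: "distinct (filter (\<lambda>j. j < 5) (map snd (snd p)))" using assms(1) by (simp add: okp_def)
  show "k = k'" by (rule distinct_filter_nth[OF d]) (use k assms(2) in auto)
qed

lemma real_ext:
  assumes r: "real H X p \<sigma>" and ok: "okp p" and l: "l < 5" and X: "X \<subseteq> X'"
    and c: "conn T (\<sigma> l) q" and T: "T \<subseteq> meeting H X' - meeting H X"
  shows "real H X' p (\<sigma>(l := q))"
proof -
  obtain \<rho> where \<rho>: "\<forall>l<5. \<rho> l = \<sigma> l" "inj_on \<rho> {5..<5 + fst p}" "\<rho> ` {5..<5 + fst p} \<subseteq> X"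
    "linked (meeting H X) (map (map_prod \<rho> \<rho>) (snd p))"
    by (fact realE[OF r])
  have "linked (meeting H X \<union> T) (map (map_prod (\<rho>(l := q)) (\<rho>(l := q))) (snd p))"
    by (rule linked_ext[where l = l and \<sigma> = \<sigma>, OF \<rho>(4) c _ refl]) (use T \<rho>(1) l okp_leaf[OF ok l] in auto)
  moreover have "meeting H X \<union> T \<subseteq> meeting H X'" using T meeting_mono[OF X] by blast
  ultimately have "linked (meeting H X') (map (map_prod (\<rho>(l := q)) (\<rho>(l := q))) (snd p))"
    by (rule linked_mono)
  moreover have "inj_on (\<rho>(l := q)) {5..<5 + fst p}"
    using \<rho>(2) l by (simp add: inj_on_def)
  moreover have "\<forall>k<5. (\<rho>(l := q)) k = (\<sigma>(l := q)) k" using \<rho>(1) by simp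
  moreover have "(\<rho>(l := q)) ` {5..<5 + fst p} \<subseteq> X'" using \<rho>(3) l X by auto
  ultimately show ?thesis unfolding real_def by (intro exI[of _ "\<rho>(l := q)"] conjI)
qed

lemma real_land:
  assumes r: "real H X p \<sigma>" and ok: "okp p" and i: "i < 4" and X: "X \<subseteq> X'"
    and t: "t \<in> X' - X" "u \<in> X' - X" "t \<noteq> u" and u: "\<sigma> 4 = u"
    and lk: "linked (meeting H X' - meeting H X) [(\<sigma> i, t), (t, u), (u, q), (t, w)]"
  shows "real H X' (land i p) (\<sigma>(i := q, 4 := w))"
proof -
  obtain \<rho> where \<rho>: "\<forall>l<5. \<rho> l = \<sigma> l" "inj_on \<rho> {5..<5 + fst p}" "\<rho> ` {5..<5 + fst p} \<subseteq> X"
    "linked (meeting H X) (map (map_prod \<rho> \<rho>) (snd p))"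
    by (fact realE[OF r])
  define n where "n = fst p"
  define \<rho>' where "\<rho>' = \<rho>(i := q, 4 := w, 5 + n := t, 6 + n := u, 7 + n := \<sigma> i)"
  have mt: "linked (meeting H X \<union> (meeting H X' - meeting H X))
      (map (map_prod \<rho> \<rho>) (snd p) @ [(\<sigma> i, t), (t, u), (u, q), (t, w)])"
    by (rule linked_append[OF \<rho>(4) lk]) blast
  have "map (map_prod \<rho> \<rho>) (snd p) @ [(\<sigma> i, t), (t, u), (u, q), (t, w)] =
      map (map_prod \<rho>' \<rho>') (snd (land i p))"
  proof -
    have "map_prod \<rho> \<rho> (a, b) = map_prod \<rho>' \<rho>' (a, if b = i then 7 + n else if b = 4 then 6 + n else b)"
      if "(a, b) \<in> set (snd p)" for a b
    proof -
      have "5 \<le> a" "a < 5 + n" "b < 5 + n" using ok that by (auto simp: okp_def list_all_iff n_def)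
      then show ?thesis using \<rho>(1) u i by (auto simp: \<rho>'_def)
    qed
    moreover have "\<rho>' (7 + n) = \<sigma> i" "\<rho>' (5 + n) = t" "\<rho>' (6 + n) = u" "\<rho>' i = q" "\<rho>' 4 = w"
      using i by (auto simp: \<rho>'_def)
    ultimately show ?thesis by (auto simp: land_def Let_def n_def[symmetric])
  qed
  moreover have "meeting H X \<union> (meeting H X' - meeting H X) = meeting H X'"
    using meeting_mono[OF X, of H] by blast
  ultimately have lk': "linked (meeting H X') (map (map_prod \<rho>' \<rho>') (snd (land i p)))"
    using mt by simp
  have n': "fst (land i p) = n + 2" by (simp add: land_def n_def Let_def)
  have v: "\<rho>' k = \<rho> k" if "k \<in> {5..<5 + n}" for k using that i by (simp add: \<rho>'_def)
  have v2: "\<rho>' (5 + n) = t" "\<rho>' (6 + n) = u" by (auto simp: \<rho>'_def)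
  have S: "{5..<5 + (n + 2)} = {5..<5 + n} \<union> {5 + n, 6 + n}" by auto
  have "inj_on \<rho>' {5..<5 + n}" using \<rho>(2) v by (simp add: inj_on_def n_def)
  moreover have "\<rho>' ` {5..<5 + n} \<subseteq> X" using \<rho>(3) v by (auto simp: n_def)
  ultimately have "inj_on \<rho>' {5..<5 + (n + 2)}" "\<rho>' ` {5..<5 + (n + 2)} \<subseteq> X'"
    unfolding S using t v2 X by (auto simp: inj_on_Un)
  moreover have "\<forall>l<5. \<rho>' l = (\<sigma>(i := q, 4 := w)) l" using \<rho>(1) i by (auto simp: \<rho>'_def)
  ultimately show ?thesis unfolding real_def n' using lk' by (intro exI[of _ \<rho>'] conjI)
qed

text \<open>Number 4 is the exit, smaller numbers are read from the list of ports. With three ports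
  the value at 3 is an arbitrary entry; the patterns for three ports never mention 3.\<close>

definition leaf_map :: "'b list \<Rightarrow> 'b \<Rightarrow> nat \<Rightarrow> 'b" where
  "leaf_map ps u l = (if l = 4 then u else ps ! l)"

text \<open>A disjunction of conjunctions: where the exit starts decides which type applies, and
  then all routings of that type are available, though not simultaneously disjoint.\<close>

definition ty :: "'b graph \<Rightarrow> pattern list list \<Rightarrow> 'b set \<Rightarrow> 'b list \<Rightarrow> 'b \<Rightarrow> bool" where
  "ty H \<tau>s X ps u \<longleftrightarrow> (\<exists>\<tau>\<in>set \<tau>s. \<forall>p\<in>set \<tau>. real H X p (leaf_map ps u))"

text \<open>For each type and each port that may be hit, the table names a type \<open>j\<close>
  reached afterwards. For each pattern of type \<open>j\<close> it names a pattern \<open>k\<close>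
  of the old type and a certificate that \<open>land\<close> turns \<open>k\<close> into a graph
  containing it.\<close>

definition closed_table :: "pattern list list \<Rightarrow> nat list \<Rightarrow> (nat \<times> (nat \<times> nat list \<times> nat list list) list) list list \<Rightarrow> bool" where
  "closed_table \<tau>s I tab \<longleftrightarrow> list_all (list_all okp) \<tau>s \<and>
     list_all2 (\<lambda>\<tau> row. list_all2 (\<lambda>i (j, ws). j < length \<tau>s \<and>
       list_all2 (\<lambda>q (k, ms, Is). k < length \<tau> \<and> check (land i (\<tau> ! k)) q ms Is) (\<tau>s ! j) ws) I row) \<tau>s tab"

text \<open>One row for each inner connection of the starting pattern on which the first exit may
  begin.\<close>

definition start_table :: "pattern list list \<Rightarrow> pattern \<Rightarrow> (nat \<times> (nat list \<times> nat list list) list) list \<Rightarrow> bool" where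
  "start_table \<tau>s p tab \<longleftrightarrow>
     list_all2 (\<lambda>k (j, ws). j < length \<tau>s \<and> list_all2 (\<lambda>q (ms, Is). check (sub k p) q ms Is) (\<tau>s ! j) ws) [0..<length tab] tab"

lemma list_all2_ex: "list_all2 R xs ys \<Longrightarrow> x \<in> set xs \<Longrightarrow> \<exists>y. R x y"
  by (auto simp: list_all2_conv_all_nth in_set_conv_nth)

lemma closed_table_land:
  assumes "closed_table \<tau>s I tab" "\<tau> \<in> set \<tau>s" "i \<in> set I"
  shows "\<exists>\<tau>'\<in>set \<tau>s. \<forall>q\<in>set \<tau>'. \<exists>p\<in>set \<tau>. \<exists>ms Is. check (land i p) q ms Is"
proof -
  obtain row where "list_all2 (\<lambda>i (j, ws). j < length \<tau>s \<and>
       list_all2 (\<lambda>q (k, ms, Is). k < length \<tau> \<and> check (land i (\<tau> ! k)) q ms Is) (\<tau>s ! j) ws) I row"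
    using list_all2_ex[OF _ assms(2)] assms(1) unfolding closed_table_def by meson
  then obtain j ws where j: "j < length \<tau>s"
    "list_all2 (\<lambda>q (k, ms, Is). k < length \<tau> \<and> check (land i (\<tau> ! k)) q ms Is) (\<tau>s ! j) ws"
    using list_all2_ex[OF _ assms(3)] by fastforce
  have "\<exists>p\<in>set \<tau>. \<exists>ms Is. check (land i p) q ms Is" if "q \<in> set (\<tau>s ! j)" for q
    using list_all2_ex[OF j(2) that] nth_mem by fastforce
  then show ?thesis using nth_mem[OF j(1)] by blast
qed

lemma start_table_sub:
  assumes "start_table \<tau>s p tab" "k < length tab"
  shows "\<exists>\<tau>\<in>set \<tau>s. \<forall>q\<in>set \<tau>. \<exists>ms Is. check (sub k p) q ms Is"
proof -
  obtain j ws where j: "j < length \<tau>s" "list_all2 (\<lambda>q (ms, Is). check (sub k p) q ms Is) (\<tau>s ! j) ws"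
    using list_all2_ex[of _ "[0..<length tab]" tab k] assms unfolding start_table_def by fastforce
  have "\<exists>ms Is. check (sub k p) q ms Is" if "q \<in> set (\<tau>s ! j)" for q
    using list_all2_ex[OF j(2) that] by fastforce
  then show ?thesis using nth_mem[OF j(1)] by blast
qed

text \<open>Enlarging \<open>X\<close> and moving exit or port keep every single pattern, so the
  type does not change. Only hitting a tail changes it, and there the table provides the new
  type.\<close>

lemma growth_ty:
  assumes cyc: "cyclically_connected k H" and n: "0 < n" "n < k" "n \<le> 4" and tab: "closed_table \<tau>s I tab" "set I \<subseteq> {..<4}"
  shows "growth H n k (set I) (ty H \<tau>s)"
proof
  have ok: "okp p" if "\<tau> \<in> set \<tau>s" "p \<in> set \<tau>" for \<tau> p
    using tab(1) that by (auto simp: closed_table_def list_all_iff)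
  show "cyclically_connected k H" "0 < n" "n < k" by fact+
  show "ty H \<tau>s X' ps u" if "ty H \<tau>s X ps u" "X \<subseteq> X'" for X X' ps u
    using that real_mono unfolding ty_def by blast
  show "ty H \<tau>s X' ps w" if a: "ty H \<tau>s X ps u" "X \<subseteq> X'" "{u, w} \<in> meeting H X' - meeting H X" for X X' ps u w
  proof -
    have lm: "(leaf_map ps u)(4 := w) = leaf_map ps w" by (auto simp: leaf_map_def)
    have "real H X' p (leaf_map ps w)" if "real H X p (leaf_map ps u)" "okp p" for p
      using real_ext[OF that, of 4 X' "{{u, w}}" w] a conn_edge[of u w "{{u, w}}"]
      by (simp add: lm) (simp add: leaf_map_def)
    then show ?thesis using a(1) ok unfolding ty_def by blast
  qed
  show "ty H \<tau>s X' (ps[i := q]) u"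
    if a: "ty H \<tau>s X ps u" "X \<subseteq> X'" "i < n" "length ps = n" "conn T (ps ! i) q" "T \<subseteq> meeting H X' - meeting H X"
    for X X' ps u i q T
  proof -
    have i4: "i < 4" using a(3) n(3) by simp
    have lm: "\<forall>l<4. l < n \<longrightarrow> ((leaf_map ps u)(i := q)) l = leaf_map (ps[i := q]) u l"
      using a(3,4) by (auto simp: leaf_map_def nth_list_update)
    have e: "(leaf_map ps u)(i := q) = leaf_map (ps[i := q]) u"
    proof
      fix l show "((leaf_map ps u)(i := q)) l = leaf_map (ps[i := q]) u l"
        using a(3,4) i4 by (auto simp: leaf_map_def)
    qed
    have "real H X' p (leaf_map (ps[i := q]) u)" if "real H X p (leaf_map ps u)" "okp p" for p
      using real_ext[OF that, of i X' T q] a(2,5,6) i4 unfolding e by (simp add: leaf_map_def)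
    then show ?thesis using a(1) ok unfolding ty_def by blast
  qed
  show "ty H \<tau>s X' (ps[i := q]) w"
    if a: "ty H \<tau>s X ps u" "X \<subseteq> X'" "i \<in> set I" "i < n" "length ps = n" "t \<in> X' - X" "u \<in> X' - X" "t \<noteq> u"
      "linked (meeting H X' - meeting H X) [(ps ! i, t), (t, u), (u, q), (t, w)]"
    for X X' ps u i t q w
  proof -
    have i4: "i < 4" using a(4) n(3) by simp
    obtain \<tau> where \<tau>: "\<tau> \<in> set \<tau>s" "\<forall>p\<in>set \<tau>. real H X p (leaf_map ps u)" using a(1) unfolding ty_def by blast
    obtain \<tau>' where \<tau>': "\<tau>' \<in> set \<tau>s" "\<forall>q\<in>set \<tau>'. \<exists>p\<in>set \<tau>. \<exists>ms Is. check (land i p) q ms Is"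
      using closed_table_land[OF tab(1) \<tau>(1) a(3)] by blast
    have e: "(leaf_map ps u)(i := q, 4 := w) = leaf_map (ps[i := q]) w"
    proof
      fix l show "((leaf_map ps u)(i := q, 4 := w)) l = leaf_map (ps[i := q]) w l"
        using a(4,5) i4 by (auto simp: leaf_map_def)
    qed
    have "real H X' p' (leaf_map (ps[i := q]) w)" if p': "p' \<in> set \<tau>'" for p'
    proof -
      obtain p ms Is where p: "p \<in> set \<tau>" "check (land i p) p' ms Is" using \<tau>'(2) p' by blast
      have "real H X p (leaf_map ps u)" using \<tau>(2) p(1) by blast
      then have "real H X' (land i p) (leaf_map (ps[i := q]) w)"
        using real_land[of H X p "leaf_map ps u" i X' t u q w] ok[OF \<tau>(1) p(1)] i4 a(2,6-9)
        unfolding e by (simp add: leaf_map_def)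
      then show ?thesis by (rule real_check[OF _ p(2)])
    qed
    then show ?thesis using \<tau>'(1) unfolding ty_def by blast
  qed
qed

text \<open>A tree with spine 5, 6, 7 carrying the leaves \<open>p1 p2\<close>, \<open>q\<close> and
  \<open>r1 r2\<close>. At the twinned corner, with ports 0 and 1 at one end and 2 and 3 at the
  other, the place of 4 tells which edge the exit subdivides: the inner edge in
  \<open>Tr 0 1 4 2 3\<close>, the edge to port 0 in \<open>Tr 0 4 1 2 3\<close>, the edge to port 2
  in \<open>Tr 2 4 3 0 1\<close>.\<close>

definition Tr :: "nat \<Rightarrow> nat \<Rightarrow> nat \<Rightarrow> nat \<Rightarrow> nat \<Rightarrow> pattern" where
  "Tr p1 p2 q r1 r2 = (3, [(5, p1), (5, p2), (5, 6), (6, q), (6, 7), (7, r1), (7, r2)])"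

text \<open>The graph that (E4) forbids, with the exit leading to the second subdivided edge: 5 and
  6 are the vertices of the corner, 7 subdivides the leg to \<open>p\<close>, and 8 and 9 subdivide
  the leg to port 3.\<close>

definition Up :: "nat \<Rightarrow> nat \<Rightarrow> pattern" where
  "Up p q = (5, [(5, q), (5, 6), (5, 7), (7, p), (7, 8), (8, 3), (8, 9), (9, 4), (9, 6), (6, 2)])"

text \<open>The graph that (E5) forbids: 7 and 10 on the legs to \<open>q\<close> and
  \<open>p\<close> are joined to 8 and 9 on the leg to port 3, and the exit starts at 11, between
  the corner vertex 5 and 10.\<close>

definition Wp :: "nat \<Rightarrow> nat \<Rightarrow> pattern" where
  "Wp p q = (7, [(5, 6), (5, 11), (11, 4), (11, 10), (10, p), (10, 9), (5, 7), (7, q), (7, 8), (8, 3),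
     (8, 9), (9, 6), (6, 2)])"

text \<open>Each type is chosen so that its routings together contradict every position of the edge
  on which the path lands; the six contradictions are drawn at the end of
  \<open>circ_false\<close>.\<close>

definition types4 :: "pattern list list" where
  "types4 =
    [[Tr 0 1 4 2 3, Tr 0 4 1 2 3, Tr 1 4 0 2 3],
     [Tr 2 4 3 0 1, Up 1 0, Up 0 1],
     [Wp 0 1, Tr 0 4 1 2 3, Tr 1 4 0 2 3],
     [Wp 1 0, Tr 0 4 1 2 3, Tr 1 4 0 2 3],
     [Tr 0 1 4 2 3, Tr 0 4 1 2 3, Tr 2 4 3 0 1, Up 1 0],
     [Tr 0 1 4 2 3, Tr 1 4 0 2 3, Tr 2 4 3 0 1, Up 0 1]]"

text \<open>The claw with centre 9 and feet 7, 8, 10, together with the corner vertices 5 and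
  6.\<close>

definition start4 :: pattern where
  "start4 = (6, [(5, 7), (5, 8), (5, 6), (9, 7), (9, 8), (9, 10), (6, 10), (7, 0), (8, 1), (10, 2), (6, 3)])"

text \<open>The star at 5 with its leg to \<open>p\<close> subdivided by the exit.\<close>

definition T3 :: "nat \<Rightarrow> nat \<Rightarrow> nat \<Rightarrow> pattern" where
  "T3 p q r = (2, [(5, q), (5, r), (5, 6), (6, p), (6, 4)])"

text \<open>A claw again: with 7 in the role of the common vertex, 6 and 8 subdivide the legs to
  \<open>q\<close> and \<open>r\<close>, and 5 is the centre whose third foot lies where the exit
  lands.\<close>

definition R3 :: "nat \<Rightarrow> nat \<Rightarrow> nat \<Rightarrow> pattern" where
  "R3 p q r = (4, [(5, 6), (6, 7), (7, 8), (8, 5), (5, 4), (6, q), (7, p), (8, r)])"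

definition types3 :: "pattern list list" where
  "types3 = [[T3 0 1 2, T3 1 0 2, T3 2 0 1, R3 0 1 2, R3 1 0 2, R3 2 0 1]]"

text \<open>The graph K_{2,3} with a leg at each vertex of the larger side: 5 is the common vertex
  of the three attachments, 6 the centre of the claw.\<close>

definition start3 :: pattern where
  "start3 = (5, [(5, 7), (5, 8), (5, 9), (6, 7), (6, 8), (6, 9), (7, 0), (8, 1), (9, 2)])"

text \<open>Rows follow \<open>types4\<close>; within a row come the ports 0, 1, 2. Port 3 has no
  entry, since its leg is a single edge in \<open>H\<close>.\<close>

definition table4 :: "(nat \<times> (nat \<times> nat list \<times> nat list list) list) list list" where
  "table4 = [[(0,[(2,[9,8,7],[[9],[1,0],[8],[10],[7,3,4],[5],[6]]),(0,[8,5,7],[[8,9],[10],[7,0],[1],[2,4],[5],[6]]),(0,[8,9,7],[[7,0,1],[10],[8],[9],[3,4],[5],[6]])]),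
  (0,[(1,[9,8,7],[[1,0],[9],[8],[10],[7,3,4],[5],[6]]),(0,[8,9,7],[[7,1,0],[10],[8],[9],[3,4],[5],[6]]),(0,[8,5,7],[[8,9],[10],[7,1],[0],[2,4],[5],[6]])]),
  (1,[(0,[8,7,5],[[8,9],[10],[7,5],[6],[4,2],[0],[1]]),(1,[5,9,6,7,8],[[0],[1],[2],[3],[4],[6],[5,7],[10],[8],[9]]),(2,[5,9,6,7,8],[[0],[1],[2],[3],[4],[6],[5,7],[10],[8],[9]])])],
  [(2,[(1,[5,6,7,8,9,11,10],[[1],[0,10],[13],[11],[12],[7],[2],[3],[4],[5],[6],[8],[9]]),(0,[8,7,6],[[8,9],[10],[7,5],[6],[4],[2,0],[3]]),(0,[8,9,5],[[7,5,6],[10],[8],[9],[1],[0],[2,3]])]),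
  (3,[(2,[5,6,7,8,9,11,10],[[1],[0,10],[13],[11],[12],[7],[2],[3],[4],[5],[6],[8],[9]]),(0,[8,9,5],[[7,6,5],[10],[8],[9],[1],[0],[2,3]]),(0,[8,7,6],[[8,9],[10],[7,6],[5],[4],[2,0],[3]])]),
  (0,[(1,[5,10,11],[[0],[2,3],[1,9,10],[13],[11],[12],[7,6,5]]),(1,[5,7,8],[[0],[1,9,10,13],[2],[3],[4],[6,7,12],[5]]),(2,[5,7,8],[[0],[1,9,10,13],[2],[3],[4],[6,7,12],[5]])])],
  [(4,[(0,[13,12,9],[[15],[2,1,6,7],[14],[16],[13,4,5],[11,12],[10,9]]),(0,[12,7,8],[[14,15],[16],[13,4,3,1,6],[7],[8],[10,11,12],[9]]),(0,[9,8,7],[[11,12],[5,4,13,16],[10],[9],[8],[6,1,2,15],[7]]),(0,[5,6,7,8,9],[[1,2,15],[0],[6],[7],[8],[9],[10],[5,4,13,16],[11],[12]])]),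
  (5,[(0,[11,7,8],[[3,4],[2,15],[1,6],[7,13,16],[8],[10,11,12],[9]]),(0,[12,7,8],[[14,15],[16],[13,7],[6,1,3,4],[8],[10,11,12],[9]]),(0,[6,9,10],[[12],[0,6,7,13,16],[11],[10,9],[5],[4],[3,2,15]]),(0,[11,5,10,8,7],[[2,15],[1],[3],[4],[5,10],[9],[8],[7,13,16],[6],[0,12]])]),
  (1,[(0,[12,8,7],[[14,15],[16],[13,12,11,10],[9],[8],[6,1,3,4],[7]]),(0,[11,13,7,8,12],[[3,4],[2],[1,6],[7],[8],[9],[10,11,12,13],[16],[14],[15]]),(0,[11,13,10,9,12],[[1,6,7],[2],[3],[4],[5],[10,9],[11,12,13],[16],[14],[15]])])],
  [(4,[(0,[11,7,8],[[2,15],[3,4],[1,6],[7,13,16],[8],[10,11,12],[9]]),(0,[12,7,8],[[14,15],[16],[13,7],[6,1,3,4],[8],[10,11,12],[9]]),(0,[6,9,10],[[12],[0,6,7,13,16],[11],[10,9],[5],[3,2,15],[4]]),(0,[11,5,10,8,7],[[2,15],[1],[3],[4],[5,10],[9],[8],[7,13,16],[6],[0,12]])]),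
  (5,[(0,[13,12,9],[[2,1,6,7],[15],[14],[16],[13,4,5],[11,12],[10,9]]),(0,[12,7,8],[[14,15],[16],[13,4,3,1,6],[7],[8],[10,11,12],[9]]),(0,[9,8,7],[[11,12],[5,4,13,16],[10],[9],[8],[7],[6,1,2,15]]),(0,[5,6,7,8,9],[[1,2,15],[0],[6],[7],[8],[9],[10],[5,4,13,16],[11],[12]])]),
  (1,[(0,[12,8,7],[[14,15],[16],[13,12,11,10],[9],[8],[7],[6,1,3,4]]),(0,[11,13,10,9,12],[[1,6,7],[2],[3],[4],[5],[10,9],[11,12,13],[16],[14],[15]]),(0,[11,13,7,8,12],[[3,4],[2],[1,6],[7],[8],[9],[10,11,12,13],[16],[14],[15]])])],
  [(2,[(3,[5,6,7,8,9,11,10],[[1],[0,10],[13],[11],[12],[7],[2],[3],[4],[5],[6],[8],[9]]),(0,[8,5,7],[[8,9],[10],[7,0],[1],[2,4],[5],[6]]),(0,[8,9,7],[[7,0,1],[10],[8],[9],[3,4],[5],[6]])]),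
  (0,[(1,[9,8,7],[[1,0],[9],[8],[10],[7,3,4],[5],[6]]),(0,[8,9,7],[[7,1,0],[10],[8],[9],[3,4],[5],[6]]),(0,[8,5,7],[[8,9],[10],[7,1],[0],[2,4],[5],[6]])]),
  (4,[(3,[5,10,11],[[0],[2,3],[1,9,10],[13],[11],[12],[7,6,5]]),(3,[5,7,8],[[0],[1,9,10,13],[2],[3],[4],[6,7,12],[5]]),(0,[8,7,5],[[8,9],[10],[7,5],[6],[4,2],[0],[1]]),(1,[5,9,6,7,8],[[0],[1],[2],[3],[4],[6],[5,7],[10],[8],[9]])])],
  [(0,[(1,[9,8,7],[[9],[1,0],[8],[10],[7,3,4],[5],[6]]),(0,[8,5,7],[[8,9],[10],[7,0],[1],[2,4],[5],[6]]),(0,[8,9,7],[[7,0,1],[10],[8],[9],[3,4],[5],[6]])]),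
  (3,[(3,[5,6,7,8,9,11,10],[[1],[0,10],[13],[11],[12],[7],[2],[3],[4],[5],[6],[8],[9]]),(0,[8,9,7],[[7,1,0],[10],[8],[9],[3,4],[5],[6]]),(0,[8,5,7],[[8,9],[10],[7,1],[0],[2,4],[5],[6]])]),
  (5,[(3,[5,10,11],[[2,3],[0],[1,9,10],[13],[11],[12],[7,6,5]]),(3,[5,7,8],[[0],[1,9,10,13],[2],[3],[4],[6,7,12],[5]]),(0,[8,7,5],[[8,9],[10],[7,5],[6],[4,2],[0],[1]]),(1,[5,9,6,7,8],[[0],[1],[2],[3],[4],[6],[5,7],[10],[8],[9]])])]]"

definition table3 :: "(nat \<times> (nat \<times> nat list \<times> nat list list) list) list list" where
  "table3 = [[(0,[(0,[5,7],[[0],[1],[2,3,5],[6,7],[8]]),(2,[8,7],[[7],[4,3],[6],[5,0,1],[8]]),(1,[8,7],[[7],[4,3],[6],[5,0,1],[8]]),(3,[7,6,5,8],[[1],[0],[3],[2],[6,8,11],[5],[4,10],[7]]),(1,[7,8,6,5],[[6],[4],[2],[0,5],[8],[7],[3],[1]]),(2,[7,8,6,5],[[6],[4],[2],[0,5],[8],[7],[3],[1]])]),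
  (0,[(2,[8,7],[[7],[4,3],[6],[5,1,0],[8]]),(0,[5,7],[[2,3],[1],[0,5],[6,7],[8]]),(0,[8,7],[[4,3],[7],[6],[5,0,1],[8]]),(0,[7,8,6,5],[[6],[4],[2],[0,5],[8],[7],[3],[1]]),(4,[7,6,5,8],[[1],[0],[3],[2],[6,8,11],[5],[4,10],[7]]),(2,[7,5,6,8],[[5,1],[2],[4],[6],[8],[0],[3],[7]])]),
  (0,[(1,[8,7],[[4,3],[7],[6],[5,1,0],[8]]),(0,[8,7],[[4,3],[7],[6],[5,1,0],[8]]),(0,[5,7],[[2,3],[0],[1,5],[6,7],[8]]),(0,[7,5,6,8],[[5,1],[2],[4],[6],[8],[0],[3],[7]]),(1,[7,5,6,8],[[5,1],[2],[4],[6],[8],[0],[3],[7]]),(5,[7,6,5,8],[[1],[0],[3],[2],[6,8,11],[5],[4,10],[7]])])]]"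

definition start_table4 :: "(nat \<times> (nat list \<times> nat list list) list) list" where
  "start_table4 = [(0,[([7,11,6],[[7],[3,4,8],[11],[12],[0,2],[6,9],[10]]),([7,8,6],[[7],[11,12],[3,4],[8],[1,2],[6,9],[10]]),([11,7,10],[[0,1,8],[12],[11],[7],[3,5],[9],[6,10]])]),
  (0,[([8,11,6],[[4,3,7],[8],[11],[12],[1,2],[6,9],[10]]),([11,8,10],[[1,0,7],[12],[11],[8],[4,5],[9],[6,10]]),([8,9,10],[[8],[11,12],[4],[3,7],[5],[9],[6,10]])]),
  (0,[([8,11,6],[[4,3,7],[8],[1,2],[12],[11],[6,9],[10]]),([7,9,10],[[7],[0,2,12],[3],[4,8],[5],[9],[6,10]]),([8,9,10],[[8],[1,2,12],[4],[3,7],[5],[9],[6,10]])]),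
  (0,[([7,11,10],[[7],[0,1,8],[11],[12],[3,5],[9],[6,10]]),([11,8,6],[[11,7],[12],[3,4],[8],[1,2],[6,9],[10]]),([11,7,6],[[3,4,8],[12],[11],[7],[0,2],[6,9],[10]])]),
  (0,[([8,11,10],[[1,0,7],[8],[11],[12],[4,5],[9],[6,10]]),([11,8,6],[[4,3,7],[12],[11],[8],[1,2],[6,9],[10]]),([11,9,10],[[11,8],[12],[4],[3,7],[5],[9],[6,10]])]),
  (0,[([9,11,10],[[3,7],[4,8],[5],[12],[11],[9],[6,10]]),([9,8,6],[[3,7],[5,12],[4],[8],[1,2],[6,9],[10]]),([9,7,6],[[4,8],[5,12],[3],[7],[0,2],[6,9],[10]])]),
  (1,[([11,6,8],[[11,9],[12],[6],[10],[2,1],[4,3,7],[8]]),([9,10,8,6,11],[[3,7],[5],[4],[8],[1,2],[10],[6],[12],[11],[9]]),([9,10,7,6,11],[[4,8],[5],[3],[7],[0,2],[10],[6],[12],[11],[9]])])]"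

definition start_table3 :: "(nat \<times> (nat list \<times> nat list list) list) list" where
  "start_table3 = [(0,[([9,7],[[2,1,7],[8],[5,3],[6],[9,10]]),([7,10],[[6],[3,5,8],[9],[0,1,7],[10]]),([7,10],[[6],[3,4,7],[9],[0,2,8],[10]]),([5,8,6,9],[[1],[4],[5],[2],[0,10],[7],[3,6],[8]]),([10,7,6,9],[[9],[3],[5],[2,0],[10],[6],[4,7],[8]]),([10,7,6,8],[[9],[3],[4],[1,0],[10],[6],[5,8],[7]])]),
  (0,[([8,10],[[7],[4,5,8],[9],[1,0,6],[10]]),([9,10],[[5,3,6],[8],[2,1],[9,7],[10]]),([8,10],[[4,3,6],[7],[9],[1,2,8],[10]]),([10,8,6,9],[[9],[4],[5],[2,1],[10],[7],[3,6],[8]]),([5,7,6,9],[[0],[3],[5],[2],[1,10],[6],[4,7],[8]]),([10,7,6,8],[[1,0],[3],[4],[9],[10],[6],[5,8],[7]])]),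
  (0,[([9,10],[[5,4,7],[8],[9],[2,0,6],[10]]),([9,10],[[5,3,6],[8],[9],[2,1,7],[10]]),([8,10],[[4,3,6],[7],[1,2],[9,8],[10]]),([10,8,6,9],[[2,1],[4],[5],[9],[10],[7],[3,6],[8]]),([10,7,6,9],[[2,0],[3],[5],[9],[10],[6],[4,7],[8]]),([5,7,6,8],[[0],[3],[4],[1],[2,10],[6],[5,8],[7]])]),
  (0,[([9,10],[[2,1,7],[8],[5,3],[9,6],[10]]),([7,10],[[6],[0,2,8],[9],[3,4,7],[10]]),([7,10],[[6],[0,1,7],[9],[3,5,8],[10]]),([6,8,5,9],[[4],[1],[2],[5],[3,10],[7],[0,6],[8]]),([10,7,8,6],[[9],[0,1],[4],[3],[10],[6],[7],[5,8]]),([10,7,9,6],[[9],[0,2],[5],[3],[10],[6],[8],[4,7]])]),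
  (0,[([8,10],[[7],[1,2,8],[9],[4,3,6],[10]]),([9,8],[[5,3,6],[8],[2,1],[7],[9,10]]),([8,10],[[1,0,6],[7],[9],[4,5,8],[10]]),([10,8,7,6],[[9],[1,0],[3],[4],[10],[7],[6],[5,8]]),([6,7,5,9],[[3],[0],[2],[5],[4,10],[6],[1,7],[8]]),([10,6,9,8],[[4],[5],[2,1],[9],[10],[3,6],[8],[7]])]),
  (0,[([9,10],[[2,1,7],[8],[9],[5,3,6],[10]]),([9,10],[[2,0,6],[8],[9],[5,4,7],[10]]),([8,9],[[4,3,6],[7],[1,2],[8],[9,10]]),([10,6,7,9],[[5],[3],[0,2],[9],[10],[4,7],[6],[8]]),([10,6,8,9],[[5],[4],[1,2],[9],[10],[3,6],[7],[8]]),([6,7,5,8],[[3],[0],[1],[4],[5,10],[6],[2,8],[7]])])]"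

lemma table3: "closed_table types3 [0, 1, 2] table3"
  by code_simp

lemma start_table3: "start_table types3 start3 start_table3"
  by code_simp

lemma table4: "closed_table types4 [0, 1, 2] table4"
  by code_simp

lemma start_table4: "start_table types4 start4 start_table4"
  by code_simp

section \<open>Clusters inside an embedding\<close>

lemma hom_embeddingD:
  assumes "hom_embedding \<eta> G H"
  shows "inj_on (vmap \<eta>) (verts G)" "vmap \<eta> ` verts G \<subseteq> verts H"
    and "e \<in> edges G \<Longrightarrow> is_path (emap \<eta> e)" "e \<in> edges G \<Longrightarrow> subgraph (emap \<eta> e) H"
    "e \<in> edges G \<Longrightarrow> ends (emap \<eta> e) = vmap \<eta> ` e"
    and "e \<in> edges G \<Longrightarrow> f \<in> edges G \<Longrightarrow> e \<noteq> f \<Longrightarrow> edges (emap \<eta> e) \<inter> edges (emap \<eta> f) = {}"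
    "e \<in> edges G \<Longrightarrow> f \<in> edges G \<Longrightarrow> e \<noteq> f \<Longrightarrow> internal_verts (emap \<eta> e) \<inter> verts (emap \<eta> f) = {}"
    and "v \<in> verts G \<Longrightarrow> e \<in> edges G \<Longrightarrow> vmap \<eta> v \<in> verts (emap \<eta> e) \<longleftrightarrow> v \<in> e"
proof -
  have a: "inj_on (vmap \<eta>) (verts G)" "vmap \<eta> ` verts G \<subseteq> verts H"
    "\<forall>e\<in>edges G. is_path (emap \<eta> e) \<and> subgraph (emap \<eta> e) H \<and> ends (emap \<eta> e) = vmap \<eta> ` e"
    "\<forall>e\<in>edges G. \<forall>f\<in>edges G. e \<noteq> f \<longrightarrow> edges (emap \<eta> e) \<inter> edges (emap \<eta> f) = {} \<and>
      internal_verts (emap \<eta> e) \<inter> verts (emap \<eta> f) = {}"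
    "\<forall>v\<in>verts G. \<forall>e\<in>edges G. vmap \<eta> v \<in> verts (emap \<eta> e) \<longleftrightarrow> v \<in> e"
    using assms unfolding hom_embedding_def by simp_all
  show "inj_on (vmap \<eta>) (verts G)" "vmap \<eta> ` verts G \<subseteq> verts H" by (fact a)+
  show "e \<in> edges G \<Longrightarrow> is_path (emap \<eta> e)" "e \<in> edges G \<Longrightarrow> subgraph (emap \<eta> e) H"
    "e \<in> edges G \<Longrightarrow> ends (emap \<eta> e) = vmap \<eta> ` e"
    using a(3) by simp_all
  show "e \<in> edges G \<Longrightarrow> f \<in> edges G \<Longrightarrow> e \<noteq> f \<Longrightarrow> edges (emap \<eta> e) \<inter> edges (emap \<eta> f) = {}"
    "e \<in> edges G \<Longrightarrow> f \<in> edges G \<Longrightarrow> e \<noteq> f \<Longrightarrow> internal_verts (emap \<eta> e) \<inter> verts (emap \<eta> f) = {}"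
    using a(4) by simp_all
  show "v \<in> verts G \<Longrightarrow> e \<in> edges G \<Longrightarrow> vmap \<eta> v \<in> verts (emap \<eta> e) \<longleftrightarrow> v \<in> e"
    using a(5) by simp
qed

lemma path_edge_verts:
  assumes "is_path P" "h \<in> edges P" shows "h \<subseteq> verts P" "h \<noteq> {}"
proof -
  obtain vs where vs: "path_listing vs P" using assms(1) by (auto simp: is_path_def)
  then show "h \<subseteq> verts P" using assms(2) consecutive_pairs_subset[of h vs] by (auto simp: path_listing_def)
  have "card h = 2" using consecutive_pairs_card[of vs h] vs assms(2) by (auto simp: path_listing_def)
  then show "h \<noteq> {}" by auto
qed

text \<open>The vertices of a cluster are named by the branch numbers of a pattern. All edges
  meeting it are listed: those inside as \<open>ints\<close>, and one for each port, from node
  \<open>prt ! l\<close> to the outer vertex \<open>pv ! l\<close>. The graph \<open>G\<close> of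
  this locale is later a claw extension of the graph of the framework. Each node lies on an inner
  edge (\<open>cov\<close>), so that its image lies in the starting region
  \<open>X0\<close>.\<close>

locale cluster =
  fixes G :: "'a graph" and H :: "'b graph" and \<xi> :: "('a, 'b) embedding" and \<phi> :: "nat \<Rightarrow> 'a"
    and n0 :: nat and ints :: "(nat \<times> nat) list" and prt :: "nat list" and pv :: "'a list"
  assumes G: "cubic G" and H: "cubic H" and \<xi>: "hom_embedding \<xi> G H"
    and inj: "inj_on \<phi> {5..<5 + n0}" and KG: "\<phi> ` {5..<5 + n0} \<subseteq> verts G"
    and ints: "\<And>i j. (i, j) \<in> set ints \<Longrightarrow> i \<in> {5..<5 + n0} \<and> j \<in> {5..<5 + n0}"
    and prt: "set prt \<subseteq> {5..<5 + n0}" "length prt = length pv" "length pv \<le> 4"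
    and pv: "set pv \<inter> \<phi> ` {5..<5 + n0} = {}" "distinct pv" "set pv \<subseteq> verts G"
    and E: "{e \<in> edges G. e \<inter> \<phi> ` {5..<5 + n0} \<noteq> {}} =
      set (map (\<lambda>(i, j). {\<phi> i, \<phi> j}) ints) \<union> set (map2 (\<lambda>i v. {\<phi> i, v}) prt pv)"
    and dint: "distinct (map (\<lambda>(i, j). {\<phi> i, \<phi> j}) ints)"
    and cov: "\<And>i. i \<in> {5..<5 + n0} \<Longrightarrow> \<exists>e\<in>set ints. i = fst e \<or> i = snd e"
    and size: "length pv \<le> n0" "0 < length pv"
begin

abbreviation "K \<equiv> \<phi> ` {5..<5 + n0}"
abbreviation "n \<equiv> length pv"

definition ie :: "nat \<Rightarrow> 'a set" where "ie k = {\<phi> (fst (ints ! k)), \<phi> (snd (ints ! k))}"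
definition pe :: "nat \<Rightarrow> 'a set" where "pe l = {\<phi> (prt ! l), pv ! l}"
definition X0 :: "'b set" where "X0 = (\<Union>k<length ints. verts (emap \<xi> (ie k)))"
definition Z :: "'b set" where
  "Z = vmap \<xi> ` (verts G - K) \<union> (\<Union>e\<in>{e \<in> edges G. e \<inter> K = {}}. verts (emap \<xi> e))"
definition start :: pattern where "start = (n0, ints @ zip prt [0..<n])"

lemma nodes: "k < length ints \<Longrightarrow> fst (ints ! k) \<in> {5..<5 + n0}" "k < length ints \<Longrightarrow> snd (ints ! k) \<in> {5..<5 + n0}"
  using ints[of "fst (ints ! k)" "snd (ints ! k)"] by simp_all

lemma prt_node: "l < n \<Longrightarrow> prt ! l \<in> {5..<5 + n0}"
  using prt(1,2) nth_mem[of l prt] by (simp add: subset_iff)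

lemma ie_edge: "k < length ints \<Longrightarrow> ie k \<in> edges G"
proof -
  assume k: "k < length ints"
  have "ie k = (\<lambda>(i, j). {\<phi> i, \<phi> j}) (ints ! k)" by (simp add: ie_def split: prod.splits)
  then have "ie k \<in> set (map (\<lambda>(i, j). {\<phi> i, \<phi> j}) ints)" using k by auto
  then show ?thesis using E by blast
qed

lemma pe_edge: "l < n \<Longrightarrow> pe l \<in> edges G"
proof -
  assume l: "l < n"
  then have "pe l = map2 (\<lambda>i v. {\<phi> i, v}) prt pv ! l" "l < length (map2 (\<lambda>i v. {\<phi> i, v}) prt pv)"
    using prt(2) by (simp_all add: pe_def)
  then have "pe l \<in> set (map2 (\<lambda>i v. {\<phi> i, v}) prt pv)" using nth_mem by metis
  then show ?thesis using E by blast
qed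

lemma K_edge:
  assumes "e \<in> edges G" "e \<inter> K \<noteq> {}"
  shows "(\<exists>k<length ints. e = ie k) \<or> (\<exists>l<n. e = pe l)"
proof -
  have "e \<in> set (map (\<lambda>(i, j). {\<phi> i, \<phi> j}) ints) \<union> set (map2 (\<lambda>i v. {\<phi> i, v}) prt pv)"
    using assms E by blast
  then show ?thesis
  proof
    assume "e \<in> set (map (\<lambda>(i, j). {\<phi> i, \<phi> j}) ints)"
    then obtain k where "k < length ints" "e = (\<lambda>(i, j). {\<phi> i, \<phi> j}) (ints ! k)"
      by (auto simp: in_set_conv_nth)
    then show ?thesis by (auto simp: ie_def split: prod.splits)
  next
    assume "e \<in> set (map2 (\<lambda>i v. {\<phi> i, v}) prt pv)"
    then obtain l where "l < length (zip prt pv)" "e = (\<lambda>(i, v). {\<phi> i, v}) (zip prt pv ! l)"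
      by (auto simp: in_set_conv_nth)
    then show ?thesis using prt(2) by (auto simp: pe_def)
  qed
qed

lemma ie_K: "k < length ints \<Longrightarrow> ie k \<subseteq> K"
  using nodes[of k] by (auto simp: ie_def)

lemma pv_notK: "l < n \<Longrightarrow> pv ! l \<notin> K"
  using pv(1) nth_mem[of l pv] by blast

lemma pe_not_ie: "l < n \<Longrightarrow> k < length ints \<Longrightarrow> pe l \<noteq> ie k"
  using pv_notK[of l] ie_K[of k] by (auto simp: pe_def)

lemma pe_inj: "l < n \<Longrightarrow> l' < n \<Longrightarrow> pe l = pe l' \<Longrightarrow> l = l'"
proof -
  assume l: "l < n" "l' < n" "pe l = pe l'"
  have "pv ! l \<in> pe l'" using l(3) by (auto simp: pe_def)
  moreover have "pv ! l \<noteq> \<phi> (prt ! l')" using pv_notK[OF l(1)] prt_node[OF l(2)] by blast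
  ultimately have "pv ! l = pv ! l'" by (simp add: pe_def)
  then show "l = l'" using pv(2) l by (simp add: nth_eq_iff_index_eq)
qed

lemma ie_inj: "k < length ints \<Longrightarrow> k' < length ints \<Longrightarrow> ie k = ie k' \<Longrightarrow> k = k'"
proof -
  assume k: "k < length ints" "k' < length ints" "ie k = ie k'"
  have "map (\<lambda>(i, j). {\<phi> i, \<phi> j}) ints ! m = ie m" if "m < length ints" for m
    using that by (simp add: ie_def case_prod_beta)
  then show "k = k'" using dint k nth_eq_iff_index_eq[of "map (\<lambda>(i, j). {\<phi> i, \<phi> j}) ints" k k'] by simp
qed

lemma pe_two: "l < n \<Longrightarrow> \<phi> (prt ! l) \<noteq> pv ! l"
  using pv_notK[of l] imageI[OF prt_node[of l], of \<phi>] by auto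

lemma vmap_ne: "a \<in> verts G \<Longrightarrow> b \<in> verts G \<Longrightarrow> a \<noteq> b \<Longrightarrow> vmap \<xi> a \<noteq> vmap \<xi> b"
  using hom_embeddingD(1)[OF \<xi>] by (meson inj_on_contraD)

definition pl :: "nat \<Rightarrow> 'b list" where
  "pl l = (SOME vs. path_listing vs (emap \<xi> (pe l)) \<and> hd vs = vmap \<xi> (\<phi> (prt ! l)) \<and> last vs = vmap \<xi> (pv ! l))"

lemma pl:
  assumes "l < n"
  shows "path_listing (pl l) (emap \<xi> (pe l))" "hd (pl l) = vmap \<xi> (\<phi> (prt ! l))" "last (pl l) = vmap \<xi> (pv ! l)"
proof -
  have "ends (emap \<xi> (pe l)) = {vmap \<xi> (\<phi> (prt ! l)), vmap \<xi> (pv ! l)}"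
    using hom_embeddingD(5)[OF \<xi> pe_edge[OF assms]] by (simp add: pe_def)
  then have "\<exists>vs. path_listing vs (emap \<xi> (pe l)) \<and> hd vs = vmap \<xi> (\<phi> (prt ! l)) \<and> last vs = vmap \<xi> (pv ! l)"
    using is_path_listing hom_embeddingD(3)[OF \<xi> pe_edge[OF assms]] by metis
  from someI_ex[OF this, folded pl_def]
  show "path_listing (pl l) (emap \<xi> (pe l))" "hd (pl l) = vmap \<xi> (\<phi> (prt ! l))" "last (pl l) = vmap \<xi> (pv ! l)"
    by auto
qed

lemma pl_Cons:
  assumes "l < n"
  obtains q rs where "pl l = vmap \<xi> (\<phi> (prt ! l)) # q # rs" "last (q # rs) = vmap \<xi> (pv ! l)"
proof -
  have v: "\<phi> (prt ! l) \<in> verts G" "pv ! l \<in> verts G"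
    using prt_node[OF assms] KG pv(3) assms nth_mem[OF assms] by blast+
  have ne: "hd (pl l) \<noteq> last (pl l)"
    using pl(2,3)[OF assms] vmap_ne[OF v pe_two[OF assms]] by simp
  have "pl l \<noteq> []" using pl(1)[OF assms] by (simp add: path_listing_def)
  then obtain x ys where x: "pl l = x # ys" by (cases "pl l") auto
  then have "ys \<noteq> []" using ne by auto
  then obtain q rs where "ys = q # rs" by (cases ys) auto
  then show thesis using that[of q rs] x pl(2,3)[OF assms] by auto
qed

text \<open>The first vertex of a port path belongs to \<open>X0\<close>. The tail begins with the
  second one, and the edge between them is the leg.\<close>

definition ts0 :: "'b list list" where "ts0 = map (\<lambda>l. tl (pl l)) [0..<n]"
definition ls0 :: "'b set list" where "ls0 = map (\<lambda>l. {hd (pl l), hd (tl (pl l))}) [0..<n]"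

lemma ts0_nth [simp]: "l < n \<Longrightarrow> ts0 ! l = tl (pl l)" and ls0_nth [simp]: "l < n \<Longrightarrow> ls0 ! l = {hd (pl l), hd (tl (pl l))}"
  and len0 [simp]: "length ts0 = n" "length ls0 = n"
  by (simp_all add: ts0_def ls0_def)

lemma int_verts: "e \<in> edges G \<Longrightarrow> x \<in> verts (emap \<xi> e) \<Longrightarrow> x \<in> internal_verts (emap \<xi> e) \<or> (\<exists>v\<in>e. x = vmap \<xi> v)"
  using hom_embeddingD(5)[OF \<xi>, of e] by (auto simp: internal_verts_def)

lemma edge_verts: "e \<in> edges G \<Longrightarrow> v \<in> e \<Longrightarrow> v \<in> verts G"
  using G by (auto simp: cubic_def simple_graph_def)

lemma verts_disjoint:
  assumes "e \<in> edges G" "f \<in> edges G" "e \<inter> f = {}"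
  shows "verts (emap \<xi> e) \<inter> verts (emap \<xi> f) = {}"
proof (rule equals0I)
  fix x assume x: "x \<in> verts (emap \<xi> e) \<inter> verts (emap \<xi> f)"
  have "e \<noteq> {}" using assms(1) G by (auto simp: cubic_def simple_graph_def)
  then have ne: "e \<noteq> f" using assms(3) by blast
  then have "x \<notin> internal_verts (emap \<xi> e)" using hom_embeddingD(7)[OF \<xi> assms(1,2)] x by blast
  then obtain v where v: "v \<in> e" "x = vmap \<xi> v" using int_verts[OF assms(1)] x by blast
  then have "v \<in> f" using hom_embeddingD(8)[OF \<xi> edge_verts[OF assms(1) v(1)] assms(2)] x by blast
  then show False using v assms(3) by blast
qed

lemma X0_vmap: "v \<in> K \<Longrightarrow> vmap \<xi> v \<in> X0"
proof -
  assume "v \<in> K"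
  then obtain i where i: "i \<in> {5..<5 + n0}" "v = \<phi> i" by blast
  obtain e where "e \<in> set ints" "i = fst e \<or> i = snd e" using cov[OF i(1)] by blast
  then obtain k where k: "k < length ints" "v \<in> ie k" using i(2) by (auto simp: in_set_conv_nth ie_def)
  then have "vmap \<xi> v \<in> verts (emap \<xi> (ie k))"
    using hom_embeddingD(8)[OF \<xi> edge_verts[OF ie_edge] ie_edge] by blast
  then show ?thesis using k(1) by (auto simp: X0_def)
qed

lemma ZX0: "Z \<inter> X0 = {}"
proof (rule equals0I)
  fix x assume x: "x \<in> Z \<inter> X0"
  then obtain k where k: "k < length ints" "x \<in> verts (emap \<xi> (ie k))" by (auto simp: X0_def)
  from x consider v where "v \<in> verts G" "v \<notin> K" "x = vmap \<xi> v"
    | e where "e \<in> edges G" "e \<inter> K = {}" "x \<in> verts (emap \<xi> e)" by (auto simp: Z_def)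
  then show False
  proof cases
    case 1
    then have "v \<in> ie k" using hom_embeddingD(8)[OF \<xi> 1(1) ie_edge[OF k(1)]] k(2) by blast
    then show False using ie_K[OF k(1)] 1(2) by blast
  next
    case 2
    then show False using verts_disjoint[OF 2(1) ie_edge[OF k(1)]] ie_K[OF k(1)] k(2) by blast
  qed
qed

lemma ZH: "Z \<subseteq> verts H"
proof -
  have "verts (emap \<xi> e) \<subseteq> verts H" if "e \<in> edges G" for e
    using hom_embeddingD(4)[OF \<xi> that] by (simp add: subgraph_def)
  then show ?thesis using hom_embeddingD(2)[OF \<xi>] unfolding Z_def by blast
qed

lemma tail_verts:
  assumes l: "l < n" and x: "x \<in> set (ts0 ! l)"
  shows "x \<in> internal_verts (emap \<xi> (pe l)) \<or> x = vmap \<xi> (pv ! l)"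
    and "x \<in> set (butlast (ts0 ! l)) \<Longrightarrow> x \<in> internal_verts (emap \<xi> (pe l))"
proof -
  obtain q rs where q: "pl l = vmap \<xi> (\<phi> (prt ! l)) # q # rs" "last (q # rs) = vmap \<xi> (pv ! l)" by (rule pl_Cons[OF l])
  have d: "distinct (pl l)" "verts (emap \<xi> (pe l)) = set (pl l)" using pl(1)[OF l] by (simp_all add: path_listing_def)
  have e: "ends (emap \<xi> (pe l)) = {vmap \<xi> (\<phi> (prt ! l)), vmap \<xi> (pv ! l)}"
    using ends_path_listing[OF pl(1)[OF l]] pl(2,3)[OF l] by simp
  show 1: "x \<in> internal_verts (emap \<xi> (pe l)) \<or> x = vmap \<xi> (pv ! l)"
    using x d q l unfolding internal_verts_def e by auto
  assume b: "x \<in> set (butlast (ts0 ! l))"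
  have "distinct (q # rs)" using d q by simp
  then have "last (q # rs) \<notin> set (butlast (q # rs))"
    by (metis append_butlast_last_id distinct_append list.distinct(1) list.set_intros(1) not_distinct_conv_prefix distinct_butlast)
  then show "x \<in> internal_verts (emap \<xi> (pe l))" using 1 b q l by auto
qed

lemma internal_notZ: "l < n \<Longrightarrow> x \<in> internal_verts (emap \<xi> (pe l)) \<Longrightarrow> x \<notin> Z"
proof
  assume l: "l < n" "x \<in> internal_verts (emap \<xi> (pe l))" "x \<in> Z"
  have K: "pe l \<inter> K \<noteq> {}" using prt_node[OF l(1)] by (auto simp: pe_def)
  from l(3) consider v where "v \<in> verts G" "x = vmap \<xi> v"
    | e where "e \<in> edges G" "e \<inter> K = {}" "x \<in> verts (emap \<xi> e)" by (auto simp: Z_def)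
  then show False
  proof cases
    case 1
    have "x \<in> verts (emap \<xi> (pe l))" using l(2) by (simp add: internal_verts_def)
    then have "v \<in> pe l" using hom_embeddingD(8)[OF \<xi> 1(1) pe_edge[OF l(1)]] 1(2) by blast
    then have "x \<in> ends (emap \<xi> (pe l))" using hom_embeddingD(5)[OF \<xi> pe_edge[OF l(1)]] 1(2) by blast
    then show False using l(2) by (simp add: internal_verts_def)
  next
    case 2
    then show False using hom_embeddingD(7)[OF \<xi> pe_edge[OF l(1)] 2(1)] K l(2) by blast
  qed
qed

lemma internal_notX0: "l < n \<Longrightarrow> x \<in> internal_verts (emap \<xi> (pe l)) \<Longrightarrow> x \<notin> X0"
  using hom_embeddingD(7)[OF \<xi> pe_edge ie_edge pe_not_ie] by (force simp: X0_def)

lemma pv_Z: "l < n \<Longrightarrow> vmap \<xi> (pv ! l) \<in> Z"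
proof -
  assume l: "l < n"
  then have "pv ! l \<in> verts G - K" using pv_notK[OF l] pv(3) nth_mem[of l pv] by blast
  then show ?thesis unfolding Z_def by blast
qed

lemma region0: "region H n Z X0 ts0 ls0"
  unfolding region_def
proof (intro conjI allI impI)
  have "verts (emap \<xi> (ie k)) \<subseteq> verts H" if "k < length ints" for k
    using hom_embeddingD(4)[OF \<xi> ie_edge[OF that]] by (simp add: subgraph_def)
  then show "X0 \<subseteq> verts H" unfolding X0_def by blast
  show "Z \<inter> X0 = {}" by (rule ZX0)
  show "length ts0 = n" "length ls0 = n" by simp_all
next
  fix l assume l: "l < n"
  obtain q rs where q: "pl l = vmap \<xi> (\<phi> (prt ! l)) # q # rs" "last (q # rs) = vmap \<xi> (pv ! l)" by (rule pl_Cons[OF l])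
  have d: "distinct (pl l)" "verts (emap \<xi> (pe l)) = set (pl l)" "edges (emap \<xi> (pe l)) = consecutive_pairs (pl l)"
    using pl(1)[OF l] by (simp_all add: path_listing_def)
  have sg: "set (pl l) \<subseteq> verts H" "consecutive_pairs (pl l) \<subseteq> edges H"
    using hom_embeddingD(4)[OF \<xi> pe_edge[OF l]] d by (auto simp: subgraph_def)
  have t: "ts0 ! l = q # rs" using q l by simp
  show "ts0 ! l \<noteq> []" "distinct (ts0 ! l)" "set (ts0 ! l) \<subseteq> verts H" using t d q sg by auto
  show "consecutive_pairs (ts0 ! l) \<subseteq> edges H" using t sg q by auto
  show "set (ts0 ! l) \<inter> X0 = {}"
    using tail_verts(1)[OF l] internal_notX0[OF l] pv_Z[OF l] ZX0 by blast
  show "set (butlast (ts0 ! l)) \<inter> Z = {}"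
    using tail_verts(2)[OF l] internal_notZ[OF l] in_set_butlastD[of _ "ts0 ! l"] by blast
  show "last (ts0 ! l) \<in> Z" using pv_Z[OF l] t q by simp
  show "ls0 ! l \<in> edges H" using sg q l by simp
  have "vmap \<xi> (\<phi> (prt ! l)) \<in> X0" using X0_vmap prt_node[OF l] by blast
  then show "\<exists>p\<in>X0. ls0 ! l = {p, hd (ts0 ! l)}" using q l by auto
next
  fix l l' assume l: "l < n" "l' < n" "l \<noteq> l'"
  have ne: "pe l \<noteq> pe l'" using pe_inj l by blast
  show "set (ts0 ! l) \<inter> set (ts0 ! l') = {}"
  proof (rule equals0I)
    fix x assume x: "x \<in> set (ts0 ! l) \<inter> set (ts0 ! l')"
    have v: "y \<in> verts (emap \<xi> (pe m))" if "m < n" "y \<in> set (ts0 ! m)" for m y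
      using that pl(1)[OF that(1)] list.set_sel(2)[of "pl m" y] by (cases "pl m") (auto simp: path_listing_def)
    have "x \<notin> internal_verts (emap \<xi> (pe l))"
      using hom_embeddingD(7)[OF \<xi> pe_edge[OF l(1)] pe_edge[OF l(2)] ne] v[OF l(2)] x by blast
    moreover have "x \<notin> internal_verts (emap \<xi> (pe l'))"
      using hom_embeddingD(7)[OF \<xi> pe_edge[OF l(2)] pe_edge[OF l(1)]] ne v[OF l(1)] x by blast
    ultimately have "vmap \<xi> (pv ! l) = vmap \<xi> (pv ! l')" using tail_verts(1) l x by blast
    then have "pv ! l = pv ! l'" using vmap_ne[of "pv ! l" "pv ! l'"] pv(3) l nth_mem by blast
    then show False using pv(2) l by (simp add: nth_eq_iff_index_eq)
  qed
qed

lemma emap_edge_at: "e \<in> edges G \<Longrightarrow> v \<in> e \<Longrightarrow> \<exists>h\<in>edges (emap \<xi> e). vmap \<xi> v \<in> h"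
proof -
  assume e: "e \<in> edges G" "v \<in> e"
  obtain a b where ab: "e = {a, b}" "a \<noteq> b" "a \<in> verts G" "b \<in> verts G"
    using simple_edgeE[OF _ e(1)] G by (metis cubic_def)
  have "vmap \<xi> v \<in> verts (emap \<xi> e)"
    using hom_embeddingD(8)[OF \<xi> edge_verts[OF e] e(1)] e(2) by blast
  then show ?thesis
    using path_at_end(1)[OF hom_embeddingD(3)[OF \<xi> e(1)], of "vmap \<xi> a" "vmap \<xi> b"]
      hom_embeddingD(5)[OF \<xi> e(1)] ab vmap_ne by simp
qed

text \<open>At the image of a cluster vertex all three edges of \<open>H\<close> belong to images of
  edges of \<open>G\<close>: those of inner edges stay in \<open>X0\<close>, those of port edges are
  legs. An exit can therefore only start inside the image of an inner edge.\<close>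

lemma exit_internal:
  assumes d: "{p, u} \<in> edges H" "p \<in> X0" "u \<notin> X0" "{p, u} \<notin> set ls0"
  shows "\<exists>k<length ints. p \<in> internal_verts (emap \<xi> (ie k))"
proof -
  obtain k where k: "k < length ints" "p \<in> verts (emap \<xi> (ie k))" using d(2) by (auto simp: X0_def)
  show ?thesis
  proof (cases "p \<in> internal_verts (emap \<xi> (ie k))")
    case False
    then obtain v where v: "v \<in> ie k" "p = vmap \<xi> v" using int_verts[OF ie_edge[OF k(1)] k(2)] by blast
    have vG: "v \<in> verts G" "v \<in> K" using edge_verts[OF ie_edge[OF k(1)] v(1)] ie_K[OF k(1)] v(1) by auto
    have no: "{p, u} \<notin> edges (emap \<xi> e)" if e: "e \<in> edges G" "v \<in> e" for e
    proof
      assume h: "{p, u} \<in> edges (emap \<xi> e)"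
      have uv: "u \<in> verts (emap \<xi> e)" using path_edge_verts(1)[OF hom_embeddingD(3)[OF \<xi> e(1)] h] by blast
      from K_edge[OF e(1)] e(2) vG(2) consider k' where "k' < length ints" "e = ie k'" | l where "l < n" "e = pe l"
        by blast
      then show False
      proof cases
        case 1 then show False using uv d(3) by (auto simp: X0_def)
      next
        case 2
        obtain q rs where q: "pl l = vmap \<xi> (\<phi> (prt ! l)) # q # rs" "last (q # rs) = vmap \<xi> (pv ! l)" by (rule pl_Cons[OF 2(1)])
        have "v \<noteq> pv ! l" using vG(2) pv_notK[OF 2(1)] by blast
        then have "v = \<phi> (prt ! l)" using e(2) 2 by (simp add: pe_def)
        then have p: "p = vmap \<xi> (\<phi> (prt ! l))" using v(2) by simp
        have dd: "distinct ([] @ p # q # rs)" and ee: "edges (emap \<xi> e) = consecutive_pairs ([] @ p # q # rs)"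
          using pl(1)[OF 2(1)] q 2(2) p by (simp_all add: path_listing_def)
        have "{p, u} \<in> {h \<in> consecutive_pairs ([] @ p # q # rs). p \<in> h}" using h ee by simp
        then have "{p, u} = {p, q}" unfolding consecutive_pairs_at[OF dd] by simp
        moreover have "ls0 ! l = {p, q}" using 2(1) q p by simp
        ultimately show False using d(4) nth_mem[of l ls0] 2(1) by simp
      qed
    qed
    obtain a b c where abc: "distinct [a, b, c]" "{e \<in> edges G. v \<in> e} = {a, b, c}"
      using cubic_edges_at[OF G vG(1)] by blast
    then have abcG: "a \<in> edges G" "b \<in> edges G" "c \<in> edges G" "v \<in> a" "v \<in> b" "v \<in> c" by blast+
    obtain h1 where h1: "h1 \<in> edges (emap \<xi> a)" "p \<in> h1" using emap_edge_at[OF abcG(1,4)] v(2) by blast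
    obtain h2 where h2: "h2 \<in> edges (emap \<xi> b)" "p \<in> h2" using emap_edge_at[OF abcG(2,5)] v(2) by blast
    obtain h3 where h3: "h3 \<in> edges (emap \<xi> c)" "p \<in> h3" using emap_edge_at[OF abcG(3,6)] v(2) by blast
    have "h1 \<noteq> h2" "h1 \<noteq> h3" "h2 \<noteq> h3"
      using hom_embeddingD(6)[OF \<xi> abcG(1,2)] hom_embeddingD(6)[OF \<xi> abcG(1,3)] hom_embeddingD(6)[OF \<xi> abcG(2,3)]
        abc(1) h1(1) h2(1) h3(1) by auto
    moreover have "{h1, h2, h3, {p, u}} \<subseteq> edges H"
      using h1 h2 h3 d(1) hom_embeddingD(4)[OF \<xi>] abcG by (auto simp: subgraph_def)
    moreover have "h1 \<noteq> {p, u}" "h2 \<noteq> {p, u}" "h3 \<noteq> {p, u}" using no abcG h1(1) h2(1) h3(1) by auto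
    ultimately show ?thesis using cubic_four_edges[OF H, of h1 h2 h3 "{p, u}" p] h1(2) h2(2) h3(2) by simp
  qed (use k in blast)
qed

lemma start_len: "length (snd start) = length ints + n"
  using prt(2) by (simp add: start_def)

text \<open>The exit splits the image of inner edge \<open>k\<close> into two pieces, which is
  exactly what \<open>sub k start\<close> describes.\<close>

lemma exit_real:
  assumes d: "{p, u} \<in> edges H" "p \<in> X0" "u \<notin> X0" "{p, u} \<notin> set ls0"
  shows "\<exists>k<length ints. real H X0 (sub k start) (leaf_map (map hd ts0) u)"
proof -
  obtain k where k: "k < length ints" "p \<in> internal_verts (emap \<xi> (ie k))" using exit_internal[OF d] by blast
  have pne: "p \<noteq> vmap \<xi> v" if "v \<in> verts G" for v
  proof
    assume "p = vmap \<xi> v"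
    moreover have "p \<in> verts (emap \<xi> (ie k))" using k(2) by (simp add: internal_verts_def)
    ultimately have "v \<in> ie k" using hom_embeddingD(8)[OF \<xi> that ie_edge[OF k(1)]] by simp
    then have "p \<in> ends (emap \<xi> (ie k))" using hom_embeddingD(5)[OF \<xi> ie_edge[OF k(1)]] \<open>p = vmap \<xi> v\<close> by blast
    then show False using k(2) by (simp add: internal_verts_def)
  qed
  let ?a = "fst (ints ! k)" and ?b = "snd (ints ! k)"
  have "ends (emap \<xi> (ie k)) = {vmap \<xi> (\<phi> ?a), vmap \<xi> (\<phi> ?b)}"
    using hom_embeddingD(5)[OF \<xi> ie_edge[OF k(1)]] by (simp add: ie_def)
  then obtain T1 T2 where T12: "T1 \<inter> T2 = {}" "T1 \<union> T2 = edges (emap \<xi> (ie k))"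
    "conn T1 (vmap \<xi> (\<phi> ?a)) p" "conn T2 p (vmap \<xi> (\<phi> ?b))"
    using path_split[OF hom_embeddingD(3)[OF \<xi> ie_edge[OF k(1)]], of "vmap \<xi> (\<phi> ?a)" "vmap \<xi> (\<phi> ?b)" p] k(2)
    unfolding internal_verts_def by blast
  define \<rho> where "\<rho> i = (if i = 5 + n0 then p else if i < 5 then leaf_map (map hd ts0) u i else vmap \<xi> (\<phi> i))" for i
  define m where "m = length ints"
  \<comment> \<open>Edge sets in the order of \<open>snd (sub k start)\<close>: the first piece
    \<open>T1\<close> takes the place of inner path \<open>k\<close>, the legs follow the inner
    paths, and the second piece and the exit edge come last.\<close>
  define S where "S i = (if i = k then T1 else if i < m then edges (emap \<xi> (ie i))
      else if i < m + n then {ls0 ! (i - m)} else if i = m + n then T2 else {{p, u}})" for i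
  define L where "L = map (map_prod \<rho> \<rho>) (snd (sub k start))"
  have len: "length L = m + n + 2" using start_len by (simp add: L_def sub_def Let_def m_def start_def prt(2))
  have node: "\<rho> i = vmap \<xi> (\<phi> i)" if "i \<in> {5..<5 + n0}" for i using that by (auto simp: \<rho>_def)
  have Lk: "L ! i = (vmap \<xi> (\<phi> (fst (ints ! i))), vmap \<xi> (\<phi> (snd (ints ! i))))" if "i < m" "i \<noteq> k" for i
    using that nodes[of i] node k(1)
    by (auto simp: L_def sub_def Let_def start_def m_def nth_append prod_eq_iff)
  have Lkk: "L ! k = (vmap \<xi> (\<phi> ?a), p)"
    using nodes[OF k(1)] node k(1) by (simp add: L_def sub_def Let_def start_def nth_append \<rho>_def[of "5 + n0"])
  have Lp: "L ! (m + l) = (hd (pl l), hd (tl (pl l)))" if "l < n" for l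
  proof -
    have "snd (sub k start) ! (m + l) = (prt ! l, l)"
      using that k(1) prt(2) by (simp add: sub_def Let_def start_def m_def nth_append)
    moreover have "m + l < length (snd (sub k start))" using len that by (simp add: L_def)
    ultimately have "L ! (m + l) = (\<rho> (prt ! l), \<rho> l)" by (simp add: L_def)
    then show ?thesis using node[OF prt_node[OF that]] that prt(3) pl(2)[OF that] by (simp add: \<rho>_def leaf_map_def)
  qed
  have L1: "L ! (m + n) = (p, vmap \<xi> (\<phi> ?b))"
    using nodes[OF k(1)] node k(1) prt(2) by (simp add: L_def sub_def Let_def start_def m_def nth_append \<rho>_def[of "5 + n0"])
  have L2: "L ! (Suc (m + n)) = (p, u)"
    using k(1) prt(2) by (simp add: L_def sub_def Let_def start_def m_def nth_append \<rho>_def leaf_map_def)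
  \<comment> \<open>Since \<open>p\<close> is interior to the image of \<open>ie k\<close>, no other
    image could contain the exit edge; and that one would put \<open>u\<close> into
    \<open>X0\<close>.\<close>
  have puE: "{p, u} \<notin> edges (emap \<xi> e)" if e: "e \<in> edges G" for e
  proof
    assume h: "{p, u} \<in> edges (emap \<xi> e)"
    have pu: "p \<in> verts (emap \<xi> e)" "u \<in> verts (emap \<xi> e)"
      using path_edge_verts(1)[OF hom_embeddingD(3)[OF \<xi> e] h] by blast+
    then have "e = ie k" using hom_embeddingD(7)[OF \<xi> ie_edge[OF k(1)] e] k(2) by blast
    then show False using pu(2) d(3) k(1) by (auto simp: X0_def)
  qed
  have lsE: "ls0 ! l \<in> edges (emap \<xi> (pe l))" if l: "l < n" for l
  proof -
    obtain q rs where q: "pl l = vmap \<xi> (\<phi> (prt ! l)) # q # rs" "last (q # rs) = vmap \<xi> (pv ! l)" by (rule pl_Cons[OF l])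
    then show ?thesis using pl(1)[OF l] l by (simp add: path_listing_def)
  qed
  have mI: "edges (emap \<xi> (ie i)) \<subseteq> meeting H X0" if "i < m" for i
  proof
    fix h assume h: "h \<in> edges (emap \<xi> (ie i))"
    note ei = ie_edge[of i] hom_embeddingD(3,4)[OF \<xi> ie_edge[of i]]
    have "h \<subseteq> X0" "h \<noteq> {}" using path_edge_verts[OF ei(2) h] that by (auto simp: X0_def m_def)
    then show "h \<in> meeting H X0" using ei(3) h that by (auto simp: meeting_def subgraph_def m_def)
  qed
  have mP: "ls0 ! l \<in> meeting H X0" if "l < n" for l
    using regionD(8,9)[OF region0 that] by (auto simp: meeting_def)
  have Sd: "S i \<subseteq> (if i < m then edges (emap \<xi> (ie i)) else if i < m + n then edges (emap \<xi> (pe (i - m)))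
      else if i = m + n then edges (emap \<xi> (ie k)) else {{p, u}})" for i
    using T12(2) lsE[of "i - m"] k(1) by (auto simp: S_def m_def)
  have lk: "linked (meeting H X0) L"
  proof (rule linkedI[of _ S])
    fix i assume i: "i < length L"
    then consider "i < m" | "m \<le> i" "i < m + n" | "i = m + n" | "i = Suc (m + n)" using len by linarith
    note c = this
    show "S i \<subseteq> meeting H X0"
      using c
    proof cases
      case 1 then show ?thesis using Sd[of i] mI[of i] by auto
    next
      case 2 then show ?thesis using mP[of "i - m"] k(1) by (auto simp: S_def m_def)
    next
      case 3 then show ?thesis using Sd[of i] mI[of k] k(1) by (auto simp: m_def)
    next
      case 4 then show ?thesis using d k(1) by (auto simp: S_def m_def meeting_def)
    qed
    show "conn (S i) (fst (L ! i)) (snd (L ! i))"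
      using c
    proof cases
      case 1
      show ?thesis
      proof (cases "i = k")
        case True then show ?thesis using Lkk T12(3) by (simp add: S_def)
      next
        case False
        have "conn (edges (emap \<xi> (ie i))) (vmap \<xi> (\<phi> (fst (ints ! i)))) (vmap \<xi> (\<phi> (snd (ints ! i))))"
          using path_conn[OF hom_embeddingD(3)[OF \<xi> ie_edge]] hom_embeddingD(5)[OF \<xi> ie_edge[of i]] 1
          by (simp add: m_def ie_def)
        then show ?thesis using Lk[OF 1 False] 1 False by (simp add: S_def)
      qed
    next
      case 2
      then have "i - m < n" "L ! i = (hd (pl (i - m)), hd (tl (pl (i - m))))" using Lp[of "i - m"] by auto
      moreover have "S i = {ls0 ! (i - m)}" using 2 k(1) by (auto simp: S_def m_def)
      ultimately show ?thesis by (simp add: conn_edge)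
    next
      case 3
      then show ?thesis using L1 T12(4) k(1) by (simp add: S_def m_def)
    next
      case 4
      then show ?thesis using L2 k(1) by (simp add: S_def m_def conn_edge)
    qed
  next
    fix i j assume ij: "i < length L" "j < length L" "i \<noteq> j"
    have key: "S i \<inter> S j = {}" if ij: "i < j" "j < m + n + 2" for i j
    proof -
      have dI: "edges (emap \<xi> (ie a)) \<inter> edges (emap \<xi> (ie b)) = {}" if "a < m" "b < m" "a \<noteq> b" for a b
        using hom_embeddingD(6)[OF \<xi> ie_edge ie_edge] ie_inj[of a b] that by (auto simp: m_def)
      have dP: "edges (emap \<xi> (ie a)) \<inter> edges (emap \<xi> (pe b)) = {}" if "a < m" "b < n" for a b
        using hom_embeddingD(6)[OF \<xi> ie_edge pe_edge] pe_not_ie[of b a] that by (auto simp: m_def)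
      have dPP: "edges (emap \<xi> (pe a)) \<inter> edges (emap \<xi> (pe b)) = {}" if "a < n" "b < n" "a \<noteq> b" for a b
        using hom_embeddingD(6)[OF \<xi> pe_edge pe_edge] pe_inj[of a b] that by auto
      have km: "k < m" using k(1) by (simp add: m_def)
      from ij consider "j < m" | "i < m" "m \<le> j" "j < m + n" | "m \<le> i" "j < m + n" | "i < m" "i \<noteq> k" "j = m + n"
        | "i = k" "j = m + n" | "m \<le> i" "j = m + n" | "j = Suc (m + n)" by linarith
      then show ?thesis
      proof cases
        case 1 then show ?thesis using Sd[of i] Sd[of j] dI[of i j] ij by auto
      next
        case 2
        then have "j - m < n" by linarith
        then show ?thesis using 2 Sd[of i] Sd[of j] dP[of i "j - m"] by auto
      next
        case 3
        then have "i - m < n" "j - m < n" "i - m \<noteq> j - m" using ij by linarith+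
        then show ?thesis using 3 Sd[of i] Sd[of j] dPP[of "i - m" "j - m"] ij by auto
      next
        case 4 then show ?thesis using Sd[of i] Sd[of j] dI[of i k] ij km by auto
      next
        case 5 then show ?thesis using T12(1) km by (auto simp: S_def)
      next
        case 6
        then have "i - m < n" using ij by linarith
        then show ?thesis using 6 Sd[of i] Sd[of j] dP[of k "i - m"] ij km by auto
      next
        case 7
        then have "S j = {{p, u}}" using km by (auto simp: S_def)
        moreover have "{p, u} \<notin> S i"
        proof -
          consider "i < m" | "m \<le> i" "i - m < n" "i < m + n" | "i = m + n" using 7 ij by linarith
          then show ?thesis
          proof cases
            case 1 then show ?thesis using Sd[of i] puE[OF ie_edge[of i]] by (auto simp: m_def)
          next
            case 2 then show ?thesis using Sd[of i] puE[OF pe_edge[of "i - m"]] by auto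
          next
            case 3 then show ?thesis using Sd[of i] puE[OF ie_edge[OF k(1)]] by auto
          qed
        qed
        ultimately show ?thesis by simp
      qed
    qed
    show "S i \<inter> S j = {}"
      using key[of i j] key[of j i] ij len by (cases "i < j") auto
  qed
  have f: "fst (sub k start) = n0 + 1" by (simp add: sub_def start_def Let_def)
  have St: "{5..<5 + (n0 + 1)} = insert (5 + n0) {5..<5 + n0}" by auto
  have "inj_on (\<lambda>i. vmap \<xi> (\<phi> i)) {5..<5 + n0}"
    using comp_inj_on[OF inj, of "vmap \<xi>"] inj_on_subset[OF hom_embeddingD(1)[OF \<xi>] KG] by (simp add: comp_def)
  then have "inj_on \<rho> {5..<5 + n0}" using node by (simp add: inj_on_def)
  moreover have "\<rho> (5 + n0) = p" by (simp add: \<rho>_def)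
  moreover have "p \<notin> \<rho> ` {5..<5 + n0}" using node pne KG by auto
  ultimately have "inj_on \<rho> {5..<5 + (n0 + 1)}" unfolding St by simp
  moreover have "\<rho> ` {5..<5 + (n0 + 1)} \<subseteq> X0"
    unfolding St using node X0_vmap d(2) \<open>\<rho> (5 + n0) = p\<close> by auto
  moreover have "\<forall>l<5. \<rho> l = leaf_map (map hd ts0) u l" by (simp add: \<rho>_def)
  ultimately have "real H X0 (sub k start) (leaf_map (map hd ts0) u)"
    unfolding real_def f using lk[unfolded L_def] by (intro exI[of _ \<rho>] conjI)
  then show ?thesis using k(1) by blast
qed

end

context cluster
begin

text \<open>The outcome of growth in terms of the embedding: ports sit at the images of the outer
  vertices, the image of the landing edge \<open>j\<close> is split at \<open>u\<close>, and the
  images of all other edges away from the cluster remain untouched.\<close>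

definition realizes :: "pattern \<Rightarrow> 'a set \<Rightarrow> 'a \<Rightarrow> 'a \<Rightarrow> 'b \<Rightarrow> bool" where
  "realizes p j j1 j2 u \<longleftrightarrow> (\<exists>\<rho>. (\<forall>l<n. \<rho> l = vmap \<xi> (pv ! l)) \<and> \<rho> 4 = u \<and> inj_on \<rho> {5..<5 + fst p} \<and>
     \<rho> ` {5..<5 + fst p} \<subseteq> verts H - Z \<and>
     linked (edges H - (\<Union>g\<in>{g \<in> edges G. g \<inter> K = {} \<and> g \<noteq> j}. edges (emap \<xi> g)))
       (map (map_prod \<rho> \<rho>) (snd p) @ [(u, vmap \<xi> j1), (u, vmap \<xi> j2)]))"

lemma typed0:
  assumes "start_table \<tau>s start tab" "length tab = length ints"
  shows "typed H (ty H \<tau>s) X0 ts0 ls0"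
  unfolding typed_def
proof (intro allI impI)
  fix p u assume d: "{p, u} \<in> edges H" "p \<in> X0" "u \<notin> X0" "{p, u} \<notin> set ls0"
  obtain k where k: "k < length ints" "real H X0 (sub k start) (leaf_map (map hd ts0) u)" using exit_real[OF d] by blast
  obtain \<tau> where \<tau>: "\<tau> \<in> set \<tau>s" "\<forall>q\<in>set \<tau>. \<exists>ms Is. check (sub k start) q ms Is"
    using start_table_sub[OF assms(1)] k(1) assms(2) by force
  have "real H X0 q (leaf_map (map hd ts0) u)" if q: "q \<in> set \<tau>" for q
  proof -
    obtain ms Is where "check (sub k start) q ms Is" using \<tau>(2) q by blast
    then show ?thesis by (rule real_check[OF k(2)])
  qed
  then show "ty H \<tau>s X0 (map hd ts0) u" unfolding ty_def using \<tau>(1) by blast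
qed

lemma card_X0: "n \<le> card X0"
proof -
  have "vmap \<xi> ` K \<subseteq> X0" using X0_vmap by blast
  moreover have "finite X0" using regionD'(1)[OF region0] cubic_finite[OF H] finite_subset by blast
  ultimately have "card (vmap \<xi> ` K) \<le> card X0" by (rule card_mono[rotated])
  moreover have "card (vmap \<xi> ` K) = n0"
    using card_image[OF inj_on_subset[OF hom_embeddingD(1)[OF \<xi>] KG]] card_image[OF inj] by simp
  ultimately show ?thesis using size(1) by simp
qed

lemma card_Z: "n \<le> card Z"
proof -
  have "vmap \<xi> ` set pv \<subseteq> Z" using pv_Z by (auto simp: in_set_conv_nth)
  moreover have "finite Z" using ZH cubic_finite[OF H] finite_subset by blast
  ultimately have "card (vmap \<xi> ` set pv) \<le> card Z" by (rule card_mono[rotated])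
  moreover have "card (vmap \<xi> ` set pv) = n"
    using card_image[OF inj_on_subset[OF hom_embeddingD(1)[OF \<xi>] pv(3)]] distinct_card[OF pv(2)] by simp
  ultimately show ?thesis by simp
qed

lemma Z_edges: "g \<in> edges G \<Longrightarrow> g \<inter> K = {} \<Longrightarrow> h \<in> edges (emap \<xi> g) \<Longrightarrow> h \<subseteq> Z"
  using path_edge_verts(1)[OF hom_embeddingD(3)[OF \<xi>], of g h] unfolding Z_def by blast

text \<open>At the image of a vertex outside the cluster, three edges of \<open>H\<close> are
  already taken, by images inside \<open>Z\<close> or by the final edge of a tail, so the exit edge
  would be a fourth.\<close>

lemma landing_edge:
  assumes R: "region H n Z X ts ls" and d: "{p, u} \<in> edges H" "p \<in> X" "u \<in> Z" "{p, u} \<notin> set ls"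
    and sf: "\<forall>l<n. suffix (ts ! l) (ts0 ! l)"
  shows "\<exists>j. j \<in> edges G \<and> j \<inter> K = {} \<and> u \<in> internal_verts (emap \<xi> j)"
proof (rule ccontr)
  assume no: "\<not> ?thesis"
  have "\<exists>i. i \<in> verts G \<and> i \<notin> K \<and> u = vmap \<xi> i"
  proof -
    from d(3) consider i where "i \<in> verts G" "i \<notin> K" "u = vmap \<xi> i"
      | e where "e \<in> edges G" "e \<inter> K = {}" "u \<in> verts (emap \<xi> e)" unfolding Z_def by blast
    then show ?thesis
    proof cases
      case 2
      then obtain v where "v \<in> e" "u = vmap \<xi> v" using no int_verts[OF 2(1,3)] by blast
      then show ?thesis using 2 edge_verts[OF 2(1)] by blast
    qed blast
  qed
  then obtain i where i: "i \<in> verts G" "i \<notin> K" "u = vmap \<xi> i" by blast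
  have pZ: "p \<notin> Z" using regionD'(2)[OF R] d(2) by blast
  have rest: "\<exists>h\<in>edges H. u \<in> h \<and> h \<subseteq> Z \<and> h \<in> edges (emap \<xi> e)" if e: "e \<in> edges G" "i \<in> e" "e \<inter> K = {}" for e
  proof -
    obtain h where h: "h \<in> edges (emap \<xi> e)" "u \<in> h" using emap_edge_at[OF e(1,2)] i(3) by blast
    have "h \<subseteq> Z" by (rule Z_edges[OF e(1,3) h(1)])
    moreover have "h \<in> edges H" using hom_embeddingD(4)[OF \<xi> e(1)] h(1) by (auto simp: subgraph_def)
    ultimately show ?thesis using h by blast
  qed
  have port: "\<exists>h\<in>edges H. u \<in> h \<and> \<not> h \<subseteq> Z \<and> h \<noteq> {p, u}" if l: "l < n" "pv ! l = i" for l
  proof -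
    have nl: "ts ! l \<noteq> []" using regionD(1)[OF R l(1)] .
    obtain as where as: "ts0 ! l = as @ ts ! l" using sf l(1) by (auto simp: suffix_def)
    obtain q rs where q: "pl l = vmap \<xi> (\<phi> (prt ! l)) # q # rs" "last (q # rs) = vmap \<xi> (pv ! l)" by (rule pl_Cons[OF l(1)])
    have "ts0 ! l = q # rs" using q l(1) by simp
    then have "last (ts ! l) = last (q # rs)" using as nl by (metis last_appendR)
    then have lu: "last (ts ! l) = u" using q(2) l(2) i(3) by simp
    have bs: "ts ! l = butlast (ts ! l) @ [u]" using append_butlast_last_id[OF nl] unfolding lu by simp
    define bs where "bs = butlast (ts ! l)"
    note bs = bs[folded bs_def]
    show ?thesis
    proof (cases bs rule: rev_cases)
      case Nil
      obtain q where q: "q \<in> X" "ls ! l = {q, u}" using regionD(9)[OF R l(1)] bs Nil by auto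
      have "ls ! l \<in> set ls" using l(1) regionD'(4)[OF R] by simp
      then have "ls ! l \<noteq> {p, u}" using d(4) by auto
      moreover have "\<not> ls ! l \<subseteq> Z" using q regionD'(2)[OF R] by auto
      ultimately show ?thesis using regionD(8)[OF R l(1)] q(2) by blast
    next
      case (snoc cs x)
      have "{x, u} \<in> consecutive_pairs (ts ! l)"
        using bs snoc consecutive_pairs_append[of cs x "[u]"] by simp
      then have "{x, u} \<in> edges H" using regionD(5)[OF R l(1)] by blast
      moreover have "x \<notin> Z" using regionD(6)[OF R l(1)] bs snoc by (auto simp: butlast_append)
      moreover have "x \<notin> X" using regionD(3)[OF R l(1)] bs snoc by auto
      then have "{x, u} \<noteq> {p, u}" using d(2,3) regionD'(2)[OF R] by (auto simp: doubleton_eq_iff)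
      ultimately show ?thesis by blast
    qed
  qed
  obtain a b c where abc: "distinct [a, b, c]" "{e \<in> edges G. i \<in> e} = {a, b, c}"
    using cubic_edges_at[OF G i(1)] by blast
  \<comment> \<open>One edge of \<open>H\<close> at \<open>u\<close> for each edge of
    \<open>G\<close> at \<open>i\<close>. Edges avoiding the cluster give edges inside
    \<open>Z\<close>; a port edge gives the last edge of its tail, or the leg if the tail is a
    single vertex, and this edge is not inside \<open>Z\<close>. As \<open>pv\<close> is distinct,
    at most one port edge occurs.\<close>
  define f where "f e = (SOME h. h \<in> edges H \<and> u \<in> h \<and>
    (if e \<inter> K = {} then h \<subseteq> Z \<and> h \<in> edges (emap \<xi> e) else \<not> h \<subseteq> Z \<and> h \<noteq> {p, u}))" for e
  have f: "f e \<in> edges H \<and> u \<in> f e \<and>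
    (if e \<inter> K = {} then f e \<subseteq> Z \<and> f e \<in> edges (emap \<xi> e) else \<not> f e \<subseteq> Z \<and> f e \<noteq> {p, u})"
    if e: "e \<in> edges G" "i \<in> e" for e
  proof -
    have "\<exists>h. h \<in> edges H \<and> u \<in> h \<and>
      (if e \<inter> K = {} then h \<subseteq> Z \<and> h \<in> edges (emap \<xi> e) else \<not> h \<subseteq> Z \<and> h \<noteq> {p, u})"
    proof (cases "e \<inter> K = {}")
      case True then show ?thesis using rest[OF e True] by auto
    next
      case False
      then obtain l where "l < n" "e = pe l" using K_edge[OF e(1) False] ie_K e(2) i(2) by blast
      then have "pv ! l = i" using e(2) i(2) prt_node by (auto simp: pe_def)
      then show ?thesis using port[OF \<open>l < n\<close>] False by auto
    qed
    from someI_ex[OF this, folded f_def] show ?thesis .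
  qed
  have one: "e = e'" if e: "e \<in> edges G" "i \<in> e" "e \<inter> K \<noteq> {}" "e' \<in> edges G" "i \<in> e'" "e' \<inter> K \<noteq> {}" for e e'
  proof -
    obtain l where l: "l < n" "e = pe l" using K_edge[OF e(1,3)] ie_K e(2) i(2) by blast
    obtain l' where l': "l' < n" "e' = pe l'" using K_edge[OF e(4,6)] ie_K e(5) i(2) by blast
    have "pv ! l = i" "pv ! l' = i" using e l l' i(2) prt_node by (auto simp: pe_def)
    then have "l = l'" using nth_eq_iff_index_eq[OF pv(2) l(1) l'(1)] by simp
    then show ?thesis using l l' by simp
  qed
  have fd: "f e \<noteq> f e'" if e: "e \<in> edges G" "i \<in> e" "e' \<in> edges G" "i \<in> e'" "e \<noteq> e'" for e e'
    using f[OF e(1,2)] f[OF e(3,4)] one[of e e'] hom_embeddingD(6)[OF \<xi> e(1,3,5)] e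
    by (auto split: if_splits)
  have fp: "f e \<noteq> {p, u}" if e: "e \<in> edges G" "i \<in> e" for e
    using f[OF e] pZ by (auto split: if_splits)
  have G3: "a \<in> edges G" "i \<in> a" "b \<in> edges G" "i \<in> b" "c \<in> edges G" "i \<in> c" using abc(2) by blast+
  have "distinct [f a, f b, f c, {p, u}]"
    using fd[OF G3(1,2,3,4)] fd[OF G3(1,2,5,6)] fd[OF G3(3,4,5,6)] abc(1) fp[OF G3(1,2)] fp[OF G3(3,4)] fp[OF G3(5,6)] by simp
  moreover have "{f a, f b, f c, {p, u}} \<subseteq> edges H" "u \<in> f a" "u \<in> f b" "u \<in> f c"
    using f[OF G3(1,2)] f[OF G3(3,4)] f[OF G3(5,6)] d(1) by simp_all
  ultimately show False using cubic_four_edges[OF H, of "f a" "f b" "f c" "{p, u}" u] by blast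
qed

text \<open>Induction on the number \<open>m\<close> of ports already moved to the ends of their
  tails. The tails are disjoint and avoid \<open>X\<close>, so each of them brings in fresh edges
  only.\<close>

lemma extend_tails:
  assumes R: "region H n Z X ts ls" and sf: "\<forall>l<n. suffix (ts ! l) (ts0 ! l)"
    and r: "real H X p (leaf_map (map hd ts) u)" and ok: "okp p" and m: "m \<le> n"
  shows "\<exists>\<rho>. (\<forall>l<5. \<rho> l = (if l < m then vmap \<xi> (pv ! l) else leaf_map (map hd ts) u l)) \<and>
    inj_on \<rho> {5..<5 + fst p} \<and> \<rho> ` {5..<5 + fst p} \<subseteq> X \<and>
    linked (meeting H X \<union> (\<Union>l<m. consecutive_pairs (ts ! l))) (map (map_prod \<rho> \<rho>) (snd p))"
  using m
proof (induction m)
  case 0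
  show ?case using r unfolding real_def by simp
next
  case (Suc m)
  then obtain \<rho> where \<rho>: "\<forall>l<5. \<rho> l = (if l < m then vmap \<xi> (pv ! l) else leaf_map (map hd ts) u l)"
    "inj_on \<rho> {5..<5 + fst p}" "\<rho> ` {5..<5 + fst p} \<subseteq> X"
    "linked (meeting H X \<union> (\<Union>l<m. consecutive_pairs (ts ! l))) (map (map_prod \<rho> \<rho>) (snd p))"
    by auto
  have mn: "m < n" using Suc.prems by simp
  have m4: "m < 4" using mn prt(3) by simp
  let ?T = "consecutive_pairs (ts ! m)"
  have nm: "ts ! m \<noteq> []" using regionD(1)[OF R mn] .
  have lst: "last (ts ! m) = vmap \<xi> (pv ! m)"
  proof -
    obtain as where as: "ts0 ! m = as @ ts ! m" using sf mn by (auto simp: suffix_def)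
    obtain q rs where q: "pl m = vmap \<xi> (\<phi> (prt ! m)) # q # rs" "last (q # rs) = vmap \<xi> (pv ! m)" by (rule pl_Cons[OF mn])
    have "ts0 ! m = q # rs" using q mn by simp
    then have "last (ts ! m) = last (q # rs)" using as nm by (metis last_appendR)
    then show ?thesis using q(2) by simp
  qed
  have \<rho>m: "\<rho> m = hd (ts ! m)" using \<rho>(1) m4 mn regionD'(3)[OF R] by (simp add: leaf_map_def)
  have c: "conn ?T (\<rho> m) (vmap \<xi> (pv ! m))" using conn_consecutive_pairs[OF nm] lst \<rho>m by simp
  have ne: "h \<noteq> {}" if "h \<in> consecutive_pairs (ts ! l)" "l < n" for h l
    using consecutive_pairs_card[OF regionD(2)[OF R that(2)] that(1)] by auto
  have T: "?T \<inter> (meeting H X \<union> (\<Union>l<m. consecutive_pairs (ts ! l))) = {}"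
  proof (rule equals0I)
    fix h assume h: "h \<in> ?T \<inter> (meeting H X \<union> (\<Union>l<m. consecutive_pairs (ts ! l)))"
    then have hs: "h \<subseteq> set (ts ! m)" "h \<noteq> {}" using consecutive_pairs_subset ne[OF _ mn] by blast+
    then have "h \<notin> meeting H X" using regionD(3)[OF R mn] by (auto simp: meeting_def)
    then obtain l where "l < m" "h \<subseteq> set (ts ! l)" using h consecutive_pairs_subset by blast
    then show False using regionD(10)[OF R mn, of l] mn hs by auto
  qed
  have "linked ((meeting H X \<union> (\<Union>l<m. consecutive_pairs (ts ! l))) \<union> ?T)
      (map (map_prod (\<rho>(m := vmap \<xi> (pv ! m))) (\<rho>(m := vmap \<xi> (pv ! m)))) (snd p))"
    by (rule linked_ext[where \<sigma> = \<rho>, OF \<rho>(4) c T refl refl]) (use okp_leaf[OF ok, of m] m4 in auto)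
  moreover have "(\<Union>l<Suc m. consecutive_pairs (ts ! l)) = (\<Union>l<m. consecutive_pairs (ts ! l)) \<union> ?T"
    by (simp add: lessThan_Suc Un_commute)
  ultimately have "linked (meeting H X \<union> (\<Union>l<Suc m. consecutive_pairs (ts ! l)))
      (map (map_prod (\<rho>(m := vmap \<xi> (pv ! m))) (\<rho>(m := vmap \<xi> (pv ! m)))) (snd p))"
    by (simp add: Un_assoc)
  moreover have "inj_on (\<rho>(m := vmap \<xi> (pv ! m))) {5..<5 + fst p}"
    "(\<rho>(m := vmap \<xi> (pv ! m))) ` {5..<5 + fst p} \<subseteq> X"
    using \<rho>(2,3) m4 by (auto simp: inj_on_def)
  moreover have "\<forall>l<5. (\<rho>(m := vmap \<xi> (pv ! m))) l = (if l < Suc m then vmap \<xi> (pv ! l) else leaf_map (map hd ts) u l)"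
    using \<rho>(1) by (auto simp: less_Suc_eq)
  ultimately show ?case by (intro exI[of _ "\<rho>(m := vmap \<xi> (pv ! m))"] conjI)
qed

text \<open>A port outside \<open>I\<close> has no entry in the table; \<open>single\<close> makes
  its tail a single vertex, so that it is hit at most in \<open>Z\<close>.\<close>

theorem cluster_exit:
  assumes cyc: "cyclically_connected k H" and nk: "n < k"
    and tab: "closed_table \<tau>s I tab" "set I \<subseteq> {..<4}" and st: "start_table \<tau>s start stab" "length stab = length ints"
    and single: "\<And>l. l < n \<Longrightarrow> l \<notin> set I \<Longrightarrow> card (edges (emap \<xi> (pe l))) = 1"
  shows "\<exists>j u. j \<in> edges G \<and> j \<inter> K = {} \<and> u \<in> internal_verts (emap \<xi> j) \<and>
    (\<exists>\<tau>\<in>set \<tau>s. \<forall>p\<in>set \<tau>. \<forall>j1 j2. j = {j1, j2} \<longrightarrow> realizes p j j1 j2 u)"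
proof -
  interpret growth H n k "set I" "ty H \<tau>s"
    by (rule growth_ty[OF cyc size(2) nk prt(3) tab])
  have len1: "length (ts0 ! l) = 1" if l: "l < n" "l \<notin> set I" for l
    using single[OF l] path_listing_card_edges(1)[OF pl(1)[OF l(1)]] l(1) by simp
  have "grown Z X0 ts0"
    by (rule grow[OF region0 typed0[OF st] card_X0 card_Z ZH len1])
  then obtain X ts ls p u where g: "region H n Z X ts ls" "X0 \<subseteq> X" "p \<in> X" "u \<in> Z" "{p, u} \<in> edges H"
    "{p, u} \<notin> set ls" "ty H \<tau>s X (map hd ts) u" "\<forall>l<n. suffix (ts ! l) (ts0 ! l)"
    unfolding grown_def by (elim exE conjE)
  obtain j where j: "j \<in> edges G" "j \<inter> K = {}" "u \<in> internal_verts (emap \<xi> j)"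
    using landing_edge[OF g(1,5,3,4,6,8)] by blast
  obtain \<tau> where \<tau>: "\<tau> \<in> set \<tau>s" "\<forall>q\<in>set \<tau>. real H X q (leaf_map (map hd ts) u)"
    using g(7) unfolding ty_def by blast
  have "realizes q j j1 j2 u" if q: "q \<in> set \<tau>" and j12: "j = {j1, j2}" for q j1 j2
  proof -
    have ok: "okp q" using tab(1) \<tau>(1) q by (auto simp: closed_table_def list_all_iff)
    let ?A = "meeting H X \<union> (\<Union>l<n. consecutive_pairs (ts ! l))"
    obtain \<rho> where \<rho>: "\<forall>l<5. \<rho> l = (if l < n then vmap \<xi> (pv ! l) else leaf_map (map hd ts) u l)"
      "inj_on \<rho> {5..<5 + fst q}" "\<rho> ` {5..<5 + fst q} \<subseteq> X" "linked ?A (map (map_prod \<rho> \<rho>) (snd q))"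
      using extend_tails[OF g(1,8) _ ok order_refl, of u] \<tau>(2) q by blast
    have "ends (emap \<xi> j) = {vmap \<xi> j1, vmap \<xi> j2}" using hom_embeddingD(5)[OF \<xi> j(1)] j12 by simp
    then obtain T1 T2 where T12: "T1 \<inter> T2 = {}" "T1 \<union> T2 = edges (emap \<xi> j)"
      "conn T1 (vmap \<xi> j1) u" "conn T2 u (vmap \<xi> j2)"
      using path_split[OF hom_embeddingD(3)[OF \<xi> j(1)], of "vmap \<xi> j1" "vmap \<xi> j2" u] j(3)
      unfolding internal_verts_def by blast
    have tE: "consecutive_pairs (ts ! l) \<subseteq> edges (emap \<xi> (pe l))" if l: "l < n" for l
    proof -
      obtain as where as: "ts0 ! l = as @ ts ! l" using g(8) l by (auto simp: suffix_def)
      obtain x xs where x: "ts ! l = x # xs" using regionD(1)[OF g(1) l] by (cases "ts ! l") auto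
      obtain q' rs where q': "pl l = vmap \<xi> (\<phi> (prt ! l)) # q' # rs" "last (q' # rs) = vmap \<xi> (pv ! l)" by (rule pl_Cons[OF l])
      have "consecutive_pairs (ts ! l) \<subseteq> consecutive_pairs (ts0 ! l)"
        unfolding as x consecutive_pairs_append[of as x xs] by blast
      also have "\<dots> \<subseteq> consecutive_pairs (pl l)" using q' l by auto
      also have "\<dots> = edges (emap \<xi> (pe l))" using pl(1)[OF l] by (simp add: path_listing_def)
      finally show ?thesis .
    qed
    have dis: "edges (emap \<xi> f) \<inter> ?A = {}" if f: "f \<in> edges G" "f \<inter> K = {}" for f
    proof -
      have "edges (emap \<xi> f) \<inter> meeting H X = {}"
      proof (rule equals0I)
        fix h assume h: "h \<in> edges (emap \<xi> f) \<inter> meeting H X"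
        then have "h \<subseteq> Z" using Z_edges[OF f] by blast
        then show False using h regionD'(2)[OF g(1)] by (auto simp: meeting_def)
      qed
      moreover have "edges (emap \<xi> f) \<inter> consecutive_pairs (ts ! l) = {}" if l: "l < n" for l
      proof -
        have "f \<noteq> pe l" using f(2) prt_node[OF l] by (auto simp: pe_def)
        then show ?thesis using hom_embeddingD(6)[OF \<xi> f(1) pe_edge[OF l]] tE[OF l] by blast
      qed
      ultimately show ?thesis by blast
    qed
    have l1: "linked (?A \<union> T1) (map (map_prod \<rho> \<rho>) (snd q) @ [(u, vmap \<xi> j1)])"
      using dis[OF j(1,2)] T12(2) by (intro linked_snoc[OF conn_sym[OF T12(3)] \<rho>(4)]) blast
    have l2: "linked (?A \<union> T1 \<union> T2) ((map (map_prod \<rho> \<rho>) (snd q) @ [(u, vmap \<xi> j1)]) @ [(u, vmap \<xi> j2)])"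
      using dis[OF j(1,2)] T12(1,2) by (intro linked_snoc[OF T12(4) l1]) blast
    have jE: "?A \<union> T1 \<union> T2 = ?A \<union> edges (emap \<xi> j)" using T12(2) by blast
    have sub: "?A \<union> T1 \<union> T2 \<subseteq> edges H - (\<Union>f\<in>{f \<in> edges G. f \<inter> K = {} \<and> f \<noteq> j}. edges (emap \<xi> f))"
    proof
      fix x assume x: "x \<in> ?A \<union> T1 \<union> T2"
      have "?A \<subseteq> edges H" using regionD(5)[OF g(1)] by (auto simp: meeting_def)
      moreover have "edges (emap \<xi> j) \<subseteq> edges H" using hom_embeddingD(4)[OF \<xi> j(1)] by (simp add: subgraph_def)
      ultimately have "x \<in> edges H" using x unfolding jE by blast
      moreover have "x \<notin> edges (emap \<xi> f)" if f: "f \<in> edges G" "f \<inter> K = {}" "f \<noteq> j" for f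
        using x hom_embeddingD(6)[OF \<xi> f(1) j(1) f(3)] dis[OF f(1,2)] unfolding jE by blast
      ultimately show "x \<in> edges H - (\<Union>f\<in>{f \<in> edges G. f \<inter> K = {} \<and> f \<noteq> j}. edges (emap \<xi> f))" by blast
    qed
    have lk: "linked (edges H - (\<Union>f\<in>{f \<in> edges G. f \<inter> K = {} \<and> f \<noteq> j}. edges (emap \<xi> f)))
        (map (map_prod \<rho> \<rho>) (snd q) @ [(u, vmap \<xi> j1), (u, vmap \<xi> j2)])"
      using linked_mono[OF l2 sub] by simp
    have "\<rho> ` {5..<5 + fst q} \<subseteq> verts H - Z" using \<rho>(3) regionD'(1,2)[OF g(1)] by blast
    moreover have "\<forall>l<n. \<rho> l = vmap \<xi> (pv ! l)" "\<rho> 4 = u" using \<rho>(1) prt(3) by (simp_all add: leaf_map_def)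
    ultimately show ?thesis unfolding realizes_def using \<rho>(2) lk by (intro exI[of _ \<rho>] conjI)
  qed
  then show ?thesis using j \<tau>(1) by blast
qed

end

section \<open>Adding edges and claws to a cubic graph\<close>

lemma plus2D:
  assumes "plus2 G {a, b} {c, d} x y G'"
  shows "{a, b} \<in> edges G" "{c, d} \<in> edges G" "{a, b} \<noteq> {c, d}" "x \<notin> verts G" "y \<notin> verts G" "x \<noteq> y"
    "verts G' = verts G \<union> {x, y}"
    "edges G' = (edges G - {{a, b}, {c, d}}) \<union> {{x, a}, {x, b}, {y, c}, {y, d}, {x, y}}"
proof -
  have s: "{{x, u} | u. u \<in> {a, b}} = {{x, a}, {x, b}}" "{{y, u} | u. u \<in> {c, d}} = {{y, c}, {y, d}}" by auto
  show "{a, b} \<in> edges G" "{c, d} \<in> edges G" "{a, b} \<noteq> {c, d}" "x \<notin> verts G" "y \<notin> verts G" "x \<noteq> y"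
    using assms unfolding plus2_def by simp_all
  have "G' = Graph (verts G \<union> {x, y}) ((edges G - {{a, b}, {c, d}}) \<union> {{x, a}, {x, b}} \<union> {{y, c}, {y, d}} \<union> {{x, y}})"
    using assms unfolding plus2_def s by (elim conjE)
  then show "verts G' = verts G \<union> {x, y}"
    "edges G' = (edges G - {{a, b}, {c, d}}) \<union> {{x, a}, {x, b}, {y, c}, {y, d}, {x, y}}"
    by (simp, simp only: graph.sel Un_assoc Un_insert_left Un_empty_left)
qed

text \<open>At an old vertex \<open>v\<close> the edges before and after correspond one to one:
  \<open>e\<close> is replaced by the edge from \<open>v\<close> to \<open>x\<close>, and
  \<open>f\<close> by the one to \<open>y\<close>.\<close>

lemma cubic_plus2:
  assumes G: "cubic G" and p: "plus2 G e f x y G'"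
  shows "cubic G'"
proof -
  have sG: "simple_graph G" using G by (simp add: cubic_def)
  have ef: "e \<in> edges G" "f \<in> edges G" using p by (auto simp: plus2_def)
  obtain a b where ab: "e = {a, b}" "a \<noteq> b" "a \<in> verts G" "b \<in> verts G" by (rule simple_edgeE[OF sG ef(1)])
  obtain c d where cd: "f = {c, d}" "c \<noteq> d" "c \<in> verts G" "d \<in> verts G" by (rule simple_edgeE[OF sG ef(2)])
  note P = plus2D[OF p[unfolded ab(1) cd(1)]]
  have sub: "\<And>g. g \<in> edges G \<Longrightarrow> g \<subseteq> verts G" using sG by (simp add: simple_graph_def)
  have xe: "x \<notin> g" "y \<notin> g" if "g \<in> edges G" for g using sub[OF that] P(4,5) by auto
  have ne: "x \<noteq> a" "x \<noteq> b" "x \<noteq> c" "x \<noteq> d" "y \<noteq> a" "y \<noteq> b" "y \<noteq> c" "y \<noteq> d" using P(4,5) ab cd by auto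
  have fin: "finite (verts G)" using sG by (simp add: simple_graph_def)
  have card2: "\<And>g. g \<in> edges G \<Longrightarrow> card g = 2" using sG by (simp add: simple_graph_def)
  have "simple_graph G'"
    unfolding simple_graph_def P(7,8) using fin sub card2 ab cd ne P(6) by auto
  moreover have "verts G' \<noteq> {}" using P(7) by simp
  moreover have "card {g \<in> edges G'. v \<in> g} = 3" if v: "v \<in> verts G'" for v
  proof -
    consider "v = x" | "v = y" | "v \<in> verts G" using v P(7) by blast
    then show ?thesis
    proof cases
      case 1
      have "{g \<in> edges G'. v \<in> g} = {{x, a}, {x, b}, {x, y}}"
        unfolding 1 P(8) using xe ne P(6) by auto
      then show ?thesis using ab ne P(6) by (auto simp: doubleton_eq_iff card_insert_if)
    next
      case 2
      have "{g \<in> edges G'. v \<in> g} = {{y, c}, {y, d}, {x, y}}"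
        unfolding 2 P(8) using xe ne P(6) by auto
      then show ?thesis using cd ne P(6) by (auto simp: doubleton_eq_iff card_insert_if)
    next
      case 3
      let ?m = "\<lambda>g. if g = {a, b} then {x, v} else if g = {c, d} then {y, v} else g"
      have vxy: "v \<noteq> x" "v \<noteq> y" using 3 P(4,5) by auto
      have im: "{g \<in> edges G'. v \<in> g} = ?m ` {g \<in> edges G. v \<in> g}"
      proof (intro set_eqI iffI)
        fix g assume "g \<in> {g \<in> edges G'. v \<in> g}"
        then have g: "g \<in> edges G'" "v \<in> g" by auto
        have "(g \<in> edges G \<and> g \<noteq> {a, b} \<and> g \<noteq> {c, d}) \<or> g = {x, a} \<or> g = {x, b} \<or> g = {y, c} \<or> g = {y, d} \<or> g = {x, y}"
          using g(1) unfolding P(8) Un_iff Diff_iff insert_iff empty_iff by argo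
        then consider "g \<in> edges G" "g \<noteq> {a, b}" "g \<noteq> {c, d}" | "g = {x, a}" | "g = {x, b}" | "g = {y, c}" | "g = {y, d}" | "g = {x, y}"
          by argo
        then show "g \<in> ?m ` {g \<in> edges G. v \<in> g}"
        proof cases
          case 1 then show ?thesis using g(2) by (intro image_eqI[of _ _ g]) auto
        next
          case 2 then show ?thesis using g(2) vxy P(1) by (intro image_eqI[of _ _ "{a, b}"]) auto
        next
          case 3 then show ?thesis using g(2) vxy P(1) by (intro image_eqI[of _ _ "{a, b}"]) auto
        next
          case 4 then show ?thesis using g(2) vxy P(2,3) by (intro image_eqI[of _ _ "{c, d}"]) auto
        next
          case 5 then show ?thesis using g(2) vxy P(2,3) by (intro image_eqI[of _ _ "{c, d}"]) auto
        next
          case 6 then show ?thesis using g(2) vxy by auto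
        qed
      next
        fix g assume "g \<in> ?m ` {g \<in> edges G. v \<in> g}"
        then obtain g' where g': "g' \<in> edges G" "v \<in> g'" "g = ?m g'" by blast
        show "g \<in> {g \<in> edges G'. v \<in> g}"
        proof (cases "g' = {a, b}")
          case True then show ?thesis using g' unfolding P(8) by auto
        next
          case False
          show ?thesis
          proof (cases "g' = {c, d}")
            case True then show ?thesis using g' False unfolding P(8) by auto
          next
            case False then show ?thesis using g' \<open>g' \<noteq> {a, b}\<close> unfolding P(8) by auto
          qed
        qed
      qed
      have "inj_on ?m {g \<in> edges G. v \<in> g}"
      proof (rule inj_onI)
        fix g g' assume g: "g \<in> {g \<in> edges G. v \<in> g}" "g' \<in> {g \<in> edges G. v \<in> g}" "?m g = ?m g'"
        have mx: "x \<in> ?m r \<longleftrightarrow> r = {a, b}" "y \<in> ?m r \<longleftrightarrow> r \<noteq> {a, b} \<and> r = {c, d}" if "r \<in> edges G" for r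
          using xe[OF that] P(6) vxy by auto
        have "g = {a, b} \<longleftrightarrow> g' = {a, b}" using mx(1)[of g] mx(1)[of g'] g by simp
        moreover have "g \<noteq> {a, b} \<and> g = {c, d} \<longleftrightarrow> g' \<noteq> {a, b} \<and> g' = {c, d}"
          using mx(2)[of g] mx(2)[of g'] g by simp
        ultimately show "g = g'" using g(3) by presburger
      qed
      then show ?thesis unfolding im using cubic_at[OF G 3] by (simp only: card_image)
    qed
  qed
  ultimately show ?thesis by (simp add: cubic_def degree_def)
qed

lemma plus2I:
  assumes "e \<in> edges G" "f \<in> edges G" "e \<noteq> f" "x \<notin> verts G" "y \<notin> verts G" "x \<noteq> y"
  obtains G' where "plus2 G e f x y G'"
  using assms by (auto simp: plus2_def)

lemma fresh_list:
  assumes "finite (S :: 'a :: infinite set)"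
  shows "\<exists>xs. length xs = m \<and> distinct xs \<and> set xs \<inter> S = {}"
proof (induction m)
  case (Suc m)
  then obtain xs where xs: "length xs = m" "distinct xs" "set xs \<inter> S = {}" by blast
  have "finite (S \<union> set xs)" using assms by simp
  then obtain x where "x \<notin> S \<union> set xs" using ex_new_if_finite[OF infinite_UNIV] by blast
  then show ?case using xs by (intro exI[of _ "x # xs"]) auto
qed simp

text \<open>The graph of \<open>plus3\<close> as a function of its new vertices, without the demand
  that the three edges be disjoint: it is also used for edges with a common end.\<close>

definition claw :: "'a graph \<Rightarrow> 'a set \<Rightarrow> 'a set \<Rightarrow> 'a set \<Rightarrow> 'a \<Rightarrow> 'a \<Rightarrow> 'a \<Rightarrow> 'a \<Rightarrow> 'a graph" where
  "claw G e f g x y z w = Graph (verts G \<union> {x, y, z, w})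
     ((edges G - {e, f, g}) \<union> {{x, a} | a. a \<in> e} \<union> {{y, a} | a. a \<in> f} \<union> {{z, a} | a. a \<in> g} \<union>
       {{w, x}, {w, y}, {w, z}})"

lemma claw_sel:
  "verts (claw G {a, b} {c, d} {s, t} x y z w) = verts G \<union> {x, y, z, w}"
  "edges (claw G {a, b} {c, d} {s, t} x y z w) = (edges G - {{a, b}, {c, d}, {s, t}}) \<union>
     {{x, a}, {x, b}, {y, c}, {y, d}, {z, s}, {z, t}, {w, x}, {w, y}, {w, z}}"
proof -
  have s: "{{x, u} | u. u \<in> {a, b}} = {{x, a}, {x, b}}" "{{y, u} | u. u \<in> {c, d}} = {{y, c}, {y, d}}"
    "{{z, u} | u. u \<in> {s, t}} = {{z, s}, {z, t}}" by auto
  show "verts (claw G {a, b} {c, d} {s, t} x y z w) = verts G \<union> {x, y, z, w}" by (simp add: claw_def)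
  show "edges (claw G {a, b} {c, d} {s, t} x y z w) = (edges G - {{a, b}, {c, d}, {s, t}}) \<union>
     {{x, a}, {x, b}, {y, c}, {y, d}, {z, s}, {z, t}, {w, x}, {w, y}, {w, z}}"
    unfolding claw_def s graph.sel by (simp only: Un_assoc Un_insert_left Un_empty_left)
qed

lemma replace_aux:
  assumes "r \<notin> E" "r \<notin> {p1, p2, p3, p4}" "g \<notin> {p1, p2, p3, p4}"
  shows "((E - {e, f}) \<union> {p1, p2, p3, p4, r}) - {r, g} = (E - {e, f, g}) \<union> {p1, p2, p3, p4}"
  using assms by blast

text \<open>Subdividing the new edge \<open>{x, y}\<close> at \<open>w\<close> and \<open>g\<close>
  at \<open>z\<close> gives the claw, which therefore inherits cubicity from two additions of an
  edge.\<close>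

lemma claw_plus2:
  assumes G: "simple_graph G" and e: "e \<in> edges G" "f \<in> edges G" "g \<in> edges G" "distinct [e, f, g]"
    and fr: "distinct [x, y, z, w]" "{x, y, z, w} \<inter> verts G = {}"
  obtains G1 where "plus2 G e f x y G1" "plus2 G1 {x, y} g w z (claw G e f g x y z w)"
proof -
  obtain a b where ab: "e = {a, b}" "a \<noteq> b" "a \<in> verts G" "b \<in> verts G" by (rule simple_edgeE[OF G e(1)])
  obtain c d where cd: "f = {c, d}" "c \<noteq> d" "c \<in> verts G" "d \<in> verts G" by (rule simple_edgeE[OF G e(2)])
  obtain s t where st: "g = {s, t}" "s \<noteq> t" "s \<in> verts G" "t \<in> verts G" by (rule simple_edgeE[OF G e(3)])
  have xy: "{x, y} \<notin> edges G" using G fr by (auto simp: simple_graph_def)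
  obtain G1 where p: "plus2 G e f x y G1" by (rule plus2I[of e G f x y]) (use e fr in auto)
  note P = plus2D[OF p[unfolded ab(1) cd(1)]]
  have E: "edges (claw G e f g x y z w) = (edges G1 - {{x, y}, g}) \<union> {{w, x}, {w, y}, {z, s}, {z, t}, {w, z}}"
  proof -
    have ne: "x \<noteq> a" "x \<noteq> b" "y \<noteq> c" "y \<noteq> d" "y \<noteq> a" "y \<noteq> b" "x \<noteq> c" "x \<noteq> d" "x \<noteq> y" "x \<noteq> s" "x \<noteq> t" "y \<noteq> s" "y \<noteq> t"
      using fr ab cd st by auto
    have "{x, y} \<notin> {{x, a}, {x, b}, {y, c}, {y, d}}" "g \<notin> {{x, a}, {x, b}, {y, c}, {y, d}}"
      using ne st(1) by (simp_all add: doubleton_eq_iff)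
    note r = replace_aux[OF xy this, of "{a, b}" "{c, d}"]
    show ?thesis unfolding P(8) r unfolding ab(1) cd(1) st(1) claw_sel
      by (simp only: Un_assoc Un_insert_left Un_empty_left insert_commute)
  qed
  have "g \<noteq> {a, b}" "g \<noteq> {c, d}" using e(4) ab(1) cd(1) by auto
  then have gE: "g \<in> edges G1" using e(3) unfolding P(8) by simp
  have g: "{x, y} \<noteq> g" using e(3) xy by blast
  have V: "verts (claw G e f g x y z w) = verts G1 \<union> {w, z}"
    unfolding P(7) claw_def by (simp add: insert_commute)
  have s: "{{w, u} | u. u \<in> {x, y}} = {{w, x}, {w, y}}" "{{z, u} | u. u \<in> {s, t}} = {{z, s}, {z, t}}" by auto
  have "claw G e f g x y z w = Graph (verts G1 \<union> {w, z})
      ((edges G1 - {{x, y}, g}) \<union> {{w, u} | u. u \<in> {x, y}} \<union> {{z, u} | u. u \<in> g} \<union> {{w, z}})"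
    by (rule graph.expand)
      (simp only: graph.sel V[unfolded st(1)] E[unfolded st(1)] st(1) s Un_assoc Un_insert_left Un_empty_left simp_thms)
  moreover have "{x, y} \<in> edges G1" unfolding P(8) by simp
  moreover have "w \<notin> verts G1" "z \<notin> verts G1" "w \<noteq> z" using fr unfolding P(7) by auto
  ultimately have "plus2 G1 {x, y} g w z (claw G e f g x y z w)"
    unfolding plus2_def using gE g by blast
  then show thesis using that p by blast
qed

lemma cubic_claw:
  assumes "cubic G" "e \<in> edges G" "f \<in> edges G" "g \<in> edges G" "distinct [e, f, g]"
    "distinct [x, y, z, w]" "{x, y, z, w} \<inter> verts G = {}"
  shows "cubic (claw G e f g x y z w)"
proof -
  have "simple_graph G" using assms(1) by (simp add: cubic_def)
  then obtain G1 where p: "plus2 G e f x y G1" "plus2 G1 {x, y} g w z (claw G e f g x y z w)"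
    by (rule claw_plus2[OF _ assms(2-7)])
  show ?thesis by (rule cubic_plus2[OF cubic_plus2[OF assms(1) p(1)] p(2)])
qed

lemma hom_linked:
  assumes \<xi>: "hom_embedding \<xi> G H" and G: "cubic G" and E: "\<And>i j. (i, j) \<in> set L \<Longrightarrow> {i, j} \<in> edges G"
    and d: "distinct (map (\<lambda>(i, j). {i, j}) L)"
  shows "linked (\<Union>e\<in>(\<lambda>(i, j). {i, j}) ` set L. edges (emap \<xi> e)) (map (map_prod (vmap \<xi>) (vmap \<xi>)) L)"
proof -
  let ?T = "\<lambda>k. edges (emap \<xi> {fst (L ! k), snd (L ! k)})"
  have e: "{fst (L ! k), snd (L ! k)} \<in> edges G" if "k < length L" for k
    using E[of "fst (L ! k)" "snd (L ! k)"] that by simp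
  have mp: "map (\<lambda>(i, j). {i, j}) L ! k = {fst (L ! k), snd (L ! k)}" if "k < length L" for k
    using that by (simp add: case_prod_beta)
  show ?thesis
  proof (rule linkedI[of _ ?T], unfold length_map)
    fix k assume k: "k < length L"
    show "?T k \<subseteq> (\<Union>e\<in>(\<lambda>(i, j). {i, j}) ` set L. edges (emap \<xi> e))"
      using k nth_mem[OF k] by (force simp: case_prod_beta)
    show "conn (?T k) (fst (map (map_prod (vmap \<xi>) (vmap \<xi>)) L ! k)) (snd (map (map_prod (vmap \<xi>) (vmap \<xi>)) L ! k))"
      using path_conn[OF hom_embeddingD(3)[OF \<xi> e[OF k]]] hom_embeddingD(5)[OF \<xi> e[OF k]] k by simp
  next
    fix k l assume kl: "k < length L" "l < length L" "k \<noteq> l"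
    then have "{fst (L ! k), snd (L ! k)} \<noteq> {fst (L ! l), snd (L ! l)}"
      using nth_eq_iff_index_eq[OF d, of k l] mp by simp
    then show "?T k \<inter> ?T l = {}" using hom_embeddingD(6)[OF \<xi> e e] kl by blast
  qed
qed

section \<open>Rerouting within an embedding\<close>

text \<open>\<open>Re\<close> contains the edges whose images can be kept, \<open>M\<close> the
  vertices whose images are no longer prescribed. Away from them \<open>vm\<close> and
  \<open>em\<close> behave like an embedding, which is all that rerouting needs.\<close>

locale spread =
  fixes G :: "'a graph" and H :: "'b graph" and Re :: "'a set set" and M :: "'a set"
    and vm :: "'a \<Rightarrow> 'b" and em :: "'a set \<Rightarrow> 'b graph"
  assumes G: "cubic G" and H: "cubic H" and Re: "Re \<subseteq> edges G" "\<And>g. g \<in> Re \<Longrightarrow> g \<inter> M = {}"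
    and path: "\<And>g. g \<in> Re \<Longrightarrow> is_path (em g) \<and> subgraph (em g) H \<and> ends (em g) = vm ` g"
    and dis: "\<And>g g'. g \<in> Re \<Longrightarrow> g' \<in> Re \<Longrightarrow> g \<noteq> g' \<Longrightarrow> edges (em g) \<inter> edges (em g') = {}"
    and inj: "inj_on vm (verts G - M)" and im: "vm ` (verts G - M) \<subseteq> verts H"
begin

text \<open>\<open>J\<close> consists of the edges whose images are given up, so that a rerouting
  may run through them.\<close>

definition free :: "'a set set \<Rightarrow> 'b set set" where
  "free J = edges H - (\<Union>g\<in>Re - J. edges (em g))"

text \<open>Giving up the image of an edge makes its whole path available as one further
  connection.\<close>

lemma open_edge:
  assumes "linked (free J) L" "{i, j} \<in> Re" "{i, j} \<notin> J"
  shows "linked (free (insert {i, j} J)) (L @ [(vm i, vm j)])"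
proof -
  have c: "conn (edges (em {i, j})) (vm i) (vm j)"
    using path_conn[of "em {i, j}" "vm i" "vm j"] path[OF assms(2)] by simp
  have "free J \<inter> edges (em {i, j}) = {}" using assms(2,3) by (auto simp: free_def)
  then have "linked (free J \<union> edges (em {i, j})) (L @ [(vm i, vm j)])" by (rule linked_snoc[OF c assms(1)])
  moreover have "free J \<union> edges (em {i, j}) \<subseteq> free (insert {i, j} J)"
  proof -
    have "edges (em {i, j}) \<subseteq> edges H" using path[OF assms(2)] by (simp add: subgraph_def)
    moreover have "edges (em {i, j}) \<inter> edges (em g) = {}" if "g \<in> Re" "g \<noteq> {i, j}" for g
      using dis[OF assms(2) that(1)] that(2) by blast
    ultimately show ?thesis unfolding free_def by blast
  qed
  ultimately show ?thesis by (rule linked_mono)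
qed

text \<open>\<open>al\<close> lists new positions for moved and for added vertices; all other
  vertices stay where they are.\<close>

definition place :: "('a \<times> 'b) list \<Rightarrow> 'a \<Rightarrow> 'b" where
  "place al t = (case map_of al t of Some p \<Rightarrow> p | None \<Rightarrow> vm t)"

text \<open>\<open>off\<close> prevents a new position from coinciding with that of a vertex that
  stays; apart from this, only the certificate for the routing has to be supplied.\<close>

lemma spread_glue:
  assumes G': "cubic G'" and V: "verts G' \<subseteq> (verts G - M) \<union> fst ` set al"
    and d1: "distinct (map fst al)" and d2: "distinct (map snd al)" and alH: "snd ` set al \<subseteq> verts H"
    and off: "\<And>t. t \<in> verts G - M \<Longrightarrow> t \<notin> fst ` set al \<Longrightarrow> vm t \<notin> snd ` set al"
    and Old: "Old \<subseteq> edges G'" "Old \<subseteq> Re - J" "\<And>g. g \<in> Old \<Longrightarrow> g \<inter> fst ` set al = {}"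
    and N: "edges G' - Old = (\<lambda>(i, j). {i, j}) ` set N"
    and L: "linked (free J) L" and rt: "routes L Is (map (map_prod (place al) (place al)) N)" "distinct (concat Is)"
  shows "\<exists>\<eta>. hom_embedding \<eta> G' H \<and> (\<forall>g\<in>Old. emap \<eta> g = em g) \<and>
    (\<forall>t\<in>verts G'. t \<notin> fst ` set al \<longrightarrow> vmap \<eta> t = vm t)"
proof -
  have pl1: "place al t = vm t" if "t \<notin> fst ` set al" for t
  proof -
    have "map_of al t = None" using that by (simp add: map_of_eq_None_iff)
    then show ?thesis by (simp add: place_def)
  qed
  have pl2: "(t, place al t) \<in> set al" if "t \<in> fst ` set al" for t
  proof -
    have "map_of al t \<noteq> None" using that by (simp add: map_of_eq_None_iff)
    then show ?thesis by (cases "map_of al t") (simp_all add: place_def map_of_SomeD)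
  qed
  have f1: "inj_on (place al) (verts G')"
  proof (rule inj_onI)
    fix t t' assume t: "t \<in> verts G'" "t' \<in> verts G'" "place al t = place al t'"
    have r: "place al r \<in> snd ` set al" if "r \<in> fst ` set al" for r using pl2[OF that] by force
    consider "t \<in> fst ` set al" "t' \<in> fst ` set al" | "t \<in> fst ` set al" "t' \<notin> fst ` set al"
      | "t \<notin> fst ` set al" "t' \<in> fst ` set al" | "t \<notin> fst ` set al" "t' \<notin> fst ` set al" by blast
    then show "t = t'"
    proof cases
      case 1
      have "inj_on snd (set al)" using d2 by (simp add: distinct_map)
      then have "(t, place al t) = (t', place al t')"
        by (rule inj_onD) (use pl2[OF 1(1)] pl2[OF 1(2)] t(3) in simp_all)
      then show ?thesis by simp
    next
      case 2
      then show ?thesis using r[OF 2(1)] pl1[OF 2(2)] off[OF _ 2(2)] t V by auto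
    next
      case 3
      then show ?thesis using r[OF 3(2)] pl1[OF 3(1)] off[OF _ 3(1)] t V by auto
    next
      case 4
      then have "t \<in> verts G - M" "t' \<in> verts G - M" using t V by blast+
      moreover have "vm t = vm t'" using pl1 4 t(3) by simp
      ultimately show ?thesis using inj by (simp add: inj_on_def)
    qed
  qed
  have f2: "place al ` verts G' \<subseteq> verts H"
  proof
    fix q assume "q \<in> place al ` verts G'"
    then obtain t where t: "t \<in> verts G'" "q = place al t" by blast
    show "q \<in> verts H"
    proof (cases "t \<in> fst ` set al")
      case True then show ?thesis using pl2[OF True] alH t(2) by force
    next
      case False then show ?thesis using pl1[OF False] im V t by auto
    qed
  qed
  have f3: "is_path (em g) \<and> subgraph (em g) H \<and> ends (em g) = place al ` g" if g: "g \<in> Old" for g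
  proof -
    have "place al ` g = vm ` g"
    proof (rule image_cong[OF refl])
      fix t assume "t \<in> g"
      then have "t \<notin> fst ` set al" using Old(3)[OF g] by blast
      then show "place al t = vm t" by (rule pl1)
    qed
    then show ?thesis using path Old(2) g by auto
  qed
  have f4: "edges (em g) \<inter> edges (em g') = {}" if "g \<in> Old" "g' \<in> Old" "g \<noteq> g'" for g g'
    using dis Old(2) that by blast
  have f5: "linked (free J) (map (map_prod (place al) (place al)) N)"
    by (rule linked_route[OF L rt])
  have f6: "free J \<subseteq> edges H" and f7: "\<And>g. g \<in> Old \<Longrightarrow> edges (em g) \<inter> free J = {}"
    using Old(2) by (auto simp: free_def)
  have "\<exists>\<eta>. hom_embedding \<eta> G' H \<and> vmap \<eta> = place al \<and> (\<forall>e\<in>Old. emap \<eta> e = em e)"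
    by (rule glue[OF H G' f1 f2 Old(1) f3 f4 N[symmetric] f5 f6 f7])
  then show ?thesis using pl1 by force
qed

end

section \<open>Combinatorics of frameworks\<close>

lemma path_at:
  assumes "path_listing vs C"
  shows "\<exists>p q. {e \<in> edges C. v \<in> e} \<subseteq> {p, q}" and "v \<in> ends C \<Longrightarrow> \<exists>p. {e \<in> edges C. v \<in> e} \<subseteq> {p}"
proof -
  have E: "edges C = consecutive_pairs vs" "distinct vs" "vs \<noteq> []" using assms by (simp_all add: path_listing_def)
  have 0: "{e \<in> edges C. v \<in> e} = {}" if "v \<notin> set vs" using E(1) that consecutive_pairs_subset by auto
  have 1: "\<exists>p q. {e \<in> edges C. v \<in> e} \<subseteq> {p, q} \<and> (v \<in> ends C \<longrightarrow> {e \<in> edges C. v \<in> e} \<subseteq> {p} \<or> {e \<in> edges C. v \<in> e} \<subseteq> {q})"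
    if v: "v \<in> set vs"
  proof -
    obtain as bs where s: "vs = as @ v # bs" using v by (meson split_list)
    have d: "distinct (as @ v # bs)" using E s by simp
    have A: "{e \<in> edges C. v \<in> e} = (if as = [] then {} else {{last as, v}}) \<union> (if bs = [] then {} else {{v, hd bs}})"
      using consecutive_pairs_at[OF d] E(1) s by simp
    have "as = [] \<or> bs = []" if "v \<in> ends C"
    proof -
      have "v = hd vs \<or> v = last vs" using that ends_path_listing[OF assms] by auto
      then show ?thesis using s d by (cases as; cases bs rule: rev_cases) auto
    qed
    then show ?thesis unfolding A by (intro exI[of _ "{last as, v}"] exI[of _ "{v, hd bs}"]) auto
  qed
  show "\<exists>p q. {e \<in> edges C. v \<in> e} \<subseteq> {p, q}"
  proof (cases "v \<in> set vs")
    case True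
    show ?thesis using 1[OF True] by (elim exE conjE) (intro exI)
  qed (simp only: 0 empty_subsetI simp_thms)
  show "\<exists>p. {e \<in> edges C. v \<in> e} \<subseteq> {p}" if "v \<in> ends C"
  proof (cases "v \<in> set vs")
    case True
    show ?thesis using 1[OF True] that by (elim exE conjE impE disjE) (assumption, (erule exI)+)
  qed (simp only: 0 empty_subsetI simp_thms)
qed

lemma circuit_at:
  assumes C: "circuit_listing vs C" and v: "v \<in> verts C"
  shows "\<exists>p q. p \<noteq> q \<and> p \<noteq> v \<and> q \<noteq> v \<and> {e \<in> edges C. v \<in> e} = {{v, p}, {v, q}}"
proof -
  have E: "edges C = insert {last vs, hd vs} (consecutive_pairs vs)" "verts C = set vs" "distinct vs" "3 \<le> length vs"
    using C by (simp_all add: circuit_listing_def)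
  obtain as bs where s: "vs = as @ v # bs" using v E(2) by (metis split_list)
  have d: "distinct (as @ v # bs)" using E s by simp
  have split: "{e \<in> edges C. v \<in> e} = (if v \<in> {last vs, hd vs} then {{last vs, hd vs}} else {}) \<union>
      ((if as = [] then {} else {{last as, v}}) \<union> (if bs = [] then {} else {{v, hd bs}}))"
    unfolding E(1) consecutive_pairs_at[OF d, folded s, symmetric] by auto
  consider "as = []" | "bs = []" "as \<noteq> []" | "as \<noteq> []" "bs \<noteq> []" by blast
  then show ?thesis
  proof cases
    case 1
    then obtain x y cs where bs: "bs = x # y # cs" using E(4) s by (cases bs; cases "tl bs") auto
    have "{e \<in> edges C. v \<in> e} = {{v, last (y # cs)}, {v, x}}" unfolding split using s 1 bs by auto
    moreover have "last (y # cs) \<in> set (y # cs)" by (rule last_in_set) simp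
    moreover have "x \<notin> set (y # cs)" "v \<notin> set (y # cs)" "x \<noteq> v" using d bs by auto
    then have "last (y # cs) \<noteq> x" "last (y # cs) \<noteq> v" "x \<noteq> v" using \<open>last (y # cs) \<in> set (y # cs)\<close> by metis+
    ultimately show ?thesis by (intro exI[of _ "last (y # cs)"] exI[of _ x] conjI)
  next
    case 2
    then have "2 \<le> length as" using E(4) s by simp
    then obtain x y cs where as: "as = x # cs @ [y]" by (cases as; cases "tl as" rule: rev_cases) auto
    have "{e \<in> edges C. v \<in> e} = {{v, x}, {v, y}}" unfolding split using s 2 as by (auto simp: insert_commute)
    moreover have "x \<noteq> y" "x \<noteq> v" "y \<noteq> v" using d as by auto
    ultimately show ?thesis by (intro exI[of _ x] exI[of _ y] conjI)
  next
    case 3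
    have l: "last as \<in> set as" "hd bs \<in> set bs" using 3 by simp_all
    have "last vs = last bs" "hd vs = hd as" using s 3 by simp_all
    then have "v \<notin> {last vs, hd vs}" using d 3 last_in_set[of bs] hd_in_set[of as] by auto
    then have "{e \<in> edges C. v \<in> e} = {{v, last as}, {v, hd bs}}" unfolding split using 3 by (auto simp: insert_commute)
    moreover have "last as \<noteq> hd bs" "last as \<noteq> v" "hd bs \<noteq> v" using d l by auto
    ultimately show ?thesis by (intro exI[of _ "last as"] exI[of _ "hd bs"] conjI)
  qed
qed

lemma three_edges:
  assumes "is_path C \<or> is_circuit C" "p \<in> edges C" "q \<in> edges C" "r \<in> edges C" "v \<in> p" "v \<in> q" "v \<in> r" "v \<in> verts C"
  shows "\<not> distinct [p, q, r]"
proof -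
  have "\<exists>x y. {e \<in> edges C. v \<in> e} \<subseteq> {x, y}"
    using assms(1)
  proof
    assume "is_path C"
    then obtain vs where "path_listing vs C" unfolding is_path_def by (elim exE)
    then show ?thesis by (rule path_at(1))
  next
    assume "is_circuit C"
    then obtain vs where "circuit_listing vs C" unfolding is_circuit_def by (elim exE)
    then have "\<exists>p q. p \<noteq> q \<and> p \<noteq> v \<and> q \<noteq> v \<and> {e \<in> edges C. v \<in> e} = {{v, p}, {v, q}}" by (rule circuit_at[OF _ assms(8)])
    then show ?thesis by (elim exE conjE) (intro exI, rule equalityD1)
  qed
  then obtain x y where xy: "{e \<in> edges C. v \<in> e} \<subseteq> {x, y}" by blast
  have "p \<in> {x, y}" "q \<in> {x, y}" "r \<in> {x, y}" using xy assms by blast+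
  then show ?thesis by auto
qed

text \<open>An end of a path has at most one edge in it, while a vertex of a circuit has
  two.\<close>

lemma path_not_circuit:
  assumes "is_path C" shows "\<not> is_circuit C"
proof
  assume "is_circuit C"
  then obtain ws where ws: "circuit_listing ws C" by (auto simp: is_circuit_def)
  obtain vs where vs: "path_listing vs C" using assms by (auto simp: is_path_def)
  have "hd vs \<in> ends C" "hd vs \<in> verts C"
    using ends_path_listing[OF vs] vs by (auto simp: path_listing_def)
  then show False using path_at(2)[OF vs, of "hd vs"] circuit_at[OF ws, of "hd vs"] by (auto simp: doubleton_eq_iff)
qed

text \<open>Different listings have the same ends, and each end lies on just one edge, so one
  listing determines \<open>end_edges\<close>.\<close>

lemma end_edges_listing:
  assumes vs: "path_listing vs C" and l: "2 \<le> length vs"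
  shows "end_edges C = {{vs ! 0, vs ! 1}, {vs ! (length vs - 2), vs ! (length vs - 1)}}"
proof -
  have ne: "vs \<noteq> []" using l by auto
  have hdl: "hd vs = vs ! 0" "last vs = vs ! (length vs - 1)" using ne by (simp_all add: hd_conv_nth last_conv_nth)
  have L: "{e \<in> edges C. vs ! 0 \<in> e} = {{vs ! 0, vs ! 1}}"
  proof -
    obtain x y zs where z: "vs = x # y # zs" using l by (cases vs; cases "tl vs") auto
    show ?thesis using consecutive_pairs_at[of "[]" x "y # zs"] vs z by (simp add: path_listing_def)
  qed
  have R: "{e \<in> edges C. vs ! (length vs - 1) \<in> e} = {{vs ! (length vs - 2), vs ! (length vs - 1)}}"
  proof -
    obtain zs x y where z: "vs = zs @ [x, y]" using l by (cases vs rule: rev_cases; cases "butlast vs" rule: rev_cases) auto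
    show ?thesis using consecutive_pairs_at[of "zs @ [x]" y "[]"] vs z by (simp add: path_listing_def nth_append)
  qed
  have "e \<in> {{vs ! 0, vs ! 1}, {vs ! (length vs - 2), vs ! (length vs - 1)}}"
    if ws: "path_listing ws C" "2 \<le> length ws" "e = {ws ! 0, ws ! 1} \<or> e = {ws ! (length ws - 2), ws ! (length ws - 1)}" for ws e
  proof -
    have wn: "ws \<noteq> []" using ws(2) by auto
    have "ws ! 0 = hd ws" "ws ! (length ws - 1) = last ws" using wn by (simp_all add: hd_conv_nth last_conv_nth)
    then have "ws ! 0 \<in> {vs ! 0, vs ! (length vs - 1)}" "ws ! (length ws - 1) \<in> {vs ! 0, vs ! (length vs - 1)}"
      using ends_path_listing[OF vs] ends_path_listing[OF ws(1)] hdl by auto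
    moreover have "{ws ! 0, ws ! 1} \<in> edges C" "{ws ! (length ws - 2), ws ! (length ws - 1)} \<in> edges C"
    proof -
      have E: "edges C = consecutive_pairs ws" using ws(1) by (simp add: path_listing_def)
      show "{ws ! 0, ws ! 1} \<in> edges C" unfolding E consecutive_pairs_def using ws(2) by force
      have "Suc (length ws - 2) = length ws - 1" using ws(2) by simp
      then show "{ws ! (length ws - 2), ws ! (length ws - 1)} \<in> edges C"
        unfolding E consecutive_pairs_def using ws(2) by (intro CollectI exI[of _ "length ws - 2"]) simp
    qed
    ultimately have "e \<in> {e \<in> edges C. vs ! 0 \<in> e} \<union> {e \<in> edges C. vs ! (length vs - 1) \<in> e}"
      using ws(3) by auto
    then show ?thesis unfolding L R by blast
  qed
  then show ?thesis using vs l unfolding end_edges_def by blast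
qed

lemma diff_two: "S - {e, f} = {h} \<Longrightarrow> e \<in> S \<Longrightarrow> f \<in> S \<Longrightarrow> h \<in> S \<and> h \<noteq> e \<and> h \<noteq> f \<and> S = {e, f, h}"
  by auto

locale frame =
  fixes G F :: "'a graph" and \<C> :: "'a graph set"
  assumes fw: "framework G F \<C>"
begin

lemma G: "cubic G" and sG: "simple_graph G" and FG: "subgraph F G"
  using fw by (auto simp: framework_def cubic_def)

lemma finG: "finite (verts G)" "finite (edges G)"
  using cubic_finite[OF G] by auto

lemma FE: "edges F \<subseteq> edges G" "verts F \<subseteq> verts G"
  using FG by (auto simp: subgraph_def)

lemma finF: "finite (edges F)" "finite (verts F)"
  using FE finG finite_subset by auto

lemma Fvert: "e \<in> edges F \<Longrightarrow> v \<in> e \<Longrightarrow> v \<in> verts F"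
  using FG by (auto simp: subgraph_def)

lemma mem:
  assumes "C \<in> \<C>"
  shows "e \<in> edges C \<Longrightarrow> e \<in> edges G" "e \<in> edges C \<Longrightarrow> e \<notin> edges F" "e \<in> edges C \<Longrightarrow> v \<in> e \<Longrightarrow> v \<in> verts C"
    and "e \<in> edges G \<Longrightarrow> e \<notin> edges F \<Longrightarrow> e \<subseteq> verts C \<Longrightarrow> e \<in> edges C"
    and "is_path C \<or> is_circuit C" "3 \<le> card (edges C)" "verts C \<subseteq> verts G"
proof -
  have "F1 G F \<C>" using fw by (simp add: framework_def)
  then have i: "induced_subgraph C (delete_edges G (edges F))" "3 \<le> card (edges C)" "is_path C \<or> is_circuit C"
    using assms unfolding F1_def by auto
  then show "is_path C \<or> is_circuit C" "3 \<le> card (edges C)" by auto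
  show "verts C \<subseteq> verts G" "e \<in> edges C \<Longrightarrow> e \<in> edges G" "e \<in> edges C \<Longrightarrow> e \<notin> edges F" "e \<in> edges C \<Longrightarrow> v \<in> e \<Longrightarrow> v \<in> verts C"
    "e \<in> edges G \<Longrightarrow> e \<notin> edges F \<Longrightarrow> e \<subseteq> verts C \<Longrightarrow> e \<in> edges C"
    using i(1) by (auto simp: induced_subgraph_def subgraph_def delete_edges_def)
qed

lemma deg2: "C \<in> \<C> \<Longrightarrow> p \<in> edges C \<Longrightarrow> q \<in> edges C \<Longrightarrow> r \<in> edges C \<Longrightarrow> v \<in> p \<Longrightarrow> v \<in> q \<Longrightarrow> v \<in> r \<Longrightarrow> \<not> distinct [p, q, r]"
  using three_edges[OF mem(5)] mem(3) by blast

lemma circuit_two: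
  assumes "C \<in> \<C>" "is_circuit C" "v \<in> verts C"
  obtains p q where "p \<noteq> q" "p \<in> edges C" "q \<in> edges C" "v \<in> p" "v \<in> q"
proof -
  obtain vs where "circuit_listing vs C" using assms(2) by (auto simp: is_circuit_def)
  then obtain x y where "x \<noteq> y" "x \<noteq> v" "y \<noteq> v" "{e \<in> edges C. v \<in> e} = {{v, x}, {v, y}}"
    using circuit_at assms(3) by metis
  then show thesis by (intro that[of "{v, x}" "{v, y}"]) (auto simp: doubleton_eq_iff)
qed

lemma end_one: "is_path C \<Longrightarrow> v \<in> ends C \<Longrightarrow> p \<in> edges C \<Longrightarrow> q \<in> edges C \<Longrightarrow> v \<in> p \<Longrightarrow> v \<in> q \<Longrightarrow> p = q"
  using path_at(2)[of _ C v] unfolding is_path_def by blast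

lemma circuit_F:
  assumes "C \<in> \<C>" "is_circuit C" "v \<in> verts C" "v \<in> verts F"
  shows "degree F v = 1" and "w \<in> verts C \<Longrightarrow> w \<in> verts F \<Longrightarrow> w = v"
proof -
  have "F5 F \<C>" using fw by (simp add: framework_def)
  then have f: "card (verts (graph_inter C F)) \<le> 1" "\<forall>v\<in>verts (graph_inter C F). degree F v = 1"
    using assms(1,2) unfolding F5_def by auto
  then show "degree F v = 1" using assms by (simp add: graph_inter_def)
  assume "w \<in> verts C" "w \<in> verts F"
  moreover have "finite (verts (graph_inter C F))" using finF by (simp add: graph_inter_def)
  ultimately show "w = v" using f(1) assms card_le_Suc0_iff_eq[of "verts (graph_inter C F)"] by (simp add: graph_inter_def)
qed

lemma path_F:
  assumes "C \<in> \<C>" "is_path C" "v \<in> verts C" "v \<in> verts F"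
  shows "v \<in> ends C" "degree F v \<noteq> 1"
proof -
  have "F5 F \<C>" using fw by (simp add: framework_def)
  then have "v \<in> ends C \<and> degree F v \<in> {0, 2}"
    using assms unfolding F5_def by (auto simp: graph_inter_def)
  then show "v \<in> ends C" "degree F v \<noteq> 1" by auto
qed

lemma cover: "e \<in> edges G \<Longrightarrow> e \<notin> edges F \<Longrightarrow> \<exists>C\<in>\<C>. e \<in> edges C"
  using fw by (auto simp: framework_def F2_def delete_edges_def)

lemma cover2: "e \<in> edges G \<Longrightarrow> f \<in> edges G \<Longrightarrow> v \<in> e \<Longrightarrow> v \<in> f \<Longrightarrow> v \<notin> verts F \<Longrightarrow> \<exists>C\<in>\<C>. e \<in> edges C \<and> f \<in> edges C"
proof -
  assume a: "e \<in> edges G" "f \<in> edges G" "v \<in> e" "v \<in> f" "v \<notin> verts F"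
  have "F2 G F \<C>" using fw by (simp add: framework_def)
  then show ?thesis using a unfolding F2_def by blast
qed

lemma share_vertex:
  assumes "C1 \<in> \<C>" "C2 \<in> \<C>" "C1 \<noteq> C2" "v \<in> verts C1" "v \<in> verts C2" "v \<notin> verts F" "w \<in> verts C1" "w \<in> verts C2" "w \<noteq> v"
  shows "\<exists>e. e \<in> edges C1 \<and> e \<in> edges C2 \<and> v \<in> e"
proof -
  have f: "F3 F \<C>" using fw by (simp add: framework_def)
  have v: "v \<in> verts (graph_inter C1 C2)" "w \<in> verts (graph_inter C1 C2)" using assms by (simp_all add: graph_inter_def)
  have "verts (graph_inter C1 C2) \<noteq> {v}" using v assms(9) by blast
  then have "\<exists>e\<in>edges (graph_inter C1 C2). v \<in> e"
    using f assms(1,2,3,6) v(1) unfolding F3_def by blast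
  then show ?thesis by (auto simp: graph_inter_def)
qed

lemma twin:
  assumes "C1 \<in> \<C>" "C2 \<in> \<C>" "C1 \<noteq> C2" "e \<in> edges C1" "f \<in> edges C1" "e \<in> edges C2" "f \<in> edges C2" "e \<noteq> f"
  shows "twinned \<C> e f"
  unfolding twinned_def using assms by (auto simp: graph_inter_def)

text \<open>With both twinned edges in \<open>C\<close>, only two alternatives of (F6) remain: a
  circuit on which they meet in \<open>F\<close>, or a path of which they are the end-edges.\<close>

lemma twin_cases:
  assumes "twinned \<C> e f" "C \<in> \<C>" "e \<in> edges C" "f \<in> edges C"
  obtains v where "is_circuit C" "v \<in> verts F" "v \<in> e" "v \<in> f"
      "\<And>P w. P \<in> \<C> \<Longrightarrow> is_path P \<Longrightarrow> w \<in> verts P \<Longrightarrow> w \<notin> e \<and> w \<notin> f"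
    | "is_path C" "end_edges C = {e, f}" "verts C \<inter> verts F = {}" "card (verts C) \<le> 6"
proof -
  have f6: "F6 F \<C>" using fw by (simp add: framework_def)
  then have c: "card (verts C) \<le> 6 \<and>
     ((f \<in> edges C \<and> is_circuit C \<and> (\<exists>v\<in>verts F. v \<in> e \<and> v \<in> f) \<and>
         (\<forall>P\<in>\<C>. is_path P \<longrightarrow> verts P \<inter> (e \<union> f) = {})) \<or>
      (f \<in> edges C \<and> is_path C \<and> end_edges C = {e, f} \<and> verts (graph_inter C F) = {}) \<or>
      (f \<notin> edges C \<and> is_path C \<and> card (edges C) = 3 \<and> e \<in> end_edges C \<and> e \<inter> verts F = {}))"
    using assms(1-3) unfolding F6_def by simp
  then consider "is_circuit C" "\<exists>v\<in>verts F. v \<in> e \<and> v \<in> f" "\<forall>P\<in>\<C>. is_path P \<longrightarrow> verts P \<inter> (e \<union> f) = {}"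
    | "is_path C" "end_edges C = {e, f}" "verts (graph_inter C F) = {}" using assms(4) by argo
  then show thesis
  proof cases
    case 1
    then obtain v where "v \<in> verts F" "v \<in> e" "v \<in> f" by blast
    then show thesis using 1 by (intro that(1)[of v]) auto
  next
    case 2
    then show thesis using c by (intro that(2)) (auto simp: graph_inter_def)
  qed
qed

lemma twin_circuit:
  assumes "twinned \<C> e f" "C \<in> \<C>" "e \<in> edges C" "f \<in> edges C" "is_circuit C"
  obtains v where "v \<in> verts F" "v \<in> e" "v \<in> f" "v \<in> verts C"
  by (rule twin_cases[OF assms(1-4)]) (use assms(5) path_not_circuit mem(3)[OF assms(2,3)] that in blast)+

lemma third_edge:
  assumes "v \<in> verts G" "e \<in> edges G" "f \<in> edges G" "v \<in> e" "v \<in> f" "e \<noteq> f"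
  obtains h where "h \<in> edges G" "v \<in> h" "h \<noteq> e" "h \<noteq> f" "{d \<in> edges G. v \<in> d} = {e, f, h}"
proof -
  obtain a b c where abc: "distinct [a, b, c]" "{e \<in> edges G. v \<in> e} = {a, b, c}" by (rule cubic_edges_at[OF G assms(1)])
  have "e \<in> {a, b, c}" "f \<in> {a, b, c}" unfolding abc(2)[symmetric] using assms by simp_all
  then have "card ({a, b, c} - {e, f}) = 1" using abc(1) assms(6) by (subst card_Diff_subset) (simp_all add: insert_commute)
  then obtain h where "{a, b, c} - {e, f} = {h}" by (rule card_1_singletonE)
  then have "h \<in> {a, b, c} \<and> h \<noteq> e \<and> h \<noteq> f \<and> {a, b, c} = {e, f, h}"
    by (rule diff_two) fact+
  then have h: "h \<in> {a, b, c}" "h \<noteq> e" "h \<noteq> f" "{a, b, c} = {e, f, h}" by simp_all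
  then have "h \<in> {e \<in> edges G. v \<in> e}" using abc(2) by blast
  then show thesis using that[of h] h abc(2) by auto
qed

lemma at_vertex:
  assumes "v \<in> verts G" "{e, f, h} \<subseteq> edges G" "v \<in> e" "v \<in> f" "v \<in> h" "distinct [e, f, h]" "d \<in> edges G" "v \<in> d"
  shows "d = e \<or> d = f \<or> d = h"
  using cubic_four_edges[OF G, of d e f h v] assms by auto

lemma edge_pair: "e \<in> edges G \<Longrightarrow> v \<in> e \<Longrightarrow> \<exists>w. e = {v, w} \<and> w \<noteq> v \<and> v \<in> verts G \<and> w \<in> verts G"
  using simple_edgeE[OF sG] by (metis doubleton_eq_iff insert_iff singletonD)

text \<open>If \<open>v\<close> were in \<open>F\<close>, then \<open>C1\<close> would be a circuit
  and the third edge at \<open>v\<close> would belong to \<open>F\<close>; then \<open>C2\<close>, a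
  circuit through \<open>v\<close>, would contain \<open>e\<close> as well. Outside
  \<open>F\<close>, (F3) gives \<open>C2\<close> and \<open>C3\<close> a common edge at
  \<open>v\<close>, which can only be \<open>h\<close>.\<close>

lemma trinity_share:
  assumes C1: "C1 \<in> \<C>" "e \<in> edges C1" "f \<in> edges C1" and C2: "C2 \<in> \<C>" "f \<in> edges C2" "g \<in> edges C2"
    and C3: "C3 \<in> \<C>" "e \<in> edges C3" "g \<in> edges C3"
    and no: "\<And>C. C \<in> \<C> \<Longrightarrow> e \<in> edges C \<Longrightarrow> f \<in> edges C \<Longrightarrow> g \<in> edges C \<Longrightarrow> False"
    and v: "e \<noteq> f" "v \<in> e" "v \<in> f" and h: "h \<in> edges G" "v \<in> h" "h \<noteq> e" "h \<noteq> f"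
  shows "v \<notin> verts F" "h \<in> edges C2" "h \<in> edges C3"
proof -
  note eG = mem(1)[OF C1(1,2)] and fG = mem(1)[OF C1(1,3)]
  have vG: "v \<in> verts G" using edge_pair[OF eG v(2)] by blast
  have at: "d = e \<or> d = f \<or> d = h" if "d \<in> edges G" "v \<in> d" for d
    using at_vertex[OF vG, of e f h d] eG fG h v that by auto
  show vF: "v \<notin> verts F"
  proof
    assume vF: "v \<in> verts F"
    have "\<not> is_path C1" using path_F[OF C1(1) _ mem(3)[OF C1(1,2) v(2)] vF] end_one[of C1 v e f] C1 v by blast
    then have c1: "is_circuit C1" using mem(5)[OF C1(1)] by blast
    have d: "degree F v = 1" by (rule circuit_F(1)[OF C1(1) c1 mem(3)[OF C1(1,2) v(2)] vF])
    obtain \<gamma> where "{x \<in> edges F. v \<in> x} = {\<gamma>}" by (rule card_1_singletonE[OF d[unfolded degree_def]])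
    then have \<gamma>: "\<gamma> \<in> edges F" "v \<in> \<gamma>" by blast+
    have "\<gamma> = h" using at[of \<gamma>] \<gamma> FE mem(2)[OF C1(1)] C1 by blast
    then have hF: "h \<in> edges F" using \<gamma> by simp
    have "\<not> is_path C2" using path_F(2)[OF C2(1) _ mem(3)[OF C2(1,2) v(3)] vF] d by blast
    then have c2: "is_circuit C2" using mem(5)[OF C2(1)] by blast
    obtain p q where pq: "p \<noteq> q" "p \<in> edges C2" "q \<in> edges C2" "v \<in> p" "v \<in> q"
      by (rule circuit_two[OF C2(1) c2 mem(3)[OF C2(1,2) v(3)]])
    have "p \<noteq> h" "q \<noteq> h" using pq mem(2)[OF C2(1)] hF by auto
    then have "e \<in> edges C2" using at[of p] at[of q] pq mem(1)[OF C2(1)] by blast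
    then show False using no[OF C2(1)] C2 by blast
  qed
  have ne: "C2 \<noteq> C3" using no[OF C2(1)] C2 C3 by blast
  obtain w where w: "w \<in> g" "w \<noteq> v"
    using simple_edgeE[OF sG mem(1)[OF C2(1,3)]] by (metis insertCI)
  obtain d where d: "d \<in> edges C2" "d \<in> edges C3" "v \<in> d"
    using share_vertex[OF C2(1) C3(1) ne mem(3)[OF C2(1,2) v(3)] mem(3)[OF C3(1,2) v(2)] vF
        mem(3)[OF C2(1,3) w(1)] mem(3)[OF C3(1,3) w(1)] w(2)] by blast
  have "d \<noteq> e" using no[OF C2(1)] C2 d by blast
  moreover have "d \<noteq> f" using no[OF C3(1)] C3 d by blast
  ultimately have "d = h" using at[OF mem(1)[OF C2(1) d(1)] d(3)] by blast
  then show "h \<in> edges C2" "h \<in> edges C3" using d by auto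
qed

text \<open>On a circuit both twins of \<open>g\<close> would meet \<open>g\<close> at the only
  vertex of \<open>F\<close>, giving three edges there; on a path \<open>g\<close> has just one
  partner among the end-edges.\<close>

lemma two_twins:
  assumes "C \<in> \<C>" "p \<in> edges C" "q \<in> edges C" "g \<in> edges C" "distinct [p, q, g]" "twinned \<C> g p" "twinned \<C> g q"
  shows False
proof (rule twin_cases[OF assms(6,1,4,2)])
  fix v assume v: "is_circuit C" "v \<in> verts F" "v \<in> g" "v \<in> p"
  obtain w where w: "w \<in> verts F" "w \<in> g" "w \<in> q" "w \<in> verts C" by (rule twin_circuit[OF assms(7,1,4,3) v(1)])
  have "v = w" using circuit_F(2)[OF assms(1) v(1) w(4,1) mem(3)[OF assms(1,2) v(4)] v(2)] .
  then show False using deg2[OF assms(1,2,3,4) v(4)] v w assms(5) by blast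
next
  assume p: "is_path C" "end_edges C = {g, p}"
  show False
    by (rule twin_cases[OF assms(7,1,4,3)]) (use p path_not_circuit assms(5) in \<open>auto simp: doubleton_eq_iff\<close>)
qed

text \<open>A minimal set of pairwise compatible edges in no common member has exactly three
  elements.\<close>

lemma helly:
  assumes Z: "Z \<subseteq> edges G - edges F" "Z \<noteq> {}"
    and pair: "\<And>e f. e \<in> Z \<Longrightarrow> f \<in> Z \<Longrightarrow> e \<noteq> f \<Longrightarrow> \<exists>C\<in>\<C>. e \<in> edges C \<and> f \<in> edges C"
    and no: "\<not> (\<exists>C\<in>\<C>. Z \<subseteq> edges C)"
  shows "\<exists>e\<in>Z. \<exists>f\<in>Z. \<exists>g\<in>Z. distinct [e, f, g] \<and> \<not> (\<exists>C\<in>\<C>. {e, f, g} \<subseteq> edges C)"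
proof -
  let ?B = "\<lambda>X. X \<subseteq> Z \<and> \<not> (\<exists>C\<in>\<C>. X \<subseteq> edges C)"
  have finZ: "finite Z" using Z(1) finG finite_subset by blast
  obtain X where X: "?B X" and mn: "\<And>Y. ?B Y \<Longrightarrow> card X \<le> card Y"
    using ex_has_least_nat[of ?B Z card] no by blast
  have finX: "finite X" using X finZ finite_subset by blast
  have del: "\<exists>C\<in>\<C>. X - {x} \<subseteq> edges C \<and> x \<notin> edges C" if x: "x \<in> X" for x
  proof -
    have "card (X - {x}) < card X" using x finX by (rule card_Diff1_less[rotated])
    then have "\<not> ?B (X - {x})" using mn[of "X - {x}"] by linarith
    then obtain C where "C \<in> \<C>" "X - {x} \<subseteq> edges C" using X by blast
    then show ?thesis using X by blast
  qed
  \<comment> \<open>Four edges would give, by minimality, members that omit one of them each. Any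
    two of these members share the other edges, which makes \<open>c\<close> twinned with both
    \<open>a\<close> and \<open>b\<close> inside \<open>Cd\<close>.\<close>
  have four: False if d: "distinct [a, b, c, d]" "{a, b, c, d} \<subseteq> X" for a b c d
  proof -
    obtain Ca where Ca: "Ca \<in> \<C>" "X - {a} \<subseteq> edges Ca" "a \<notin> edges Ca" using del[of a] d(2) by blast
    obtain Cb where Cb: "Cb \<in> \<C>" "X - {b} \<subseteq> edges Cb" "b \<notin> edges Cb" using del[of b] d(2) by blast
    obtain Cd where Cd: "Cd \<in> \<C>" "X - {d} \<subseteq> edges Cd" "d \<notin> edges Cd" using del[of d] d(2) by blast
    have inX: "a \<in> X" "b \<in> X" "c \<in> X" "d \<in> X" using d(2) by simp_all
    have "b \<in> edges Ca" "c \<in> edges Ca" "d \<in> edges Ca" by (rule subsetD[OF Ca(2)], use inX d(1) in force)+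
    moreover have "a \<in> edges Cb" "c \<in> edges Cb" "d \<in> edges Cb" by (rule subsetD[OF Cb(2)], use inX d(1) in force)+
    moreover have "a \<in> edges Cd" "b \<in> edges Cd" "c \<in> edges Cd" by (rule subsetD[OF Cd(2)], use inX d(1) in force)+
    ultimately have m: "b \<in> edges Ca" "c \<in> edges Ca" "d \<in> edges Ca" "a \<in> edges Cb" "c \<in> edges Cb" "d \<in> edges Cb"
      "a \<in> edges Cd" "b \<in> edges Cd" "c \<in> edges Cd" by simp_all
    have "twinned \<C> c b" by (rule twin[OF Ca(1) Cd(1)]) (use m Cd d(1) in auto)
    moreover have "twinned \<C> c a" by (rule twin[OF Cb(1) Cd(1)]) (use m Cd d(1) in auto)
    ultimately show False using two_twins[OF Cd(1) m(8,7,9)] d(1) by auto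
  qed
  have Xn: "X \<noteq> {}"
  proof
    assume "X = {}"
    moreover obtain z where "z \<in> Z" using Z(2) by blast
    ultimately show False using X cover[of z] Z(1) by blast
  qed
  then obtain a where a: "a \<in> X" by blast
  have "X \<noteq> {a}" using X cover[of a] Z(1) by blast
  then obtain b where b: "b \<in> X" "b \<noteq> a" using a by blast
  have "X \<noteq> {a, b}" using X pair[of a b] a b by blast
  then obtain c where c: "c \<in> X" "c \<noteq> a" "c \<noteq> b" using a b by blast
  have "X = {a, b, c}"
  proof (rule ccontr)
    assume "X \<noteq> {a, b, c}"
    then obtain d where "d \<in> X" "d \<notin> {a, b, c}" using a b c by blast
    then show False using four[of a b c d] a b c by auto
  qed
  then have "\<not> (\<exists>C\<in>\<C>. {a, b, c} \<subseteq> edges C)" "a \<in> Z" "b \<in> Z" "c \<in> Z" using X by simp_all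
  moreover have "distinct [a, b, c]" using b(2) c(2,3) by simp
  ultimately show ?thesis by (intro bexI conjI)
qed

text \<open>Members through \<open>a\<close> are circuits containing \<open>e\<close> and the
  joining edge, which are thus twinned, so no path meets \<open>b\<close>. At \<open>b\<close> the
  circuits \<open>C2\<close> and \<open>C3\<close> both continue along the third edge
  \<open>q\<close>. Then \<open>q\<close> and \<open>g\<close> are twinned and meet in the only
  vertex of \<open>C3\<close> in \<open>F\<close>, namely \<open>a\<close>, which makes
  \<open>q\<close> the joining edge.\<close>

lemma joined_in_F:
  assumes C1: "C1 \<in> \<C>" "e \<in> edges C1" "f \<in> edges C1" and C2: "C2 \<in> \<C>" "f \<in> edges C2" "g \<in> edges C2"
    and C3: "C3 \<in> \<C>" "e \<in> edges C3" "g \<in> edges C3"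
    and no: "\<And>C. C \<in> \<C> \<Longrightarrow> e \<in> edges C \<Longrightarrow> f \<in> edges C \<Longrightarrow> g \<in> edges C \<Longrightarrow> False"
    and dj: "e \<inter> f = {}" "f \<inter> g = {}" and k: "a \<in> e" "b \<in> f" "{a, b} \<in> edges G" "{a, b} \<notin> edges F"
    and aF: "a \<in> verts F"
  shows False
proof -
  let ?k = "{a, b}"
  have ab: "a \<noteq> b" using dj k by blast
  have ke: "?k \<noteq> e" "?k \<noteq> f" using dj k by blast+
  note aC1 = mem(3)[OF C1(1,2) k(1)] and bC1 = mem(3)[OF C1(1,3) k(2)]
  have k1: "?k \<in> edges C1" by (rule mem(4)[OF C1(1) k(3,4)]) (use aC1 bC1 in simp)
  have "\<not> is_path C1" using path_F[OF C1(1) _ aC1 aF] end_one[of C1 a e ?k] C1 k k1 ke by blast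
  then have c1: "is_circuit C1" using mem(5)[OF C1(1)] by blast
  have d: "degree F a = 1" by (rule circuit_F(1)[OF C1(1) c1 aC1 aF])
  have aG: "a \<in> verts G" "b \<in> verts G" using edge_pair[OF k(3)] by auto
  obtain \<gamma> where "{x \<in> edges F. a \<in> x} = {\<gamma>}" by (rule card_1_singletonE[OF d[unfolded degree_def]])
  then have \<gamma>: "\<gamma> \<in> edges F" "a \<in> \<gamma>" by blast+
  note eG = mem(1)[OF C1(1,2)] and fG = mem(1)[OF C1(1,3)]
  have at: "d = e \<or> d = ?k" if "d \<in> edges G" "a \<in> d" "d \<notin> edges F" for d
    using at_vertex[OF aG(1), of e ?k \<gamma> d] eG k \<gamma> FE ke that mem(2)[OF C1(1,2)] by auto
  have circ: "is_circuit C \<and> (e \<in> edges C \<and> ?k \<in> edges C)" if C: "C \<in> \<C>" "a \<in> verts C" for C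
  proof -
    have "\<not> is_path C" using path_F(2)[OF C(1) _ C(2) aF] d by blast
    then have c: "is_circuit C" using mem(5)[OF C(1)] by blast
    obtain p q where pq: "p \<noteq> q" "p \<in> edges C" "q \<in> edges C" "a \<in> p" "a \<in> q" by (rule circuit_two[OF C(1) c C(2)])
    have "p = e \<or> p = ?k" "q = e \<or> q = ?k"
      using at[of p] at[of q] pq mem(1,2)[OF C(1)] by blast+
    then show ?thesis using pq c by auto
  qed
  have k3: "?k \<in> edges C3" and c3: "is_circuit C3" using circ[OF C3(1) mem(3)[OF C3(1,2) k(1)]] by auto
  have ne: "C1 \<noteq> C3" using no[OF C1(1)] C1 C3 by blast
  have tw: "twinned \<C> e ?k" by (rule twin[OF C1(1) C3(1) ne]) (use C1 C3 k1 k3 ke in auto)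
  have nopath: "\<not> is_path C" if "C \<in> \<C>" "b \<in> verts C" for C
  proof (rule twin_cases[OF tw C1(1,2) k1])
    fix v assume "\<And>P w. P \<in> \<C> \<Longrightarrow> is_path P \<Longrightarrow> w \<in> verts P \<Longrightarrow> w \<notin> e \<and> w \<notin> ?k"
    then show ?thesis using that by blast
  qed (use c1 path_not_circuit in blast)
  note bC2 = mem(3)[OF C2(1,2) k(2)]
  have c2: "is_circuit C2" using nopath[OF C2(1) bC2] mem(5)[OF C2(1)] by blast
  have bC3: "b \<in> verts C3" using mem(3)[OF C3(1) k3] by blast
  obtain q where q: "q \<in> edges G" "b \<in> q" "q \<noteq> f" "q \<noteq> ?k" "{d \<in> edges G. b \<in> d} = {f, ?k, q}"
    by (rule third_edge[OF aG(2) fG k(3,2)]) (use ke in auto)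
  have two: "q \<in> edges C" if C: "C \<in> \<C>" "is_circuit C" "b \<in> verts C" "f \<notin> edges C \<or> ?k \<notin> edges C" for C
  proof -
    obtain p r where pr: "p \<noteq> r" "p \<in> edges C" "r \<in> edges C" "b \<in> p" "b \<in> r" by (rule circuit_two[OF C(1-3)])
    have "p \<in> {f, ?k, q}" "r \<in> {f, ?k, q}" using pr q(5) mem(1)[OF C(1)] by blast+
    then show ?thesis using pr C(4) by auto
  qed
  have "f \<notin> edges C3" using no[OF C3(1)] C3 by blast
  then have q3: "q \<in> edges C3" using two[OF C3(1) c3 bC3] by blast
  have "?k \<notin> edges C2"
  proof
    assume "?k \<in> edges C2"
    then have "e \<in> edges C2" using circ[OF C2(1) mem(3)[OF C2(1), of ?k a]] by blast
    then show False using no[OF C2(1)] C2 by blast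
  qed
  then have q2: "q \<in> edges C2" using two[OF C2(1) c2 bC2] by blast
  have qg: "q \<noteq> g" using q(2) k(2) dj(2) by blast
  have "C2 \<noteq> C3" using no[OF C2(1)] C2 C3 by blast
  then have "twinned \<C> q g" using twin[OF C2(1) C3(1)] q2 q3 C2 C3 qg by blast
  then obtain t where t: "t \<in> verts F" "t \<in> q" "t \<in> g" "t \<in> verts C3" by (rule twin_circuit[OF _ C3(1) q3 C3(3) c3])
  have "t = a" by (rule circuit_F(2)[OF C3(1) c3 mem(3)[OF C3(1,2) k(1)] aF t(4,1)])
  then have "a \<in> q" using t by simp
  moreover obtain w where "q = {b, w}" using edge_pair[OF q(1,2)] by blast
  ultimately have "q = ?k" using ab by auto
  then show False using q(4) by blast
qed

text \<open>Each end of the joining edge contributes an edge of \<open>C4\<close> twinned with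
  \<open>g\<close>, and \<open>two_twins\<close> forbids two of them.\<close>

lemma joined_not_in_F:
  assumes C1: "C1 \<in> \<C>" "e \<in> edges C1" "f \<in> edges C1" and C2: "C2 \<in> \<C>" "f \<in> edges C2" "g \<in> edges C2"
    and C3: "C3 \<in> \<C>" "e \<in> edges C3" "g \<in> edges C3"
    and no: "\<And>C. C \<in> \<C> \<Longrightarrow> e \<in> edges C \<Longrightarrow> f \<in> edges C \<Longrightarrow> g \<in> edges C \<Longrightarrow> False"
    and dj: "e \<inter> f = {}" "f \<inter> g = {}" "e \<inter> g = {}" and k: "a \<in> e" "b \<in> f" "{a, b} \<in> edges G" "{a, b} \<notin> edges F"
    and F: "a \<notin> verts F" "b \<notin> verts F" and C4: "C4 \<in> \<C>" "{a, b} \<in> edges C4" "g \<in> edges C4"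
  shows False
proof -
  let ?k = "{a, b}"
  have ke: "?k \<noteq> e" "?k \<noteq> f" "a \<noteq> b" using dj k by blast+
  note aC1 = mem(3)[OF C1(1,2) k(1)] and bC1 = mem(3)[OF C1(1,3) k(2)]
  have k1: "?k \<in> edges C1" by (rule mem(4)[OF C1(1) k(3,4)]) (use aC1 bC1 in simp)
  have aG: "a \<in> verts G" "b \<in> verts G" using edge_pair[OF k(3)] by auto
  have main: "\<exists>p. p \<in> edges C4 \<and> twinned \<C> g p \<and> r \<in> p \<and> p \<noteq> ?k \<and> p \<noteq> g"
    if r: "r \<in> {a, b}" "r \<in> d" "d \<in> edges C1" "d \<noteq> ?k" "d \<inter> g = {}" and Cx: "Cx \<in> \<C>" "d \<in> edges Cx" "g \<in> edges Cx" "Cx \<noteq> C1" for r d Cx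
  proof -
    have rF: "r \<notin> verts F" using r(1) F by blast
    have rG: "r \<in> verts G" using r(1) aG by blast
    \<comment> \<open>A member containing \<open>d\<close>, the joining edge and \<open>g\<close>
      would make the first two twinned in \<open>C1\<close>. They meet outside \<open>F\<close>, and
      the end-edges of a path with at least three edges do not meet at all.\<close>
    have no2: False if C: "C \<in> \<C>" "d \<in> edges C" "?k \<in> edges C" "g \<in> edges C" for C
    proof -
      have g1: "g \<notin> edges C1" using no[OF C1(1)] C1 by blast
      then have "C \<noteq> C1" using C(4) by blast
      then have tw: "twinned \<C> d ?k" using twin[OF C(1) C1(1)] C k1 r by blast
      show False
      proof (rule twin_cases[OF tw C1(1) r(3) k1])
        fix v assume v: "v \<in> verts F" "v \<in> d" "v \<in> ?k"
        obtain w where w: "d = {r, w}" using edge_pair[OF mem(1)[OF C1(1) r(3)] r(2)] by blast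
        have "v \<noteq> r" using v rF by blast
        then have "d = ?k" using w v r(1) F by blast
        then show False using r(4) by blast
      next
        assume p: "is_path C1" "end_edges C1 = {d, ?k}"
        obtain vs where vs: "path_listing vs C1" using p(1) by (auto simp: is_path_def)
        have l: "4 \<le> length vs" using path_listing_card_edges(1)[OF vs] mem(6)[OF C1(1)] by linarith
        have ee: "end_edges C1 = {{vs ! 0, vs ! 1}, {vs ! (length vs - 2), vs ! (length vs - 1)}}"
          using end_edges_listing[OF vs] l by simp
        have "distinct vs" "vs \<noteq> []" using vs by (simp_all add: path_listing_def)
        then have "vs ! 0 \<noteq> vs ! (length vs - 2)" "vs ! 0 \<noteq> vs ! (length vs - 1)" "vs ! 1 \<noteq> vs ! (length vs - 2)" "vs ! 1 \<noteq> vs ! (length vs - 1)"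
          using l \<open>vs \<noteq> []\<close> by (simp_all add: nth_eq_iff_index_eq[OF \<open>distinct vs\<close>])
        then have "{vs ! 0, vs ! 1} \<inter> {vs ! (length vs - 2), vs ! (length vs - 1)} = {}" by auto
        then have "x = y \<or> x \<inter> y = {}" if "x \<in> end_edges C1" "y \<in> end_edges C1" for x y
          using that unfolding ee by auto
        then have "d \<inter> ?k = {}" using p(2) r(4) by blast
        then show False using r(1,2) by blast
      qed
    qed
    obtain p where p: "p \<in> edges G" "r \<in> p" "p \<noteq> d" "p \<noteq> ?k" "{x \<in> edges G. r \<in> x} = {d, ?k, p}"
      by (rule third_edge[OF rG mem(1)[OF C1(1) r(3)] k(3) r(2,1,4)])
    \<comment> \<open>The edges \<open>d\<close>, \<open>?k\<close> and \<open>g\<close> again form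
      a trinity, now with the common vertex \<open>r\<close>.\<close>
    have ts: "p \<in> edges C4" "p \<in> edges Cx"
      using trinity_share(2,3)[OF C1(1) r(3) k1 C4 Cx(1,2,3) no2 r(4,2,1) p(1,2,3,4)] by auto
    have "p \<noteq> g"
    proof
      assume "p = g"
      then show False using p(2) r(2,5) by blast
    qed
    moreover have "C4 \<noteq> Cx" using no2[OF C4(1)] C4 Cx by blast
    ultimately have "twinned \<C> g p" using twin[OF C4(1) Cx(1)] ts C4 Cx by blast
    then show ?thesis using ts(1) p \<open>p \<noteq> g\<close> by blast
  qed
  have "C3 \<noteq> C1" "C2 \<noteq> C1" using no[OF C1(1)] C1 C2 C3 by blast+
  obtain p where p: "p \<in> edges C4" "twinned \<C> g p" "a \<in> p" "p \<noteq> ?k" "p \<noteq> g"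
    using main[of a e C3] k C1 C3 ke dj \<open>C3 \<noteq> C1\<close> by blast
  obtain q where q: "q \<in> edges C4" "twinned \<C> g q" "b \<in> q" "q \<noteq> ?k" "q \<noteq> g"
    using main[of b f C2] k C1 C2 ke dj \<open>C2 \<noteq> C1\<close> by blast
  have "p \<noteq> q"
  proof
    assume "p = q"
    moreover obtain w where "p = {a, w}" using edge_pair[OF mem(1)[OF C4(1) p(1)] p(3)] by blast
    ultimately have "p = ?k" using q(3) ke(3) by auto
    then show False using p(4) by blast
  qed
  then show False using two_twins[OF C4(1) p(1) q(1) C4(3) _ p(2) q(2)] p q by auto
qed

end

lemma path_listing_from:
  assumes "is_path C" "end_edges C = {e, k}" "e \<noteq> k" "3 \<le> card (edges C)"
  obtains vs where "path_listing vs C" "length vs = Suc (card (edges C))" "e = {vs ! 0, vs ! 1}"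
    "k = {vs ! (length vs - 2), vs ! (length vs - 1)}"
proof -
  obtain vs where vs: "path_listing vs C" using assms(1) by (auto simp: is_path_def)
  have "vs \<noteq> []" using vs by (simp add: path_listing_def)
  then have l: "length vs = Suc (card (edges C))" using path_listing_card_edges(1)[OF vs] by (cases vs) simp_all
  have ee: "{e, k} = {{vs ! 0, vs ! 1}, {vs ! (length vs - 2), vs ! (length vs - 1)}}"
    using end_edges_listing[OF vs] l assms(2,4) by simp
  then consider "e = {vs ! 0, vs ! 1}" "k = {vs ! (length vs - 2), vs ! (length vs - 1)}"
    | "k = {vs ! 0, vs ! 1}" "e = {vs ! (length vs - 2), vs ! (length vs - 1)}"
    using assms(3) unfolding doubleton_eq_iff[of e k] by argo
  then show thesis
  proof cases
    case 1 then show thesis using that[OF vs l] by simp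
  next
    case 2
    have "rev vs ! 0 = vs ! (length vs - 1)" "rev vs ! 1 = vs ! (length vs - 2)"
      "rev vs ! (length vs - 1) = vs ! 0" "rev vs ! (length vs - 2) = vs ! 1"
      using l assms(4) by (simp_all add: rev_nth Suc_diff_le numeral_2_eq_2)
    then show thesis using that[OF path_listing_rev[OF vs]] l 2 by (simp add: insert_commute)
  qed
qed

context frame begin

lemma twin_path_end:
  assumes "twinned \<C> e f" "C \<in> \<C>" "e \<in> edges C" "is_path C"
  shows "e \<in> end_edges C"
proof -
  have f6: "F6 F \<C>" using fw by (simp add: framework_def)
  have "is_circuit C \<or> end_edges C = {e, f} \<or> e \<in> end_edges C"
    using f6[unfolded F6_def, rule_format, OF assms(1-3)] by argo
  then show ?thesis using path_not_circuit[OF assms(4)] by blast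
qed

end

section \<open>The exceptional configuration: two edges at a vertex and a twin of the third\<close>

text \<open>In the notation of the overview \<open>{v, b}\<close> is f, \<open>{v, c}\<close> is h
  and \<open>{v, a}\<close> is e. Exchanging \<open>b\<close> with \<open>c\<close> and
  \<open>Df\<close> with \<open>Dh\<close> is a symmetry, used throughout by
  \<open>swap\<close>.\<close>

locale config = frame G F \<C> for G F :: "'a graph" and \<C> +
  fixes v a b c :: 'a and k :: "'a set" and Df Dh :: "'a graph"
  assumes vF: "v \<notin> verts F" and at: "{d \<in> edges G. v \<in> d} = {{v, a}, {v, b}, {v, c}}"
    and dist: "distinct [v, a, b, c]" and vk: "v \<notin> k"
    and Df: "Df \<in> \<C>" "{v, a} \<in> edges Df" "{v, b} \<in> edges Df" "k \<in> edges Df"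
    and Dh: "Dh \<in> \<C>" "{v, a} \<in> edges Dh" "{v, c} \<in> edges Dh" "k \<in> edges Dh"
begin

lemma swap: "config G F \<C> v a c b k Dh Df"
proof -
  have "c \<noteq> b" using dist by auto
  then show ?thesis by unfold_locales (use vF at dist vk Df Dh in \<open>simp_all add: insert_commute\<close>)
qed

lemma ne: "v \<noteq> a" "v \<noteq> b" "v \<noteq> c" "a \<noteq> b" "a \<noteq> c" "b \<noteq> c" "a \<noteq> v" "b \<noteq> v" "c \<noteq> v" "b \<noteq> a" "c \<noteq> a" "c \<noteq> b"
  using dist by auto

lemma ene: "{v, a} \<noteq> {v, b}" "{v, a} \<noteq> {v, c}" "{v, b} \<noteq> {v, c}" "k \<noteq> {v, a}" "k \<noteq> {v, b}" "k \<noteq> {v, c}"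
  using ne vk by (simp_all add: doubleton_eq_iff) blast+

lemma EG: "{v, a} \<in> edges G" "{v, b} \<in> edges G" "{v, c} \<in> edges G" "k \<in> edges G"
  using mem(1)[OF Df(1)] mem(1)[OF Dh(1)] Df Dh by auto

lemma EF: "{v, a} \<notin> edges F" "{v, b} \<notin> edges F" "{v, c} \<notin> edges F" "k \<notin> edges F"
  using mem(2)[OF Df(1)] mem(2)[OF Dh(1)] Df Dh by auto

lemma VG: "v \<in> verts G" "a \<in> verts G" "b \<in> verts G" "c \<in> verts G"
  using edge_pair[OF EG(1), of v] edge_pair[OF EG(1), of a] edge_pair[OF EG(2), of b] edge_pair[OF EG(3), of c] by auto

lemma hDf: "{v, c} \<notin> edges Df"
  using deg2[OF Df(1-3), of "{v, c}" v] ene by auto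

text \<open>\<open>Df\<close> is induced, so with \<open>c\<close> it would contain
  \<open>{v, c}\<close>, a third edge at \<open>v\<close>.\<close>

lemma cDf: "c \<notin> verts Df"
  using mem(4)[OF Df(1) EG(3) EF(3)] mem(3)[OF Df(1,2), of v] hDf by auto

lemma Dne: "Df \<noteq> Dh"
  using hDf Dh by auto

lemma tw: "twinned \<C> {v, a} k"
  using twin[OF Df(1) Dh(1) Dne] Df Dh ene by simp

text \<open>By (F6) the path has at most six vertices and end-edges \<open>{v, a}\<close> and
  \<open>k\<close>, so it begins with \<open>a\<close>, \<open>v\<close>, \<open>b\<close>. With
  only three edges, \<open>k\<close> would contain \<open>b\<close> and bring it into
  \<open>Dh\<close>.\<close>

lemma shape:
  assumes p: "is_path Df"
  shows "(\<exists>s t. path_listing [a, v, b, s, t] Df \<and> k = {s, t}) \<or> card (edges Df) = 5"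
    and "end_edges Df = {{v, a}, k}" and "verts Df \<inter> verts F = {}" and "is_path Dh"
proof -
  have c: "end_edges Df = {{v, a}, k} \<and> verts Df \<inter> verts F = {} \<and> card (verts Df) \<le> 6"
    by (rule twin_cases[OF tw Df(1,2,4)]) (use p path_not_circuit in auto)
  then show ee: "end_edges Df = {{v, a}, k}" and "verts Df \<inter> verts F = {}" by auto
  show "is_path Dh"
  proof (rule twin_cases[OF tw Dh(1,2,4)])
    fix t assume "\<And>P w. P \<in> \<C> \<Longrightarrow> is_path P \<Longrightarrow> w \<in> verts P \<Longrightarrow> w \<notin> {v, a} \<and> w \<notin> k"
    from this[OF Df(1) p mem(3)[OF Df(1,2)]] show ?thesis by blast
  qed
  obtain vs where vs: "path_listing vs Df" "length vs = Suc (card (edges Df))" "{v, a} = {vs ! 0, vs ! 1}"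
    "k = {vs ! (length vs - 2), vs ! (length vs - 1)}"
    by (rule path_listing_from[OF p ee ene(4)[symmetric] mem(6)[OF Df(1)]])
  have d: "distinct vs" "edges Df = consecutive_pairs vs" "verts Df = set vs" using vs(1) by (simp_all add: path_listing_def)
  have l: "4 \<le> length vs" "length vs \<le> 6" using vs(2) mem(6)[OF Df(1)] c d distinct_card[OF d(1)] by auto
  obtain x0 x1 x2 ws where sh: "vs = x0 # x1 # x2 # ws" "ws \<noteq> []" "length ws \<le> 3"
    using l by (cases vs; cases "tl vs"; cases "tl (tl vs)"; cases "tl (tl (tl vs))") auto
  have x0: "x0 \<in> ends Df" using ends_path_listing[OF vs(1)] sh by simp
  have "v \<noteq> x0" using end_one[OF p x0 Df(2,3)] ene(1) by auto
  then have x1: "v = x1" "a = x0" using vs(3) sh by (auto simp: doubleton_eq_iff)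
  have atv: "{e \<in> edges Df. v \<in> e} = {{a, v}, {v, x2}}"
    using consecutive_pairs_at[of "[x0]" x1 "x2 # ws"] d sh x1 by (simp add: insert_commute)
  have "{v, b} \<in> {{a, v}, {v, x2}}" unfolding atv[symmetric] using Df(3) by simp
  then have x2: "b = x2" using ne by (auto simp: doubleton_eq_iff)
  have bk: "b \<notin> k"
  proof
    assume "b \<in> k"
    then have "b \<in> verts Dh" using mem(3)[OF Dh(1,4)] by blast
    then show False using config.cDf[OF swap] by blast
  qed
  obtain y ys where ws: "ws = y # ys" using sh(2) by (cases ws) auto
  show "(\<exists>s t. path_listing [a, v, b, s, t] Df \<and> k = {s, t}) \<or> card (edges Df) = 5"
  proof (cases ys)
    case Nil
    then have "k = {b, y}" using vs(4) sh(1) ws x2 by (simp add: numeral_2_eq_2)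
    then show ?thesis using bk by blast
  next
    case (Cons z zs)
    show ?thesis
    proof (cases zs)
      case Nil
      then show ?thesis using vs(1,4) sh(1) ws x1 x2 Cons by (intro disjI1 exI[of _ y] exI[of _ z]) (simp add: numeral_2_eq_2)
    next
      case (Cons z' zs')
      then show ?thesis using sh(1,3) vs(2) ws \<open>ys = z # zs\<close> by simp
    qed
  qed
qed

text \<open>This is (F7); it ensures that at least one of the two paths has four edges.\<close>

lemma not_both_long:
  assumes "is_path Df" "card (edges Df) = 5" shows "card (edges Dh) \<noteq> 5"
proof -
  have f7: "F7 \<C>" using fw by (simp add: framework_def)
  have "card (edges Dh) \<le> 4"
    using f7[unfolded F7_def, rule_format, OF Df(1), of "{v, a}" k, THEN conjunct1, rule_format, of Dh]
      assms shape(2,4)[OF assms(1)] tw Dh Dne by blast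
  then show ?thesis by simp
qed

text \<open>The edges \<open>{v, b}\<close>, \<open>{b, s}\<close> and \<open>{v, c}\<close> form a
  trinity meeting at \<open>b\<close>. The third edge at \<open>b\<close> is then twinned with
  \<open>{v, c}\<close>, which would have to be an end-edge of the path \<open>Dh\<close>.\<close>

lemma path_reroute:
  assumes p: "path_listing [a, v, b, s, t] Df" "k = {s, t}" and C4: "C4 \<in> \<C>" "{b, s} \<in> edges C4" "{v, c} \<in> edges C4"
  shows False
proof -
  have ip: "is_path Df" using p(1) unfolding is_path_def by (rule exI)
  have "is_path Dh" by (rule shape(4)[OF ip])
  then have ipc: "\<not> is_circuit Df" "\<not> is_circuit Dh" using path_not_circuit ip by auto
  have d: "distinct [a, v, b, s, t]" and mDf: "{b, s} \<in> edges Df" using p(1) by (simp_all add: path_listing_def)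
  have bF: "b \<notin> verts F" using shape(3)[OF ip] mem(3)[OF Df(1,3)] by blast
  obtain C5 where C5: "C5 \<in> \<C>" "{v, b} \<in> edges C5" "{v, c} \<in> edges C5"
    using cover2[OF EG(2,3) _ _ vF] by blast
  have fm: "{v, b} \<noteq> {b, s}" "{v, b} \<noteq> k" using d p(2) by (simp_all add: doubleton_eq_iff)
  have no: False if C: "C \<in> \<C>" "{v, b} \<in> edges C" "{b, s} \<in> edges C" "{v, c} \<in> edges C" for C
  proof -
    have "C \<noteq> Df" using C(4) hDf by blast
    then have "twinned \<C> {v, b} {b, s}" using twin[OF C(1) Df(1)] C Df mDf fm by blast
    then have "{v, b} \<in> end_edges Df" by (rule twin_path_end[OF _ Df(1,3) ip])
    then show False using shape(2)[OF ip] ene fm by auto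
  qed
  have bG: "b \<in> verts G" by (rule VG)
  obtain \<beta> where \<beta>: "\<beta> \<in> edges G" "b \<in> \<beta>" "\<beta> \<noteq> {v, b}" "\<beta> \<noteq> {b, s}" "{x \<in> edges G. b \<in> x} = {{v, b}, {b, s}, \<beta>}"
    by (rule third_edge[OF bG EG(2) mem(1)[OF Df(1) mDf]]) (use fm in auto)
  have sh: "\<beta> \<in> edges C4" "\<beta> \<in> edges C5"
    by (rule trinity_share(2,3)[OF Df(1,3) mDf C4 C5 no fm(1) _ _ \<beta>(1-4)]; simp)+
  have "\<beta> \<noteq> {v, c}" using \<beta>(2) ne by auto
  moreover have "C4 \<noteq> C5" using no[OF C4(1) _ C4(2,3)] C5(2) by blast
  ultimately have t: "twinned \<C> {v, c} \<beta>" using twin[OF C4(1) C5(1)] sh C4 C5 by blast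
  have "{v, c} \<in> end_edges Dh" by (rule twin_path_end[OF t Dh(1,3) \<open>is_path Dh\<close>])
  moreover have "end_edges Dh = {{v, a}, k}"
    by (rule config.shape(2)[OF swap \<open>is_path Dh\<close>])
  ultimately show False using ene by auto
qed

end

text \<open>The twinned edges meet in the vertex \<open>a\<close> of \<open>F\<close>:
  \<open>s\<close> is the other end of \<open>k\<close>, \<open>A\<close> the neighbour of
  \<open>a\<close> in \<open>F\<close>, and \<open>C0\<close> the member that continues from
  \<open>{v, b}\<close> to \<open>{v, c}\<close>. By (F6) no path of the framework touches the
  corner.\<close>

locale circ = config G F \<C> v a b c "{a, s}" Df Dh for G F :: "'a graph" and \<C> v a b c s Df Dh +
  fixes A :: 'a and C0 :: "'a graph"
  assumes cDfD: "is_circuit Df" and aF: "a \<in> verts F" "degree F a = 1" and AF: "{a, A} \<in> edges F"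
    and ata: "{d \<in> edges G. a \<in> d} = {{v, a}, {a, s}, {a, A}}"
    and nopath: "\<And>P w. P \<in> \<C> \<Longrightarrow> is_path P \<Longrightarrow> w \<in> {v, a, s} \<Longrightarrow> w \<notin> verts P"
    and C0: "C0 \<in> \<C>" "{v, b} \<in> edges C0" "{v, c} \<in> edges C0"

lemma (in config) to_circ:
  assumes "is_circuit Df"
  obtains s A C0 where "k = {a, s}" "circ G F \<C> v a b c s Df Dh A C0"
proof -
  obtain C0 where C0: "C0 \<in> \<C>" "{v, b} \<in> edges C0" "{v, c} \<in> edges C0"
    using cover2[OF EG(2,3) _ _ vF] by blast
  obtain w where w: "w \<in> verts F" "w \<in> {v, a}" "w \<in> k"
      "\<And>P w. P \<in> \<C> \<Longrightarrow> is_path P \<Longrightarrow> w \<in> verts P \<Longrightarrow> w \<notin> {v, a} \<and> w \<notin> k"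
  proof (rule twin_cases[OF tw Df(1,2,4)])
    fix w assume c: "w \<in> verts F" "w \<in> {v, a}" "w \<in> k"
      "\<And>P w. P \<in> \<C> \<Longrightarrow> is_path P \<Longrightarrow> w \<in> verts P \<Longrightarrow> w \<notin> {v, a} \<and> w \<notin> k"
    show thesis by (rule that[OF c])
  next
    assume "is_path Df"
    then show thesis using path_not_circuit assms by metis
  qed
  have wa: "w = a" using w(1,2) vF by auto
  have "a \<in> k" using w(3) wa by simp
  then obtain s where s: "k = {a, s}" "s \<noteq> a" using edge_pair[OF EG(4)] by meson
  have dF: "degree F a = 1" by (rule circuit_F(1)[OF Df(1) assms mem(3)[OF Df(1,2)]]) (use w wa in auto)
  obtain \<gamma> where "{x \<in> edges F. a \<in> x} = {\<gamma>}" by (rule card_1_singletonE[OF dF[unfolded degree_def]])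
  then have \<gamma>: "\<gamma> \<in> edges F" "a \<in> \<gamma>" by blast+
  obtain A where A: "\<gamma> = {a, A}" using edge_pair[of \<gamma> a] \<gamma> FE by blast
  have gG: "{a, A} \<in> edges G" using \<gamma> A FE by auto
  obtain g where g: "g \<in> edges G" "a \<in> g" "g \<noteq> {v, a}" "g \<noteq> k" "{d \<in> edges G. a \<in> d} = {{v, a}, k, g}"
    by (rule third_edge[OF VG(2) EG(1,4)]) (use ene s in auto)
  have "{a, A} \<in> {{v, a}, k, g}" unfolding g(5)[symmetric] using gG by simp
  moreover have "{a, A} \<noteq> {v, a}" "{a, A} \<noteq> k" using EF \<gamma> A by auto
  ultimately have gA: "g = {a, A}" by auto
  have "circ G F \<C> v a b c s Df Dh A C0"
    unfolding circ_def circ_axioms_def using assms w(1) wa dF \<gamma> A g(5) s(1) gA C0 config_axioms w(4) by auto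
  then show thesis by (rule that[OF s(1)])
qed

context circ begin

lemma Dh_circuit: "is_circuit Dh"
  using nopath[OF Dh(1), of v] mem(3)[OF Dh(1,2), of v] mem(5)[OF Dh(1)] by auto

lemma C0_circuit: "is_circuit C0"
  using nopath[OF C0(1), of v] mem(3)[OF C0(1,2), of v] mem(5)[OF C0(1)] by auto

lemma swapc: "circ G F \<C> v a c b s Dh Df A C0"
  unfolding circ_def circ_axioms_def using swap Dh_circuit aF AF ata nopath C0 by auto

lemma AG: "{a, A} \<in> edges G" using AF FE by auto

lemma sne: "s \<noteq> a" "s \<noteq> v" "s \<noteq> b" "A \<noteq> a"
proof -
  show "s \<noteq> a" "A \<noteq> a" using edge_pair[OF EG(4), of a] edge_pair[OF AG, of a] by (auto simp: doubleton_eq_iff)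
  show "s \<noteq> v" using vk by auto
  show "s \<noteq> b" using config.cDf[OF swap] mem(3)[OF Dh(1,4)] by auto
qed

lemma Fv: "w \<in> verts Df \<Longrightarrow> w \<in> verts F \<Longrightarrow> w = a"
  using circuit_F(2)[OF Df(1) cDfD mem(3)[OF Df(1,2)] aF(1)] by auto

lemma nF: "b \<notin> verts F" "s \<notin> verts F"
  using Fv[of b] Fv[of s] mem(3)[OF Df(1,3)] mem(3)[OF Df(1,4)] ne sne by auto

lemma Ane: "A \<noteq> v" "A \<noteq> b" "A \<noteq> s"
  using Fvert[OF AF, of A] vF nF by auto

lemma two_at:
  assumes "C \<in> \<C>" "v \<in> verts C \<or> a \<in> verts C \<or> s \<in> verts C" "w \<in> verts C"
  obtains p q where "p \<noteq> q" "p \<in> edges C" "q \<in> edges C" "w \<in> p" "w \<in> q"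
proof -
  have "is_circuit C" using nopath[OF assms(1)] mem(5)[OF assms(1)] assms(2) by blast
  then show thesis using circuit_two[OF assms(1) _ assms(3)] that by blast
qed

text \<open>The third edge at \<open>a\<close> is in \<open>F\<close>, so a member through
  \<open>a\<close> uses \<open>{v, a}\<close> and \<open>{a, s}\<close>, and at \<open>v\<close> it
  turns to \<open>b\<close> or to \<open>c\<close>. A second member with the same turn would give
  \<open>{v, a}\<close> a second twin.\<close>

lemma mem_a:
  assumes "C \<in> \<C>" "a \<in> verts C" shows "{v, a} \<in> edges C" "{a, s} \<in> edges C" "C = Df \<or> C = Dh"
proof -
  obtain p q where pq: "p \<noteq> q" "p \<in> edges C" "q \<in> edges C" "a \<in> p" "a \<in> q"
    by (rule two_at[OF assms(1) _ assms(2)]) (use assms in auto)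
  have "p \<in> {{v, a}, {a, s}, {a, A}}" "q \<in> {{v, a}, {a, s}, {a, A}}"
    unfolding ata[symmetric] using pq mem(1)[OF assms(1)] by simp_all
  moreover have "p \<noteq> {a, A}" "q \<noteq> {a, A}" using AF mem(2)[OF assms(1)] pq by auto
  ultimately show e: "{v, a} \<in> edges C" and k: "{a, s} \<in> edges C" using pq by auto
  have vC: "v \<in> verts C" using mem(3)[OF assms(1) e] by simp
  obtain p q where pq: "p \<noteq> q" "p \<in> edges C" "q \<in> edges C" "v \<in> p" "v \<in> q"
    by (rule two_at[OF assms(1) _ vC]) (use vC in auto)
  have "p \<in> {{v, a}, {v, b}, {v, c}}" "q \<in> {{v, a}, {v, b}, {v, c}}"
    unfolding at[symmetric] using pq mem(1)[OF assms(1)] by simp_all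
  then consider "{v, b} \<in> edges C" | "{v, c} \<in> edges C" using pq by auto
  then show "C = Df \<or> C = Dh"
  proof cases
    case 1
    have t: "twinned \<C> {v, a} {v, b}" if "C \<noteq> Df" using twin[OF assms(1) Df(1) that e 1 Df(2,3)] ene by simp
    have "C = Df"
    proof (rule ccontr)
      assume "C \<noteq> Df"
      show False by (rule two_twins[OF Df(1,3,4,2) _ t[OF \<open>C \<noteq> Df\<close>] tw]) (use ene in simp)
    qed
    then show ?thesis by simp
  next
    case 2
    have t: "twinned \<C> {v, a} {v, c}" if "C \<noteq> Dh" using twin[OF assms(1) Dh(1) that e 2 Dh(2,3)] ene by simp
    have "C = Dh"
    proof (rule ccontr)
      assume "C \<noteq> Dh"
      show False by (rule two_twins[OF Dh(1,3,4,2) _ t[OF \<open>C \<noteq> Dh\<close>] tw]) (use ene in simp)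
    qed
    then show ?thesis by simp
  qed
qed

lemma mem_e: "C \<in> \<C> \<Longrightarrow> {v, a} \<in> edges C \<Longrightarrow> C = Df \<or> C = Dh"
  using mem_a(3)[of C] mem(3)[of C "{v, a}" a] by simp

lemma mem_k: "C \<in> \<C> \<Longrightarrow> {a, s} \<in> edges C \<Longrightarrow> C = Df \<or> C = Dh"
  using mem_a(3)[of C] mem(3)[of C "{a, s}" a] by simp

lemma aC0: "a \<notin> verts C0"
proof
  assume "a \<in> verts C0"
  then have "{v, a} \<in> edges C0" by (rule mem_a(1)[OF C0(1)])
  then show False using deg2[OF C0, of "{v, a}" v] ene by simp
qed

lemma C0ne: "C0 \<noteq> Df" "C0 \<noteq> Dh"
  using aC0 mem(3)[OF Df(1,2)] mem(3)[OF Dh(1,2)] by auto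

text \<open>At \<open>v\<close> the circuit continues to \<open>a\<close> or to \<open>c\<close>. In
  the latter case a member other than \<open>C0\<close> would make \<open>{v, b}\<close> and
  \<open>{v, c}\<close> twinned on a circuit, and their common vertex is not in
  \<open>F\<close>.\<close>

lemma mem_f:
  assumes C: "C \<in> \<C>" "{v, b} \<in> edges C" shows "C = Df \<or> C = C0"
proof -
  have vC: "v \<in> verts C" using mem(3)[OF C] by simp
  obtain p q where pq: "p \<noteq> q" "p \<in> edges C" "q \<in> edges C" "v \<in> p" "v \<in> q"
    by (rule two_at[OF C(1) _ vC]) (use vC in auto)
  have "p \<in> {{v, a}, {v, b}, {v, c}}" "q \<in> {{v, a}, {v, b}, {v, c}}"
    unfolding at[symmetric] using pq mem(1)[OF C(1)] by simp_all
  then consider "{v, a} \<in> edges C" | "{v, c} \<in> edges C" using pq by auto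
  then show ?thesis
  proof cases
    case 1
    have "C \<noteq> Dh" using config.hDf[OF swap] C by auto
    then show ?thesis using mem_e[OF C(1) 1] by simp
  next
    case 2
    have False if "C \<noteq> C0"
    proof -
      have "twinned \<C> {v, b} {v, c}" using twin[OF C(1) C0(1) that C(2) 2 C0(2,3)] ene by simp
      then obtain t where "t \<in> verts F" "t \<in> {v, b}" "t \<in> {v, c}" by (rule twin_circuit[OF _ C0 C0_circuit])
      then show False using vF ne by auto
    qed
    then show ?thesis by blast
  qed
qed

text \<open>Another common edge would be twinned with \<open>{v, b}\<close>, and the two would meet
  in the only vertex of \<open>Df\<close> in \<open>F\<close>, which is \<open>a\<close>.\<close>

lemma i0: "d \<in> edges Df \<Longrightarrow> d \<in> edges C0 \<Longrightarrow> d = {v, b}"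
proof (rule ccontr)
  assume d: "d \<in> edges Df" "d \<in> edges C0" "d \<noteq> {v, b}"
  have "twinned \<C> {v, b} d" using twin[OF Df(1) C0(1) C0ne(1)[symmetric] Df(3) d(1) C0(2) d(2)] d(3) by simp
  then obtain t where "t \<in> verts F" "t \<in> {v, b}" "t \<in> verts Df" by (rule twin_circuit[OF _ Df(1,3) d(1) cDfD])
  then show False using Fv[of t] ne by auto
qed

text \<open>A third common edge would be a second twin of \<open>{v, a}\<close> on
  \<open>Df\<close>.\<close>

lemma ii: "d \<in> edges Df \<Longrightarrow> d \<in> edges Dh \<Longrightarrow> d = {v, a} \<or> d = {a, s}"
proof (rule ccontr)
  assume d: "d \<in> edges Df" "d \<in> edges Dh" "\<not> (d = {v, a} \<or> d = {a, s})"
  have t: "twinned \<C> {v, a} d" by (rule twin[OF Df(1) Dh(1) Dne Df(2) d(1) Dh(2) d(2)]) (use d(3) in metis)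
  show False by (rule two_twins[OF Df(1,4) d(1) Df(2) _ tw t]) (use d(3) ene(4) in \<open>simp, metis\<close>)
qed

lemma distinct6: "distinct [v, a, b, c, s, A]"
proof -
  interpret sw: circ G F \<C> v a c b s Dh Df A C0 by (rule swapc)
  show ?thesis using ne sne sw.sne Ane sw.Ane by auto
qed

end

section \<open>Hubs, feet of bridges, and new embeddings from old ones\<close>

text \<open>The hub is the first vertex at which a walk from \<open>p3\<close> meets a path from
  \<open>p1\<close> to \<open>p2\<close>; until then the walk uses no edge of that path.\<close>

lemma conn_three:
  assumes "conn T p1 p2" "conn T p3 p1"
  shows "\<exists>q. linked T [(q, p1), (q, p2), (q, p3)]"
proof -
  obtain vs where vs: "vs \<noteq> []" "distinct vs" "hd vs = p1" "last vs = p2" "consecutive_pairs vs \<subseteq> T"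
    using conn_path[OF assms(1)] by auto
  have "\<exists>q\<in>set vs. \<exists>S\<subseteq>T - consecutive_pairs vs. conn S q r" if "conn T r p1" for r
    using that[unfolded conn_def]
  proof (induction rule: converse_rtranclp_induct)
    case base
    show ?case using hd_in_set[OF vs(1)] vs(3) by (intro bexI[of _ p1] exI[of _ "{}"]) simp_all
  next
    case (step r r')
    show ?case
    proof (cases "r \<in> set vs")
      case True
      then show ?thesis by (intro bexI[of _ r] exI[of _ "{}"]) simp_all
    next
      case False
      obtain q S where q: "q \<in> set vs" "S \<subseteq> T - consecutive_pairs vs" "conn S q r'" using step.IH by blast
      have "{r, r'} \<notin> consecutive_pairs vs" using consecutive_pairs_subset[of "{r, r'}" vs] False by auto
      then have "insert {r, r'} S \<subseteq> T - consecutive_pairs vs" using q(2) step.hyps(1) by simp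
      moreover have "conn (insert {r, r'} S) q r"
        by (rule conn_trans[OF conn_mono[OF q(3)] conn_sym[OF conn_edge]]) auto
      ultimately show ?thesis using q(1) by (intro bexI[of _ q] exI[of _ "insert {r, r'} S"] conjI)
    qed
  qed
  from this[OF assms(2)] obtain q S where q: "q \<in> set vs" "S \<subseteq> T - consecutive_pairs vs" "conn S q p3" by (elim bexE exE conjE)
  obtain as bs where s: "vs = as @ q # bs" using split_list[OF q(1)] by (elim exE)
  have 1: "conn (consecutive_pairs (as @ [q])) q p1"
    by (rule conn_sym) (use conn_consecutive_pairs[of "as @ [q]"] vs(3) s in \<open>cases as; simp\<close>)
  have 2: "conn (consecutive_pairs (q # bs)) q p2"
    using conn_consecutive_pairs[of "q # bs"] vs(4) s by simp
  have P: "consecutive_pairs vs = consecutive_pairs (as @ [q]) \<union> consecutive_pairs (q # bs)"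
    unfolding s by (rule consecutive_pairs_append)
  have D: "consecutive_pairs (as @ [q]) \<inter> consecutive_pairs (q # bs) = {}"
    by (rule consecutive_pairs_disjoint) (use vs(2) s in simp)
  have "linked (consecutive_pairs (as @ [q]) \<union> (consecutive_pairs (q # bs) \<union> S)) [(q, p1), (q, p2), (q, p3)]"
    by (rule linked_Cons[OF 1 linked_Cons[OF 2 linked_single[OF q(3)]]]) (use D P q(2) in blast)+
  then have "linked T [(q, p1), (q, p2), (q, p3)]"
    by (rule linked_mono) (use P vs(5) q(2) in blast)
  then show ?thesis by blast
qed

lemma conn_first: "conn T p q \<Longrightarrow> p \<noteq> q \<Longrightarrow> \<exists>d\<in>T. p \<in> d"
  unfolding conn_def by (erule converse_rtranclpE) auto

lemma linked_split:
  assumes "is_path P" "ends P = {a, b}" "u \<in> verts P"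
  shows "linked (edges P) [(u, a), (u, b)]"
proof -
  obtain T1 T2 where T: "T1 \<inter> T2 = {}" "T1 \<union> T2 = edges P" "conn T1 a u" "conn T2 u b"
    using path_split[OF assms] by blast
  have "linked (T1 \<union> T2) [(u, a), (u, b)]"
    by (rule linked_Cons[OF conn_sym[OF T(3)] linked_single[OF T(4) subset_refl] T(1)])
  then show ?thesis using T(2) by simp
qed

text \<open>A branch vertex has three edges in the image and an interior vertex of an edge path has
  two, which leaves room for one further edge in the second case only.\<close>

lemma foot:
  assumes \<eta>: "hom_embedding \<eta> G H" and G: "cubic G" and H: "cubic H" and e: "e \<in> edges G" and p: "p \<in> verts (emap \<eta> e)"
    and d: "d \<in> edges H" "p \<in> d" "d \<notin> edges (image_graph \<eta> G)"
  shows "p \<in> internal_verts (emap \<eta> e)"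
    and "d' \<in> edges H \<Longrightarrow> p \<in> d' \<Longrightarrow> d' \<notin> edges (image_graph \<eta> G) \<Longrightarrow> d' = d"
proof -
  have sG: "simple_graph G" using G by (simp add: cubic_def)
  have sub: "edges (emap \<eta> g) \<subseteq> edges H" "edges (emap \<eta> g) \<subseteq> edges (image_graph \<eta> G)" if "g \<in> edges G" for g
    using hom_embeddingD(4)[OF \<eta> that] that by (auto simp: subgraph_def image_graph_def)
  have nend: "\<exists>d\<in>edges (emap \<eta> g). vmap \<eta> t \<in> d" if g: "g \<in> edges G" "t \<in> g" for g t
  proof -
    obtain r s where rs: "g = {r, s}" "r \<noteq> s" "r \<in> verts G" "s \<in> verts G" by (rule simple_edgeE[OF sG g(1)])
    have "ends (emap \<eta> g) = {vmap \<eta> r, vmap \<eta> s}" using hom_embeddingD(5)[OF \<eta> g(1)] rs(1) by simp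
    moreover have "vmap \<eta> r \<noteq> vmap \<eta> s" using inj_on_eq_iff[OF hom_embeddingD(1)[OF \<eta>] rs(3,4)] rs(2) by simp
    moreover have "t \<in> verts G" using g rs by auto
    ultimately show ?thesis
      by (intro path_at_end(1)[OF hom_embeddingD(3)[OF \<eta> g(1)]]) (use hom_embeddingD(8)[OF \<eta> \<open>t \<in> verts G\<close> g(1)] g(2) in simp_all)
  qed
  obtain a b where ab: "e = {a, b}" "a \<noteq> b" "a \<in> verts G" "b \<in> verts G" by (rule simple_edgeE[OF sG e])
  have en: "ends (emap \<eta> e) = {vmap \<eta> a, vmap \<eta> b}" "vmap \<eta> a \<noteq> vmap \<eta> b"
    using hom_embeddingD(5)[OF \<eta> e] ab inj_on_eq_iff[OF hom_embeddingD(1)[OF \<eta>] ab(3,4)] by simp_all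
  have nb: "p \<noteq> vmap \<eta> t" if t: "t \<in> verts G" for t
  proof
    assume pt: "p = vmap \<eta> t"
    obtain g1 g2 g3 where g: "distinct [g1, g2, g3]" "{g \<in> edges G. t \<in> g} = {g1, g2, g3}" by (rule cubic_edges_at[OF G t])
    have gG: "g1 \<in> edges G \<and> t \<in> g1" "g2 \<in> edges G \<and> t \<in> g2" "g3 \<in> edges G \<and> t \<in> g3"
      using g(2) by (metis (mono_tags, lifting) insertCI mem_Collect_eq)+
    obtain d1 where d1: "d1 \<in> edges (emap \<eta> g1)" "p \<in> d1" using nend gG(1) pt by metis
    obtain d2 where d2: "d2 \<in> edges (emap \<eta> g2)" "p \<in> d2" using nend gG(2) pt by metis
    obtain d3 where d3: "d3 \<in> edges (emap \<eta> g3)" "p \<in> d3" using nend gG(3) pt by metis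
    have i: "edges (emap \<eta> g1) \<inter> edges (emap \<eta> g2) = {}" "edges (emap \<eta> g1) \<inter> edges (emap \<eta> g3) = {}"
      "edges (emap \<eta> g2) \<inter> edges (emap \<eta> g3) = {}"
      using hom_embeddingD(6)[OF \<eta>] gG g(1) by simp_all
    have dd: "d1 \<noteq> d2" "d1 \<noteq> d3" "d2 \<noteq> d3" using i d1 d2 d3 by blast+
    have "d1 \<noteq> d" "d2 \<noteq> d" "d3 \<noteq> d" using sub(2) gG d1(1) d2(1) d3(1) d(3) by blast+
    moreover have "{d1, d2, d3, d} \<subseteq> edges H" using sub(1) gG d1 d2 d3 d(1) by blast
    ultimately show False using cubic_four_edges[OF H, of d1 d2 d3 d p] d1 d2 d3 d(2) dd by simp
  qed
  have pe: "p \<notin> {vmap \<eta> a, vmap \<eta> b}" using nb ab by auto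
  then show "p \<in> internal_verts (emap \<eta> e)" using p en by (simp add: internal_verts_def)
  assume d': "d' \<in> edges H" "p \<in> d'" "d' \<notin> edges (image_graph \<eta> G)"
  obtain d1 d2 where d12: "d1 \<in> edges (emap \<eta> e)" "d2 \<in> edges (emap \<eta> e)" "d1 \<noteq> d2" "p \<in> d1" "p \<in> d2"
    using path_at_end(2)[OF hom_embeddingD(3)[OF \<eta> e] en p pe] by blast
  have m: "{d1, d2, d', d} \<subseteq> edges H" "d1 \<noteq> d" "d2 \<noteq> d" "d1 \<noteq> d'" "d2 \<noteq> d'"
    using sub[OF e] d12 d d' by blast+
  show "d' = d" using cubic_four_edges[OF H m(1), of p] m d12 d d' by auto
qed

lemma spread_sub:
  fixes Re :: "'a set set"
  assumes "hom_embedding \<xi> \<Gamma> H" "cubic G" "cubic H" "verts G \<subseteq> verts \<Gamma>" "Re \<subseteq> edges G" "Re \<subseteq> edges \<Gamma>"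
    "\<And>g. g \<in> Re \<Longrightarrow> g \<inter> M = {}"
  shows "spread G H Re M (vmap \<xi>) (emap \<xi>)"
proof
  fix g assume g: "g \<in> Re"
  then have g\<Gamma>: "g \<in> edges \<Gamma>" using assms(6) by blast
  show "is_path (emap \<xi> g) \<and> subgraph (emap \<xi> g) H \<and> ends (emap \<xi> g) = vmap \<xi> ` g"
    using hom_embeddingD(3-5)[OF assms(1) g\<Gamma>] by simp
  fix g' assume "g' \<in> Re" "g \<noteq> g'"
  then show "edges (emap \<xi> g) \<inter> edges (emap \<xi> g') = {}"
    using hom_embeddingD(6)[OF assms(1) g\<Gamma>] assms(6) by blast
next
  show "inj_on (vmap \<xi>) (verts G - M)"
    by (rule inj_on_subset[OF hom_embeddingD(1)[OF assms(1)]]) (use assms(4) in blast)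
  show "vmap \<xi> ` (verts G - M) \<subseteq> verts H" using hom_embeddingD(2)[OF assms(1)] assms(4) by blast
qed (use assms in auto)

lemma (in spread) place_simps:
  "place [] t = vm t" "place ((u, p) # al) t = (if t = u then p else place al t)"
  by (simp_all add: place_def)

text \<open>The edges of \<open>G\<close> fall into three kinds: those in \<open>D\<close> are
  deleted, those in \<open>R\<close> get new images, and all others keep theirs. \<open>Nw\<close>
  are the edges at the added vertices \<open>xs\<close>.\<close>

lemma (in spread) embed:
  assumes G': "cubic G'" "verts G' = verts G \<union> set xs" "set xs \<inter> verts G = {}" "edges G' = (edges G - D) \<union> Nw"
    and Nw: "\<And>g. g \<in> Nw \<Longrightarrow> g \<inter> set xs \<noteq> {}"
    and R: "R \<subseteq> edges G" "R \<inter> D = {}" "J \<subseteq> D \<union> R"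
    and old: "\<And>g. g \<in> edges G \<Longrightarrow> g \<notin> D \<union> R \<Longrightarrow> g \<in> Re \<and> g \<inter> fst ` set al = {}"
    and al: "M \<subseteq> fst ` set al" "set xs \<subseteq> fst ` set al" "distinct (map fst al)" "distinct (map snd al)"
      "snd ` set al \<subseteq> verts H" "\<And>t. t \<in> verts G - M \<Longrightarrow> t \<notin> fst ` set al \<Longrightarrow> vm t \<notin> snd ` set al"
    and N: "(\<lambda>(i, j). {i, j}) ` set N = R \<union> Nw"
    and L: "linked (free J) L" "routes L Is (map (map_prod (place al) (place al)) N)" "distinct (concat Is)"
  shows "\<exists>\<eta>. hom_embedding \<eta> G' H \<and> (\<forall>g\<in>edges G - (D \<union> R). emap \<eta> g = em g) \<and>
    (\<forall>t\<in>verts G. t \<notin> fst ` set al \<longrightarrow> vmap \<eta> t = vm t)"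
proof -
  let ?Old = "edges G - (D \<union> R)"
  have v: "verts G' \<subseteq> (verts G - M) \<union> fst ` set al" using G'(2) al(1,2) by blast
  have o1: "?Old \<subseteq> edges G'" using G'(4) by blast
  have o2: "?Old \<subseteq> Re - J" using old R(3) by blast
  have o3: "g \<inter> fst ` set al = {}" if "g \<in> ?Old" for g using old[of g] that by blast
  have "g \<notin> edges G" if "g \<in> Nw" for g
  proof
    assume "g \<in> edges G"
    then have "g \<subseteq> verts G" using G by (simp add: cubic_def simple_graph_def)
    then show False using Nw[OF that] G'(3) by blast
  qed
  then have n: "edges G' - ?Old = (\<lambda>(i, j). {i, j}) ` set N" unfolding N G'(4) using R by blast
  have "\<exists>\<eta>. hom_embedding \<eta> G' H \<and> (\<forall>g\<in>?Old. emap \<eta> g = em g) \<and>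
    (\<forall>t\<in>verts G'. t \<notin> fst ` set al \<longrightarrow> vmap \<eta> t = vm t)"
    by (rule spread_glue[OF G'(1) v al(3-6) o1 o2 o3 n L])
  then show ?thesis unfolding G'(2) by blast
qed

text \<open>Images of edges outside \<open>Re\<close> avoid all kept images, so they are available
  without giving up anything.\<close>

lemma (in spread) linked_off:
  assumes "hom_embedding \<xi> \<Gamma> H" "cubic \<Gamma>" "Re \<subseteq> edges \<Gamma>" "em = emap \<xi>" "vm = vmap \<xi>"
    "\<And>i j. (i, j) \<in> set L \<Longrightarrow> {i, j} \<in> edges \<Gamma>" "\<And>i j. (i, j) \<in> set L \<Longrightarrow> {i, j} \<notin> Re"
    "distinct (map (\<lambda>(i, j). {i, j}) L)"
  shows "linked (free {}) (map (map_prod vm vm) L)"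
proof -
  have "linked (\<Union>e\<in>(\<lambda>(i, j). {i, j}) ` set L. edges (emap \<xi> e)) (map (map_prod (vmap \<xi>) (vmap \<xi>)) L)"
    by (rule hom_linked[OF assms(1,2)]) (use assms(6,8) in auto)
  then have l: "linked (\<Union>e\<in>(\<lambda>(i, j). {i, j}) ` set L. edges (emap \<xi> e)) (map (map_prod vm vm) L)"
    unfolding assms(5) .
  have 1: "(\<lambda>(i, j). {i, j}) q \<in> edges \<Gamma> - Re" if "q \<in> set L" for q
    using assms(6)[of "fst q" "snd q"] assms(7)[of "fst q" "snd q"] that by (simp add: case_prod_beta)
  have 2: "edges (emap \<xi> e) \<subseteq> free {}" if e: "e \<in> edges \<Gamma> - Re" for e
  proof -
    have "edges (emap \<xi> e) \<subseteq> edges H" using hom_embeddingD(4)[OF assms(1), of e] e by (simp add: subgraph_def)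
    moreover have "edges (emap \<xi> e) \<inter> edges (emap \<xi> g) = {}" if "g \<in> Re" for g
      using hom_embeddingD(6)[OF assms(1), of e g] e that assms(3) by blast
    ultimately have "edges (emap \<xi> e) \<subseteq> edges H - (\<Union>g\<in>Re - {}. edges (em g))" unfolding assms(4) by blast
    then show ?thesis unfolding free_def .
  qed
  show ?thesis by (rule linked_mono[OF l UN_least[OF 2]]) (use 1 in blast)
qed

lemma connected_conn: "connected_graph K \<longleftrightarrow> verts K \<noteq> {} \<and> (\<forall>u\<in>verts K. \<forall>v\<in>verts K. conn (edges K) u v)"
proof -
  have "conn (edges K) u v \<longleftrightarrow> (u, v) \<in> {(a, b). adjacent K a b}\<^sup>*" for u v
    unfolding conn_def adjacent_def using rtranclp_rtrancl_eq[of "\<lambda>a b. {a, b} \<in> edges K" u v] by simp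
  then show ?thesis unfolding connected_graph_def by simp
qed

lemma not_at: "{d \<in> E. a \<in> d} = S \<Longrightarrow> S \<subseteq> T \<Longrightarrow> d \<in> E \<Longrightarrow> d \<notin> T \<Longrightarrow> a \<notin> d"
  by blast

lemma claw_old: "d \<in> edges G \<Longrightarrow> d \<notin> {e, f, g} \<Longrightarrow> d \<in> edges (claw G e f g x y z w)"
  by (simp add: claw_def)

section \<open>Consequences of the conditions on \<open>H\<close>\<close>

locale setting = frame G F \<C> for G F :: "'a::infinite graph" and \<C> +
  fixes H :: "'b graph" and \<eta>F :: "('a, 'b) embedding"
  assumes e1: "E1 F \<C> H \<eta>F" and e2: "E2 G F \<C> H \<eta>F" and e3: "E3 G F \<C> H \<eta>F"
    and e4: "E4 G F \<C> H \<eta>F" and e5: "E5 G F \<C> H \<eta>F"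
begin

lemma H: "cubic H" "cyclically_connected 4 H" "twinned \<C> e f \<Longrightarrow> cyclically_connected 5 H"
  using e1 by (auto simp: E1_def)

text \<open>By (E1) the image is a single edge. Hence no bridge attaches to an edge of
  \<open>F\<close>, and no path lands inside its image.\<close>

lemma F_no_internal:
  assumes "hom_embedding \<xi> \<Gamma> H" "extends \<xi> \<eta>F F" "e \<in> edges F" "e \<in> edges \<Gamma>"
  shows "internal_verts (emap \<xi> e) = {}"
proof -
  have "card (edges (emap \<xi> e)) = 1" using assms(2,3) e1 by (simp add: extends_def E1_def)
  moreover obtain vs where vs: "path_listing vs (emap \<xi> e)" using hom_embeddingD(3)[OF assms(1,4)] by (auto simp: is_path_def)
  ultimately have "length vs = 2" using path_listing_card_edges(1)[OF vs] by simp
  then obtain p q where "vs = [p, q]" by (cases vs; cases "tl vs") auto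
  then show ?thesis using vs ends_path_listing[OF vs] by (simp add: internal_verts_def path_listing_def)
qed

text \<open>Respecting concerns \<open>F\<close> without its leaves only, so leaves of
  \<open>F\<close> and the edges of \<open>F\<close> at them may be rerouted.\<close>

lemma respectsI:
  assumes "extends \<xi> \<eta>F F" and em: "\<And>d. d \<in> edges G \<Longrightarrow> d \<notin> X \<Longrightarrow> emap \<rho> d = emap \<xi> d"
    and vm: "\<And>t. t \<in> verts G \<Longrightarrow> t \<notin> S \<Longrightarrow> vmap \<rho> t = vmap \<xi> t"
    and X: "\<And>d. d \<in> X \<Longrightarrow> d \<in> edges F \<Longrightarrow> \<exists>t\<in>d. degree F t = 1"
    and S: "\<And>t. t \<in> S \<Longrightarrow> t \<in> verts F \<Longrightarrow> degree F t = 1"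
  shows "respects_embedding \<rho> \<eta>F F"
proof -
  have "emap \<rho> d = emap \<eta>F d" if "d \<in> edges (delete_leaves F)" for d
  proof -
    have d: "d \<in> edges F" "\<And>t. t \<in> d \<Longrightarrow> degree F t \<noteq> 1"
      using that Fvert[of d] by (auto simp: delete_leaves_def delete_verts_def)
    then have "emap \<rho> d = emap \<xi> d" using em X FE by blast
    then show ?thesis using assms(1) d(1) by (simp add: extends_def)
  qed
  moreover have "vmap \<rho> t = vmap \<eta>F t" if "t \<in> verts (delete_leaves F)" for t
  proof -
    have t: "t \<in> verts F" "degree F t \<noteq> 1" using that by (auto simp: delete_leaves_def delete_verts_def)
    then have "vmap \<rho> t = vmap \<xi> t" using vm S FE by blast
    then show ?thesis using assms(1) t(1) by (simp add: extends_def)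
  qed
  ultimately show ?thesis by (simp add: respects_embedding_def extends_def)
qed

lemma pair_common:
  assumes "e \<in> edges G" "e \<notin> edges F" "f \<in> edges G" "f \<notin> edges F" "e \<noteq> f"
    "plus2 G e f x y G'" "hom_embedding \<rho> G' H" "respects_embedding \<rho> \<eta>F F"
  shows "\<exists>C\<in>\<C>. e \<in> edges C \<and> f \<in> edges C"
  using e2[unfolded E2_def, rule_format, of e f] assms by blast

text \<open>In the image \<open>x\<close>, \<open>a\<close>, \<open>b\<close>, \<open>y\<close>,
  \<open>w\<close> form a pentagon. Its other side through \<open>w\<close> can replace the edge
  \<open>{a, b}\<close>; as \<open>w\<close> also leads to \<open>g\<close>, this yields an
  embedding of \<open>G\<close> with \<open>{a, b}\<close> joined to \<open>g\<close>, and (E2)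
  applies.\<close>

lemma pentagon:
  assumes \<xi>: "hom_embedding \<xi> (claw G {a, a'} {b, b'} g x y z w) H" and ext: "extends \<xi> \<eta>F F"
    and fr: "distinct [x, y, z, w]" "{x, y, z, w} \<inter> verts G = {}"
    and E: "{a, a'} \<in> edges G" "{b, b'} \<in> edges G" "g \<in> edges G" "{a, b} \<in> edges G"
    and EF: "{a, a'} \<notin> edges F" "{b, b'} \<notin> edges F" "g \<notin> edges F" "{a, b} \<notin> edges F"
    and ne: "a \<noteq> b" "a \<noteq> b'" "a' \<noteq> b" "a \<notin> g" "b \<notin> g" and F: "a \<notin> verts F" "b \<notin> verts F"
  shows "\<exists>C\<in>\<C>. {a, b} \<in> edges C \<and> g \<in> edges C"
proof -
  obtain s t where g: "g = {s, t}" "s \<noteq> t" "s \<in> verts G" "t \<in> verts G" by (rule simple_edgeE[OF sG E(3)])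
  have V: "a \<in> verts G" "a' \<in> verts G" "b \<in> verts G" "b' \<in> verts G" "a \<noteq> a'" "b \<noteq> b'"
    using edge_pair[OF E(1), of a] edge_pair[OF E(1), of a'] edge_pair[OF E(2), of b] edge_pair[OF E(2), of b'] by auto
  have e: "{a, a'} \<noteq> {a, b}" "{b, b'} \<noteq> {a, b}" using ne V by (auto simp: doubleton_eq_iff)
  obtain p where p: "p \<in> edges G" "a \<in> p" "p \<noteq> {a, a'}" "p \<noteq> {a, b}" "{d \<in> edges G. a \<in> d} = {{a, a'}, {a, b}, p}"
    by (rule third_edge[OF V(1) E(1,4)]) (use e in auto)
  obtain q where q: "q \<in> edges G" "b \<in> q" "q \<noteq> {b, b'}" "q \<noteq> {a, b}" "{d \<in> edges G. b \<in> d} = {{b, b'}, {a, b}, q}"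
    by (rule third_edge[OF V(3) E(2,4)]) (use e in auto)
  obtain a2 where a2: "p = {a, a2}" "a2 \<noteq> a" "a2 \<in> verts G" using edge_pair[OF p(1,2)] by blast
  obtain b2 where b2: "q = {b, b2}" "b2 \<noteq> b" "b2 \<in> verts G" using edge_pair[OF q(1,2)] by blast
  have ne2: "a2 \<noteq> b" "b2 \<noteq> a" "a2 \<noteq> a'" "b2 \<noteq> b'" using p(3,4) q(3,4) a2(1) b2(1) by (auto simp: insert_commute)
  have fg: "u \<notin> {x, y, z, w}" if "u \<in> verts G" for u using fr(2) that by auto
  note new = fg[OF V(1)] fg[OF V(2)] fg[OF V(3)] fg[OF V(4)] fg[OF g(3)] fg[OF g(4)] fg[OF a2(3)] fg[OF b2(3)]
  have st: "s \<noteq> a" "t \<noteq> a" "s \<noteq> b" "t \<noteq> b" using g(1) ne by auto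
  have dis3: "distinct [{a, a'}, {b, b'}, g]" using ne st g(1) V by (auto simp: doubleton_eq_iff)
  let ?\<Gamma> = "claw G {a, a'} {b, b'} g x y z w"
  have c\<Gamma>: "cubic ?\<Gamma>" by (rule cubic_claw[OF G E(1-3) dis3 fr])
  have sel: "verts ?\<Gamma> = verts G \<union> {x, y, z, w}" "edges ?\<Gamma> = (edges G - {{a, a'}, {b, b'}, g}) \<union>
     {{x, a}, {x, a'}, {y, b}, {y, b'}, {z, s}, {z, t}, {w, x}, {w, y}, {w, z}}"
    unfolding g(1) by (rule claw_sel)+
  let ?Re = "{d \<in> edges G. d \<notin> {{a, a'}, {b, b'}, g} \<and> d \<inter> {a, b} = {}}"
  have Re\<Gamma>: "?Re \<subseteq> edges ?\<Gamma>" by (rule subsetI, rule claw_old) simp_all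
  interpret sp: spread G H ?Re "{a, b}" "vmap \<xi>" "emap \<xi>"
    by (rule spread_sub[OF \<xi> G H(1) _ _ Re\<Gamma>]) (simp_all add: sel(1) subset_iff)
  let ?v = "vmap \<xi>"
  let ?L = "[(x, a), (x, a'), (y, b), (y, b'), (a, a2), (b, b2), (w, x), (w, y), (w, z), (z, s), (z, t)]"
  have L: "linked (sp.free {}) (map (map_prod ?v ?v) ?L)"
  proof (rule sp.linked_off[OF \<xi> c\<Gamma> Re\<Gamma> refl refl])
    fix i j assume ij: "(i, j) \<in> set ?L"
    have "p \<notin> {{a, a'}, {b, b'}, g}" "q \<notin> {{a, a'}, {b, b'}, g}"
      using a2 b2 ne ne2 V st g(1) by (auto simp: doubleton_eq_iff)
    then have "{a, a2} \<in> edges ?\<Gamma>" "{b, b2} \<in> edges ?\<Gamma>" unfolding sel using p(1) q(1) a2(1) b2(1) by simp_all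
    moreover have "{x, a} \<in> edges ?\<Gamma>" "{x, a'} \<in> edges ?\<Gamma>" "{y, b} \<in> edges ?\<Gamma>" "{y, b'} \<in> edges ?\<Gamma>" "{z, s} \<in> edges ?\<Gamma>"
      "{z, t} \<in> edges ?\<Gamma>" "{w, x} \<in> edges ?\<Gamma>" "{w, y} \<in> edges ?\<Gamma>" "{w, z} \<in> edges ?\<Gamma>" unfolding sel by simp_all
    ultimately show "{i, j} \<in> edges ?\<Gamma>" using ij by auto
    have "i \<in> {x, y, z, w} \<or> i = a \<or> i = b" using ij by auto
    then show "{i, j} \<notin> ?Re"
    proof
      assume "i \<in> {x, y, z, w}"
      then have "i \<notin> verts G" using fr(2) by blast
      then have "{i, j} \<notin> edges G" using edge_pair[of "{i, j}" i] by auto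
      then show ?thesis by simp
    qed auto
  next
    have n: "p \<noteq> r \<and> r \<noteq> p" if "p \<in> {x, y, z, w}" "r \<in> verts G" for p r using fr(2) that by auto
    note n' = n[OF _ V(1)] n[OF _ V(2)] n[OF _ V(3)] n[OF _ V(4)] n[OF _ g(3)] n[OF _ g(4)] n[OF _ a2(3)] n[OF _ b2(3)]
    show "distinct (map (\<lambda>(i, j). {i, j}) ?L)"
      using n' fr(1) V(5,6) g(2) ne(1) ne2(1) by (simp add: doubleton_eq_iff)
  qed
  have rv: "distinct [w, z, y, x]" "w \<noteq> a" "w \<noteq> b" "z \<noteq> a" "z \<noteq> b" "b \<noteq> a" using fr(1) new ne(1) by auto
  have abg: "{a, b} \<noteq> g" using ne by auto
  have wz: "w \<notin> verts G" "z \<notin> verts G" "w \<noteq> z" using fr by auto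
  obtain G' where G': "plus2 G {a, b} g w z G'" by (rule plus2I[OF E(4,3) abg wz])
  note P = plus2D[OF G'[unfolded g(1)]]
  \<comment> \<open>The vertices \<open>a\<close> and \<open>b\<close> move to the feet of the claw.
    Their old images become interior points of the paths to \<open>a2\<close> and \<open>b2\<close>,
    and the old image of \<open>{a, b}\<close> is dropped.\<close>
  let ?al = "[(a, ?v x), (b, ?v y), (w, ?v w), (z, ?v z)]"
  have xG: "{x, y, z, w} \<subseteq> verts ?\<Gamma>" unfolding sel by auto
  have vi: "?v i = ?v j \<longleftrightarrow> i = j" if "i \<in> verts ?\<Gamma>" "j \<in> verts ?\<Gamma>" for i j
    by (rule inj_on_eq_iff[OF hom_embeddingD(1)[OF \<xi>] that])
  have "\<exists>\<rho>. hom_embedding \<rho> G' H \<and> (\<forall>d\<in>edges G - ({{a, b}, g} \<union> {{a, a'}, {b, b'}, p, q}). emap \<rho> d = emap \<xi> d) \<and>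
    (\<forall>t\<in>verts G. t \<notin> fst ` set ?al \<longrightarrow> vmap \<rho> t = ?v t)"
  proof (rule sp.embed[where xs = "[w, z]" and J = "{}" and L = "map (map_prod ?v ?v) ?L"
        and N = "[(a, a'), (b, b'), (a, a2), (b, b2), (w, a), (w, b), (z, s), (z, t), (w, z)]"
        and Is = "[[1], [3], [0, 4], [2, 5], [6], [7], [9], [10], [8]]"])
    show "cubic G'" by (rule cubic_plus2[OF G G'])
    show "verts G' = verts G \<union> set [w, z]" using P(7) by simp
    show "edges G' = (edges G - {{a, b}, g}) \<union> {{w, a}, {w, b}, {z, s}, {z, t}, {w, z}}" using P(8) g(1) by simp
    have "{a, a'} \<noteq> g" "{b, b'} \<noteq> g" "p \<noteq> g" "q \<noteq> g" using ne(4,5) p(2) q(2) by blast+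
    then show "{{a, a'}, {b, b'}, p, q} \<inter> {{a, b}, g} = {}"
      using e p(4) q(4) by (simp add: Int_insert_left)
    show "linked (sp.free {}) (map (map_prod ?v ?v) ?L)" by (rule L)
    fix d assume d: "d \<in> edges G" "d \<notin> {{a, b}, g} \<union> {{a, a'}, {b, b'}, p, q}"
    have "d \<subseteq> verts G" using d(1) sG by (simp add: simple_graph_def)
    moreover have "a \<notin> d" by (rule not_at[OF p(5) _ d]) simp
    moreover have "b \<notin> d" by (rule not_at[OF q(5) _ d]) simp
    ultimately show "d \<in> ?Re \<and> d \<inter> fst ` set ?al = {}" using d fr(2) by (simp add: subset_iff) blast
  next
    show "snd ` set ?al \<subseteq> verts H" using hom_embeddingD(2)[OF \<xi>] xG by auto
    fix t assume "t \<in> verts G - {a, b}" "t \<notin> fst ` set ?al"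
    then show "?v t \<notin> snd ` set ?al" using vi[of t] xG fg[of t] sel(1) by auto
  next
    show "distinct (map snd ?al)" using vi xG fr(1) by auto
    show "distinct (map fst ?al)" using fr(1) ne new by auto
  next
    show "routes (map (map_prod ?v ?v) ?L) [[1], [3], [0, 4], [2, 5], [6], [7], [9], [10], [8]]
       (map (map_prod (sp.place ?al) (sp.place ?al)) [(a, a'), (b, b'), (a, a2), (b, b2), (w, a), (w, b), (z, s), (z, t), (w, z)])"
      using ne ne2 st new V fr(1) a2(2) b2(2) rv by (simp add: sp.place_simps)
  qed (use fr E p(1) q(1) a2(1) b2(1) new in \<open>auto simp: insert_commute\<close>)
  then obtain \<rho> where \<rho>0: "hom_embedding \<rho> G' H \<and> (\<forall>d\<in>edges G - ({{a, b}, g} \<union> {{a, a'}, {b, b'}, p, q}). emap \<rho> d = emap \<xi> d) \<and>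
    (\<forall>t\<in>verts G. t \<notin> fst ` set ?al \<longrightarrow> vmap \<rho> t = ?v t)" by (elim exE)
  have \<rho>: "hom_embedding \<rho> G' H" "\<And>d. d \<in> edges G \<Longrightarrow> d \<notin> {{a, b}, g} \<union> {{a, a'}, {b, b'}, p, q} \<Longrightarrow> emap \<rho> d = emap \<xi> d"
    "\<And>t. t \<in> verts G \<Longrightarrow> t \<notin> {a, b, w, z} \<Longrightarrow> vmap \<rho> t = ?v t" using \<rho>0 by simp_all
  have r: "respects_embedding \<rho> \<eta>F F"
  proof (rule respectsI[OF ext \<rho>(2,3)])
    fix d assume "d \<in> {{a, b}, g} \<union> {{a, a'}, {b, b'}, p, q}" "d \<in> edges F"
    then show "\<exists>t\<in>d. degree F t = 1" using EF F Fvert[of p a] Fvert[of q b] p(2) q(2) by auto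
  next
    fix t assume "t \<in> {a, b, w, z}" "t \<in> verts F"
    then show "degree F t = 1" using F FE(2) fr(2) by auto
  qed
  show ?thesis by (rule pair_common[OF E(4) EF(4) E(3) EF(3) abg G' \<rho>(1) r])
qed

end

text \<open>A bridge without attachments would come from a component of \<open>H\<close> that no
  edge leaves, giving an empty cut.\<close>

lemma bridge_no_attachment:
  assumes \<eta>: "hom_embedding \<eta> G H" and G: "cubic G" and H: "cyclically_connected k H" "0 < k" and B: "bridge \<eta> G H B"
  shows "\<exists>e. attachment \<eta> G B e"
proof (rule ccontr)
  assume no: "\<not> ?thesis"
  have sG: "simple_graph G" using G by (simp add: cubic_def)
  have cH: "cubic H" using H(1) by (simp add: cyclically_connected_def)
  have off: "p \<notin> verts (image_graph \<eta> G)" if p: "p \<in> verts B" for p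
  proof
    assume "p \<in> verts (image_graph \<eta> G)"
    then consider t where "t \<in> verts G" "p = vmap \<eta> t" | e where "e \<in> edges G" "p \<in> verts (emap \<eta> e)"
      by (auto simp: image_graph_def)
    then show False
    proof cases
      case 1
      obtain g1 g2 g3 where g: "distinct [g1, g2, g3]" "{g \<in> edges G. t \<in> g} = {g1, g2, g3}" by (rule cubic_edges_at[OF G 1(1)])
      have "g1 \<in> {g \<in> edges G. t \<in> g}" unfolding g(2) by simp
      then have g1: "g1 \<in> edges G" "t \<in> g1" by simp_all
      have "p \<in> verts (emap \<eta> g1)" using hom_embeddingD(8)[OF \<eta> 1(1) g1(1)] g1(2) 1(2) by simp
      then show False using no g1(1) p by (auto simp: attachment_def)
    next
      case 2
      then show False using no p by (auto simp: attachment_def)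
    qed
  qed
  have "verts B \<noteq> {}" using B by (auto simp: bridge_def connected_graph_def)
  let ?Hd = "delete_verts H (verts (image_graph \<eta> G))"
  have "\<not> (\<exists>e. B = Graph e {e} \<and> e \<subseteq> verts (image_graph \<eta> G))"
    using off \<open>verts B \<noteq> {}\<close> by auto
  then obtain K where K: "component K ?Hd" "B = (let D = {e \<in> edges H. e \<inter> verts K \<noteq> {}} in Graph (\<Union>D) D)"
    using B by (auto simp: bridge_def)
  have subK: "subgraph K ?Hd" and cK: "connected_graph K"
    and max: "\<And>K'. subgraph K' ?Hd \<Longrightarrow> connected_graph K' \<Longrightarrow> subgraph K K' \<Longrightarrow> K' = K"
    using K(1) by (auto simp: component_def)
  have VK: "verts K \<subseteq> verts H" "verts K \<inter> verts (image_graph \<eta> G) = {}" using subK by (auto simp: subgraph_def delete_verts_def)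
  \<comment> \<open>A neighbour of \<open>K\<close> is also off the image, since the joining edge
    belongs to \<open>B\<close>. By maximality of the component it lies in \<open>K\<close>.\<close>
  have closed: "q \<in> verts K" if d: "{p, q} \<in> edges H" "p \<in> verts K" for p q
  proof -
    have "{p, q} \<subseteq> verts B" using K(2) d by (auto simp: Let_def)
    then have o: "p \<notin> verts (image_graph \<eta> G)" "q \<notin> verts (image_graph \<eta> G)" using off by auto
    have pq: "p \<in> verts H" "q \<in> verts H" using d(1) cH by (auto simp: cubic_def simple_graph_def)
    let ?K = "Graph (insert q (verts K)) (insert {p, q} (edges K))"
    have "subgraph ?K ?Hd" using subK o pq d unfolding subgraph_def delete_verts_def by auto
    moreover have "connected_graph ?K"
    proof -
      have c: "conn (insert {p, q} (edges K)) u p" if "u \<in> insert q (verts K)" for u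
      proof (cases "u = q")
        case True then show ?thesis by (metis conn_edge insert_commute insertI1)
      next
        case False
        then have "conn (edges K) u p" using that d(2) cK by (simp add: connected_conn)
        then show ?thesis by (rule conn_mono) blast
      qed
      show ?thesis unfolding connected_conn
        using c conn_trans conn_sym by (metis graph.sel insert_not_empty)
    qed
    moreover have "subgraph K ?K" using subK by (auto simp: subgraph_def)
    ultimately have "?K = K" by (rule max)
    then show ?thesis by (metis graph.sel(1) insertI1)
  qed
  have "cut H (verts K) = {}"
  proof -
    have "card (e \<inter> verts K) \<noteq> 1" if e: "e \<in> edges H" for e
    proof
      assume "card (e \<inter> verts K) = 1"
      then obtain p where p: "e \<inter> verts K = {p}" by (rule card_1_singletonE)
      have "simple_graph H" using cH by (simp add: cubic_def)
      then obtain r s where rs: "e = {r, s}" "r \<noteq> s" by (rule simple_edgeE[OF _ e])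
      have "r \<in> verts K \<longleftrightarrow> s \<in> verts K" using closed[of r s] closed[of s r] e rs(1) by (auto simp: insert_commute)
      moreover have "p \<in> e" "p \<in> verts K" "\<And>t. t \<in> e \<Longrightarrow> t \<in> verts K \<Longrightarrow> t = p" using p by blast+
      ultimately show False using rs by (metis insertCI insertE singletonD)
    qed
    then show ?thesis by (auto simp: cut_def)
  qed
  moreover obtain t where t: "t \<in> verts G" using G by (auto simp: cubic_def)
  have "vmap \<eta> t \<in> verts H - verts K"
    using hom_embeddingD(2)[OF \<eta>] t VK(2) by (auto simp: image_graph_def)
  moreover have "verts K \<noteq> {}" using cK by (simp add: connected_graph_def)
  ultimately have "k \<le> card (cut H (verts K))"
    by (intro cyclically_connected_cut[OF H(1) VK(1)]) auto
  then show False using \<open>cut H (verts K) = {}\<close> H(2) by simp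
qed

section \<open>What a bridge with two or three attachments provides\<close>

locale bridged = setting G F \<C> H \<eta>F for G F :: "'a::infinite graph" and \<C> and H :: "'b graph" and \<eta>F +
  fixes \<eta> :: "('a, 'b) embedding" and B :: "'b graph"
  assumes \<eta>: "hom_embedding \<eta> G H" and ext: "extends \<eta> \<eta>F F" and B: "bridge \<eta> G H B"
begin

lemma B_edges: "edges B \<subseteq> edges H" "edges B \<inter> edges (image_graph \<eta> G) = {}"
  using B by (auto simp: bridge_def subgraph_def)

lemma B_conn: "p \<in> verts B \<Longrightarrow> q \<in> verts B \<Longrightarrow> conn (edges B) p q"
  using B by (auto simp: bridge_def connected_conn)

lemma B_edge: "p \<in> verts B \<Longrightarrow> \<exists>d\<in>edges B. p \<in> d"
  using B by (auto simp: bridge_def Let_def)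

lemma feet:
  assumes "attachment \<eta> G B e"
  obtains p where "e \<in> edges G" "e \<notin> edges F" "p \<in> verts B" "p \<in> internal_verts (emap \<eta> e)" "p \<in> verts (emap \<eta> e)"
proof -
  obtain p where p: "e \<in> edges G" "p \<in> verts B" "p \<in> verts (emap \<eta> e)" using assms by (auto simp: attachment_def)
  obtain d where d: "d \<in> edges B" "p \<in> d" using B_edge[OF p(2)] by blast
  have i: "p \<in> internal_verts (emap \<eta> e)"
    by (rule foot(1)[OF \<eta> G H(1) p(1,3) _ d(2)]) (use d(1) B_edges in auto)
  then have "e \<notin> edges F" using F_no_internal[OF \<eta> ext _ p(1)] by auto
  then show thesis using that p i by blast
qed

lemma one_B_edge:
  assumes "e \<in> edges G" "p \<in> verts (emap \<eta> e)" "d \<in> edges B" "d' \<in> edges B" "p \<in> d" "p \<in> d'"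
  shows "d = d'"
  by (rule foot(2)[OF \<eta> G H(1) assms(1,2) _ assms(6) _ _ assms(5)]) (use assms B_edges in auto)

lemma spr: "spread G H (edges G) {} (vmap \<eta>) (emap \<eta>)"
  by (rule spread_sub[OF \<eta> G H(1)]) auto

sublocale sp: spread G H "edges G" "{}" "vmap \<eta>" "emap \<eta>"
  by (rule spr)

lemma B_free: "edges B \<subseteq> sp.free J"
  using B_edges unfolding sp.free_def image_graph_def by auto

lemma emap_free: "e \<in> J \<Longrightarrow> e \<in> edges G \<Longrightarrow> edges (emap \<eta> e) \<subseteq> sp.free J"
  using hom_embeddingD(4)[OF \<eta>, of e] hom_embeddingD(6)[OF \<eta>, of e] unfolding sp.free_def subgraph_def by blast

lemma emap_split:
  assumes "{a, b} \<in> edges G" "p \<in> verts (emap \<eta> {a, b})"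
  shows "linked (edges (emap \<eta> {a, b})) [(p, vmap \<eta> a), (p, vmap \<eta> b)]"
  by (rule linked_split[OF hom_embeddingD(3)[OF \<eta> assms(1)] _ assms(2)]) (use hom_embeddingD(5)[OF \<eta> assms(1)] in simp)

lemma emap_B: "e \<in> edges G \<Longrightarrow> edges B \<inter> edges (emap \<eta> e) = {}"
  using B_edges by (auto simp: image_graph_def)

lemma internal_off: "e \<in> edges G \<Longrightarrow> p \<in> internal_verts (emap \<eta> e) \<Longrightarrow> t \<in> verts G \<Longrightarrow> vmap \<eta> t \<noteq> p"
  using hom_embeddingD(8)[OF \<eta>, of t e] hom_embeddingD(5)[OF \<eta>, of e] by (auto simp: internal_verts_def)

lemma internal_ne: "e \<in> edges G \<Longrightarrow> f \<in> edges G \<Longrightarrow> e \<noteq> f \<Longrightarrow> p \<in> internal_verts (emap \<eta> e) \<Longrightarrow> p \<notin> verts (emap \<eta> f)"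
  using hom_embeddingD(7)[OF \<eta>, of e f] by blast

lemma emap_H: "e \<in> edges G \<Longrightarrow> p \<in> verts (emap \<eta> e) \<Longrightarrow> p \<in> verts H"
  using hom_embeddingD(4)[OF \<eta>, of e] by (auto simp: subgraph_def)

text \<open>Two feet joined through the bridge embed \<open>G\<close> with an edge added between
  \<open>e\<close> and \<open>f\<close>, and (E2) yields the member.\<close>

lemma pair:
  assumes e: "attachment \<eta> G B e" and f: "attachment \<eta> G B f" and ef: "e \<noteq> f"
  shows "\<exists>C\<in>\<C>. e \<in> edges C \<and> f \<in> edges C"
proof -
  obtain p where p: "e \<in> edges G" "e \<notin> edges F" "p \<in> verts B" "p \<in> internal_verts (emap \<eta> e)" "p \<in> verts (emap \<eta> e)" by (rule feet[OF e])
  obtain q where q: "f \<in> edges G" "f \<notin> edges F" "q \<in> verts B" "q \<in> internal_verts (emap \<eta> f)" "q \<in> verts (emap \<eta> f)" by (rule feet[OF f])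
  obtain a b where ab: "e = {a, b}" "a \<noteq> b" "a \<in> verts G" "b \<in> verts G" by (rule simple_edgeE[OF sG p(1)])
  obtain c d where cd: "f = {c, d}" "c \<noteq> d" "c \<in> verts G" "d \<in> verts G" by (rule simple_edgeE[OF sG q(1)])
  obtain x y where xy: "x \<noteq> y" "x \<notin> verts G" "y \<notin> verts G"
    using fresh_list[OF finG(1), of 2] by (auto simp: length_Suc_conv numeral_2_eq_2)
  obtain G' where G': "plus2 G e f x y G'" by (rule plus2I[OF p(1) q(1) ef xy(2,3,1)])
  note P = plus2D[OF G'[unfolded ab(1) cd(1)]]
  let ?v = "vmap \<eta>" and ?al = "[(x, p), (y, q)]"
  have "linked (edges B \<union> (edges (emap \<eta> e) \<union> edges (emap \<eta> f))) ([(p, q)] @ [(p, ?v a), (p, ?v b)] @ [(q, ?v c), (q, ?v d)])"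
    by (intro linked_append linked_single[OF B_conn[OF p(3) q(3)] subset_refl] emap_split[of a b, folded ab(1)] emap_split[of c d, folded cd(1)]
        p q Int_Un_distrib[THEN trans] hom_embeddingD(6)[OF \<eta> p(1) q(1) ef])
      (use emap_B[OF p(1)] emap_B[OF q(1)] in simp)
  then have L: "linked (sp.free {e, f}) [(p, q), (p, ?v a), (p, ?v b), (q, ?v c), (q, ?v d)]"
    by (simp only: append_Cons append_Nil) (erule linked_mono, intro Un_least B_free emap_free; use p q in simp)
  have nt: "t \<noteq> x" "t \<noteq> y" if "t \<in> verts G" for t using that xy by auto
  have "\<exists>\<rho>. hom_embedding \<rho> G' H \<and> (\<forall>d\<in>edges G - ({e, f} \<union> {}). emap \<rho> d = emap \<eta> d) \<and>
    (\<forall>t\<in>verts G. t \<notin> fst ` set ?al \<longrightarrow> vmap \<rho> t = ?v t)"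
  proof (rule sp.embed[where xs = "[x, y]" and J = "{e, f}" and N = "[(x, y), (x, a), (x, b), (y, c), (y, d)]"
        and Is = "[[0], [1], [2], [3], [4]]", OF _ _ _ _ _ _ _ _ _ _ _ _ _ _ _ _ L])
    show "cubic G'" by (rule cubic_plus2[OF G G'])
    show "verts G' = verts G \<union> set [x, y]" using P(7) by simp
    show "edges G' = (edges G - {e, f}) \<union> {{x, a}, {x, b}, {y, c}, {y, d}, {x, y}}" using P(8) ab(1) cd(1) by simp
    fix g assume g: "g \<in> edges G"
    have "g \<subseteq> verts G" using g sG by (simp add: simple_graph_def)
    then show "g \<in> edges G \<and> g \<inter> fst ` set ?al = {}" using g xy by auto
  next
    show "distinct (map snd ?al)" using internal_ne[OF p(1) q(1) ef p(4)] q(5) by auto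
    show "snd ` set ?al \<subseteq> verts H" using emap_H p q by auto
    fix t assume "t \<in> verts G - {}"
    then show "?v t \<notin> snd ` set ?al" using internal_off[OF p(1,4), of t] internal_off[OF q(1,4), of t] by simp
  next
    show "routes [(p, q), (p, ?v a), (p, ?v b), (q, ?v c), (q, ?v d)] [[0], [1], [2], [3], [4]]
     (map (map_prod (sp.place ?al) (sp.place ?al)) [(x, y), (x, a), (x, b), (y, c), (y, d)])"
      using nt[OF ab(3)] nt[OF ab(4)] nt[OF cd(3)] nt[OF cd(4)] xy xy(1)[symmetric] by (simp add: sp.place_simps)
  qed (use xy in auto)
  then obtain \<rho> where \<rho>0: "hom_embedding \<rho> G' H \<and> (\<forall>d\<in>edges G - ({e, f} \<union> {}). emap \<rho> d = emap \<eta> d) \<and>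
    (\<forall>t\<in>verts G. t \<notin> fst ` set ?al \<longrightarrow> vmap \<rho> t = ?v t)" by (elim exE)
  have \<rho>: "hom_embedding \<rho> G' H" "\<And>d. d \<in> edges G \<Longrightarrow> d \<notin> {e, f} \<Longrightarrow> emap \<rho> d = emap \<eta> d"
    "\<And>t. t \<in> verts G \<Longrightarrow> t \<notin> {x, y} \<Longrightarrow> vmap \<rho> t = ?v t" using \<rho>0 by simp_all
  have r: "respects_embedding \<rho> \<eta>F F"
    by (rule respectsI[OF ext \<rho>(2,3), where X = "{e, f}" and S = "{x, y}"]) (use p(2) q(2) xy FE in auto)
  show ?thesis by (rule pair_common[OF p(1,2) q(1,2) ef G' \<rho>(1) r])
qed

text \<open>The claw has its feet where the bridge meets the three images and its centre at a hub
  inside the bridge. It remains to be seen that the hub is not on the image.\<close>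

lemma three:
  assumes e: "attachment \<eta> G B e" and f: "attachment \<eta> G B f" and g: "attachment \<eta> G B g" and d3: "distinct [e, f, g]"
    and fr: "distinct [x, y, z, w]" "{x, y, z, w} \<inter> verts G = {}"
  shows "\<exists>\<xi>. hom_embedding \<xi> (claw G e f g x y z w) H \<and> extends \<xi> \<eta>F F"
proof -
  obtain p where p: "e \<in> edges G" "e \<notin> edges F" "p \<in> verts B" "p \<in> internal_verts (emap \<eta> e)" "p \<in> verts (emap \<eta> e)" by (rule feet[OF e])
  obtain q where q: "f \<in> edges G" "f \<notin> edges F" "q \<in> verts B" "q \<in> internal_verts (emap \<eta> f)" "q \<in> verts (emap \<eta> f)" by (rule feet[OF f])
  obtain r where r: "g \<in> edges G" "g \<notin> edges F" "r \<in> verts B" "r \<in> internal_verts (emap \<eta> g)" "r \<in> verts (emap \<eta> g)" by (rule feet[OF g])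
  obtain a b where ab: "e = {a, b}" "a \<noteq> b" "a \<in> verts G" "b \<in> verts G" by (rule simple_edgeE[OF sG p(1)])
  obtain c d where cd: "f = {c, d}" "c \<noteq> d" "c \<in> verts G" "d \<in> verts G" by (rule simple_edgeE[OF sG q(1)])
  obtain s t where st: "g = {s, t}" "s \<noteq> t" "s \<in> verts G" "t \<in> verts G" by (rule simple_edgeE[OF sG r(1)])
  have ne: "e \<noteq> f" "e \<noteq> g" "f \<noteq> g" using d3 by auto
  have pqr: "p \<noteq> q" "p \<noteq> r" "q \<noteq> r"
    using internal_ne[OF p(1) q(1) ne(1) p(4)] internal_ne[OF p(1) r(1) ne(2) p(4)] internal_ne[OF q(1) r(1) ne(3) q(4)] q(5) r(5) by auto
  obtain hb where hb: "linked (edges B) [(hb, p), (hb, q), (hb, r)]"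
    using conn_three[OF B_conn[OF p(3) q(3)] B_conn[OF r(3) p(3)]] by blast
  obtain T where T: "\<And>i. i < 3 \<Longrightarrow> T i \<subseteq> edges B" "conn (T 0) hb p" "conn (T (Suc 0)) hb q" "conn (T 2) hb r"
      "\<And>i j. i < 3 \<Longrightarrow> j < 3 \<Longrightarrow> i \<noteq> j \<Longrightarrow> T i \<inter> T j = {}"
  proof (rule linkedE[OF hb])
    fix T assume a: "\<And>i. i < length [(hb, p), (hb, q), (hb, r)] \<Longrightarrow> T i \<subseteq> edges B"
      "\<And>i. i < length [(hb, p), (hb, q), (hb, r)] \<Longrightarrow> conn (T i) (fst ([(hb, p), (hb, q), (hb, r)] ! i)) (snd ([(hb, p), (hb, q), (hb, r)] ! i))"
      "\<And>i j. i < length [(hb, p), (hb, q), (hb, r)] \<Longrightarrow> j < length [(hb, p), (hb, q), (hb, r)] \<Longrightarrow> i \<noteq> j \<Longrightarrow> T i \<inter> T j = {}"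
    show thesis by (rule that[of T]) (use a(1,3) a(2)[of 0] a(2)[of 1] a(2)[of 2] in simp_all)
  qed
  \<comment> \<open>At most one of the three feet can be the hub, so two of its disjoint connections
    are nontrivial and start with different edges.\<close>
  have two: "\<exists>d1\<in>edges B. \<exists>d2\<in>edges B. d1 \<noteq> d2 \<and> hb \<in> d1 \<and> hb \<in> d2"
  proof -
    have two': ?thesis if ij: "i < 3" "j < 3" "i \<noteq> j" "conn (T i) hb u" "conn (T j) hb u'" "hb \<noteq> u" "hb \<noteq> u'" for i j u u'
    proof -
      obtain d1 where d1: "d1 \<in> T i" "hb \<in> d1" using conn_first[OF ij(4,6)] by blast
      obtain d2 where d2: "d2 \<in> T j" "hb \<in> d2" using conn_first[OF ij(5,7)] by blast
      have "d1 \<noteq> d2" using T(5)[OF ij(1-3)] d1 d2 by blast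
      then show ?thesis using d1 d2 T(1)[OF ij(1)] T(1)[OF ij(2)] by blast
    qed
    consider "hb \<noteq> p" "hb \<noteq> q" | "hb = p" | "hb = q" by blast
    then show ?thesis
    proof cases
      case 1 then show ?thesis using two'[OF _ _ _ T(2,3)] by simp
    next
      case 2 then show ?thesis using two'[OF _ _ _ T(3,4)] pqr by simp
    next
      case 3 then show ?thesis using two'[OF _ _ _ T(2,4)] pqr by simp
    qed
  qed
  then obtain d1 d2 where d12: "d1 \<in> edges B" "d2 \<in> edges B" "d1 \<noteq> d2" "hb \<in> d1" "hb \<in> d2" by blast
  \<comment> \<open>A vertex on the image has at most one edge in the bridge.\<close>
  have oe: "hb \<notin> verts (emap \<eta> e')" if "e' \<in> edges G" for e' using one_B_edge[OF that _ d12(1,2,4,5)] d12(3) by blast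
  have ov: "vmap \<eta> u \<noteq> hb" if u: "u \<in> verts G" for u
  proof
    assume hb: "vmap \<eta> u = hb"
    obtain g1 g2 g3 where gs: "distinct [g1, g2, g3]" "{g \<in> edges G. u \<in> g} = {g1, g2, g3}" by (rule cubic_edges_at[OF G u])
    have "g1 \<in> {g \<in> edges G. u \<in> g}" unfolding gs(2) by simp
    then have g1: "g1 \<in> edges G" "u \<in> g1" by simp_all
    show False using hom_embeddingD(8)[OF \<eta> u g1(1)] g1(2) oe[OF g1(1)] hb by simp
  qed
  have oH: "hb \<in> verts H" using d12(1,4) B_edges(1) H(1) by (auto simp: cubic_def simple_graph_def)
  have opqr: "hb \<noteq> p" "hb \<noteq> q" "hb \<noteq> r" using oe p(1,5) q(1,5) r(1,5) by auto
  let ?v = "vmap \<eta>" and ?al = "[(x, p), (y, q), (z, r), (w, hb)]"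
  have "linked (edges B \<union> (edges (emap \<eta> e) \<union> (edges (emap \<eta> f) \<union> edges (emap \<eta> g))))
     ([(hb, p), (hb, q), (hb, r)] @ [(p, ?v a), (p, ?v b)] @ [(q, ?v c), (q, ?v d)] @ [(r, ?v s), (r, ?v t)])"
    by (intro linked_append hb emap_split[of a b, folded ab(1)] emap_split[of c d, folded cd(1)] emap_split[of s t, folded st(1)] p q r)
      (use emap_B[OF p(1)] emap_B[OF q(1)] emap_B[OF r(1)] hom_embeddingD(6)[OF \<eta> p(1) q(1) ne(1)]
        hom_embeddingD(6)[OF \<eta> p(1) r(1) ne(2)] hom_embeddingD(6)[OF \<eta> q(1) r(1) ne(3)] in \<open>simp_all add: Int_Un_distrib\<close>)
  then have L: "linked (sp.free {e, f, g}) [(hb, p), (hb, q), (hb, r), (p, ?v a), (p, ?v b), (q, ?v c), (q, ?v d), (r, ?v s), (r, ?v t)]"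
    by (simp only: append_Cons append_Nil) (erule linked_mono, intro Un_least B_free emap_free; use p q r in simp)
  have nt: "u \<noteq> x" "u \<noteq> y" "u \<noteq> z" "u \<noteq> w" if "u \<in> verts G" for u using that fr by auto
  note sel = claw_sel[of G a b c d s t x y z w]
  have "\<exists>\<rho>. hom_embedding \<rho> (claw G e f g x y z w) H \<and> (\<forall>d\<in>edges G - ({e, f, g} \<union> {}). emap \<rho> d = emap \<eta> d) \<and>
    (\<forall>t\<in>verts G. t \<notin> fst ` set ?al \<longrightarrow> vmap \<rho> t = ?v t)"
  proof (rule sp.embed[where xs = "[x, y, z, w]" and J = "{e, f, g}" and N = "[(w, x), (w, y), (w, z), (x, a), (x, b), (y, c), (y, d), (z, s), (z, t)]"
        and Is = "[[0], [1], [2], [3], [4], [5], [6], [7], [8]]", OF _ _ _ _ _ _ _ _ _ _ _ _ _ _ _ _ L])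
    show "cubic (claw G e f g x y z w)" by (rule cubic_claw[OF G p(1) q(1) r(1) d3 fr])
    show "verts (claw G e f g x y z w) = verts G \<union> set [x, y, z, w]" by (simp add: claw_def)
    show "edges (claw G e f g x y z w) = (edges G - {e, f, g}) \<union> {{x, a}, {x, b}, {y, c}, {y, d}, {z, s}, {z, t}, {w, x}, {w, y}, {w, z}}"
      unfolding ab(1) cd(1) st(1) by (rule sel)
    fix h assume h: "h \<in> edges G"
    have "h \<subseteq> verts G" using h sG by (simp add: simple_graph_def)
    then show "h \<in> edges G \<and> h \<inter> fst ` set ?al = {}" using h fr(2) by auto
  next
    show "distinct (map snd ?al)" using pqr opqr by simp
    show "snd ` set ?al \<subseteq> verts H" using emap_H p q r oH by auto
    fix t assume "t \<in> verts G - {}"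
    then show "?v t \<notin> snd ` set ?al"
      using internal_off[OF p(1,4), of t] internal_off[OF q(1,4), of t] internal_off[OF r(1,4), of t] ov[of t] by simp
  next
    show "routes [(hb, p), (hb, q), (hb, r), (p, ?v a), (p, ?v b), (q, ?v c), (q, ?v d), (r, ?v s), (r, ?v t)] [[0], [1], [2], [3], [4], [5], [6], [7], [8]]
     (map (map_prod (sp.place ?al) (sp.place ?al)) [(w, x), (w, y), (w, z), (x, a), (x, b), (y, c), (y, d), (z, s), (z, t)])"
      using nt[OF ab(3)] nt[OF ab(4)] nt[OF cd(3)] nt[OF cd(4)] nt[OF st(3)] nt[OF st(4)] fr fr(1)[unfolded distinct_rev[symmetric, of "[x, y, z, w]"]] by (simp add: sp.place_simps)
  qed (use fr in auto)
  then obtain \<rho> where \<rho>0: "hom_embedding \<rho> (claw G e f g x y z w) H \<and> (\<forall>d\<in>edges G - ({e, f, g} \<union> {}). emap \<rho> d = emap \<eta> d) \<and>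
    (\<forall>t\<in>verts G. t \<notin> fst ` set ?al \<longrightarrow> vmap \<rho> t = ?v t)" by (elim exE)
  have \<rho>: "hom_embedding \<rho> (claw G e f g x y z w) H" "\<And>d. d \<in> edges G \<Longrightarrow> d \<notin> {e, f, g} \<Longrightarrow> emap \<rho> d = emap \<eta> d"
    "\<And>t. t \<in> verts G \<Longrightarrow> t \<notin> {x, y, z, w} \<Longrightarrow> vmap \<rho> t = ?v t" using \<rho>0 by simp_all
  have "extends \<rho> \<eta>F F"
    unfolding extends_def
  proof (intro conjI ballI)
    fix h assume h: "h \<in> edges F"
    then have "emap \<rho> h = emap \<eta> h" using \<rho>(2)[of h] FE(1) p(2) q(2) r(2) by auto
    then show "emap \<rho> h = emap \<eta>F h" using ext h by (simp add: extends_def)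
  next
    fix t assume t: "t \<in> verts F"
    then have "vmap \<rho> t = vmap \<eta> t" using \<rho>(3)[of t] FE(2) fr(2) by auto
    then show "vmap \<rho> t = vmap \<eta>F t" using ext t by (simp add: extends_def)
  qed
  then show ?thesis using \<rho>(1) by blast
qed

end

lemma (in setting) fresh4: obtains x y z w where "distinct [x, y, z, w]" "{x, y, z, w} \<inter> verts G = {}"
proof -
  obtain xs where "length xs = 4 \<and> distinct xs \<and> set xs \<inter> verts G = {}" using fresh_list[OF finG(1), of 4] by (elim exE)
  moreover from this obtain x y z w where "xs = [x, y, z, w]" by (auto simp: length_Suc_conv eval_nat_numeral)
  ultimately show thesis using that[of x y z w] by simp
qed

abbreviation eds :: "('a \<times> 'a) list \<Rightarrow> 'a set set" where "eds N \<equiv> (\<lambda>(i, j). {i, j}) ` set N"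

section \<open>Embeddings obtained after a path has landed\<close>

text \<open>A path has left the cluster and reached the image of \<open>{j1, j2}\<close> at
  \<open>u\<close>. \<open>M\<close> contains the cluster vertices that belong to \<open>G\<close>;
  outside them \<open>\<Gamma>\<close> contains the edges of \<open>G\<close>.\<close>

locale landed = setting G F \<C> H \<eta>F for G F :: "'a::infinite graph" and \<C> and H :: "'b graph" and \<eta>F +
  fixes \<xi> :: "('a, 'b) embedding" and \<Gamma> :: "'a graph" and M :: "'a set" and j1 j2 :: 'a and u :: 'b
  assumes \<xi>: "hom_embedding \<xi> \<Gamma> H" and ext: "extends \<xi> \<eta>F F" and V\<Gamma>: "verts G \<subseteq> verts \<Gamma>"
    and Re\<Gamma>: "{d \<in> edges G. d \<inter> M = {}} \<subseteq> edges \<Gamma>"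
    and jG: "{j1, j2} \<in> edges G" and jM: "j1 \<notin> M" "j2 \<notin> M" and uj: "u \<in> internal_verts (emap \<xi> {j1, j2})"
begin

abbreviation "Rest \<equiv> {d \<in> edges G. d \<inter> M = {}}"

abbreviation "vx \<equiv> vmap \<xi>"

abbreviation "lands G' X S \<equiv> \<exists>\<rho>. hom_embedding \<rho> G' H \<and> (\<forall>d\<in>edges G - X. emap \<rho> d = emap \<xi> d) \<and>
  (\<forall>t\<in>verts G. t \<notin> S \<longrightarrow> vmap \<rho> t = vmap \<xi> t)"

lemma spr: "spread G H Rest M (vmap \<xi>) (emap \<xi>)"
  by (rule spread_sub[OF \<xi> G H(1) V\<Gamma> _ Re\<Gamma>]) simp_all

sublocale sp: spread G H Rest M "vmap \<xi>" "emap \<xi>"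
  by (rule spr)

lemma j\<Gamma>: "{j1, j2} \<in> edges \<Gamma>"
  by (rule subsetD[OF Re\<Gamma>]) (use jG jM in simp)

lemma jF: "{j1, j2} \<notin> edges F"
  using F_no_internal[OF \<xi> ext _ j\<Gamma>] uj by auto

lemma jV: "j1 \<in> verts G" "j2 \<in> verts G" "j1 \<noteq> j2"
  using edge_pair[OF jG, of j1] edge_pair[OF jG, of j2] by auto

lemma uH: "u \<in> verts H"
  using hom_embeddingD(4)[OF \<xi> j\<Gamma>] uj by (auto simp: subgraph_def internal_verts_def)

lemma u_off: "t \<in> verts G \<Longrightarrow> vmap \<xi> t \<noteq> u"
  using hom_embeddingD(8)[OF \<xi> subsetD[OF V\<Gamma>] j\<Gamma>, of t] hom_embeddingD(5)[OF \<xi> j\<Gamma>] uj by (auto simp: internal_verts_def)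

lemma vm_eq: "s \<in> verts G \<Longrightarrow> t \<in> verts G \<Longrightarrow> vmap \<xi> s = vmap \<xi> t \<longleftrightarrow> s = t"
  by (rule inj_on_eq_iff[OF hom_embeddingD(1)[OF \<xi>]]) (use V\<Gamma> in auto)

text \<open>Positions that can be given to moved or added vertices without collision, apart from
  \<open>u\<close> itself.\<close>

definition good :: "'b \<Rightarrow> bool" where
  "good r \<longleftrightarrow> r \<in> verts H \<and> r \<noteq> u \<and> (\<forall>t\<in>verts G - M. vmap \<xi> t \<noteq> r)"

text \<open>\<open>ms\<close> are the vertices to be moved; each edge at one of them must be deleted
  or rerouted (\<open>mv\<close>). Rerouted edges are listed in \<open>Nold\<close>, edges at the
  added vertices in \<open>Nnew\<close>, each as pairs in the order of the walks
  \<open>Is\<close>.\<close>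

lemma land:
  assumes G': "cubic G'" "verts G' = verts G \<union> set xs" "set xs \<inter> verts G = {}"
      "edges G' = (edges G - D) \<union> eds Nnew"
    and Nnew: "\<And>i j. (i, j) \<in> set Nnew \<Longrightarrow> i \<in> set xs \<or> j \<in> set xs"
    and Nold: "\<And>i j. (i, j) \<in> set Nold \<Longrightarrow> {i, j} \<in> edges G \<and> {i, j} \<notin> D"
    and J: "J \<subseteq> D \<union> eds Nold"
    and mv: "\<And>t. t \<in> set ms \<Longrightarrow> {d \<in> edges G. t \<in> d} \<subseteq> D \<union> eds Nold" "M \<subseteq> set ms" "set ms \<subseteq> verts G"
    and al: "map fst al = ms @ xs" "distinct ms" "distinct xs" "distinct (map snd al)"
      "\<And>q. q \<in> snd ` set al \<Longrightarrow> q = u \<or> good q \<or> q \<in> vmap \<xi> ` set ms"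
    and L: "linked (sp.free J) L" "routes L Is (map (map_prod (sp.place al) (sp.place al)) (Nold @ Nnew))" "distinct (concat Is)"
  shows "\<exists>\<rho>. hom_embedding \<rho> G' H \<and>
      (\<forall>d\<in>edges G - (D \<union> eds Nold). emap \<rho> d = emap \<xi> d) \<and>
      (\<forall>t\<in>verts G. t \<notin> set ms \<longrightarrow> vmap \<rho> t = vmap \<xi> t)"
proof -
  let ?R = "eds Nold" and ?Nw = "eds Nnew"
  have fa: "fst ` set al = set ms \<union> set xs" using arg_cong[OF al(1), of set] by simp
  have "\<exists>\<rho>. hom_embedding \<rho> G' H \<and> (\<forall>d\<in>edges G - (D \<union> ?R). emap \<rho> d = emap \<xi> d) \<and>
      (\<forall>t\<in>verts G. t \<notin> fst ` set al \<longrightarrow> vmap \<rho> t = vmap \<xi> t)"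
  proof (rule sp.embed[OF G'(1,2,3,4), where R = ?R and al = al and N = "Nold @ Nnew", OF _ _ _ J _ _ _ _ _ _ _ _ L])
    fix g assume "g \<in> ?Nw"
    then show "g \<inter> set xs \<noteq> {}" using Nnew by auto
  next
    show "?R \<subseteq> edges G" "?R \<inter> D = {}" using Nold by auto
  next
    fix g assume g: "g \<in> edges G" "g \<notin> D \<union> ?R"
    have "g \<subseteq> verts G" using g(1) sG by (simp add: simple_graph_def)
    moreover have "g \<inter> set ms = {}" using mv(1) g by blast
    ultimately show "g \<in> Rest \<and> g \<inter> fst ` set al = {}" unfolding fa using g(1) mv(2) G'(3) by blast
  next
    show "M \<subseteq> fst ` set al" "set xs \<subseteq> fst ` set al" unfolding fa using mv(2) by auto
    show "distinct (map fst al)" unfolding al(1) using al(2,3) mv(3) G'(3) by auto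
    show "distinct (map snd al)" by (rule al(4))
    show "snd ` set al \<subseteq> verts H"
    proof
      fix q assume "q \<in> snd ` set al"
      then have "q = u \<or> good q \<or> q \<in> vmap \<xi> ` set ms" by (rule al(5))
      then show "q \<in> verts H" using uH hom_embeddingD(2)[OF \<xi>] mv(3) V\<Gamma> by (auto simp: good_def)
    qed
    fix t assume t: "t \<in> verts G - M" "t \<notin> fst ` set al"
    show "vmap \<xi> t \<notin> snd ` set al"
    proof
      assume q: "vmap \<xi> t \<in> snd ` set al"
      have "vmap \<xi> t \<notin> vmap \<xi> ` set ms" using vm_eq t mv(3) unfolding fa by blast
      then show False using al(5)[OF q] u_off[of t] t(1) by (auto simp: good_def)
    qed
  next
    show "(\<lambda>(i, j). {i, j}) ` set (Nold @ Nnew) = ?R \<union> ?Nw" by (simp add: image_Un)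
  qed
  then obtain \<rho> where \<rho>: "hom_embedding \<rho> G' H \<and> (\<forall>d\<in>edges G - (D \<union> ?R). emap \<rho> d = emap \<xi> d) \<and>
      (\<forall>t\<in>verts G. t \<notin> fst ` set al \<longrightarrow> vmap \<rho> t = vmap \<xi> t)" by (elim exE)
  have "vmap \<rho> t = vmap \<xi> t" if "t \<in> verts G" "t \<notin> set ms" for t
    using \<rho> that G'(3) unfolding fa by blast
  then show ?thesis using \<rho> by (intro exI[of _ \<rho>] conjI ballI impI) simp_all
qed

lemma landed_respects:
  assumes "\<exists>\<rho>. hom_embedding \<rho> G' H \<and>
      (\<forall>d\<in>edges G - X. emap \<rho> d = emap \<xi> d) \<and> (\<forall>t\<in>verts G. t \<notin> S \<longrightarrow> vmap \<rho> t = vmap \<xi> t)"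
    and "\<And>d. d \<in> X \<Longrightarrow> d \<in> edges F \<Longrightarrow> \<exists>t\<in>d. degree F t = 1" "\<And>t. t \<in> S \<Longrightarrow> t \<in> verts F \<Longrightarrow> degree F t = 1"
  obtains \<rho> where "hom_embedding \<rho> G' H" "respects_embedding \<rho> \<eta>F F"
proof -
  obtain \<rho> where \<rho>: "hom_embedding \<rho> G' H \<and>
      (\<forall>d\<in>edges G - X. emap \<rho> d = emap \<xi> d) \<and> (\<forall>t\<in>verts G. t \<notin> S \<longrightarrow> vmap \<rho> t = vmap \<xi> t)" using assms(1) by (elim exE)
  have "respects_embedding \<rho> \<eta>F F"
    by (rule respectsI[OF ext _ _ assms(2,3)]) (use \<rho> in simp_all)
  then show thesis by (rule that[OF conjunct1[OF \<rho>]])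
qed

lemma landed_extends:
  assumes "\<exists>\<rho>. hom_embedding \<rho> G' H \<and>
      (\<forall>d\<in>edges G - X. emap \<rho> d = emap \<xi> d) \<and> (\<forall>t\<in>verts G. t \<notin> S \<longrightarrow> vmap \<rho> t = vmap \<xi> t)"
    and "X \<inter> edges F = {}" "S \<inter> verts F = {}"
  shows "\<exists>\<rho>. hom_embedding \<rho> G' H \<and> extends \<rho> \<eta>F F"
proof -
  obtain \<rho> where \<rho>: "hom_embedding \<rho> G' H \<and>
      (\<forall>d\<in>edges G - X. emap \<rho> d = emap \<xi> d) \<and> (\<forall>t\<in>verts G. t \<notin> S \<longrightarrow> vmap \<rho> t = vmap \<xi> t)" using assms(1) by (elim exE)
  have "extends \<rho> \<eta>F F"
    unfolding extends_def
  proof (intro conjI ballI)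
    fix h assume h: "h \<in> edges F"
    then have "emap \<rho> h = emap \<xi> h" using \<rho> FE(1) assms(2) by blast
    then show "emap \<rho> h = emap \<eta>F h" using ext h by (simp add: extends_def)
  next
    fix t assume t: "t \<in> verts F"
    then have "vmap \<rho> t = vmap \<xi> t" using \<rho> FE(2) assms(3) by blast
    then show "vmap \<rho> t = vmap \<eta>F t" using ext t by (simp add: extends_def)
  qed
  then show ?thesis using \<rho> by blast
qed

end

section \<open>Three attached edges with a common vertex\<close>

locale landed_star = landed G F \<C> H \<eta>F \<xi> \<Gamma> "{v}" j1 j2 u for G F :: "'a::infinite graph" and \<C> and H :: "'b graph" and \<eta>F \<xi> \<Gamma> v j1 j2 u +
  fixes P Q R :: 'a
  assumes at: "{d \<in> edges G. v \<in> d} = {{v, P}, {v, Q}, {v, R}}" and dist: "distinct [v, P, Q, R]" and vF: "v \<notin> verts F"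
begin

lemma legs: "{v, P} \<in> edges G" "{v, Q} \<in> edges G" "{v, R} \<in> edges G"
  using at by (metis (mono_tags, lifting) insertCI mem_Collect_eq)+

lemma legsF: "{v, P} \<notin> edges F" "{v, Q} \<notin> edges F" "{v, R} \<notin> edges F"
  using Fvert[of _ v] vF by auto

lemma VG: "v \<in> verts G" "P \<in> verts G" "Q \<in> verts G" "R \<in> verts G"
  using edge_pair[OF legs(1), of v] edge_pair[OF legs(1), of P] edge_pair[OF legs(2), of Q] edge_pair[OF legs(3), of R] by auto

lemma dist': "distinct [R, Q, P, v]" "j1 \<noteq> v" "j2 \<noteq> v" "v \<noteq> j1" "v \<noteq> j2"
  using dist jM by auto

lemma jlegs: "{j1, j2} \<noteq> {v, P}" "{j1, j2} \<noteq> {v, Q}" "{j1, j2} \<noteq> {v, R}" "{v, P} \<noteq> {j1, j2}" "{v, Q} \<noteq> {j1, j2}" "{v, R} \<noteq> {j1, j2}"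
    "{v, P} \<noteq> {v, Q}" "{v, P} \<noteq> {v, R}" "{v, Q} \<noteq> {v, R}"
  using dist dist' by (auto simp: doubleton_eq_iff)

text \<open>The routing \<open>T3\<close>: \<open>r5\<close> becomes the new \<open>v\<close>,
  \<open>r6\<close> subdivides the edge to \<open>P\<close>, and \<open>u\<close> subdivides the
  landing edge. This is \<open>G\<close> with an edge added, so (E2) applies.\<close>

lemma to_leg:
  assumes r: "good r5" "good r6" "r5 \<noteq> r6"
    and L: "linked (sp.free {{j1, j2}}) [(r5, vmap \<xi> Q), (r5, vmap \<xi> R), (r5, r6), (r6, vmap \<xi> P), (r6, u), (u, vmap \<xi> j1), (u, vmap \<xi> j2)]"
  shows "\<exists>C\<in>\<C>. {v, P} \<in> edges C \<and> {j1, j2} \<in> edges C"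
proof -
  obtain x y where xy: "x \<noteq> y" "x \<notin> verts G" "y \<notin> verts G"
    using fresh_list[OF finG(1), of 2] by (auto simp: length_Suc_conv numeral_2_eq_2)
  obtain G' where G': "plus2 G {v, P} {j1, j2} x y G'" by (rule plus2I[OF legs(1) jG jlegs(4) xy(2,3,1)])
  note A = plus2D[OF G']
  have nt: "t \<noteq> x" "t \<noteq> y" "x \<noteq> t" "y \<noteq> t" if "t \<in> verts G" for t using that xy by auto
  note nts = nt[OF VG(1)] nt[OF VG(2)] nt[OF VG(3)] nt[OF VG(4)] nt[OF jV(1)] nt[OF jV(2)]
  let ?N1 = "[(v, Q), (v, R)]" and ?N2 = "[(v, x), (x, P), (x, y), (y, j1), (y, j2)]" and ?al = "[(v, r5), (x, r6), (y, u)]"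
  let ?D = "{{v, P}, {j1, j2}}"
  have "\<exists>\<rho>. hom_embedding \<rho> G' H \<and> (\<forall>d\<in>edges G - (?D \<union> eds ?N1). emap \<rho> d = emap \<xi> d) \<and>
      (\<forall>t\<in>verts G. t \<notin> set [v] \<longrightarrow> vmap \<rho> t = vmap \<xi> t)"
  proof (rule land[where xs = "[x, y]" and J = "{{j1, j2}}" and al = ?al and Nnew = ?N2
        and Is = "[[0], [1], [2], [3], [4], [5], [6]]", OF _ _ _ _ _ _ _ _ _ _ _ _ _ _ _ L])
    show "cubic G'" by (rule cubic_plus2[OF G G'])
    show "verts G' = verts G \<union> set [x, y]" using A(7) by simp
    show "edges G' = (edges G - ?D) \<union> eds ?N2" using A(8) by (simp add: insert_commute)
    show "{d \<in> edges G. t \<in> d} \<subseteq> ?D \<union> eds ?N1" if "t \<in> set [v]" for t using that at by simp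
    show "distinct (map snd ?al)" using r by (simp add: good_def)
    show "q = u \<or> good q \<or> q \<in> vmap \<xi> ` set [v]" if "q \<in> snd ` set ?al" for q using that r by auto
    show "{i, j} \<in> edges G \<and> {i, j} \<notin> ?D" if "(i, j) \<in> set ?N1" for i j
      using that legs jlegs by (simp; elim disjE conjE; simp)
  qed (use xy VG nts dist dist' in \<open>auto simp: sp.place_simps\<close>)
  then obtain \<rho> where \<rho>: "hom_embedding \<rho> G' H" "respects_embedding \<rho> \<eta>F F"
    by (rule landed_respects) (use legsF jF vF in auto)
  show ?thesis by (rule pair_common[OF legs(1) legsF(1) jG jF jlegs(4) G' \<rho>])
qed

lemma to_claw:
  assumes r: "good r5" "good r6" "good r7" "good r8" "distinct [r5, r6, r7, r8]"
    and L: "linked (sp.free {{j1, j2}}) [(r5, r6), (r6, r7), (r7, r8), (r8, r5), (r5, u), (r6, vmap \<xi> Q), (r7, vmap \<xi> P), (r8, vmap \<xi> R),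
      (u, vmap \<xi> j1), (u, vmap \<xi> j2)]"
    and fr: "distinct [x, y, z, w]" "{x, y, z, w} \<inter> verts G = {}"
  shows "\<exists>\<rho>. hom_embedding \<rho> (claw G {v, Q} {v, R} {j1, j2} x y z w) H \<and> extends \<rho> \<eta>F F"
proof -
  have nt: "t \<noteq> x" "t \<noteq> y" "x \<noteq> t" "y \<noteq> t" "t \<noteq> z" "t \<noteq> w" "z \<noteq> t" "w \<noteq> t" if "t \<in> verts G" for t using that fr by auto
  note nts = nt[OF VG(1)] nt[OF VG(2)] nt[OF VG(3)] nt[OF VG(4)] nt[OF jV(1)] nt[OF jV(2)]
  have fr': "distinct [w, z, y, x]" using fr(1) by auto
  \<comment> \<open>The circuit \<open>r5\<close>, \<open>r6\<close>, \<open>r7\<close>,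
    \<open>r8\<close> of \<open>R3\<close> becomes \<open>w\<close>, \<open>x\<close>,
    \<open>v\<close>, \<open>y\<close>, and the third foot \<open>z\<close> is put at
    \<open>u\<close>.\<close>
  let ?N1 = "[(v, P)]" and ?N2 = "[(w, x), (x, v), (v, y), (y, w), (w, z), (x, Q), (y, R), (z, j1), (z, j2)]"
    and ?al = "[(v, r7), (x, r6), (y, r8), (z, u), (w, r5)]"
  let ?D = "{{v, Q}, {v, R}, {j1, j2}}"
  show ?thesis
  proof (rule landed_extends[OF land[where xs = "[x, y, z, w]" and J = "{{j1, j2}}" and al = ?al and Nold = ?N1 and Nnew = ?N2 and ms = "[v]" and D = ?D
        and Is = "[[6], [0], [1], [2], [3], [4], [5], [7], [8], [9]]", OF _ _ _ _ _ _ _ _ _ _ _ _ _ _ _ L]])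
    show "cubic (claw G {v, Q} {v, R} {j1, j2} x y z w)" by (rule cubic_claw[OF G legs(2,3) jG _ fr]) (use jlegs in simp)
    show "verts (claw G {v, Q} {v, R} {j1, j2} x y z w) = verts G \<union> set [x, y, z, w]" by (simp add: claw_def)
    show "edges (claw G {v, Q} {v, R} {j1, j2} x y z w) = (edges G - ?D) \<union> eds ?N2"
      unfolding claw_sel by (simp add: insert_commute)
    show "{d \<in> edges G. t \<in> d} \<subseteq> ?D \<union> eds ?N1" if "t \<in> set [v]" for t using that at by simp
    show "distinct (map snd ?al)" using r by (auto simp: good_def)
    show "q = u \<or> good q \<or> q \<in> vmap \<xi> ` set [v]" if "q \<in> snd ` set ?al" for q using that r by auto
    show "{i, j} \<in> edges G \<and> {i, j} \<notin> ?D" if "(i, j) \<in> set ?N1" for i j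
      using that legs jlegs by (simp; elim disjE conjE; simp)
    show "(?D \<union> eds ?N1) \<inter> edges F = {}" using legsF jF by simp
    show "set [v] \<inter> verts F = {}" using vF by simp
  qed (use fr fr' VG nts dist dist' in \<open>auto simp: sp.place_simps\<close>)
qed

end

lemma (in landed) realized:
  assumes cl: "cluster \<Gamma> H \<xi> \<phi> n0 ints prt pv" and K: "{g \<in> edges \<Gamma>. g \<inter> \<phi> ` {5..<5 + n0} = {}} = Rest"
      "verts G - M \<subseteq> verts \<Gamma> - \<phi> ` {5..<5 + n0}"
    and r: "cluster.realizes \<Gamma> H \<xi> \<phi> n0 pv p {j1, j2} j1 j2 u"
  obtains \<rho> where "\<And>l. l < length pv \<Longrightarrow> \<rho> l = vmap \<xi> (pv ! l)" "\<rho> 4 = u" "\<And>is. set is \<subseteq> {5..<5 + fst p} \<Longrightarrow> distinct is \<Longrightarrow> distinct (map \<rho> is)"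
    "\<And>i. i \<in> {5..<5 + fst p} \<Longrightarrow> good (\<rho> i)"
    "linked (sp.free {{j1, j2}}) (map (map_prod \<rho> \<rho>) (snd p) @ [(u, vmap \<xi> j1), (u, vmap \<xi> j2)])"
proof -
  interpret cl: cluster \<Gamma> H \<xi> \<phi> n0 ints prt pv by (rule cl)
  obtain \<rho> where \<rho>: "\<forall>l<length pv. \<rho> l = vmap \<xi> (pv ! l)" "\<rho> 4 = u" "inj_on \<rho> {5..<5 + fst p}"
      "\<rho> ` {5..<5 + fst p} \<subseteq> verts H - cl.Z"
      "linked (edges H - (\<Union>g\<in>{g \<in> edges \<Gamma>. g \<inter> \<phi> ` {5..<5 + n0} = {} \<and> g \<noteq> {j1, j2}}. edges (emap \<xi> g)))
         (map (map_prod \<rho> \<rho>) (snd p) @ [(u, vmap \<xi> j1), (u, vmap \<xi> j2)])"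
    using r unfolding cl.realizes_def by (elim exE conjE)
  have "{g \<in> edges \<Gamma>. g \<inter> \<phi> ` {5..<5 + n0} = {} \<and> g \<noteq> {j1, j2}} = Rest - {{j1, j2}}" using K(1) by blast
  then have L: "linked (sp.free {{j1, j2}}) (map (map_prod \<rho> \<rho>) (snd p) @ [(u, vmap \<xi> j1), (u, vmap \<xi> j2)])"
    using \<rho>(5) by (simp only: sp.free_def)
  have "{j1, j2} \<in> {g \<in> edges \<Gamma>. g \<inter> \<phi> ` {5..<5 + n0} = {}}" unfolding K(1) using jG jM by simp
  then have uZ: "u \<in> cl.Z" using uj unfolding cl.Z_def internal_verts_def by blast
  have "vmap \<xi> t \<in> cl.Z" if "t \<in> verts G - M" for t using that K(2) unfolding cl.Z_def by blast
  then have g: "good (\<rho> i)" if "i \<in> {5..<5 + fst p}" for i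
    using \<rho>(4) that uZ unfolding good_def by blast
  have d: "distinct (map \<rho> is)" if "set is \<subseteq> {5..<5 + fst p}" "distinct is" for "is"
    using inj_on_subset[OF \<rho>(3) that(1)] that(2) by (simp add: distinct_map)
  show thesis by (rule that[of \<rho>, OF _ \<rho>(2) d g L]) (use \<rho>(1) in simp_all)
qed

lemma meets_eq: "E = A \<union> B \<Longrightarrow> (\<And>e. e \<in> A \<Longrightarrow> e \<inter> K = {}) \<Longrightarrow> (\<And>e. e \<in> B \<Longrightarrow> e \<inter> K \<noteq> {}) \<Longrightarrow> {e \<in> E. e \<inter> K \<noteq> {}} = B \<and> {e \<in> E. e \<inter> K = {}} = A"
  by blast

text \<open>The claw on the three edges at \<open>v\<close> together with \<open>v\<close> is a
  cluster with three legs. Its only type contains a routing for each leg and one for each pair of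
  legs, so the landing edge \<open>j\<close> is compatible with every leg and can replace any of the
  three in the claw.\<close>

lemma (in setting) star:
  assumes at: "{d \<in> edges G. v \<in> d} = {{v, a}, {v, b}, {v, c}}" and dist: "distinct [v, a, b, c]" and vF: "v \<notin> verts F"
    and \<xi>: "hom_embedding \<xi> (claw G {v, a} {v, b} {v, c} x y z w) H" and ext: "extends \<xi> \<eta>F F"
    and fr: "distinct [x, y, z, w]" "{x, y, z, w} \<inter> verts G = {}"
  obtains j where "j \<in> edges G" "v \<notin> j" "j \<notin> edges F" "\<And>p. p \<in> {a, b, c} \<Longrightarrow> \<exists>C\<in>\<C>. {v, p} \<in> edges C \<and> j \<in> edges C"
    "\<And>p q. p \<in> {a, b, c} \<Longrightarrow> q \<in> {a, b, c} \<Longrightarrow> p \<noteq> q \<Longrightarrow> \<exists>\<rho>. hom_embedding \<rho> (claw G {v, p} {v, q} j x y z w) H \<and> extends \<rho> \<eta>F F"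
proof -
  let ?\<Gamma> = "claw G {v, a} {v, b} {v, c} x y z w"
  have legs: "{v, a} \<in> edges G" "{v, b} \<in> edges G" "{v, c} \<in> edges G"
    using at by (metis (mono_tags, lifting) insertCI mem_Collect_eq)+
  have VG: "v \<in> verts G" "a \<in> verts G" "b \<in> verts G" "c \<in> verts G"
    using edge_pair[OF legs(1), of v] edge_pair[OF legs(1), of a] edge_pair[OF legs(2), of b] edge_pair[OF legs(3), of c] by auto
  have d3: "distinct [{v, a}, {v, b}, {v, c}]" using dist by (simp add: doubleton_eq_iff)
  have nt: "t \<noteq> x" "t \<noteq> y" "x \<noteq> t" "y \<noteq> t" "t \<noteq> z" "t \<noteq> w" "z \<noteq> t" "w \<noteq> t" if "t \<in> verts G" for t using that fr by auto
  note nts = nt[OF VG(1)] nt[OF VG(2)] nt[OF VG(3)] nt[OF VG(4)]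
  have rv: "distinct [c, b, a, v]" "distinct [w, z, y, x]" using dist fr(1) by auto
  \<comment> \<open>The order matches \<open>start3\<close>: 5 is \<open>v\<close>, 6 the centre of
    the claw, and 7, 8, 9 its feet.\<close>
  define \<phi> where "\<phi> i = [v, w, x, y, z] ! (i - 5)" for i
  have \<phi>: "\<phi> 5 = v" "\<phi> 6 = w" "\<phi> 7 = x" "\<phi> 8 = y" "\<phi> 9 = z" by (simp_all add: \<phi>_def)
  have five: "{5..<5 + 5::nat} = {5, 6, 7, 8, 9}" by auto
  have K: "\<phi> ` {5..<5 + 5} = {v, w, x, y, z}" unfolding five by (simp add: \<phi>)
  let ?ints = "[(5, 7), (5, 8), (5, 9), (6, 7), (6, 8), (6, 9)] :: (nat \<times> nat) list"
  let ?New = "{{x, v}, {x, a}, {y, v}, {y, b}, {z, v}, {z, c}, {w, x}, {w, y}, {w, z}}"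
  have off: "d \<inter> {v, w, x, y, z} = {}" if d: "d \<in> edges G - {{v, a}, {v, b}, {v, c}}" for d
  proof -
    have "d \<subseteq> verts G" using d sG by (simp add: simple_graph_def)
    moreover have "v \<notin> d" by (rule not_at[OF at subset_refl]) (use d in auto)
    ultimately show ?thesis using fr(2) by blast
  qed
  note me = meets_eq[OF claw_sel(2)[of G v a v b v c x y z w], of "{v, w, x, y, z}"]
  have me': "{e \<in> edges ?\<Gamma>. e \<inter> {v, w, x, y, z} \<noteq> {}} = ?New \<and> {e \<in> edges ?\<Gamma>. e \<inter> {v, w, x, y, z} = {}} = edges G - {{v, a}, {v, b}, {v, c}}"
    by (rule me) (use off in auto)
  have RestK: "edges G - {{v, a}, {v, b}, {v, c}} = {d \<in> edges G. d \<inter> {v} = {}}" unfolding at[symmetric] by blast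
  have cl: "cluster ?\<Gamma> H \<xi> \<phi> 5 ?ints [7, 8, 9] [a, b, c]"
  proof
    show "cubic ?\<Gamma>" by (rule cubic_claw[OF G legs d3 fr])
    have "distinct (map \<phi> [5, 6, 7, 8, 9])" using nts fr(1) rv by (simp add: \<phi>)
    then have "inj_on \<phi> (set [5, 6, 7, 8, 9])" by (simp only: distinct_map)
    then show "inj_on \<phi> {5..<5 + 5}" unfolding five by simp
    show "\<phi> ` {5..<5 + 5} \<subseteq> verts ?\<Gamma>" unfolding K claw_sel using VG by simp
    show "set [a, b, c] \<inter> \<phi> ` {5..<5 + 5} = {}" unfolding K using nts rv dist by simp
    show "set [a, b, c] \<subseteq> verts ?\<Gamma>" unfolding claw_sel using VG by simp
    show "{e \<in> edges ?\<Gamma>. e \<inter> \<phi> ` {5..<5 + 5} \<noteq> {}} = set (map (\<lambda>(i, j). {\<phi> i, \<phi> j}) ?ints) \<union> set (map2 (\<lambda>i v. {\<phi> i, v}) [7, 8, 9] [a, b, c])"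
      unfolding K me'[THEN conjunct1] by (simp add: \<phi> insert_commute)
    show "distinct (map (\<lambda>(i, j). {\<phi> i, \<phi> j}) ?ints)" using nts fr(1) rv by (simp add: \<phi> doubleton_eq_iff)
    show "\<exists>e\<in>set ?ints. i = fst e \<or> i = snd e" if "i \<in> {5..<5 + 5}" for i using that unfolding five by auto
    show "i \<in> {5..<5 + 5} \<and> j \<in> {5..<5 + 5}" if "(i, j) \<in> set ?ints" for i j using that by auto
  qed (use H \<xi> dist in auto)
  interpret cl: cluster ?\<Gamma> H \<xi> \<phi> 5 ?ints "[7, 8, 9]" "[a, b, c]" by (rule cl)
  have st: "cl.start = start3" by (simp add: cl.start_def start3_def upt_rec)
  have "\<exists>j u. j \<in> edges ?\<Gamma> \<and> j \<inter> cl.K = {} \<and> u \<in> internal_verts (emap \<xi> j) \<and>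
    (\<exists>\<tau>\<in>set types3. \<forall>p\<in>set \<tau>. \<forall>j1 j2. j = {j1, j2} \<longrightarrow> cl.realizes p j j1 j2 u)"
    by (rule cl.cluster_exit[OF H(2) _ table3 _ start_table3[folded st]]) (auto simp: start_table3_def less_Suc_eq numeral_3_eq_3)
  then obtain j u where ju: "j \<in> edges ?\<Gamma>" "j \<inter> cl.K = {}" "u \<in> internal_verts (emap \<xi> j)"
      "\<exists>\<tau>\<in>set types3. \<forall>p\<in>set \<tau>. \<forall>j1 j2. j = {j1, j2} \<longrightarrow> cl.realizes p j j1 j2 u" by (elim exE conjE)
  have "j \<in> {e \<in> edges ?\<Gamma>. e \<inter> {v, w, x, y, z} = {}}" using ju(1,2) unfolding K by simp
  then have jR: "j \<in> edges G" "v \<notin> j" unfolding me'[THEN conjunct2] RestK by auto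
  obtain j1 j2 where j: "j = {j1, j2}" by (rule simple_edgeE[OF sG jR(1)])
  have re: "cl.realizes p {j1, j2} j1 j2 u" if "p \<in> {T3 0 1 2, T3 1 0 2, T3 2 0 1, R3 0 1 2, R3 1 0 2, R3 2 0 1}" for p
  proof -
    have "\<forall>j1 j2. j = {j1, j2} \<longrightarrow> cl.realizes p j j1 j2 u" using ju(4) that by (auto simp: types3_def)
    from this[rule_format, OF j] show ?thesis unfolding j .
  qed
  have ls: "landed_star G F \<C> H \<eta>F \<xi> ?\<Gamma> v j1 j2 u P Q R" if "{{v, P}, {v, Q}, {v, R}} = {{v, a}, {v, b}, {v, c}}" "distinct [v, P, Q, R]" for P Q R
  proof
    show "{d \<in> edges G. d \<inter> {v} = {}} \<subseteq> edges ?\<Gamma>" unfolding RestK[symmetric] me'[THEN conjunct2, symmetric] by blast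
    show "verts G \<subseteq> verts ?\<Gamma>" unfolding claw_sel by blast
    show "{d \<in> edges G. v \<in> d} = {{v, P}, {v, Q}, {v, R}}" using at that(1) by simp
  qed (use \<xi> ext jR j ju(3) that(2) vF in auto)
  have l1: "landed_star G F \<C> H \<eta>F \<xi> ?\<Gamma> v j1 j2 u a b c" and l2: "landed_star G F \<C> H \<eta>F \<xi> ?\<Gamma> v j1 j2 u b a c"
    and l3: "landed_star G F \<C> H \<eta>F \<xi> ?\<Gamma> v j1 j2 u c a b"
    by (rule ls; use dist rv in \<open>simp add: insert_commute\<close>)+
  have vK: "verts G - {v} \<subseteq> verts ?\<Gamma> - {v, w, x, y, z}" using nt unfolding claw_sel by blast
  have leg: "\<exists>C\<in>\<C>. {v, P} \<in> edges C \<and> {j1, j2} \<in> edges C"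
    if l: "landed_star G F \<C> H \<eta>F \<xi> ?\<Gamma> v j1 j2 u P Q R" and p: "cl.realizes (T3 p q r) {j1, j2} j1 j2 u"
      "p < 3" "q < 3" "r < 3" "[a, b, c] ! p = P" "[a, b, c] ! q = Q" "[a, b, c] ! r = R" for P Q R p q r
  proof -
    interpret l: landed_star G F \<C> H \<eta>F \<xi> ?\<Gamma> v j1 j2 u P Q R by (rule l)
    obtain \<rho> where \<rho>: "\<And>l. l < length [a, b, c] \<Longrightarrow> \<rho> l = vmap \<xi> ([a, b, c] ! l)" "\<rho> 4 = u"
        "\<And>is. set is \<subseteq> {5..<5 + fst (T3 p q r)} \<Longrightarrow> distinct is \<Longrightarrow> distinct (map \<rho> is)"
        "\<And>i. i \<in> {5..<5 + fst (T3 p q r)} \<Longrightarrow> l.good (\<rho> i)"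
        "linked (l.sp.free {{j1, j2}}) (map (map_prod \<rho> \<rho>) (snd (T3 p q r)) @ [(u, vmap \<xi> j1), (u, vmap \<xi> j2)])"
      by (rule l.realized[OF cl _ _ p(1)]) (use me' RestK vK K in auto)
    show ?thesis
      by (rule l.to_leg[of "\<rho> 5" "\<rho> 6"]) (use \<rho>(1)[of p] \<rho>(1)[of q] \<rho>(1)[of r] \<rho>(2) \<rho>(3)[of "[5, 6]"] \<rho>(4)[of 5] \<rho>(4)[of 6] \<rho>(5) p in \<open>simp_all add: T3_def\<close>)
  qed
  have clw: "\<exists>\<rho>. hom_embedding \<rho> (claw G {v, Q} {v, R} {j1, j2} x' y' z w) H \<and> extends \<rho> \<eta>F F"
    if l: "landed_star G F \<C> H \<eta>F \<xi> ?\<Gamma> v j1 j2 u P Q R" and p: "cl.realizes (R3 p q r) {j1, j2} j1 j2 u"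
      "p < 3" "q < 3" "r < 3" "[a, b, c] ! p = P" "[a, b, c] ! q = Q" "[a, b, c] ! r = R"
      and f: "distinct [x', y', z, w]" "{x', y', z, w} \<inter> verts G = {}" for P Q R p q r x' y'
  proof -
    interpret l: landed_star G F \<C> H \<eta>F \<xi> ?\<Gamma> v j1 j2 u P Q R by (rule l)
    obtain \<rho> where \<rho>: "\<And>l. l < length [a, b, c] \<Longrightarrow> \<rho> l = vmap \<xi> ([a, b, c] ! l)" "\<rho> 4 = u"
        "\<And>is. set is \<subseteq> {5..<5 + fst (R3 p q r)} \<Longrightarrow> distinct is \<Longrightarrow> distinct (map \<rho> is)"
        "\<And>i. i \<in> {5..<5 + fst (R3 p q r)} \<Longrightarrow> l.good (\<rho> i)"
        "linked (l.sp.free {{j1, j2}}) (map (map_prod \<rho> \<rho>) (snd (R3 p q r)) @ [(u, vmap \<xi> j1), (u, vmap \<xi> j2)])"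
      by (rule l.realized[OF cl _ _ p(1)]) (use me' RestK vK K in auto)
    show ?thesis
      by (rule l.to_claw[of "\<rho> 5" "\<rho> 6" "\<rho> 7" "\<rho> 8", OF _ _ _ _ _ _ f]) (use \<rho>(1)[of p] \<rho>(1)[of q] \<rho>(1)[of r] \<rho>(2) \<rho>(3)[of "[5, 6, 7, 8]"] \<rho>(4)[of 5] \<rho>(4)[of 6] \<rho>(4)[of 7] \<rho>(4)[of 8] \<rho>(5) p in \<open>simp_all add: R3_def\<close>)
  qed
  show thesis
  proof (rule that[of j])
    show "j \<notin> edges F" using F_no_internal[OF \<xi> ext _ ju(1)] ju(3) by auto
    show "\<exists>C\<in>\<C>. {v, p} \<in> edges C \<and> j \<in> edges C" if "p \<in> {a, b, c}" for p
    proof -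
      have "\<exists>C\<in>\<C>. {v, a} \<in> edges C \<and> {j1, j2} \<in> edges C" by (rule leg[OF l1 re, of 0 1 2]) simp_all
      moreover have "\<exists>C\<in>\<C>. {v, b} \<in> edges C \<and> {j1, j2} \<in> edges C" by (rule leg[OF l2 re, of 1 0 2]) simp_all
      moreover have "\<exists>C\<in>\<C>. {v, c} \<in> edges C \<and> {j1, j2} \<in> edges C" by (rule leg[OF l3 re, of 2 0 1]) simp_all
      ultimately show ?thesis using that unfolding j by (elim insertE emptyE; simp)
    qed
    \<comment> \<open>For a pair of legs in the other order the names of the first two feet have to
      be exchanged as well.\<close>
    have sw: "claw G e f g x y z w = claw G f e g y x z w" for e f g
      by (simp add: claw_def insert_commute Un_ac)
    have fr2: "distinct [y, x, z, w]" "{y, x, z, w} \<inter> verts G = {}" using fr by auto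
    have r6: "cl.realizes (R3 0 1 2) {j1, j2} j1 j2 u" "cl.realizes (R3 1 0 2) {j1, j2} j1 j2 u" "cl.realizes (R3 2 0 1) {j1, j2} j1 j2 u"
      by (rule re; simp)+
    have "\<exists>\<rho>. hom_embedding \<rho> (claw G {v, b} {v, c} j x y z w) H \<and> extends \<rho> \<eta>F F"
      "\<exists>\<rho>. hom_embedding \<rho> (claw G {v, a} {v, c} j x y z w) H \<and> extends \<rho> \<eta>F F"
      "\<exists>\<rho>. hom_embedding \<rho> (claw G {v, a} {v, b} j x y z w) H \<and> extends \<rho> \<eta>F F"
      "\<exists>\<rho>. hom_embedding \<rho> (claw G {v, c} {v, b} j x y z w) H \<and> extends \<rho> \<eta>F F"
      "\<exists>\<rho>. hom_embedding \<rho> (claw G {v, c} {v, a} j x y z w) H \<and> extends \<rho> \<eta>F F"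
      "\<exists>\<rho>. hom_embedding \<rho> (claw G {v, b} {v, a} j x y z w) H \<and> extends \<rho> \<eta>F F"
      using clw[OF l1 r6(1) _ _ _ _ _ _ fr] clw[OF l2 r6(2) _ _ _ _ _ _ fr] clw[OF l3 r6(3) _ _ _ _ _ _ fr]
        clw[OF l1 r6(1) _ _ _ _ _ _ fr2] clw[OF l2 r6(2) _ _ _ _ _ _ fr2] clw[OF l3 r6(3) _ _ _ _ _ _ fr2]
      unfolding j sw[of "{v, c}" "{v, b}"] sw[of "{v, c}" "{v, a}"] sw[of "{v, b}" "{v, a}"] by simp_all
    then show "\<exists>\<rho>. hom_embedding \<rho> (claw G {v, p} {v, q} j x y z w) H \<and> extends \<rho> \<eta>F F"
      if "p \<in> {a, b, c}" "q \<in> {a, b, c}" "p \<noteq> q" for p q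
      using that by (elim insertE emptyE; simp)
  qed (use jR in auto)
qed

section \<open>Twinned edges meeting in a vertex of \<open>F\<close>\<close>

lemma double_aux:
  assumes "y \<notin> E" "y \<notin> N1" "e2 \<notin> N1" "e2 \<noteq> y"
  shows "((E - D1) \<union> insert y N1) - {e2, y} \<union> N2 = (E - insert e2 D1) \<union> (N1 \<union> N2)"
  using assms by blast

text \<open>The extension in (E4), which also forms the first two steps of (E5). The second edge is
  attached to the piece of \<open>{a, A}\<close> next to \<open>a\<close>, so \<open>y'\<close> lies
  between \<open>a\<close> and \<open>y\<close>.\<close>

lemma double_plus2:
  assumes G: "cubic G" and E: "{p, p'} \<in> edges G" "{a, A} \<in> edges G" "{q, q'} \<in> edges G" "distinct [{p, p'}, {a, A}, {q, q'}]"
    and fr: "distinct [x, y, x', y']" "{x, y, x', y'} \<inter> verts G = {}"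
  obtains G1 G2 where "plus2 G {p, p'} {a, A} x y G1" "plus2 G1 {q, q'} {a, y} x' y' G2" "cubic G2" "verts G2 = verts G \<union> {x, y, x', y'}"
    "edges G2 = (edges G - {{p, p'}, {a, A}, {q, q'}}) \<union> {{x, p}, {x, p'}, {y, A}, {x, y}, {x', q}, {x', q'}, {y', a}, {y', y}, {x', y'}}"
proof -
  have sG: "simple_graph G" using G by (simp add: cubic_def)
  have sub: "d \<subseteq> verts G" if "d \<in> edges G" for d using sG that by (simp add: simple_graph_def)
  obtain G1 where G1: "plus2 G {p, p'} {a, A} x y G1" by (rule plus2I[OF E(1,2), of x y]) (use E(4) fr in auto)
  note P = plus2D[OF G1]
  have V: "p \<in> verts G" "p' \<in> verts G" "a \<in> verts G" "A \<in> verts G" "q \<in> verts G" "q' \<in> verts G" using sub[OF E(1)] sub[OF E(2)] sub[OF E(3)] by auto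
  have nt: "t \<noteq> x" "t \<noteq> y" "x \<noteq> t" "y \<noteq> t" "t \<noteq> x'" "t \<noteq> y'" "x' \<noteq> t" "y' \<noteq> t" if "t \<in> verts G" for t using that fr by auto
  note nts = nt[OF V(1)] nt[OF V(2)] nt[OF V(3)] nt[OF V(4)] nt[OF V(5)] nt[OF V(6)]
  have aA: "a \<noteq> A" using sG E(2) by (auto simp: simple_graph_def)
  have rv: "distinct [y', x', y, x]" using fr(1) by auto
  have yE: "{a, y} \<notin> edges G" using sub[of "{a, y}"] fr(2) by auto
  have qn: "{q, q'} \<noteq> {p, p'}" "{q, q'} \<noteq> {a, A}" using E(4) by auto
  have E1: "{q, q'} \<in> edges G1" unfolding P(8) using E(3) qn by simp
  have E1y: "{a, y} \<in> edges G1" unfolding P(8) by (simp add: insert_commute)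
  have qy: "{q, q'} \<noteq> {a, y}" using E(3) yE by auto
  have fr1: "x' \<notin> verts G1" "y' \<notin> verts G1" "x' \<noteq> y'" unfolding P(7) using fr rv by auto
  obtain G2 where G2: "plus2 G1 {q, q'} {a, y} x' y' G2" by (rule plus2I[OF E1 E1y qy fr1])
  note Q = plus2D[OF G2]
  have E1': "edges G1 = (edges G - {{p, p'}, {a, A}}) \<union> insert {a, y} {{x, p}, {x, p'}, {y, A}, {x, y}}"
    unfolding P(8) by (simp add: insert_commute)
  have "edges G2 = (edges G - insert {q, q'} {{p, p'}, {a, A}}) \<union> ({{x, p}, {x, p'}, {y, A}, {x, y}} \<union> {{x', q}, {x', q'}, {y', a}, {y', y}, {x', y'}})"
    unfolding Q(8) E1' by (rule double_aux) (use yE nts rv fr(1) aA aA[symmetric] qy in \<open>simp_all add: doubleton_eq_iff\<close>)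
  then have "edges G2 = (edges G - {{p, p'}, {a, A}, {q, q'}}) \<union> {{x, p}, {x, p'}, {y, A}, {x, y}, {x', q}, {x', q'}, {y', a}, {y', y}, {x', y'}}"
    by (simp add: insert_commute)
  moreover have "verts G2 = verts G \<union> {x, y, x', y'}" unfolding Q(7) P(7) by auto
  ultimately show thesis using that[OF G1 G2 cubic_plus2[OF cubic_plus2[OF G G1] G2]] by blast
qed

locale landed_circ = landed G F \<C> H \<eta>F \<xi> \<Gamma> "{v, a}" j1 j2 u + circ G F \<C> v a b c s Df Dh A C0
  for G F :: "'a::infinite graph" and \<C> and H :: "'b graph" and \<eta>F \<xi> \<Gamma> v a b c s Df Dh A C0 j1 j2 u
begin

lemma swapl: "landed_circ G F \<C> H \<eta>F \<xi> \<Gamma> v a c b s Dh Df A C0 j1 j2 u"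
  unfolding landed_circ_def using landed_axioms swapc by blast

lemma swapj: "landed_circ G F \<C> H \<eta>F \<xi> \<Gamma> v a b c s Df Dh A C0 j2 j1 u"
proof -
  have "landed G F \<C> H \<eta>F \<xi> \<Gamma> {v, a} j2 j1 u"
    using landed_axioms unfolding landed_def landed_axioms_def by (simp add: insert_commute)
  then show ?thesis unfolding landed_circ_def using circ_axioms by blast
qed

lemma cs: "c \<noteq> s" "s \<noteq> c" "A \<noteq> c" "c \<noteq> A" "b \<noteq> s" "A \<noteq> s" "s \<noteq> A" "b \<noteq> A" "v \<noteq> s" "a \<noteq> s" "v \<noteq> A" "a \<noteq> A"
  using distinct6 by auto

lemma jne: "j1 \<noteq> v" "j1 \<noteq> a" "j2 \<noteq> v" "j2 \<noteq> a" "v \<noteq> j1" "a \<noteq> j1" "v \<noteq> j2" "a \<noteq> j2" "j1 \<noteq> j2" "j2 \<noteq> j1"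
  using jM jV by auto

lemma V: "s \<in> verts G" "A \<in> verts G"
  using edge_pair[OF EG(4), of s] edge_pair[OF AG, of A] by auto

lemma cF: "c \<notin> verts F" "b \<notin> verts F"
proof -
  interpret sw: circ G F \<C> v a c b s Dh Df A C0 by (rule swapc)
  show "c \<notin> verts F" "b \<notin> verts F" using sw.nF nF by auto
qed

lemma touch:
  assumes "{{v, a}, {v, b}, {v, c}, {a, s}, {a, A}} \<subseteq> X" "t \<in> {v, a}" shows "{d \<in> edges G. t \<in> d} \<subseteq> X"
proof -
  have "{d \<in> edges G. v \<in> d} \<subseteq> X" "{d \<in> edges G. a \<in> d} \<subseteq> X" unfolding at ata using assms(1) by simp_all
  then show ?thesis using assms(2) by blast
qed

lemma e4_use:
  assumes "e1 \<in> edges Dh" "e1 \<notin> edges Df" "e2 \<in> edges Df" "e2 \<notin> edges Dh" "e1 \<inter> e2 = {}"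
    "plus2 G e1 {a, A} x y G1" "plus2 G1 e2 {a, y} x' y' G2" "hom_embedding \<rho> G2 H" "respects_embedding \<rho> \<eta>F F"
  shows False
proof -
  have a: "a \<in> verts F \<and> degree F a = 1 \<and> {a, A} \<in> edges F \<and> a \<in> {a, A}" using aF AF by simp
  have "Dh \<noteq> Df \<and> a \<in> verts Dh \<and> a \<in> verts Df" using Dne mem(3)[OF Df(1,2)] mem(3)[OF Dh(1,2)] by auto
  note n = e4[unfolded E4_def, rule_format, OF a Dh(1) Df(1) this, of e1 e2]
  show False using n assms by blast
qed

lemma vF0: "v \<notin> d \<or> d \<notin> edges F" "b \<notin> d \<or> d \<notin> edges F" "c \<notin> d \<or> d \<notin> edges F"
  using Fvert vF cF by blast+

text \<open>The routing \<open>Tr 0 1 4 2 3\<close>: \<open>r5\<close> and \<open>r7\<close> become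
  \<open>v\<close> and \<open>a\<close>, and \<open>r6\<close> subdivides the edge between
  them.\<close>

lemma to_e:
  assumes r: "good r5" "good r6" "good r7" "distinct [r5, r6, r7]"
    and L: "linked (sp.free {{j1, j2}}) [(r5, vx b), (r5, vx c), (r5, r6), (r6, u), (r6, r7), (r7, vx s), (r7, vx A), (u, vx j1), (u, vx j2)]"
  shows "\<exists>C\<in>\<C>. {v, a} \<in> edges C \<and> {j1, j2} \<in> edges C"
proof -
  obtain xs where xs: "length xs = 2 \<and> distinct xs \<and> set xs \<inter> verts G = {}" using fresh_list[OF finG(1), of 2] by (elim exE)
  then obtain x y where xsd: "xs = [x, y]" by (auto simp: length_Suc_conv eval_nat_numeral)
  have fr: "distinct [x, y]" "{x, y} \<inter> verts G = {}" using xs xsd by auto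
  have rv: "distinct [y, x]" using fr(1) by auto
  have nt: "x \<noteq> t" "t \<noteq> x" "y \<noteq> t" "t \<noteq> y" if "t \<in> verts G" for t using that fr(2) by auto
  have ej: "{v, a} \<noteq> {j1, j2}" using jne by (auto simp: doubleton_eq_iff)
  have exy: "x \<notin> verts G" "y \<notin> verts G" "x \<noteq> y" using fr by auto
  have eG: "{v, a} \<in> edges G" "{v, a} \<notin> edges F" using EG EF by auto
  obtain G2 where P2: "plus2 G {v, a} {j1, j2} x y G2" by (rule plus2I[OF eG(1) jG ej exy])
  have G2: "cubic G2" by (rule cubic_plus2[OF G P2])
  note G2v = plus2D(7)[OF P2] and G2e = plus2D(8)[OF P2]
  let ?N1 = "[(v, b), (v, c), (a, s), (a, A)]" and ?N2 = "[(x, v), (x, y), (x, a), (y, j1), (y, j2)]" and ?al = "[(v, r5), (a, r7), (x, r6), (y, u)]"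
  let ?D = "{{v, a}, {j1, j2}}" and ?S = "set [v, a]"
  have VV: "A \<in> verts G" "a \<in> verts G" "b \<in> verts G" "c \<in> verts G" "j1 \<in> verts G" "j2 \<in> verts G" "s \<in> verts G" "v \<in> verts G" by (use VG V jV in simp_all)
  note nts = nt[OF VV(1)] nt[OF VV(2)] nt[OF VV(3)] nt[OF VV(4)] nt[OF VV(5)] nt[OF VV(6)] nt[OF VV(7)] nt[OF VV(8)]
  have mv: "{d \<in> edges G. t \<in> d} \<subseteq> ?D \<union> eds ?N1" if "t \<in> ?S" for t
    using touch[of "?D \<union> eds ?N1" t] that by (simp add: insert_commute)
  have N1: "{i, j} \<in> edges G \<and> {i, j} \<notin> ?D" if "(i, j) \<in> set ?N1" for i j
    using that by (simp, elim disjE conjE; use EG AG jG ne cs sne jne in \<open>simp add: doubleton_eq_iff insert_commute\<close>)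
  have rt: "routes [(r5, vx b), (r5, vx c), (r5, r6), (r6, u), (r6, r7), (r7, vx s), (r7, vx A), (u, vx j1), (u, vx j2)] [[0], [1], [5], [6], [2], [3], [4], [7], [8]] (map (map_prod (sp.place ?al) (sp.place ?al)) (?N1 @ ?N2))"
    using nts fr(1) rv ne cs sne jne by (simp add: sp.place_simps)
  have "lands G2 (?D \<union> eds ?N1) ?S"
  proof (rule land[where xs = "[x, y]" and J = "{{j1, j2}}" and al = ?al and Nnew = ?N2, OF G2 _ _ _ _ N1 _ mv _ _ _ _ _ _ _ L rt])
    show "verts G2 = verts G \<union> set [x, y]" unfolding G2v by (simp add: insert_commute)
    show "edges G2 = (edges G - ?D) \<union> eds ?N2" unfolding G2e by (simp add: insert_commute)
    show "distinct (map snd ?al)" using r VV ne by (simp add: good_def vm_eq u_off u_off[symmetric]; metis)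
    show "q = u \<or> good q \<or> q \<in> vx ` ?S" if "q \<in> snd ` set ?al" for q using that r by auto
  qed (use fr VV ne cs sne jne in auto)
  then obtain \<rho> where \<rho>: "hom_embedding \<rho> G2 H" "respects_embedding \<rho> \<eta>F F"
  proof (rule landed_respects)
    fix t assume "t \<in> ?S" "t \<in> verts F" then show "degree F t = 1" using vF cF aF by auto
  next
    fix d assume "d \<in> ?D \<union> eds ?N1" "d \<in> edges F"
    then show "\<exists>t\<in>d. degree F t = 1"
      by (simp, elim disjE; use jF EF vF0 aF in \<open>auto; fail\<close>)
  qed
  show ?thesis by (rule pair_common[OF eG jG jF ej P2 \<rho>])
qed

text \<open>The routing \<open>Tr 0 4 1 2 3\<close>: now \<open>r6\<close> and \<open>r7\<close>
  become \<open>v\<close> and \<open>a\<close>, and \<open>r5\<close> subdivides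
  \<open>{v, b}\<close>.\<close>

lemma to_f:
  assumes r: "good r5" "good r6" "good r7" "distinct [r5, r6, r7]"
    and L: "linked (sp.free {{j1, j2}}) [(r5, vx b), (r5, u), (r5, r6), (r6, vx c), (r6, r7), (r7, vx s), (r7, vx A), (u, vx j1), (u, vx j2)]"
  shows "\<exists>C\<in>\<C>. {v, b} \<in> edges C \<and> {j1, j2} \<in> edges C"
proof -
  obtain xs where xs: "length xs = 2 \<and> distinct xs \<and> set xs \<inter> verts G = {}" using fresh_list[OF finG(1), of 2] by (elim exE)
  then obtain x y where xsd: "xs = [x, y]" by (auto simp: length_Suc_conv eval_nat_numeral)
  have fr: "distinct [x, y]" "{x, y} \<inter> verts G = {}" using xs xsd by auto
  have rv: "distinct [y, x]" using fr(1) by auto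
  have nt: "x \<noteq> t" "t \<noteq> x" "y \<noteq> t" "t \<noteq> y" if "t \<in> verts G" for t using that fr(2) by auto
  have ej: "{v, b} \<noteq> {j1, j2}" using jne by (auto simp: doubleton_eq_iff)
  have exy: "x \<notin> verts G" "y \<notin> verts G" "x \<noteq> y" using fr by auto
  have eG: "{v, b} \<in> edges G" "{v, b} \<notin> edges F" using EG EF by auto
  obtain G2 where P2: "plus2 G {v, b} {j1, j2} x y G2" by (rule plus2I[OF eG(1) jG ej exy])
  have G2: "cubic G2" by (rule cubic_plus2[OF G P2])
  note G2v = plus2D(7)[OF P2] and G2e = plus2D(8)[OF P2]
  let ?N1 = "[(v, c), (v, a), (a, s), (a, A)]" and ?N2 = "[(x, b), (x, y), (x, v), (y, j1), (y, j2)]" and ?al = "[(v, r6), (a, r7), (x, r5), (y, u)]"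
  let ?D = "{{v, b}, {j1, j2}}" and ?S = "set [v, a]"
  have VV: "A \<in> verts G" "a \<in> verts G" "b \<in> verts G" "c \<in> verts G" "j1 \<in> verts G" "j2 \<in> verts G" "s \<in> verts G" "v \<in> verts G" by (use VG V jV in simp_all)
  note nts = nt[OF VV(1)] nt[OF VV(2)] nt[OF VV(3)] nt[OF VV(4)] nt[OF VV(5)] nt[OF VV(6)] nt[OF VV(7)] nt[OF VV(8)]
  have mv: "{d \<in> edges G. t \<in> d} \<subseteq> ?D \<union> eds ?N1" if "t \<in> ?S" for t
    using touch[of "?D \<union> eds ?N1" t] that by (simp add: insert_commute)
  have N1: "{i, j} \<in> edges G \<and> {i, j} \<notin> ?D" if "(i, j) \<in> set ?N1" for i j
    using that by (simp, elim disjE conjE; use EG AG jG ne cs sne jne in \<open>simp add: doubleton_eq_iff insert_commute\<close>)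
  have rt: "routes [(r5, vx b), (r5, u), (r5, r6), (r6, vx c), (r6, r7), (r7, vx s), (r7, vx A), (u, vx j1), (u, vx j2)] [[3], [4], [5], [6], [0], [1], [2], [7], [8]] (map (map_prod (sp.place ?al) (sp.place ?al)) (?N1 @ ?N2))"
    using nts fr(1) rv ne cs sne jne by (simp add: sp.place_simps)
  have "lands G2 (?D \<union> eds ?N1) ?S"
  proof (rule land[where xs = "[x, y]" and J = "{{j1, j2}}" and al = ?al and Nnew = ?N2, OF G2 _ _ _ _ N1 _ mv _ _ _ _ _ _ _ L rt])
    show "verts G2 = verts G \<union> set [x, y]" unfolding G2v by (simp add: insert_commute)
    show "edges G2 = (edges G - ?D) \<union> eds ?N2" unfolding G2e by (simp add: insert_commute)
    show "distinct (map snd ?al)" using r VV ne by (simp add: good_def vm_eq u_off u_off[symmetric]; metis)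
    show "q = u \<or> good q \<or> q \<in> vx ` ?S" if "q \<in> snd ` set ?al" for q using that r by auto
  qed (use fr VV ne cs sne jne in auto)
  then obtain \<rho> where \<rho>: "hom_embedding \<rho> G2 H" "respects_embedding \<rho> \<eta>F F"
  proof (rule landed_respects)
    fix t assume "t \<in> ?S" "t \<in> verts F" then show "degree F t = 1" using vF cF aF by auto
  next
    fix d assume "d \<in> ?D \<union> eds ?N1" "d \<in> edges F"
    then show "\<exists>t\<in>d. degree F t = 1"
      by (simp, elim disjE; use jF EF vF0 aF in \<open>auto; fail\<close>)
  qed
  show ?thesis by (rule pair_common[OF eG jG jF ej P2 \<rho>])
qed

text \<open>The routing \<open>Tr 2 4 3 0 1\<close>, read from the other end of the spine:
  \<open>r7\<close> becomes \<open>v\<close>, \<open>r6\<close> becomes \<open>a\<close>, and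
  \<open>r5\<close> subdivides \<open>{a, s}\<close>.\<close>

lemma to_k:
  assumes r: "good r5" "good r6" "good r7" "distinct [r5, r6, r7]"
    and L: "linked (sp.free {{j1, j2}}) [(r5, vx s), (r5, u), (r5, r6), (r6, vx A), (r6, r7), (r7, vx b), (r7, vx c), (u, vx j1), (u, vx j2)]"
  shows "\<exists>C\<in>\<C>. {a, s} \<in> edges C \<and> {j1, j2} \<in> edges C"
proof -
  obtain xs where xs: "length xs = 2 \<and> distinct xs \<and> set xs \<inter> verts G = {}" using fresh_list[OF finG(1), of 2] by (elim exE)
  then obtain x y where xsd: "xs = [x, y]" by (auto simp: length_Suc_conv eval_nat_numeral)
  have fr: "distinct [x, y]" "{x, y} \<inter> verts G = {}" using xs xsd by auto
  have rv: "distinct [y, x]" using fr(1) by auto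
  have nt: "x \<noteq> t" "t \<noteq> x" "y \<noteq> t" "t \<noteq> y" if "t \<in> verts G" for t using that fr(2) by auto
  have ej: "{a, s} \<noteq> {j1, j2}" using jne by (auto simp: doubleton_eq_iff)
  have exy: "x \<notin> verts G" "y \<notin> verts G" "x \<noteq> y" using fr by auto
  have eG: "{a, s} \<in> edges G" "{a, s} \<notin> edges F" using EG EF by auto
  obtain G2 where P2: "plus2 G {a, s} {j1, j2} x y G2" by (rule plus2I[OF eG(1) jG ej exy])
  have G2: "cubic G2" by (rule cubic_plus2[OF G P2])
  note G2v = plus2D(7)[OF P2] and G2e = plus2D(8)[OF P2]
  let ?N1 = "[(v, b), (v, c), (v, a), (a, A)]" and ?N2 = "[(x, s), (x, y), (x, a), (y, j1), (y, j2)]" and ?al = "[(v, r7), (a, r6), (x, r5), (y, u)]"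
  let ?D = "{{a, s}, {j1, j2}}" and ?S = "set [v, a]"
  have VV: "A \<in> verts G" "a \<in> verts G" "b \<in> verts G" "c \<in> verts G" "j1 \<in> verts G" "j2 \<in> verts G" "s \<in> verts G" "v \<in> verts G" by (use VG V jV in simp_all)
  note nts = nt[OF VV(1)] nt[OF VV(2)] nt[OF VV(3)] nt[OF VV(4)] nt[OF VV(5)] nt[OF VV(6)] nt[OF VV(7)] nt[OF VV(8)]
  have mv: "{d \<in> edges G. t \<in> d} \<subseteq> ?D \<union> eds ?N1" if "t \<in> ?S" for t
    using touch[of "?D \<union> eds ?N1" t] that by (simp add: insert_commute)
  have N1: "{i, j} \<in> edges G \<and> {i, j} \<notin> ?D" if "(i, j) \<in> set ?N1" for i j
    using that by (simp, elim disjE conjE; use EG AG jG ne cs sne jne in \<open>simp add: doubleton_eq_iff insert_commute\<close>)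
  have rt: "routes [(r5, vx s), (r5, u), (r5, r6), (r6, vx A), (r6, r7), (r7, vx b), (r7, vx c), (u, vx j1), (u, vx j2)] [[5], [6], [4], [3], [0], [1], [2], [7], [8]] (map (map_prod (sp.place ?al) (sp.place ?al)) (?N1 @ ?N2))"
    using nts fr(1) rv ne cs sne jne by (simp add: sp.place_simps)
  have "lands G2 (?D \<union> eds ?N1) ?S"
  proof (rule land[where xs = "[x, y]" and J = "{{j1, j2}}" and al = ?al and Nnew = ?N2, OF G2 _ _ _ _ N1 _ mv _ _ _ _ _ _ _ L rt])
    show "verts G2 = verts G \<union> set [x, y]" unfolding G2v by (simp add: insert_commute)
    show "edges G2 = (edges G - ?D) \<union> eds ?N2" unfolding G2e by (simp add: insert_commute)
    show "distinct (map snd ?al)" using r VV ne by (simp add: good_def vm_eq u_off u_off[symmetric]; metis)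
    show "q = u \<or> good q \<or> q \<in> vx ` ?S" if "q \<in> snd ` set ?al" for q using that r by auto
  qed (use fr VV ne cs sne jne in auto)
  then obtain \<rho> where \<rho>: "hom_embedding \<rho> G2 H" "respects_embedding \<rho> \<eta>F F"
  proof (rule landed_respects)
    fix t assume "t \<in> ?S" "t \<in> verts F" then show "degree F t = 1" using vF cF aF by auto
  next
    fix d assume "d \<in> ?D \<union> eds ?N1" "d \<in> edges F"
    then show "\<exists>t\<in>d. degree F t = 1"
      by (simp, elim disjE; use jF EF vF0 aF in \<open>auto; fail\<close>)
  qed
  show ?thesis by (rule pair_common[OF eG jG jF ej P2 \<rho>])
qed

text \<open>The routing \<open>Up 1 0\<close> contradicts (E4) for \<open>{v, c}\<close> in
  \<open>Dh\<close> and the landing edge in \<open>Df\<close>. These edges are disjoint since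
  \<open>c\<close> is not on \<open>Df\<close>, and the landing edge is not in \<open>Dh\<close>
  since it avoids the corner.\<close>

lemma outer_leg:
  assumes r: "good r5" "good r6" "good r7" "good r8" "good r9" "distinct [r5, r6, r7, r8, r9]"
    and L: "linked (sp.free {{j1, j2}}) [(r5, vx b), (r5, r6), (r5, r7), (r7, vx c), (r7, r8), (r8, vx A), (r8, r9), (r9, u), (r9, r6), (r6, vx s), (u, vx j1), (u, vx j2)]"
    and jD: "{j1, j2} \<in> edges Df"
  shows "False"
proof -
  have cj: "c \<notin> {j1, j2}" using cDf mem(3)[OF Df(1) jD] by blast
  have jDh: "{j1, j2} \<notin> edges Dh" using ii[OF jD] jne by (auto simp: doubleton_eq_iff)
  have nn: "c \<noteq> j1" "c \<noteq> j2" "j1 \<noteq> c" "j2 \<noteq> c" using cj by auto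
  have eG: "{v, c} \<in> edges G" "{j1, j2} \<in> edges G" using EG jG by auto
  obtain x y x' y' where fr: "distinct [x, y, x', y']" "{x, y, x', y'} \<inter> verts G = {}" by (rule fresh4)
  have rv: "distinct [y', x', y, x]" using fr(1) by auto
  have nt: "x \<noteq> t" "t \<noteq> x" "y \<noteq> t" "t \<noteq> y" "x' \<noteq> t" "t \<noteq> x'" "y' \<noteq> t" "t \<noteq> y'" if "t \<in> verts G" for t using that fr(2) by auto
  have d3: "distinct [{v, c}, {a, A}, {j1, j2}]" using ne cs sne jne nn by (simp add: doubleton_eq_iff)
  obtain G1 G2 where P1: "plus2 G {v, c} {a, A} x y G1" and P2: "plus2 G1 {j1, j2} {a, y} x' y' G2" and G2: "cubic G2"
    and G2v: "verts G2 = verts G \<union> {x, y, x', y'}"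
    and G2e: "edges G2 = (edges G - {{v, c}, {a, A}, {j1, j2}}) \<union> {{x, v}, {x, c}, {y, A}, {x, y}, {x', j1}, {x', j2}, {y', a}, {y', y}, {x', y'}}"
    by (rule double_plus2[OF G eG(1) AG eG(2) d3 fr])
  let ?N1 = "[(v, b), (v, a), (a, s)]" and ?N2 = "[(x, v), (x, c), (y, A), (x, y), (x', j1), (x', j2), (y', a), (y', y), (x', y')]" and ?al = "[(v, r5), (a, r6), (x, r7), (y, r8), (x', u), (y', r9)]"
  let ?D = "{{v, c}, {a, A}, {j1, j2}}" and ?S = "set [v, a]"
  have VV: "A \<in> verts G" "a \<in> verts G" "b \<in> verts G" "c \<in> verts G" "j1 \<in> verts G" "j2 \<in> verts G" "s \<in> verts G" "v \<in> verts G" by (use VG V jV nn in simp_all)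
  note nts = nt[OF VV(1)] nt[OF VV(2)] nt[OF VV(3)] nt[OF VV(4)] nt[OF VV(5)] nt[OF VV(6)] nt[OF VV(7)] nt[OF VV(8)]
  have mv: "{d \<in> edges G. t \<in> d} \<subseteq> ?D \<union> eds ?N1" if "t \<in> ?S" for t
    using touch[of "?D \<union> eds ?N1" t] that by (simp add: insert_commute)
  have N1: "{i, j} \<in> edges G \<and> {i, j} \<notin> ?D" if "(i, j) \<in> set ?N1" for i j
    using that by (simp, elim disjE conjE; use EG AG jG ne cs sne jne nn in \<open>simp add: doubleton_eq_iff insert_commute\<close>)
  have rt: "routes [(r5, vx b), (r5, r6), (r5, r7), (r7, vx c), (r7, r8), (r8, vx A), (r8, r9), (r9, u), (r9, r6), (r6, vx s), (u, vx j1), (u, vx j2)] [[0], [1], [9], [2], [3], [5], [4], [10], [11], [8], [6], [7]] (map (map_prod (sp.place ?al) (sp.place ?al)) (?N1 @ ?N2))"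
    using nts fr(1) rv ne cs sne jne nn by (simp add: sp.place_simps)
  have "lands G2 (?D \<union> eds ?N1) ?S"
  proof (rule land[where xs = "[x, y, x', y']" and J = "{{j1, j2}}" and al = ?al and Nnew = ?N2, OF G2 _ _ _ _ N1 _ mv _ _ _ _ _ _ _ L rt])
    show "verts G2 = verts G \<union> set [x, y, x', y']" unfolding G2v by (simp add: insert_commute)
    show "edges G2 = (edges G - ?D) \<union> eds ?N2" unfolding G2e by (simp add: insert_commute)
    show "distinct (map snd ?al)" using r VV ne nn by (simp add: good_def vm_eq u_off u_off[symmetric]; metis)
    show "q = u \<or> good q \<or> q \<in> vx ` ?S" if "q \<in> snd ` set ?al" for q using that r by auto
  qed (use fr VV ne cs sne jne nn in auto)
  then obtain \<rho> where \<rho>: "hom_embedding \<rho> G2 H" "respects_embedding \<rho> \<eta>F F"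
  proof (rule landed_respects)
    fix t assume "t \<in> ?S" "t \<in> verts F" then show "degree F t = 1" using vF cF aF by auto
  next
    fix d assume "d \<in> ?D \<union> eds ?N1" "d \<in> edges F"
    then show "\<exists>t\<in>d. degree F t = 1"
      by (simp, elim disjE; use jF EF vF0 aF in \<open>auto; fail\<close>)
  qed
  show False by (rule e4_use[OF Dh(3) hDf jD jDh _ P1 P2 \<rho>]) (use jne nn in auto)
qed

text \<open>The connections of \<open>Wp 0 1\<close> with \<open>r5\<close> to \<open>r11\<close>
  for its nodes; \<open>ps\<close> holds the halves of the landing edge and edges given up
  later.\<close>

abbreviation "wp r5 r6 r7 r8 r9 r10 r11 ps \<equiv>
  [(r5, r6), (r5, r11), (r11, u), (r11, r10), (r10, vx b), (r10, r9), (r5, r7), (r7, vx c), (r7, r8), (r8, vx A), (r8, r9), (r9, r6),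
   (r6, vx s)] @ ps"

text \<open>The routing \<open>Wp 0 1\<close> contradicts (E5) directly, provided that the landing
  edge satisfies the distance conditions there. The cases in which it does not are treated by the
  four lemmas that follow.\<close>

lemma far:
  assumes r: "good r5" "good r6" "good r7" "good r8" "good r9" "good r10" "good r11" "distinct [r5, r6, r7, r8, r9, r10, r11]"
    and L: "linked (sp.free {{j1, j2}}) (wp r5 r6 r7 r8 r9 r10 r11 [(u, vx j1), (u, vx j2)])"
    and jC: "{j1, j2} \<in> edges C0"
    and far: "c \<notin> {j1, j2}" "b \<notin> {j1, j2}" "\<not> adjacent G j1 b" "\<not> adjacent G j2 b"
  shows "False"
proof -
  have nn: "c \<noteq> j1" "c \<noteq> j2" "j1 \<noteq> c" "j2 \<noteq> c" "b \<noteq> j1" "b \<noteq> j2" "j1 \<noteq> b" "j2 \<noteq> b" using far by auto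
  obtain xs where xs: "length xs = 6 \<and> distinct xs \<and> set xs \<inter> verts G = {}" using fresh_list[OF finG(1), of 6] by (elim exE)
  then obtain x y x' y' x3 y3 where xsd: "xs = [x, y, x', y', x3, y3]" by (auto simp: length_Suc_conv eval_nat_numeral)
  have fr: "distinct [x, y, x', y', x3, y3]" "{x, y, x', y', x3, y3} \<inter> verts G = {}" using xs xsd by auto
  have rv: "distinct [y3, x3, y', x', y, x]" using fr(1) by auto
  have nt: "x \<noteq> t" "t \<noteq> x" "y \<noteq> t" "t \<noteq> y" "x' \<noteq> t" "t \<noteq> x'" "y' \<noteq> t" "t \<noteq> y'" "x3 \<noteq> t" "t \<noteq> x3" "y3 \<noteq> t" "t \<noteq> y3" if "t \<in> verts G" for t using that fr(2) by auto
  have d3: "distinct [{v, c}, {a, A}, {v, b}]" using ne cs sne by (simp add: doubleton_eq_iff)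
  have fr4: "distinct [x, y, x', y']" "{x, y, x', y'} \<inter> verts G = {}" using fr by auto
  obtain G0 G1 where P0: "plus2 G {v, c} {a, A} x y G0" and P1: "plus2 G0 {v, b} {a, y} x' y' G1" and G1: "cubic G1"
    and G1v: "verts G1 = verts G \<union> {x, y, x', y'}"
    and G1e: "edges G1 = (edges G - {{v, c}, {a, A}, {v, b}}) \<union> {{x, v}, {x, c}, {y, A}, {x, y}, {x', v}, {x', b}, {y', a}, {y', y}, {x', y'}}"
    by (rule double_plus2[OF G EG(3) AG EG(2) d3 fr4])
  have x'G: "x' \<notin> verts G" using fr by simp
  have jx: "{v, x'} \<noteq> {j1, j2}" using jV jne by (auto simp: doubleton_eq_iff)
  have jE: "{j1, j2} \<in> edges G1" unfolding G1e using jG jne by (simp add: doubleton_eq_iff)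
  have xE: "{v, x'} \<in> edges G1" unfolding G1e by (simp add: insert_commute)
  have fr1: "x3 \<notin> verts G1" "y3 \<notin> verts G1" "x3 \<noteq> y3" unfolding G1v using fr rv by auto
  obtain G2 where P2: "plus2 G1 {v, x'} {j1, j2} x3 y3 G2" by (rule plus2I[OF xE jE jx fr1])
  have G2: "cubic G2" by (rule cubic_plus2[OF G1 P2])
  have G2v: "verts G2 = verts G \<union> {x, y, x', y', x3, y3}" unfolding plus2D(7)[OF P2] G1v by auto
  have xE': "{v, x'} \<notin> edges G" using edge_pair[of "{v, x'}" x'] x'G by auto
  have G1e': "edges G1 = (edges G - {{v, c}, {a, A}, {v, b}}) \<union> insert {v, x'} {{x, v}, {x, c}, {y, A}, {x, y}, {x', b}, {y', a}, {y', y}, {x', y'}}"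
    unfolding G1e by (simp add: insert_commute)
  have nt6: "t \<noteq> x" "t \<noteq> y" "t \<noteq> x'" "t \<noteq> y'" "x \<noteq> t" "y \<noteq> t" "x' \<noteq> t" "y' \<noteq> t" if "t \<in> verts G" for t using that fr by auto
  note nt6s = nt6[OF VG(1)] nt6[OF VG(2)] nt6[OF VG(3)] nt6[OF VG(4)] nt6[OF V(2)] nt6[OF jV(1)] nt6[OF jV(2)]
  have sw2: "{{v, x'}, {j1, j2}} = {{j1, j2}, {v, x'}}" by (rule insert_commute)
  have "edges G2 = (edges G - insert {j1, j2} {{v, c}, {a, A}, {v, b}}) \<union> ({{x, v}, {x, c}, {y, A}, {x, y}, {x', b}, {y', a}, {y', y}, {x', y'}} \<union>
      {{x3, v}, {x3, x'}, {y3, j1}, {y3, j2}, {x3, y3}})"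
    unfolding plus2D(8)[OF P2] sw2 G1e'
    by (rule double_aux) (use xE' nt6s fr(1) rv jne ne in \<open>simp_all add: doubleton_eq_iff\<close>)
  then have G2e: "edges G2 = (edges G - {{v, c}, {a, A}, {v, b}, {j1, j2}}) \<union> {{x, v}, {x, c}, {y, A}, {x, y}, {x', b}, {y', a}, {y', y}, {x', y'},
      {x3, v}, {x3, x'}, {y3, j1}, {y3, j2}, {x3, y3}}" by (simp add: insert_commute)
  let ?N1 = "[(v, a), (a, s)]" and ?N2 = "[(x, v), (x, c), (y, A), (x, y), (x', b), (y', a), (y', y), (x', y'), (x3, v), (x3, x'), (y3, j1), (y3, j2), (x3, y3)]" and ?al = "[(v, r5), (a, r6), (x, r7), (y, r8), (x', r10), (y', r9), (x3, r11), (y3, u)]"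
  let ?D = "{{v, c}, {a, A}, {v, b}, {j1, j2}}" and ?S = "set [v, a]"
  have VV: "A \<in> verts G" "a \<in> verts G" "b \<in> verts G" "c \<in> verts G" "j1 \<in> verts G" "j2 \<in> verts G" "s \<in> verts G" "v \<in> verts G" by (use VG V jV nn in simp_all)
  note nts = nt[OF VV(1)] nt[OF VV(2)] nt[OF VV(3)] nt[OF VV(4)] nt[OF VV(5)] nt[OF VV(6)] nt[OF VV(7)] nt[OF VV(8)]
  have mv: "{d \<in> edges G. t \<in> d} \<subseteq> ?D \<union> eds ?N1" if "t \<in> ?S" for t
    using touch[of "?D \<union> eds ?N1" t] that by (simp add: insert_commute)
  have N1: "{i, j} \<in> edges G \<and> {i, j} \<notin> ?D" if "(i, j) \<in> set ?N1" for i j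
    using that by (simp, elim disjE conjE; use EG AG jG ne cs sne jne nn in \<open>simp add: doubleton_eq_iff insert_commute\<close>)
  have rt: "routes (wp r5 r6 r7 r8 r9 r10 r11 [(u, vx j1), (u, vx j2)]) [[0], [12], [6], [7], [9], [8], [4], [11], [10], [5], [1], [3], [13], [14], [2]] (map (map_prod (sp.place ?al) (sp.place ?al)) (?N1 @ ?N2))"
    using nts fr(1) rv ne cs sne jne nn by (simp add: sp.place_simps)
  have "lands G2 (?D \<union> eds ?N1) ?S"
  proof (rule land[where xs = "[x, y, x', y', x3, y3]" and J = "{{j1, j2}}" and al = ?al and Nnew = ?N2, OF G2 _ _ _ _ N1 _ mv _ _ _ _ _ _ _ L rt])
    show "verts G2 = verts G \<union> set [x, y, x', y', x3, y3]" unfolding G2v by (simp add: insert_commute)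
    show "edges G2 = (edges G - ?D) \<union> eds ?N2" unfolding G2e by (simp add: insert_commute)
    show "distinct (map snd ?al)" using r VV ne nn by (simp add: good_def vm_eq u_off u_off[symmetric]; metis)
    show "q = u \<or> good q \<or> q \<in> vx ` ?S" if "q \<in> snd ` set ?al" for q using that r by auto
  qed (use fr VV ne cs sne jne nn in auto)
  then obtain \<rho> where \<rho>: "hom_embedding \<rho> G2 H" "respects_embedding \<rho> \<eta>F F"
  proof (rule landed_respects)
    fix t assume "t \<in> ?S" "t \<in> verts F" then show "degree F t = 1" using vF cF aF by auto
  next
    fix d assume "d \<in> ?D \<union> eds ?N1" "d \<in> edges F"
    then show "\<exists>t\<in>d. degree F t = 1"
      by (simp, elim disjE; use jF EF vF0 aF in \<open>auto; fail\<close>)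
  qed
  have adj: "{t. adjacent G v t} = {a, c, b}"
  proof -
    have "adjacent G v t \<longleftrightarrow> {v, t} \<in> {d \<in> edges G. v \<in> d}" for t by (simp add: adjacent_def)
    then have "adjacent G v t \<longleftrightarrow> t = a \<or> t = b \<or> t = c" for t unfolding at by (auto simp: doubleton_eq_iff)
    then show ?thesis by auto
  qed
  have h1: "a \<in> verts F \<and> degree F a = 1 \<and> {a, A} \<in> edges F \<and> a \<in> {a, A} \<and> adjacent (delete_edges G (edges F)) v a \<and>
      C0 \<in> \<C> \<and> v \<in> verts C0 \<and> a \<notin> verts C0 \<and> distinct [a, c, b] \<and> {t. adjacent G v t} = {a, c, b}"
    using aF AF EG(1) EF(1) C0(1) mem(3)[OF C0(1,2)] aC0 ne adj by (simp add: adjacent_def delete_edges_def)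
  \<comment> \<open>(E5) is used with \<open>a\<close> as the leaf of \<open>F\<close>,
    \<open>v\<close> as its neighbour, \<open>c\<close> and \<open>b\<close> as \<open>w1\<close>
    and \<open>w2\<close>, and i = 2; hence only adjacency to \<open>b\<close> matters.\<close>
  note E5i = e5[unfolded E5_def, rule_format, OF h1 conjI[OF P0 P1], of "(x', b)", unfolded prod.case, rule_format, OF _ jC]
  have "\<not> (\<exists>x'' y'' G''' \<eta>. plus2 G1 {v, x'} {j1, j2} x'' y'' G''' \<and> hom_embedding \<eta> G''' H \<and> respects_embedding \<eta> \<eta>F F)"
    by (rule E5i) (use far in auto)
  then show False using P2 \<rho> by blast
qed

lemma near_b:
  \<comment> \<open>The case in which the landing edge starts at \<open>b\<close>: moving
    \<open>b\<close> to \<open>u\<close> frees its old image as a foot on the remaining edge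
    \<open>{b, b1}\<close> of \<open>Df\<close>, and (E4) applies to \<open>{v, c}\<close> and
    \<open>{b, b1}\<close>.\<close>
  assumes r: "good r5" "good r6" "good r7" "good r8" "good r9" "good r10" "good r11" "distinct [r5, r6, r7, r8, r9, r10, r11]"
    and L: "linked (sp.free {{j1, j2}}) (wp r5 r6 r7 r8 r9 r10 r11 [(u, vx j1), (u, vx j2)])"
    and jC: "{j1, j2} \<in> edges C0"
    and jb: "j1 = b"
  shows "False"
proof -
  have jb': "{j1, j2} = {b, j2}" using jb by simp
  have oG: "{b, j2} \<in> edges G" using jG jb by simp
  have ob: "b \<in> {b, j2}" by simp
  have one: "{v, b} \<noteq> {b, j2}" using jne by (auto simp: doubleton_eq_iff)
  have oDf: "{b, j2} \<notin> edges Df" using i0[of "{b, j2}"] jC jb jne by (auto simp: doubleton_eq_iff)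
  obtain m where m: "m \<in> edges G" "b \<in> m" "m \<noteq> {v, b}" "m \<noteq> {b, j2}" "{d \<in> edges G. b \<in> d} = {{v, b}, {b, j2}, m}"
    by (rule third_edge[OF VG(3) EG(2) oG _ ob one]) simp
  obtain b1 where b1: "m = {b, b1}" "b1 \<noteq> b" "b1 \<in> verts G" using edge_pair[OF m(1,2)] by blast
  have mDf: "{b, b1} \<in> edges Df"
  proof -
    obtain p q where pq: "p \<noteq> q" "p \<in> edges Df" "q \<in> edges Df" "b \<in> p" "b \<in> q"
      by (rule circuit_two[OF Df(1) cDfD, of b]) (use mem(3)[OF Df(1,3), of b] in auto)
    have "p \<in> {{v, b}, {b, j2}, m}" "q \<in> {{v, b}, {b, j2}, m}" unfolding m(5)[symmetric] using pq mem(1)[OF Df(1)] by simp_all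
    then show ?thesis using pq oDf b1(1) by auto
  qed
  have b1n: "b1 \<noteq> v" "b1 \<noteq> c" using m(3) b1(1) cDf mem(3)[OF Df(1) mDf, of b1] by (auto simp: insert_commute)
  have b1a: "b1 \<noteq> a"
  proof
    assume "b1 = a"
    then have "{b, a} \<in> {d \<in> edges G. a \<in> d}" using m(1) b1(1) by simp
    then show False unfolding ata using ne cs by (auto simp: doubleton_eq_iff)
  qed
  have mDh: "{b, b1} \<notin> edges Dh" using ii[OF mDf] ne b1n b1a by (auto simp: doubleton_eq_iff)
  have b1j: "b1 \<noteq> j2" using m(4) b1(1) by auto
  have nn: "j1 = b" "b1 \<noteq> b" "b1 \<noteq> v" "b1 \<noteq> c" "b1 \<noteq> a" "b1 \<noteq> j2" "b \<noteq> b1" "v \<noteq> b1" "c \<noteq> b1" "a \<noteq> b1" "j2 \<noteq> b1" "b1 \<in> verts G" "j2 \<noteq> b" "b \<noteq> j2"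
    using jb b1 b1n b1a b1j jne by auto
  have op: "{b, b1} \<in> Rest" "{b, b1} \<notin> {{j1, j2}}" using m(1) b1(1) nn ne by (auto simp: doubleton_eq_iff)
  have eG: "{v, c} \<in> edges G" "{b, b1} \<in> edges G" using EG m(1) b1(1) by auto
  note atb = m(5)[unfolded b1(1)]
  obtain x y x' y' where fr: "distinct [x, y, x', y']" "{x, y, x', y'} \<inter> verts G = {}" by (rule fresh4)
  have rv: "distinct [y', x', y, x]" using fr(1) by auto
  have nt: "x \<noteq> t" "t \<noteq> x" "y \<noteq> t" "t \<noteq> y" "x' \<noteq> t" "t \<noteq> x'" "y' \<noteq> t" "t \<noteq> y'" if "t \<in> verts G" for t using that fr(2) by auto
  have L1: "linked (sp.free {{b, b1}, {j1, j2}}) (wp r5 r6 r7 r8 r9 r10 r11 [(u, vx j1), (u, vx j2), (vx b, vx b1)])"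
    using sp.open_edge[OF L op(1) op(2)] by simp
  have d3: "distinct [{v, c}, {a, A}, {b, b1}]" using ne cs sne jne nn by (simp add: doubleton_eq_iff)
  obtain G1 G2 where P1: "plus2 G {v, c} {a, A} x y G1" and P2: "plus2 G1 {b, b1} {a, y} x' y' G2" and G2: "cubic G2"
    and G2v: "verts G2 = verts G \<union> {x, y, x', y'}"
    and G2e: "edges G2 = (edges G - {{v, c}, {a, A}, {b, b1}}) \<union> {{x, v}, {x, c}, {y, A}, {x, y}, {x', b}, {x', b1}, {y', a}, {y', y}, {x', y'}}"
    by (rule double_plus2[OF G eG(1) AG eG(2) d3 fr])
  let ?N1 = "[(v, a), (a, s), (v, b), (b, j2)]" and ?N2 = "[(x, v), (x, c), (y, A), (x, y), (x', b), (x', b1), (y', a), (y', y), (x', y')]" and ?al = "[(v, r5), (a, r6), (b, u), (x, r7), (y, r8), (x', vx b), (y', r9)]"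
  let ?D = "{{v, c}, {a, A}, {b, b1}}" and ?S = "set [v, a, b]"
  have VV: "A \<in> verts G" "a \<in> verts G" "b \<in> verts G" "b1 \<in> verts G" "c \<in> verts G" "j2 \<in> verts G" "s \<in> verts G" "v \<in> verts G" by (use VG V jV nn in simp_all)
  note nts = nt[OF VV(1)] nt[OF VV(2)] nt[OF VV(3)] nt[OF VV(4)] nt[OF VV(5)] nt[OF VV(6)] nt[OF VV(7)] nt[OF VV(8)]
  have mv: "{d \<in> edges G. t \<in> d} \<subseteq> ?D \<union> eds ?N1" if "t \<in> ?S" for t
    using that touch[of "?D \<union> eds ?N1" t] atb by (simp add: insert_commute; elim disjE; simp add: insert_commute)
  have N1: "{i, j} \<in> edges G \<and> {i, j} \<notin> ?D" if "(i, j) \<in> set ?N1" for i j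
    using that by (simp, elim disjE conjE; use EG AG jG ne cs sne jne nn in \<open>simp add: doubleton_eq_iff insert_commute\<close>)
  have rt: "routes (wp r5 r6 r7 r8 r9 r10 r11 [(u, vx j1), (u, vx j2), (vx b, vx b1)]) [[0], [12], [1, 2], [14], [6], [7], [9], [8], [13], [15], [11], [10], [4, 5]] (map (map_prod (sp.place ?al) (sp.place ?al)) (?N1 @ ?N2))"
    using nts fr(1) rv ne cs sne jne nn by (simp add: sp.place_simps)
  have "lands G2 (?D \<union> eds ?N1) ?S"
  proof (rule land[where xs = "[x, y, x', y']" and J = "{{b, b1}, {j1, j2}}" and al = ?al and Nnew = ?N2, OF G2 _ _ _ _ N1 _ mv _ _ _ _ _ _ _ L1 rt])
    show "verts G2 = verts G \<union> set [x, y, x', y']" unfolding G2v by (simp add: insert_commute)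
    show "edges G2 = (edges G - ?D) \<union> eds ?N2" unfolding G2e by (simp add: insert_commute)
    show "distinct (map snd ?al)"
    proof -
      have gb: "vx b \<noteq> r" "r \<noteq> vx b" "r \<noteq> u" "u \<noteq> r" if "good r" for r using that VG(3) ne unfolding good_def by auto
      have "distinct [r11, r10, r9, r8, r7, r6, r5]" using r(8) by auto
      then show ?thesis using r(8) gb[OF r(1)] gb[OF r(2)] gb[OF r(3)] gb[OF r(4)] gb[OF r(5)] gb[OF r(6)] gb[OF r(7)]
          u_off[OF VG(3)] u_off[OF VG(3), symmetric] by simp
    qed
    show "q = u \<or> good q \<or> q \<in> vx ` ?S" if "q \<in> snd ` set ?al" for q using that r by auto
  qed (use fr VV ne cs sne jne nn in auto)
  then obtain \<rho> where \<rho>: "hom_embedding \<rho> G2 H" "respects_embedding \<rho> \<eta>F F"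
  proof (rule landed_respects)
    fix t assume "t \<in> ?S" "t \<in> verts F" then show "degree F t = 1" using vF cF aF by auto
  next
    fix d assume "d \<in> ?D \<union> eds ?N1" "d \<in> edges F"
    then show "\<exists>t\<in>d. degree F t = 1"
      by (simp, elim disjE; use jF EF vF0 aF in \<open>auto; fail\<close>)
  qed
  show False by (rule e4_use[OF Dh(3) hDf mDf mDh _ P1 P2 \<rho>]) (use ne nn in auto)
qed

text \<open>The landing edge starts at \<open>c\<close>. Here \<open>c\<close> moves to
  \<open>u\<close> and \<open>v\<close> to \<open>r11\<close>, the old image of \<open>c\<close>
  becomes a foot on the edge \<open>{c, c2}\<close> of \<open>Dh\<close>, and (E4) applies to
  \<open>{c, c2}\<close> and \<open>{v, b}\<close>.\<close>

lemma near_c: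
  assumes r: "good r5" "good r6" "good r7" "good r8" "good r9" "good r10" "good r11" "distinct [r5, r6, r7, r8, r9, r10, r11]"
    and L: "linked (sp.free {{j1, j2}}) (wp r5 r6 r7 r8 r9 r10 r11 [(u, vx j1), (u, vx j2)])"
    and jC: "{j1, j2} \<in> edges C0"
    and jc: "j1 = c"
  shows "False"
proof -
  interpret sw: circ G F \<C> v a c b s Dh Df A C0 by (rule swapc)
  have oG: "{c, j2} \<in> edges G" using jG jc by simp
  have one: "{v, c} \<noteq> {c, j2}" using jne by (auto simp: doubleton_eq_iff)
  have oDh: "{c, j2} \<notin> edges Dh" using sw.i0[of "{c, j2}"] jC jc jne by (auto simp: doubleton_eq_iff)
  obtain m where m: "m \<in> edges G" "c \<in> m" "m \<noteq> {v, c}" "m \<noteq> {c, j2}" "{d \<in> edges G. c \<in> d} = {{v, c}, {c, j2}, m}"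
    by (rule third_edge[OF VG(4) EG(3) oG _ _ one]) simp_all
  obtain c2 where c2: "m = {c, c2}" "c2 \<noteq> c" "c2 \<in> verts G" using edge_pair[OF m(1,2)] by blast
  have mDh: "{c, c2} \<in> edges Dh"
  proof -
    obtain p q where pq: "p \<noteq> q" "p \<in> edges Dh" "q \<in> edges Dh" "c \<in> p" "c \<in> q"
      by (rule circuit_two[OF Dh(1) Dh_circuit, of c]) (use mem(3)[OF Dh(1,3), of c] in auto)
    have "p \<in> {{v, c}, {c, j2}, m}" "q \<in> {{v, c}, {c, j2}, m}" unfolding m(5)[symmetric] using pq mem(1)[OF Dh(1)] by simp_all
    then show ?thesis using pq oDh c2(1) by auto
  qed
  have c2n: "c2 \<noteq> v" "c2 \<noteq> b" using m(3) c2(1) sw.cDf mem(3)[OF Dh(1) mDh, of c2] by (auto simp: insert_commute)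
  have c2a: "c2 \<noteq> a"
  proof
    assume "c2 = a"
    then have "{c, a} \<in> {d \<in> edges G. a \<in> d}" using m(1) c2(1) by simp
    then show False unfolding ata using ne cs by (auto simp: doubleton_eq_iff)
  qed
  have mDf: "{c, c2} \<notin> edges Df" using sw.ii[OF mDh] ne c2n c2a by (auto simp: doubleton_eq_iff)
  have c2j: "c2 \<noteq> j2" using m(4) c2(1) by auto
  have nn: "j1 = c" "c2 \<noteq> c" "c2 \<noteq> v" "c2 \<noteq> b" "c2 \<noteq> a" "c2 \<noteq> j2" "c \<noteq> c2" "v \<noteq> c2" "b \<noteq> c2" "a \<noteq> c2" "j2 \<noteq> c2" "c2 \<in> verts G" "j2 \<noteq> c" "c \<noteq> j2"
    using jc c2 c2n c2a c2j jne by auto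
  have op: "{c, c2} \<in> Rest" "{c, c2} \<notin> {{j1, j2}}" using m(1) c2(1) nn ne by (auto simp: doubleton_eq_iff)
  have eG: "{c, c2} \<in> edges G" "{v, b} \<in> edges G" using EG m(1) c2(1) by auto
  note atb = m(5)[unfolded c2(1)]
  obtain x y x' y' where fr: "distinct [x, y, x', y']" "{x, y, x', y'} \<inter> verts G = {}" by (rule fresh4)
  have rv: "distinct [y', x', y, x]" using fr(1) by auto
  have nt: "x \<noteq> t" "t \<noteq> x" "y \<noteq> t" "t \<noteq> y" "x' \<noteq> t" "t \<noteq> x'" "y' \<noteq> t" "t \<noteq> y'" if "t \<in> verts G" for t using that fr(2) by auto
  have L1: "linked (sp.free {{c, c2}, {j1, j2}}) (wp r5 r6 r7 r8 r9 r10 r11 [(u, vx j1), (u, vx j2), (vx c, vx c2)])"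
    using sp.open_edge[OF L op(1) op(2)] by simp
  have d3: "distinct [{c, c2}, {a, A}, {v, b}]" using ne cs sne jne nn by (simp add: doubleton_eq_iff)
  obtain G1 G2 where P1: "plus2 G {c, c2} {a, A} x y G1" and P2: "plus2 G1 {v, b} {a, y} x' y' G2" and G2: "cubic G2"
    and G2v: "verts G2 = verts G \<union> {x, y, x', y'}"
    and G2e: "edges G2 = (edges G - {{c, c2}, {a, A}, {v, b}}) \<union> {{x, c}, {x, c2}, {y, A}, {x, y}, {x', v}, {x', b}, {y', a}, {y', y}, {x', y'}}"
    by (rule double_plus2[OF G eG(1) AG eG(2) d3 fr])
  let ?N1 = "[(v, a), (a, s), (v, c), (c, j2)]" and ?N2 = "[(x, c), (x, c2), (y, A), (x, y), (x', v), (x', b), (y', a), (y', y), (x', y')]" and ?al = "[(v, r11), (a, r6), (c, u), (x, vx c), (y, r8), (x', r10), (y', r9)]"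
  let ?D = "{{c, c2}, {a, A}, {v, b}}" and ?S = "set [v, a, c]"
  have VV: "A \<in> verts G" "a \<in> verts G" "b \<in> verts G" "c \<in> verts G" "c2 \<in> verts G" "j2 \<in> verts G" "s \<in> verts G" "v \<in> verts G" by (use VG V jV nn in simp_all)
  note nts = nt[OF VV(1)] nt[OF VV(2)] nt[OF VV(3)] nt[OF VV(4)] nt[OF VV(5)] nt[OF VV(6)] nt[OF VV(7)] nt[OF VV(8)]
  have mv: "{d \<in> edges G. t \<in> d} \<subseteq> ?D \<union> eds ?N1" if "t \<in> ?S" for t
    using that touch[of "?D \<union> eds ?N1" t] atb by (simp add: insert_commute; elim disjE; simp add: insert_commute)
  have N1: "{i, j} \<in> edges G \<and> {i, j} \<notin> ?D" if "(i, j) \<in> set ?N1" for i j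
    using that by (simp, elim disjE conjE; use EG AG jG ne cs sne jne nn in \<open>simp add: doubleton_eq_iff insert_commute\<close>)
  have rt: "routes (wp r5 r6 r7 r8 r9 r10 r11 [(u, vx j1), (u, vx j2), (vx c, vx c2)]) [[1, 0], [12], [2], [14], [13], [15], [9], [7, 8], [3], [4], [11], [10], [5]] (map (map_prod (sp.place ?al) (sp.place ?al)) (?N1 @ ?N2))"
    using nts fr(1) rv ne cs sne jne nn by (simp add: sp.place_simps)
  have "lands G2 (?D \<union> eds ?N1) ?S"
  proof (rule land[where xs = "[x, y, x', y']" and J = "{{c, c2}, {j1, j2}}" and al = ?al and Nnew = ?N2, OF G2 _ _ _ _ N1 _ mv _ _ _ _ _ _ _ L1 rt])
    show "verts G2 = verts G \<union> set [x, y, x', y']" unfolding G2v by (simp add: insert_commute)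
    show "edges G2 = (edges G - ?D) \<union> eds ?N2" unfolding G2e by (simp add: insert_commute)
    show "distinct (map snd ?al)"
    proof -
      have gb: "vx c \<noteq> r" "r \<noteq> vx c" "r \<noteq> u" "u \<noteq> r" if "good r" for r using that VG(4) ne unfolding good_def by auto
      have "distinct [r11, r10, r9, r8, r7, r6, r5]" using r(8) by auto
      then show ?thesis using r(8) gb[OF r(1)] gb[OF r(2)] gb[OF r(3)] gb[OF r(4)] gb[OF r(5)] gb[OF r(6)] gb[OF r(7)]
          u_off[OF VG(4)] u_off[OF VG(4), symmetric] by simp
    qed
    show "q = u \<or> good q \<or> q \<in> vx ` ?S" if "q \<in> snd ` set ?al" for q using that r by auto
  qed (use fr VV ne cs sne jne nn in auto)
  then obtain \<rho> where \<rho>: "hom_embedding \<rho> G2 H" "respects_embedding \<rho> \<eta>F F"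
  proof (rule landed_respects)
    fix t assume "t \<in> ?S" "t \<in> verts F" then show "degree F t = 1" using vF cF aF by auto
  next
    fix d assume "d \<in> ?D \<union> eds ?N1" "d \<in> edges F"
    then show "\<exists>t\<in>d. degree F t = 1"
      by (simp, elim disjE; use jF EF vF0 aF in \<open>auto; fail\<close>)
  qed
  show False by (rule e4_use[OF mDh mDf Df(3) sw.hDf _ P1 P2 \<rho>]) (use ne nn in auto)
qed

lemma near_adj:
  assumes r: "good r5" "good r6" "good r7" "good r8" "good r9" "good r10" "good r11" "distinct [r5, r6, r7, r8, r9, r10, r11]"
    and L: "linked (sp.free {{j1, j2}}) (wp r5 r6 r7 r8 r9 r10 r11 [(u, vx j1), (u, vx j2)])"
    and jC: "{j1, j2} \<in> edges C0"
    and far: "c \<notin> {j1, j2}" "b \<notin> {j1, j2}"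
    and near: "adjacent G j1 b"
    and jA: "j1 \<noteq> A"
  shows "False"
proof -
  have jn: "j1 \<noteq> b" "j2 \<noteq> b" "j1 \<noteq> c" "j2 \<noteq> c" using far by auto
  have j1C: "j1 \<in> verts C0" using mem(3)[OF C0(1) jC, of j1] by simp
  have sC0: "s \<notin> verts C0"
  proof
    assume s: "s \<in> verts C0"
    have "\<exists>e. e \<in> edges Df \<and> e \<in> edges C0 \<and> s \<in> e"
      by (rule share_vertex[OF Df(1) C0(1) C0ne(1)[symmetric] _ s nF(2), of v])
        (use mem(3)[OF Df(1,4), of s] mem(3)[OF Df(1,2), of v] mem(3)[OF C0(1,2), of v] cs in auto)
    then show False using i0 cs sne by blast
  qed
  have js: "j1 \<noteq> s" using j1C sC0 by auto
  have oG: "{b, j1} \<in> edges G" using near by (simp add: adjacent_def insert_commute)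
  have ob: "b \<in> {b, j1}" by simp
  have one: "{v, b} \<noteq> {b, j1}" using jne by (auto simp: doubleton_eq_iff)
  have oC0: "{b, j1} \<in> edges C0"
    by (rule mem(4)[OF C0(1) oG]) (use Fvert[of "{b, j1}" b] cF j1C mem(3)[OF C0(1,2), of b] in auto)
  have oDf: "{b, j1} \<notin> edges Df" using i0[of "{b, j1}"] oC0 jne by (auto simp: doubleton_eq_iff)
  obtain m where m: "m \<in> edges G" "b \<in> m" "m \<noteq> {v, b}" "m \<noteq> {b, j1}" "{d \<in> edges G. b \<in> d} = {{v, b}, {b, j1}, m}"
    by (rule third_edge[OF VG(3) EG(2) oG _ ob one]) simp
  obtain b1 where b1: "m = {b, b1}" "b1 \<noteq> b" "b1 \<in> verts G" using edge_pair[OF m(1,2)] by blast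
  have mDf: "{b, b1} \<in> edges Df"
  proof -
    obtain p q where pq: "p \<noteq> q" "p \<in> edges Df" "q \<in> edges Df" "b \<in> p" "b \<in> q"
      by (rule circuit_two[OF Df(1) cDfD, of b]) (use mem(3)[OF Df(1,3), of b] in auto)
    have "p \<in> {{v, b}, {b, j1}, m}" "q \<in> {{v, b}, {b, j1}, m}" unfolding m(5)[symmetric] using pq mem(1)[OF Df(1)] by simp_all
    then show ?thesis using pq oDf b1(1) by auto
  qed
  have b1n: "b1 \<noteq> v" "b1 \<noteq> c" using m(3) b1(1) cDf mem(3)[OF Df(1) mDf, of b1] by (auto simp: insert_commute)
  have b1a: "b1 \<noteq> a"
  proof
    assume "b1 = a"
    then have "{b, a} \<in> {d \<in> edges G. a \<in> d}" using m(1) b1(1) by simp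
    then show False unfolding ata using ne cs by (auto simp: doubleton_eq_iff)
  qed
  have mDh: "{b, b1} \<notin> edges Dh" using ii[OF mDf] ne b1n b1a by (auto simp: doubleton_eq_iff)
  have b1j: "b1 \<noteq> j1" using m(4) b1(1) by auto
  have jo: "{j1, j2} \<noteq> {b, j1}" using jn jne by (auto simp: doubleton_eq_iff)
  obtain g where g: "g \<in> edges G" "j1 \<in> g" "g \<noteq> {j1, j2}" "g \<noteq> {b, j1}" "{d \<in> edges G. j1 \<in> d} = {{j1, j2}, {b, j1}, g}"
    by (rule third_edge[OF jV(1) jG oG _ _ jo]) simp_all
  have lf: "degree F j1 = 1" if "j1 \<in> verts F" by (rule circuit_F(1)[OF C0(1) C0_circuit j1C that])
  obtain r2 where r2: "g = {j1, r2}" "r2 \<noteq> j1" "r2 \<in> verts G" using edge_pair[OF g(1,2)] by blast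
  have r2n: "r2 \<noteq> j2" "r2 \<noteq> b" using g(3,4) r2(1) by (auto simp: insert_commute)
  have r2v: "r2 \<noteq> v"
  proof
    assume "r2 = v"
    then have "{j1, v} \<in> {d \<in> edges G. v \<in> d}" using g(1) r2(1) by simp
    then show False unfolding at using jne jn by (auto simp: doubleton_eq_iff)
  qed
  have r2a: "r2 \<noteq> a"
  proof
    assume "r2 = a"
    then have "{j1, a} \<in> {d \<in> edges G. a \<in> d}" using g(1) r2(1) by simp
    then show False unfolding ata using jne jn js jA by (auto simp: doubleton_eq_iff)
  qed
  have nn: "b1 \<noteq> b" "b1 \<noteq> v" "b1 \<noteq> c" "b1 \<noteq> a" "b1 \<noteq> j1" "b \<noteq> b1" "v \<noteq> b1" "c \<noteq> b1" "a \<noteq> b1" "j1 \<noteq> b1" "b1 \<in> verts G" "j1 \<noteq> b" "b \<noteq> j1" "j2 \<noteq> b" "b \<noteq> j2"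
    "j1 \<noteq> c" "c \<noteq> j1" "j2 \<noteq> c" "c \<noteq> j2" "j1 \<noteq> s" "s \<noteq> j1"
    "r2 \<noteq> j1" "r2 \<noteq> j2" "r2 \<noteq> b" "r2 \<noteq> v" "r2 \<noteq> a" "j1 \<noteq> r2" "j2 \<noteq> r2" "b \<noteq> r2" "v \<noteq> r2" "a \<noteq> r2" "r2 \<in> verts G" "j1 \<noteq> A" "A \<noteq> j1"
    using b1 b1n b1a b1j jn js r2 r2n r2v r2a jA by auto
  have op: "{b, b1} \<in> Rest" "{b, b1} \<notin> {{j1, j2}}" "{j1, r2} \<in> Rest" "{j1, r2} \<notin> {{b, b1}, {j1, j2}}"
    using m(1) b1(1) g(1) r2(1) nn ne jne by (auto simp: doubleton_eq_iff)
  have eG: "{v, c} \<in> edges G" "{b, b1} \<in> edges G" "{b, j1} \<in> edges G" "{j1, r2} \<in> edges G" using EG m(1) b1(1) oG g(1) r2(1) by auto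
  note atb = m(5)[unfolded b1(1)] g(5)[unfolded r2(1)]
  obtain x y x' y' where fr: "distinct [x, y, x', y']" "{x, y, x', y'} \<inter> verts G = {}" by (rule fresh4)
  have rv: "distinct [y', x', y, x]" using fr(1) by auto
  have nt: "x \<noteq> t" "t \<noteq> x" "y \<noteq> t" "t \<noteq> y" "x' \<noteq> t" "t \<noteq> x'" "y' \<noteq> t" "t \<noteq> y'" if "t \<in> verts G" for t using that fr(2) by auto
  have L1: "linked (sp.free {{b, b1}, {j1, j2}}) (wp r5 r6 r7 r8 r9 r10 r11 [(u, vx j1), (u, vx j2), (vx b, vx b1)])"
    using sp.open_edge[OF L op(1) op(2)] by simp
  have L2: "linked (sp.free {{j1, r2}, {b, b1}, {j1, j2}}) (wp r5 r6 r7 r8 r9 r10 r11 [(u, vx j1), (u, vx j2), (vx b, vx b1), (vx j1, vx r2)])"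
    using sp.open_edge[OF L1 op(3) op(4)] by simp
  have d3: "distinct [{v, c}, {a, A}, {b, b1}]" using ne cs sne jne nn by (simp add: doubleton_eq_iff)
  obtain G1 G2 where P1: "plus2 G {v, c} {a, A} x y G1" and P2: "plus2 G1 {b, b1} {a, y} x' y' G2" and G2: "cubic G2"
    and G2v: "verts G2 = verts G \<union> {x, y, x', y'}"
    and G2e: "edges G2 = (edges G - {{v, c}, {a, A}, {b, b1}}) \<union> {{x, v}, {x, c}, {y, A}, {x, y}, {x', b}, {x', b1}, {y', a}, {y', y}, {x', y'}}"
    by (rule double_plus2[OF G eG(1) AG eG(2) d3 fr])
  let ?N1 = "[(v, a), (a, s), (v, b), (b, j1), (j1, j2), (j1, r2)]" and ?N2 = "[(x, v), (x, c), (y, A), (x, y), (x', b), (x', b1), (y', a), (y', y), (x', y')]" and ?al = "[(v, r5), (a, r6), (b, r11), (j1, u), (x, r7), (y, r8), (x', r10), (y', r9)]"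
  let ?D = "{{v, c}, {a, A}, {b, b1}}" and ?S = "set [v, a, b, j1]"
  have VV: "A \<in> verts G" "a \<in> verts G" "b \<in> verts G" "b1 \<in> verts G" "c \<in> verts G" "j1 \<in> verts G" "j2 \<in> verts G" "r2 \<in> verts G" "s \<in> verts G" "v \<in> verts G" by (use VG V jV nn in simp_all)
  note nts = nt[OF VV(1)] nt[OF VV(2)] nt[OF VV(3)] nt[OF VV(4)] nt[OF VV(5)] nt[OF VV(6)] nt[OF VV(7)] nt[OF VV(8)] nt[OF VV(9)] nt[OF VV(10)]
  have mv: "{d \<in> edges G. t \<in> d} \<subseteq> ?D \<union> eds ?N1" if "t \<in> ?S" for t
    using that touch[of "?D \<union> eds ?N1" t] atb by (simp add: insert_commute; elim disjE; simp add: insert_commute)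
  have N1: "{i, j} \<in> edges G \<and> {i, j} \<notin> ?D" if "(i, j) \<in> set ?N1" for i j
    using that by (simp, elim disjE conjE; use EG AG jG eG ne cs sne jne nn in \<open>simp add: doubleton_eq_iff insert_commute\<close>)
  have rt: "routes (wp r5 r6 r7 r8 r9 r10 r11 [(u, vx j1), (u, vx j2), (vx b, vx b1), (vx j1, vx r2)]) [[0], [12], [1], [2], [14], [13, 16], [6], [7], [9], [8], [3], [4, 15], [11], [10], [5]] (map (map_prod (sp.place ?al) (sp.place ?al)) (?N1 @ ?N2))"
    using nts fr(1) rv ne cs sne jne nn by (simp add: sp.place_simps)
  have "lands G2 (?D \<union> eds ?N1) ?S"
  proof (rule land[where xs = "[x, y, x', y']" and J = "{{j1, r2}, {b, b1}, {j1, j2}}" and al = ?al and Nnew = ?N2, OF G2 _ _ _ _ N1 _ mv _ _ _ _ _ _ _ L2 rt])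
    show "verts G2 = verts G \<union> set [x, y, x', y']" unfolding G2v by (simp add: insert_commute)
    show "edges G2 = (edges G - ?D) \<union> eds ?N2" unfolding G2e by (simp add: insert_commute)
    show "distinct (map snd ?al)" using r VV ne nn by (simp add: good_def vm_eq u_off u_off[symmetric]; metis)
    show "q = u \<or> good q \<or> q \<in> vx ` ?S" if "q \<in> snd ` set ?al" for q using that r by auto
  qed (use fr VV ne cs sne jne nn in auto)
  then obtain \<rho> where \<rho>: "hom_embedding \<rho> G2 H" "respects_embedding \<rho> \<eta>F F"
  proof (rule landed_respects)
    fix t assume "t \<in> ?S" "t \<in> verts F" then show "degree F t = 1" using vF cF aF lf by auto
  next
    fix d assume "d \<in> ?D \<union> eds ?N1" "d \<in> edges F"
    then show "\<exists>t\<in>d. degree F t = 1"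
      by (simp, elim disjE; use jF EF vF0 aF lf Fvert[of "{j1, r2}" j1] in \<open>auto; fail\<close>)
  qed
  show False by (rule e4_use[OF Dh(3) hDf mDf mDh _ P1 P2 \<rho>]) (use ne nn in auto)
qed

text \<open>The variant with \<open>j1\<close> equal to \<open>A\<close>: the third edge at
  \<open>j1\<close> is \<open>{a, A}\<close> itself, which is deleted, so no further edge has to be
  given up and the connection from \<open>y\<close> to \<open>A\<close> passes through the old image
  of \<open>A\<close>.\<close>

lemma near_adj_A:
  assumes r: "good r5" "good r6" "good r7" "good r8" "good r9" "good r10" "good r11" "distinct [r5, r6, r7, r8, r9, r10, r11]"
    and L: "linked (sp.free {{j1, j2}}) (wp r5 r6 r7 r8 r9 r10 r11 [(u, vx j1), (u, vx j2)])"
    and jC: "{j1, j2} \<in> edges C0"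
    and far: "c \<notin> {j1, j2}" "b \<notin> {j1, j2}"
    and near: "adjacent G j1 b"
    and jA: "j1 = A"
  shows "False"
proof -
  have jn: "j1 \<noteq> b" "j2 \<noteq> b" "j1 \<noteq> c" "j2 \<noteq> c" using far by auto
  have j1C: "j1 \<in> verts C0" using mem(3)[OF C0(1) jC, of j1] by simp
  have sC0: "s \<notin> verts C0"
  proof
    assume s: "s \<in> verts C0"
    have "\<exists>e. e \<in> edges Df \<and> e \<in> edges C0 \<and> s \<in> e"
      by (rule share_vertex[OF Df(1) C0(1) C0ne(1)[symmetric] _ s nF(2), of v])
        (use mem(3)[OF Df(1,4), of s] mem(3)[OF Df(1,2), of v] mem(3)[OF C0(1,2), of v] cs in auto)
    then show False using i0 cs sne by blast
  qed
  have js: "j1 \<noteq> s" using j1C sC0 by auto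
  have oG: "{b, j1} \<in> edges G" using near by (simp add: adjacent_def insert_commute)
  have ob: "b \<in> {b, j1}" by simp
  have one: "{v, b} \<noteq> {b, j1}" using jne by (auto simp: doubleton_eq_iff)
  have oC0: "{b, j1} \<in> edges C0"
    by (rule mem(4)[OF C0(1) oG]) (use Fvert[of "{b, j1}" b] cF j1C mem(3)[OF C0(1,2), of b] in auto)
  have oDf: "{b, j1} \<notin> edges Df" using i0[of "{b, j1}"] oC0 jne by (auto simp: doubleton_eq_iff)
  obtain m where m: "m \<in> edges G" "b \<in> m" "m \<noteq> {v, b}" "m \<noteq> {b, j1}" "{d \<in> edges G. b \<in> d} = {{v, b}, {b, j1}, m}"
    by (rule third_edge[OF VG(3) EG(2) oG _ ob one]) simp
  obtain b1 where b1: "m = {b, b1}" "b1 \<noteq> b" "b1 \<in> verts G" using edge_pair[OF m(1,2)] by blast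
  have mDf: "{b, b1} \<in> edges Df"
  proof -
    obtain p q where pq: "p \<noteq> q" "p \<in> edges Df" "q \<in> edges Df" "b \<in> p" "b \<in> q"
      by (rule circuit_two[OF Df(1) cDfD, of b]) (use mem(3)[OF Df(1,3), of b] in auto)
    have "p \<in> {{v, b}, {b, j1}, m}" "q \<in> {{v, b}, {b, j1}, m}" unfolding m(5)[symmetric] using pq mem(1)[OF Df(1)] by simp_all
    then show ?thesis using pq oDf b1(1) by auto
  qed
  have b1n: "b1 \<noteq> v" "b1 \<noteq> c" using m(3) b1(1) cDf mem(3)[OF Df(1) mDf, of b1] by (auto simp: insert_commute)
  have b1a: "b1 \<noteq> a"
  proof
    assume "b1 = a"
    then have "{b, a} \<in> {d \<in> edges G. a \<in> d}" using m(1) b1(1) by simp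
    then show False unfolding ata using ne cs by (auto simp: doubleton_eq_iff)
  qed
  have mDh: "{b, b1} \<notin> edges Dh" using ii[OF mDf] ne b1n b1a by (auto simp: doubleton_eq_iff)
  have b1j: "b1 \<noteq> j1" using m(4) b1(1) by auto
  have jo: "{j1, j2} \<noteq> {b, j1}" using jn jne by (auto simp: doubleton_eq_iff)
  obtain g where g: "g \<in> edges G" "j1 \<in> g" "g \<noteq> {j1, j2}" "g \<noteq> {b, j1}" "{d \<in> edges G. j1 \<in> d} = {{j1, j2}, {b, j1}, g}"
    by (rule third_edge[OF jV(1) jG oG _ _ jo]) simp_all
  have lf: "degree F j1 = 1" if "j1 \<in> verts F" by (rule circuit_F(1)[OF C0(1) C0_circuit j1C that])
  have gA: "g = {a, j1}"
  proof -
    have "{a, j1} \<in> {d \<in> edges G. j1 \<in> d}" using AG jA by simp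
    then show ?thesis unfolding g(5) using jne jn ne by (auto simp: doubleton_eq_iff)
  qed
  have nn: "b1 \<noteq> b" "b1 \<noteq> v" "b1 \<noteq> c" "b1 \<noteq> a" "b1 \<noteq> j1" "b \<noteq> b1" "v \<noteq> b1" "c \<noteq> b1" "a \<noteq> b1" "j1 \<noteq> b1" "b1 \<in> verts G" "j1 \<noteq> b" "b \<noteq> j1" "j2 \<noteq> b" "b \<noteq> j2"
    "j1 \<noteq> c" "c \<noteq> j1" "j2 \<noteq> c" "c \<noteq> j2" "j1 \<noteq> s" "s \<noteq> j1" "A = j1"
    using b1 b1n b1a b1j jn js jA by auto
  have op: "{b, b1} \<in> Rest" "{b, b1} \<notin> {{j1, j2}}" using m(1) b1(1) nn ne jne by (auto simp: doubleton_eq_iff)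
  have eG: "{v, c} \<in> edges G" "{b, b1} \<in> edges G" "{b, j1} \<in> edges G" using EG m(1) b1(1) oG by auto
  note atb = m(5)[unfolded b1(1)] g(5)[unfolded gA]
  obtain x y x' y' where fr: "distinct [x, y, x', y']" "{x, y, x', y'} \<inter> verts G = {}" by (rule fresh4)
  have rv: "distinct [y', x', y, x]" using fr(1) by auto
  have nt: "x \<noteq> t" "t \<noteq> x" "y \<noteq> t" "t \<noteq> y" "x' \<noteq> t" "t \<noteq> x'" "y' \<noteq> t" "t \<noteq> y'" if "t \<in> verts G" for t using that fr(2) by auto
  have L1: "linked (sp.free {{b, b1}, {j1, j2}}) (wp r5 r6 r7 r8 r9 r10 r11 [(u, vx j1), (u, vx j2), (vx b, vx b1)])"
    using sp.open_edge[OF L op(1) op(2)] by simp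
  have d3: "distinct [{v, c}, {a, A}, {b, b1}]" using ne cs sne jne nn by (simp add: doubleton_eq_iff)
  obtain G1 G2 where P1: "plus2 G {v, c} {a, A} x y G1" and P2: "plus2 G1 {b, b1} {a, y} x' y' G2" and G2: "cubic G2"
    and G2v: "verts G2 = verts G \<union> {x, y, x', y'}"
    and G2e: "edges G2 = (edges G - {{v, c}, {a, A}, {b, b1}}) \<union> {{x, v}, {x, c}, {y, A}, {x, y}, {x', b}, {x', b1}, {y', a}, {y', y}, {x', y'}}"
    by (rule double_plus2[OF G eG(1) AG eG(2) d3 fr])
  let ?N1 = "[(v, a), (a, s), (v, b), (b, j1), (j1, j2)]" and ?N2 = "[(x, v), (x, c), (y, A), (x, y), (x', b), (x', b1), (y', a), (y', y), (x', y')]" and ?al = "[(v, r5), (a, r6), (b, r11), (j1, u), (x, r7), (y, r8), (x', r10), (y', r9)]"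
  let ?D = "{{v, c}, {a, A}, {b, b1}}" and ?S = "set [v, a, b, j1]"
  have VV: "A \<in> verts G" "a \<in> verts G" "b \<in> verts G" "b1 \<in> verts G" "c \<in> verts G" "j1 \<in> verts G" "j2 \<in> verts G" "s \<in> verts G" "v \<in> verts G" by (use VG V jV nn in simp_all)
  note nts = nt[OF VV(1)] nt[OF VV(2)] nt[OF VV(3)] nt[OF VV(4)] nt[OF VV(5)] nt[OF VV(6)] nt[OF VV(7)] nt[OF VV(8)] nt[OF VV(9)]
  have mv: "{d \<in> edges G. t \<in> d} \<subseteq> ?D \<union> eds ?N1" if "t \<in> ?S" for t
    using that touch[of "?D \<union> eds ?N1" t] atb nn by (simp add: insert_commute; elim disjE; simp add: insert_commute)
  have N1: "{i, j} \<in> edges G \<and> {i, j} \<notin> ?D" if "(i, j) \<in> set ?N1" for i j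
    using that by (simp, elim disjE conjE; use EG AG jG eG ne cs sne jne nn in \<open>simp add: doubleton_eq_iff insert_commute\<close>)
  have rt: "routes (wp r5 r6 r7 r8 r9 r10 r11 [(u, vx j1), (u, vx j2), (vx b, vx b1)]) [[0], [12], [1], [2], [14], [6], [7], [9, 13], [8], [3], [4, 15], [11], [10], [5]] (map (map_prod (sp.place ?al) (sp.place ?al)) (?N1 @ ?N2))"
    using nts fr(1) rv ne cs sne jne nn by (simp add: sp.place_simps)
  have "lands G2 (?D \<union> eds ?N1) ?S"
  proof (rule land[where xs = "[x, y, x', y']" and J = "{{b, b1}, {j1, j2}}" and al = ?al and Nnew = ?N2, OF G2 _ _ _ _ N1 _ mv _ _ _ _ _ _ _ L1 rt])
    show "verts G2 = verts G \<union> set [x, y, x', y']" unfolding G2v by (simp add: insert_commute)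
    show "edges G2 = (edges G - ?D) \<union> eds ?N2" unfolding G2e by (simp add: insert_commute)
    show "distinct (map snd ?al)" using r VV ne nn by (simp add: good_def vm_eq u_off u_off[symmetric]; metis)
    show "q = u \<or> good q \<or> q \<in> vx ` ?S" if "q \<in> snd ` set ?al" for q using that r by auto
  qed (use fr VV ne cs sne jne nn in auto)
  then obtain \<rho> where \<rho>: "hom_embedding \<rho> G2 H" "respects_embedding \<rho> \<eta>F F"
  proof (rule landed_respects)
    fix t assume "t \<in> ?S" "t \<in> verts F" then show "degree F t = 1" using vF cF aF lf by auto
  next
    fix d assume "d \<in> ?D \<union> eds ?N1" "d \<in> edges F"
    then show "\<exists>t\<in>d. degree F t = 1"
      by (simp, elim disjE; use jF EF vF0 aF lf in \<open>auto; fail\<close>)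
  qed
  show False by (rule e4_use[OF Dh(3) hDf mDf mDh _ P1 P2 \<rho>]) (use ne nn in auto)
qed

text \<open>Each obstruction concerns one end of the landing edge. Applied to both ends by the
  symmetry \<open>swapj\<close>, they leave only the situation of \<open>far\<close>.\<close>

lemma no_C0:
  assumes r: "good r5" "good r6" "good r7" "good r8" "good r9" "good r10" "good r11" "distinct [r5, r6, r7, r8, r9, r10, r11]"
    and L: "linked (sp.free {{j1, j2}}) (wp r5 r6 r7 r8 r9 r10 r11 [(u, vx j1), (u, vx j2)])"
  shows "{j1, j2} \<notin> edges C0"
proof
  assume jC: "{j1, j2} \<in> edges C0"
  then have jC': "{j2, j1} \<in> edges C0" by (simp add: insert_commute)
  interpret sj: landed_circ G F \<C> H \<eta>F \<xi> \<Gamma> v a b c s Df Dh A C0 j2 j1 u by (rule swapj)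
  have "linked (sp.free {{j1, j2}}) (wp r5 r6 r7 r8 r9 r10 r11 [(u, vx j2), (u, vx j1)])"
    by (rule linked_route[OF L, of "[[0], [1], [2], [3], [4], [5], [6], [7], [8], [9], [10], [11], [12], [14], [13]]"]) simp_all
  then have L': "linked (sp.free {{j2, j1}}) (wp r5 r6 r7 r8 r9 r10 r11 [(u, vx j2), (u, vx j1)])" by (simp only: insert_commute)
  have nb: "j1 \<noteq> b" "j2 \<noteq> b" using near_b[OF r L jC] sj.near_b[OF r L' jC'] by blast+
  have nc: "j1 \<noteq> c" "j2 \<noteq> c" using near_c[OF r L jC] sj.near_c[OF r L' jC'] by blast+
  have n1: "c \<notin> {j1, j2}" "b \<notin> {j1, j2}" "c \<notin> {j2, j1}" "b \<notin> {j2, j1}" using nb nc by auto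
  have "\<not> adjacent G j1 b" using near_adj[OF r L jC n1(1,2)] near_adj_A[OF r L jC n1(1,2)] by blast
  moreover have "\<not> adjacent G j2 b" using sj.near_adj[OF r L' jC' n1(3,4)] sj.near_adj_A[OF r L' jC' n1(3,4)] by blast
  ultimately show False by (rule far[OF r L jC n1(1,2)])
qed

end

section \<open>Elimination of the exceptional configuration\<close>

lemma split_aux: "e \<in> E \<Longrightarrow> g \<in> E \<Longrightarrow> e \<notin> T \<Longrightarrow> g \<notin> T \<Longrightarrow> (E - T) \<union> Nw = (E - (T \<union> {e, g})) \<union> ({e, g} \<union> Nw)"
  by blast

context setting begin

text \<open>Any two of \<open>Df\<close>, \<open>Dh\<close> and \<open>C0\<close> share only edges
  at the corner, so the landing edge lies in at most one of them. Each routing either puts it into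
  one of two of them, by (E2), or excludes it from one, by (E4) and (E5); the routings of every type
  together exclude all possibilities.\<close>

lemma circ_false:
  assumes ci: "circ G F \<C> v a b c s Df Dh A C0" and \<xi>: "hom_embedding \<xi> (claw G {v, b} {v, c} {a, s} x y z w) H" and ext: "extends \<xi> \<eta>F F"
    and fr: "distinct [x, y, z, w]" "{x, y, z, w} \<inter> verts G = {}"
  shows False
proof -
  interpret ci: circ G F \<C> v a b c s Df Dh A C0 by (rule ci)
  interpret sw: circ G F \<C> v a c b s Dh Df A C0 by (rule ci.swapc)
  let ?\<Gamma> = "claw G {v, b} {v, c} {a, s} x y z w"
  have VG: "s \<in> verts G" "A \<in> verts G" using edge_pair[OF ci.EG(4), of s] edge_pair[OF ci.AG, of A] by auto
  have d3: "distinct [{v, b}, {v, c}, {a, s}]" using ci.ene by auto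
  have nt: "t \<noteq> x" "t \<noteq> y" "x \<noteq> t" "y \<noteq> t" "t \<noteq> z" "t \<noteq> w" "z \<noteq> t" "w \<noteq> t" if "t \<in> verts G" for t using that fr by auto
  note nts = nt[OF ci.VG(1)] nt[OF ci.VG(2)] nt[OF ci.VG(3)] nt[OF ci.VG(4)] nt[OF VG(1)] nt[OF VG(2)]
  have rv: "distinct [w, z, y, x]" "distinct [A, s, c, b, a, v]" using ci.distinct6 fr(1) by auto
  \<comment> \<open>The order matches \<open>start4\<close>: 5 and 6 are the corner
    \<open>v\<close>, \<open>a\<close>, then come the feet \<open>x\<close>, \<open>y\<close>, the
    centre \<open>w\<close>, and the foot \<open>z\<close> on \<open>{a, s}\<close>.\<close>
  define \<phi> where "\<phi> i = [v, a, x, y, w, z] ! (i - 5)" for i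
  have \<phi>: "\<phi> 5 = v" "\<phi> 6 = a" "\<phi> 7 = x" "\<phi> 8 = y" "\<phi> 9 = w" "\<phi> 10 = z" by (simp_all add: \<phi>_def)
  have six: "{5..<5 + 6::nat} = {5, 6, 7, 8, 9, 10}" by auto
  have K: "\<phi> ` {5..<5 + 6} = {v, a, x, y, w, z}" unfolding six by (simp add: \<phi>)
  let ?ints = "[(5, 7), (5, 8), (5, 6), (9, 7), (9, 8), (9, 10), (6, 10)] :: (nat \<times> nat) list"
  let ?T = "{{v, b}, {v, c}, {a, s}}"
  let ?New = "{{x, v}, {x, b}, {y, v}, {y, c}, {z, a}, {z, s}, {w, x}, {w, y}, {w, z}}"
  have eT: "{v, a} \<notin> ?T" "{a, A} \<notin> ?T" using ci.distinct6 rv(2) by (auto simp: doubleton_eq_iff)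
  have E\<Gamma>: "edges ?\<Gamma> = (edges G - (?T \<union> {{v, a}, {a, A}})) \<union> ({{v, a}, {a, A}} \<union> ?New)"
    unfolding claw_sel(2)[of G v b v c a s x y z w] by (rule split_aux[OF ci.EG(1) ci.AG eT])
  have off: "d \<inter> {v, a, x, y, w, z} = {}" if d: "d \<in> edges G - (?T \<union> {{v, a}, {a, A}})" for d
  proof -
    have dG: "d \<in> edges G" and dn: "d \<notin> ?T \<union> {{v, a}, {a, A}}" using d by auto
    have "d \<subseteq> verts G" using dG sG by (simp add: simple_graph_def)
    moreover have "v \<notin> d" by (rule not_at[OF ci.at _ dG dn]) simp
    moreover have "a \<notin> d" by (rule not_at[OF ci.ata _ dG dn]) simp
    ultimately show ?thesis using fr(2) by blast
  qed
  have me: "{e \<in> edges ?\<Gamma>. e \<inter> {v, a, x, y, w, z} \<noteq> {}} = {{v, a}, {a, A}} \<union> ?New \<and>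
      {e \<in> edges ?\<Gamma>. e \<inter> {v, a, x, y, w, z} = {}} = edges G - (?T \<union> {{v, a}, {a, A}})"
    by (rule meets_eq[OF E\<Gamma> off]) auto
  have RestK: "edges G - (?T \<union> {{v, a}, {a, A}}) = {d \<in> edges G. d \<inter> {v, a} = {}}"
  proof (intro subset_antisym subsetI)
    fix d assume d: "d \<in> edges G - (?T \<union> {{v, a}, {a, A}})"
    have "d \<inter> {v, a} = {}" using off[OF d] by auto
    then show "d \<in> {d \<in> edges G. d \<inter> {v, a} = {}}" using DiffD1[OF d] by simp
  next
    fix d assume "d \<in> {d \<in> edges G. d \<inter> {v, a} = {}}"
    then show "d \<in> edges G - (?T \<union> {{v, a}, {a, A}})" by auto
  qed
  have cl: "cluster ?\<Gamma> H \<xi> \<phi> 6 ?ints [7, 8, 10, 6] [b, c, s, A]"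
  proof
    show "cubic ?\<Gamma>" by (rule cubic_claw[OF G ci.EG(2,3,4) d3 fr])
    have "distinct (map \<phi> [5, 6, 7, 8, 9, 10])" using nts fr(1) rv ci.distinct6 by (simp add: \<phi>)
    then have "inj_on \<phi> (set [5, 6, 7, 8, 9, 10])" by (simp only: distinct_map)
    then show "inj_on \<phi> {5..<5 + 6}" unfolding six by simp
    show "\<phi> ` {5..<5 + 6} \<subseteq> verts ?\<Gamma>" unfolding K claw_sel using ci.VG by simp
    show "set [b, c, s, A] \<inter> \<phi> ` {5..<5 + 6} = {}" unfolding K using nts rv ci.distinct6 by simp
    show "set [b, c, s, A] \<subseteq> verts ?\<Gamma>" unfolding claw_sel using ci.VG VG by simp
    show "distinct [b, c, s, A]" using ci.distinct6 by simp
    show "{e \<in> edges ?\<Gamma>. e \<inter> \<phi> ` {5..<5 + 6} \<noteq> {}} = set (map (\<lambda>(i, j). {\<phi> i, \<phi> j}) ?ints) \<union> set (map2 (\<lambda>i v. {\<phi> i, v}) [7, 8, 10, 6] [b, c, s, A])"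
      unfolding K me[THEN conjunct1] by (simp add: \<phi> insert_commute)
    show "distinct (map (\<lambda>(i, j). {\<phi> i, \<phi> j}) ?ints)" using nts fr(1) rv ci.distinct6 by (simp add: \<phi> doubleton_eq_iff)
    show "\<exists>e\<in>set ?ints. i = fst e \<or> i = snd e" if "i \<in> {5..<5 + 6}" for i using that unfolding six by auto
    show "i \<in> {5..<5 + 6} \<and> j \<in> {5..<5 + 6}" if "(i, j) \<in> set ?ints" for i j using that by auto
  qed (use H \<xi> in auto)
  interpret cl: cluster ?\<Gamma> H \<xi> \<phi> 6 ?ints "[7, 8, 10, 6]" "[b, c, s, A]" by (rule cl)
  have st: "cl.start = start4" by (simp add: cl.start_def start4_def upt_rec)
  \<comment> \<open>The port without entries in the table is the edge \<open>{a, A}\<close> of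
    \<open>F\<close>, whose image is a single edge by (E1).\<close>
  have sing: "card (edges (emap \<xi> (cl.pe l))) = 1" if l: "l < length [b, c, s, A]" "l \<notin> set [0, 1, 2]" for l
  proof -
    have "l = 3" using l by auto
    then have "cl.pe l = {a, A}" by (simp add: cl.pe_def \<phi>)
    then show ?thesis using ext ci.AF e1 by (simp add: extends_def E1_def)
  qed
  have "\<exists>j u. j \<in> edges ?\<Gamma> \<and> j \<inter> cl.K = {} \<and> u \<in> internal_verts (emap \<xi> j) \<and>
    (\<exists>\<tau>\<in>set types4. \<forall>p\<in>set \<tau>. \<forall>j1 j2. j = {j1, j2} \<longrightarrow> cl.realizes p j j1 j2 u)"
    by (rule cl.cluster_exit[OF H(3)[OF ci.tw] _ table4 _ start_table4[folded st] _ sing]) (auto simp: start_table4_def)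
  then obtain j u where ju: "j \<in> edges ?\<Gamma>" "j \<inter> cl.K = {}" "u \<in> internal_verts (emap \<xi> j)"
      "\<exists>\<tau>\<in>set types4. \<forall>p\<in>set \<tau>. \<forall>j1 j2. j = {j1, j2} \<longrightarrow> cl.realizes p j j1 j2 u" by (elim exE conjE)
  have "j \<in> {e \<in> edges ?\<Gamma>. e \<inter> {v, a, x, y, w, z} = {}}" using ju(1,2) unfolding K by simp
  then have jR: "j \<in> edges G" "v \<notin> j" "a \<notin> j" unfolding me[THEN conjunct2] RestK by auto
  obtain j1 j2 where j: "j = {j1, j2}" by (rule simple_edgeE[OF sG jR(1)])
  have la: "landed G F \<C> H \<eta>F \<xi> ?\<Gamma> {v, a} j1 j2 u"
  proof
    show "{d \<in> edges G. d \<inter> {v, a} = {}} \<subseteq> edges ?\<Gamma>" unfolding RestK[symmetric] me[THEN conjunct2, symmetric] by blast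
    show "verts G \<subseteq> verts ?\<Gamma>" unfolding claw_sel by blast
  qed (use \<xi> ext jR j ju(3) in auto)
  have lc: "landed_circ G F \<C> H \<eta>F \<xi> ?\<Gamma> v a b c s Df Dh A C0 j1 j2 u"
    unfolding landed_circ_def using la ci by blast
  interpret l: landed_circ G F \<C> H \<eta>F \<xi> ?\<Gamma> v a b c s Df Dh A C0 j1 j2 u by (rule lc)
  interpret ls: landed_circ G F \<C> H \<eta>F \<xi> ?\<Gamma> v a c b s Dh Df A C0 j1 j2 u by (rule l.swapl)
  have vK: "verts G - {v, a} \<subseteq> verts ?\<Gamma> - {v, a, x, y, w, z}" using nt unfolding claw_sel by blast
  have KR: "{g \<in> edges ?\<Gamma>. g \<inter> \<phi> ` {5..<5 + 6} = {}} = {d \<in> edges G. d \<inter> {v, a} = {}}"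
    unfolding K me[THEN conjunct2] by (rule RestK)
  have vK': "verts G - {v, a} \<subseteq> verts ?\<Gamma> - \<phi> ` {5..<5 + 6}" unfolding K by (rule vK)
  let ?real = "\<lambda>p \<rho>. (\<forall>is. set is \<subseteq> {5..<5 + fst p} \<longrightarrow> distinct is \<longrightarrow> distinct (map \<rho> is)) \<and> (\<forall>i\<in>{5..<5 + fst p}. l.good (\<rho> i)) \<and>
      \<rho> 0 = vmap \<xi> b \<and> \<rho> 1 = vmap \<xi> c \<and> \<rho> 2 = vmap \<xi> s \<and> \<rho> 3 = vmap \<xi> A \<and> \<rho> 4 = u \<and>
      linked (l.sp.free {{j1, j2}}) (map (map_prod \<rho> \<rho>) (snd p) @ [(u, vmap \<xi> j1), (u, vmap \<xi> j2)])"
  have get: "\<exists>\<rho>. ?real p \<rho>" if p: "cl.realizes p {j1, j2} j1 j2 u" for p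
  proof (rule l.realized[OF cl KR vK' p])
    fix \<rho> assume \<rho>: "\<And>l. l < length [b, c, s, A] \<Longrightarrow> \<rho> l = vmap \<xi> ([b, c, s, A] ! l)" "\<rho> 4 = u"
      "\<And>is. set is \<subseteq> {5..<5 + fst p} \<Longrightarrow> distinct is \<Longrightarrow> distinct (map \<rho> is)"
      "\<And>i. i \<in> {5..<5 + fst p} \<Longrightarrow> l.good (\<rho> i)"
      "linked (l.sp.free {{j1, j2}}) (map (map_prod \<rho> \<rho>) (snd p) @ [(u, vmap \<xi> j1), (u, vmap \<xi> j2)])"
    have h: "\<rho> 0 = vmap \<xi> b" "\<rho> 1 = vmap \<xi> c" "\<rho> 2 = vmap \<xi> s" "\<rho> 3 = vmap \<xi> A"
      using \<rho>(1)[of 0] \<rho>(1)[of 1] \<rho>(1)[of 2] \<rho>(1)[of 3] by simp_all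
    have d: "\<forall>is. set is \<subseteq> {5..<5 + fst p} \<longrightarrow> distinct is \<longrightarrow> distinct (map \<rho> is)" by (intro allI impI) (rule \<rho>(3))
    have g: "\<forall>i\<in>{5..<5 + fst p}. l.good (\<rho> i)" by (rule ballI) (rule \<rho>(4))
    have "?real p \<rho>" by (intro conjI d g h \<rho>(2) \<rho>(5))
    then show ?thesis by (intro exI[of _ \<rho>])
  qed
  let ?R = "\<lambda>p. cl.realizes p {j1, j2} j1 j2 u"
  have te: "\<exists>C\<in>\<C>. {v, a} \<in> edges C \<and> {j1, j2} \<in> edges C" if r: "?R (Tr 0 1 4 2 3)"
  proof -
    from get[OF r] obtain \<rho> where \<rho>: "?real (Tr 0 1 4 2 3) \<rho>" by (elim exE)
    show ?thesis by (rule l.to_e[of "\<rho> 5" "\<rho> 6" "\<rho> 7"]; insert conjunct2[OF conjunct2[OF \<rho>]] conjunct1[OF \<rho>, rule_format, of "[5, 6, 7]"] conjunct1[OF conjunct2[OF \<rho>], rule_format, of 5] conjunct1[OF conjunct2[OF \<rho>], rule_format, of 6] conjunct1[OF conjunct2[OF \<rho>], rule_format, of 7]; elim conjE; simp add: Tr_def)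
  qed
  have tf: "\<exists>C\<in>\<C>. {v, b} \<in> edges C \<and> {j1, j2} \<in> edges C" if r: "?R (Tr 0 4 1 2 3)"
  proof -
    from get[OF r] obtain \<rho> where \<rho>: "?real (Tr 0 4 1 2 3) \<rho>" by (elim exE)
    show ?thesis by (rule l.to_f[of "\<rho> 5" "\<rho> 6" "\<rho> 7"]; insert conjunct2[OF conjunct2[OF \<rho>]] conjunct1[OF \<rho>, rule_format, of "[5, 6, 7]"] conjunct1[OF conjunct2[OF \<rho>], rule_format, of 5] conjunct1[OF conjunct2[OF \<rho>], rule_format, of 6] conjunct1[OF conjunct2[OF \<rho>], rule_format, of 7]; elim conjE; simp add: Tr_def)
  qed
  have th: "\<exists>C\<in>\<C>. {v, c} \<in> edges C \<and> {j1, j2} \<in> edges C" if r: "?R (Tr 1 4 0 2 3)"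
  proof -
    from get[OF r] obtain \<rho> where \<rho>: "?real (Tr 1 4 0 2 3) \<rho>" by (elim exE)
    show ?thesis by (rule ls.to_f[of "\<rho> 5" "\<rho> 6" "\<rho> 7"]; insert conjunct2[OF conjunct2[OF \<rho>]] conjunct1[OF \<rho>, rule_format, of "[5, 6, 7]"] conjunct1[OF conjunct2[OF \<rho>], rule_format, of 5] conjunct1[OF conjunct2[OF \<rho>], rule_format, of 6] conjunct1[OF conjunct2[OF \<rho>], rule_format, of 7]; elim conjE; simp add: Tr_def)
  qed
  have tk: "\<exists>C\<in>\<C>. {a, s} \<in> edges C \<and> {j1, j2} \<in> edges C" if r: "?R (Tr 2 4 3 0 1)"
  proof -
    from get[OF r] obtain \<rho> where \<rho>: "?real (Tr 2 4 3 0 1) \<rho>" by (elim exE)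
    show ?thesis by (rule l.to_k[of "\<rho> 5" "\<rho> 6" "\<rho> 7"]; insert conjunct2[OF conjunct2[OF \<rho>]] conjunct1[OF \<rho>, rule_format, of "[5, 6, 7]"] conjunct1[OF conjunct2[OF \<rho>], rule_format, of 5] conjunct1[OF conjunct2[OF \<rho>], rule_format, of 6] conjunct1[OF conjunct2[OF \<rho>], rule_format, of 7]; elim conjE; simp add: Tr_def)
  qed
  have up1: "{j1, j2} \<notin> edges Df" if r: "?R (Up 1 0)"
  proof
    assume jD: "{j1, j2} \<in> edges Df"
    from get[OF r] obtain \<rho> where \<rho>: "?real (Up 1 0) \<rho>" by (elim exE)
    show False by (rule l.outer_leg[of "\<rho> 5" "\<rho> 6" "\<rho> 7" "\<rho> 8" "\<rho> 9", OF _ _ _ _ _ _ _ jD]; insert conjunct2[OF conjunct2[OF \<rho>]] conjunct1[OF \<rho>, rule_format, of "[5, 6, 7, 8, 9]"] conjunct1[OF conjunct2[OF \<rho>], rule_format, of 5] conjunct1[OF conjunct2[OF \<rho>], rule_format, of 6] conjunct1[OF conjunct2[OF \<rho>], rule_format, of 7] conjunct1[OF conjunct2[OF \<rho>], rule_format, of 8] conjunct1[OF conjunct2[OF \<rho>], rule_format, of 9]; elim conjE; simp add: Up_def)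
  qed
  have up2: "{j1, j2} \<notin> edges Dh" if r: "?R (Up 0 1)"
  proof
    assume jD: "{j1, j2} \<in> edges Dh"
    from get[OF r] obtain \<rho> where \<rho>: "?real (Up 0 1) \<rho>" by (elim exE)
    show False by (rule ls.outer_leg[of "\<rho> 5" "\<rho> 6" "\<rho> 7" "\<rho> 8" "\<rho> 9", OF _ _ _ _ _ _ _ jD]; insert conjunct2[OF conjunct2[OF \<rho>]] conjunct1[OF \<rho>, rule_format, of "[5, 6, 7, 8, 9]"] conjunct1[OF conjunct2[OF \<rho>], rule_format, of 5] conjunct1[OF conjunct2[OF \<rho>], rule_format, of 6] conjunct1[OF conjunct2[OF \<rho>], rule_format, of 7] conjunct1[OF conjunct2[OF \<rho>], rule_format, of 8] conjunct1[OF conjunct2[OF \<rho>], rule_format, of 9]; elim conjE; simp add: Up_def)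
  qed
  have wp1: "{j1, j2} \<notin> edges C0" if r: "?R (Wp 0 1)"
  proof -
    from get[OF r] obtain \<rho> where \<rho>: "?real (Wp 0 1) \<rho>" by (elim exE)
    show ?thesis by (rule l.no_C0[of "\<rho> 5" "\<rho> 6" "\<rho> 7" "\<rho> 8" "\<rho> 9" "\<rho> 10" "\<rho> 11"]; insert conjunct2[OF conjunct2[OF \<rho>]] conjunct1[OF \<rho>, rule_format, of "[5, 6, 7, 8, 9, 10, 11]"] conjunct1[OF conjunct2[OF \<rho>], rule_format, of 5] conjunct1[OF conjunct2[OF \<rho>], rule_format, of 6] conjunct1[OF conjunct2[OF \<rho>], rule_format, of 7] conjunct1[OF conjunct2[OF \<rho>], rule_format, of 8] conjunct1[OF conjunct2[OF \<rho>], rule_format, of 9] conjunct1[OF conjunct2[OF \<rho>], rule_format, of 10] conjunct1[OF conjunct2[OF \<rho>], rule_format, of 11]; elim conjE; simp add: Wp_def)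
  qed
  have wp2: "{j1, j2} \<notin> edges C0" if r: "?R (Wp 1 0)"
  proof -
    from get[OF r] obtain \<rho> where \<rho>: "?real (Wp 1 0) \<rho>" by (elim exE)
    show ?thesis by (rule ls.no_C0[of "\<rho> 5" "\<rho> 6" "\<rho> 7" "\<rho> 8" "\<rho> 9" "\<rho> 10" "\<rho> 11"]; insert conjunct2[OF conjunct2[OF \<rho>]] conjunct1[OF \<rho>, rule_format, of "[5, 6, 7, 8, 9, 10, 11]"] conjunct1[OF conjunct2[OF \<rho>], rule_format, of 5] conjunct1[OF conjunct2[OF \<rho>], rule_format, of 6] conjunct1[OF conjunct2[OF \<rho>], rule_format, of 7] conjunct1[OF conjunct2[OF \<rho>], rule_format, of 8] conjunct1[OF conjunct2[OF \<rho>], rule_format, of 9] conjunct1[OF conjunct2[OF \<rho>], rule_format, of 10] conjunct1[OF conjunct2[OF \<rho>], rule_format, of 11]; elim conjE; simp add: Wp_def)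
  qed
  let ?DF = "{j1, j2} \<in> edges Df" and ?DH = "{j1, j2} \<in> edges Dh" and ?C0 = "{j1, j2} \<in> edges C0"
  have te': "?DF \<or> ?DH" if "?R (Tr 0 1 4 2 3)" using te[OF that] ci.mem_e by blast
  have tk': "?DF \<or> ?DH" if "?R (Tr 2 4 3 0 1)" using tk[OF that] ci.mem_k by blast
  have tf': "?DF \<or> ?C0" if "?R (Tr 0 4 1 2 3)" using tf[OF that] ci.mem_f by blast
  have th': "?DH \<or> ?C0" if "?R (Tr 1 4 0 2 3)" using th[OF that] sw.mem_f by blast
  have x1: "\<not> (?DF \<and> ?DH)" using ci.ii[of "{j1, j2}"] jR(2,3) j by auto
  have x2: "\<not> (?DF \<and> ?C0)" using ci.i0[of "{j1, j2}"] jR(2) j by auto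
  have x3: "\<not> (?DH \<and> ?C0)" using sw.i0[of "{j1, j2}"] jR(2) j by auto
  obtain \<tau> where \<tau>: "\<tau> \<in> set types4" and R\<tau>: "\<forall>p\<in>set \<tau>. \<forall>j1 j2. j = {j1, j2} \<longrightarrow> cl.realizes p j j1 j2 u" using ju(4) by (elim bexE)
  have R: "?R p" if "p \<in> set \<tau>" for p using R\<tau>[rule_format, OF that j] unfolding j .
  have "\<tau> \<in> {[Tr 0 1 4 2 3, Tr 0 4 1 2 3, Tr 1 4 0 2 3], [Tr 2 4 3 0 1, Up 1 0, Up 0 1],
      [Wp 0 1, Tr 0 4 1 2 3, Tr 1 4 0 2 3], [Wp 1 0, Tr 0 4 1 2 3, Tr 1 4 0 2 3],
      [Tr 0 1 4 2 3, Tr 0 4 1 2 3, Tr 2 4 3 0 1, Up 1 0], [Tr 0 1 4 2 3, Tr 1 4 0 2 3, Tr 2 4 3 0 1, Up 0 1]}"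
    using \<tau> by (simp only: types4_def list.set)
  then show False
  proof (elim insertE emptyE)
    assume t: "\<tau> = [Tr 0 1 4 2 3, Tr 0 4 1 2 3, Tr 1 4 0 2 3]"
    have "?DF \<or> ?DH" by (rule te'[OF R]) (simp add: t)
    moreover have "?DF \<or> ?C0" by (rule tf'[OF R]) (simp add: t)
    moreover have "?DH \<or> ?C0" by (rule th'[OF R]) (simp add: t)
    ultimately show False using x1 x2 x3 by argo
  next
    assume t: "\<tau> = [Tr 2 4 3 0 1, Up 1 0, Up 0 1]"
    have "?DF \<or> ?DH" by (rule tk'[OF R]) (simp add: t)
    moreover have "\<not> ?DF" by (rule up1[OF R]) (simp add: t)
    moreover have "\<not> ?DH" by (rule up2[OF R]) (simp add: t)
    ultimately show False using x1 x2 x3 by argo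
  next
    assume t: "\<tau> = [Wp 0 1, Tr 0 4 1 2 3, Tr 1 4 0 2 3]"
    have "\<not> ?C0" by (rule wp1[OF R]) (simp add: t)
    moreover have "?DF \<or> ?C0" by (rule tf'[OF R]) (simp add: t)
    moreover have "?DH \<or> ?C0" by (rule th'[OF R]) (simp add: t)
    ultimately show False using x1 x2 x3 by argo
  next
    assume t: "\<tau> = [Wp 1 0, Tr 0 4 1 2 3, Tr 1 4 0 2 3]"
    have "\<not> ?C0" by (rule wp2[OF R]) (simp add: t)
    moreover have "?DF \<or> ?C0" by (rule tf'[OF R]) (simp add: t)
    moreover have "?DH \<or> ?C0" by (rule th'[OF R]) (simp add: t)
    ultimately show False using x1 x2 x3 by argo
  next
    assume t: "\<tau> = [Tr 0 1 4 2 3, Tr 0 4 1 2 3, Tr 2 4 3 0 1, Up 1 0]"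
    have "?DF \<or> ?DH" by (rule te'[OF R]) (simp add: t)
    moreover have "?DF \<or> ?C0" by (rule tf'[OF R]) (simp add: t)
    moreover have "\<not> ?DF" by (rule up1[OF R]) (simp add: t)
    ultimately show False using x1 x2 x3 by argo
  next
    assume t: "\<tau> = [Tr 0 1 4 2 3, Tr 1 4 0 2 3, Tr 2 4 3 0 1, Up 0 1]"
    have "?DF \<or> ?DH" by (rule te'[OF R]) (simp add: t)
    moreover have "?DH \<or> ?C0" by (rule th'[OF R]) (simp add: t)
    moreover have "\<not> ?DH" by (rule up2[OF R]) (simp add: t)
    ultimately show False using x1 x2 x3 by argo
  qed
qed

lemma claw_perm: "claw G e f g x y z w = claw G f e g y x z w" "claw G e f g x y z w = claw G e g f x z y w"
proof -
  have "(E - {e, f, g}) \<union> P \<union> Q \<union> R \<union> {a, b, c} = (E - {f, e, g}) \<union> Q \<union> P \<union> R \<union> {b, a, c}"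
    "(E - {e, f, g}) \<union> P \<union> Q \<union> R \<union> {a, b, c} = (E - {e, g, f}) \<union> P \<union> R \<union> Q \<union> {a, c, b}"
    for E P Q R :: "'c set" and e f g a b c by blast+
  note s = this
  show "claw G e f g x y z w = claw G f e g y x z w" "claw G e f g x y z w = claw G e g f x z y w"
    unfolding claw_def by (rule arg_cong2[where f = Graph, OF _ s(1)], blast) (rule arg_cong2[where f = Graph, OF _ s(2)], blast)
qed

text \<open>If \<open>Df\<close> is a circuit, the twinned edges meet in \<open>F\<close> and
  \<open>circ_false\<close> applies. Otherwise both members are paths, one of them with four edges,
  and the pentagon formed with that path is rerouted.\<close>

lemma config_false:
  assumes co: "config G F \<C> v a b c k Df Dh" and \<xi>: "hom_embedding \<xi> (claw G {v, b} {v, c} k x y z w) H" and ext: "extends \<xi> \<eta>F F"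
    and fr: "distinct [x, y, z, w]" "{x, y, z, w} \<inter> verts G = {}"
  shows False
proof -
  have path: False if co: "config G F \<C> v a b c k Df Dh" and \<xi>: "hom_embedding \<xi> (claw G {v, b} {v, c} k x y z w) H"
    and l: "path_listing [a, v, b, s, t] Df" "k = {s, t}" and fr: "distinct [x, y, z, w]" "{x, y, z, w} \<inter> verts G = {}" for b c Df Dh x y s t
  proof -
    interpret co: config G F \<C> v a b c k Df Dh by (rule co)
    have ip: "is_path Df" using l(1) unfolding is_path_def by (rule exI)
    have d: "distinct [a, v, b, s, t]" and mDf: "{b, s} \<in> edges Df" using l(1) by (simp_all add: path_listing_def)
    have VF: "b \<notin> verts F" "s \<notin> verts F"
      using co.shape(3)[OF ip] mem(3)[OF co.Df(1) mDf, of b] mem(3)[OF co.Df(1) mDf, of s] by auto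
    have sc: "s \<noteq> c" using co.cDf mem(3)[OF co.Df(1) mDf, of s] by auto
    \<comment> \<open>The claw is read with its first two feet on \<open>{b, v}\<close> and
      \<open>{s, t}\<close>, which \<open>{b, s}\<close> joins; the third foot, on
      \<open>{v, c}\<close>, plays the part of \<open>g\<close> in \<open>pentagon\<close>.\<close>
    have X: "hom_embedding \<xi> (claw G {b, v} {s, t} {v, c} x z y w) H"
      using \<xi> unfolding l(2) claw_perm(2)[of "{v, b}" "{v, c}"] by (simp only: insert_commute)
    have sv: "s \<noteq> v" "s \<noteq> b" using d by auto
    have fr': "distinct [x, z, y, w]" "{x, z, y, w} \<inter> verts G = {}" using fr by auto
    have "\<exists>C\<in>\<C>. {b, s} \<in> edges C \<and> {v, c} \<in> edges C"
      by (rule pentagon[OF X ext fr'])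
        (use co.EG co.EF l(2) mem(1,2)[OF co.Df(1) mDf] d VF sc sv co.ne in \<open>simp_all add: insert_commute\<close>)
    then show False using co.path_reroute[OF l] by blast
  qed
  interpret co: config G F \<C> v a b c k Df Dh by (rule co)
  interpret sw: config G F \<C> v a c b k Dh Df by (rule co.swap)
  show False
  proof (cases "is_circuit Df")
    case True
    obtain s A C0 where s: "k = {a, s}" "circ G F \<C> v a b c s Df Dh A C0" by (rule co.to_circ[OF True])
    show False by (rule circ_false[OF s(2) \<xi>[unfolded s(1)] ext fr])
  next
    case False
    then have p: "is_path Df" using mem(5)[OF co.Df(1)] by blast
    have ph: "is_path Dh" by (rule co.shape(4)[OF p])
    have X: "hom_embedding \<xi> (claw G {v, c} {v, b} k y x z w) H" using \<xi> unfolding claw_perm(1)[of "{v, b}"] .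
    have fr': "distinct [y, x, z, w]" "{y, x, z, w} \<inter> verts G = {}" using fr by auto
    show False
      using co.shape(1)[OF p] sw.shape(1)[OF ph] co.not_both_long[OF p] path[OF co \<xi> _ _ fr] path[OF co.swap X _ _ fr'] by blast
  qed
qed

end

section \<open>Three attachments without a common member\<close>

context bridged begin

text \<open>Let \<open>h\<close> be the third edge at the common vertex of \<open>e\<close> and
  \<open>f\<close>. If it is not \<open>g\<close>, then \<open>trinity_share\<close> makes
  \<open>C3\<close> and \<open>C2\<close> into the exceptional configuration with \<open>k\<close>
  equal to \<open>g\<close>. If it is, the three attachments form a star, and the landing edge
  \<open>j\<close> found by \<open>star\<close> takes over the role of \<open>k\<close>.\<close>

lemma share:
  assumes at: "attachment \<eta> G B e" "attachment \<eta> G B f" "attachment \<eta> G B g" and d: "distinct [e, f, g]"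
    and no: "\<And>C. C \<in> \<C> \<Longrightarrow> e \<in> edges C \<Longrightarrow> f \<in> edges C \<Longrightarrow> g \<in> edges C \<Longrightarrow> False" and v: "v \<in> e" "v \<in> f"
  shows False
proof -
  have ne: "e \<noteq> f" "e \<noteq> g" "f \<noteq> g" using d by auto
  obtain C1 where C1: "C1 \<in> \<C>" "e \<in> edges C1" "f \<in> edges C1" using pair[OF at(1,2) ne(1)] by blast
  obtain C2 where C2: "C2 \<in> \<C>" "f \<in> edges C2" "g \<in> edges C2" using pair[OF at(2,3) ne(3)] by blast
  obtain C3 where C3: "C3 \<in> \<C>" "e \<in> edges C3" "g \<in> edges C3" using pair[OF at(1,3) ne(2)] by blast
  have eG: "e \<in> edges G" "f \<in> edges G" "g \<in> edges G" using at by (simp_all add: attachment_def)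
  have vG: "v \<in> verts G" using edge_pair[OF eG(1) v(1)] by blast
  obtain h where h: "h \<in> edges G" "v \<in> h" "h \<noteq> e" "h \<noteq> f" "{d \<in> edges G. v \<in> d} = {e, f, h}"
    by (rule third_edge[OF vG eG(1,2) v ne(1)])
  have sh: "v \<notin> verts F" "h \<in> edges C2" "h \<in> edges C3"
    by (rule trinity_share[OF C1 C2 C3 no ne(1) v h(1-4)]; assumption)+
  obtain b where b: "e = {v, b}" "b \<noteq> v" using edge_pair[OF eG(1) v(1)] by blast
  obtain c where c: "f = {v, c}" "c \<noteq> v" using edge_pair[OF eG(2) v(2)] by blast
  obtain a where a: "h = {v, a}" "a \<noteq> v" using edge_pair[OF h(1,2)] by blast
  have abc: "distinct [v, a, b, c]" using a b c ne(1) h(3,4) by auto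
  have at3: "{d \<in> edges G. v \<in> d} = {{v, a}, {v, b}, {v, c}}" using h(5) unfolding a(1) b(1) c(1) by auto
  obtain x y z w where fr: "distinct [x, y, z, w]" "{x, y, z, w} \<inter> verts G = {}" by (rule fresh4)
  show False
  proof (cases "h = g")
    case False
    have vg: "v \<notin> g"
    proof
      assume "v \<in> g"
      then have "g \<in> {d \<in> edges G. v \<in> d}" using eG(3) by simp
      then show False unfolding h(5) using ne False by auto
    qed
    have co: "config G F \<C> v a b c g C3 C2"
      by unfold_locales (use sh at3 abc vg C2 C3 a b c in simp_all)
    obtain \<xi> where \<xi>: "hom_embedding \<xi> (claw G e f g x y z w) H" "extends \<xi> \<eta>F F" using three[OF at d fr] by blast
    show False by (rule config_false[OF co \<xi>(1)[unfolded b(1) c(1)] \<xi>(2) fr])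
  next
    case True
    have d': "distinct [g, e, f]" using ne by auto
    obtain \<xi> where \<xi>: "hom_embedding \<xi> (claw G g e f x y z w) H" "extends \<xi> \<eta>F F" using three[OF at(3,1,2) d' fr] by blast
    have ga: "g = {v, a}" using True a(1) by simp
    show False
    proof (rule star[OF at3 abc sh(1) \<xi>(1)[unfolded ga b(1) c(1)] \<xi>(2) fr])
    fix j assume j: "j \<in> edges G" "v \<notin> j" "j \<notin> edges F" "\<And>p. p \<in> {a, b, c} \<Longrightarrow> \<exists>C\<in>\<C>. {v, p} \<in> edges C \<and> j \<in> edges C"
        "\<And>p q. p \<in> {a, b, c} \<Longrightarrow> q \<in> {a, b, c} \<Longrightarrow> p \<noteq> q \<Longrightarrow> \<exists>\<rho>. hom_embedding \<rho> (claw G {v, p} {v, q} j x y z w) H \<and> extends \<rho> \<eta>F F"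
    \<comment> \<open>Two legs are compatible with \<open>j\<close> if a single member contains all
      three edges. An incompatible pair forms a trinity with \<open>j\<close>, and
      \<open>trinity_share\<close> then makes the two other pairs compatible (\<open>other\<close>).
      So some leg is compatible with both others, and it serves as \<open>{v, a}\<close> of the
      configuration (\<open>center\<close>).\<close>
    let ?ok = "\<lambda>p q. \<exists>C\<in>\<C>. {v, p} \<in> edges C \<and> {v, q} \<in> edges C \<and> j \<in> edges C"
    have center: False if P: "{{v, P}, {v, Q}, {v, R}} = {{v, a}, {v, b}, {v, c}}" "distinct [v, P, Q, R]" "{P, Q, R} = {a, b, c}"
      and ok: "?ok P Q" "?ok P R" for P Q R
    proof -
      obtain D1 where D1: "D1 \<in> \<C>" "{v, P} \<in> edges D1" "{v, Q} \<in> edges D1" "j \<in> edges D1" using ok(1) by blast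
      obtain D2 where D2: "D2 \<in> \<C>" "{v, P} \<in> edges D2" "{v, R} \<in> edges D2" "j \<in> edges D2" using ok(2) by blast
      have co: "config G F \<C> v P Q R j D1 D2"
        by unfold_locales (use sh at3 P j(2) D1 D2 in simp_all)
      have PQ: "Q \<in> {a, b, c}" "R \<in> {a, b, c}" "Q \<noteq> R" using P(2,3) by auto
      obtain \<rho> where \<rho>: "hom_embedding \<rho> (claw G {v, Q} {v, R} j x y z w) H" "extends \<rho> \<eta>F F" using j(5)[OF PQ] by blast
      show False by (rule config_false[OF co \<rho> fr])
    qed
    have other: "?ok P Q \<and> ?ok P R" if P: "{{v, P}, {v, Q}, {v, R}} = {{v, a}, {v, b}, {v, c}}" "distinct [v, P, Q, R]" "{P, Q, R} = {a, b, c}"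
      and nok: "\<not> ?ok Q R" for P Q R
    proof -
      have L: "{v, P} \<in> edges G" "{v, Q} \<in> edges G" "{v, R} \<in> edges G"
      proof -
        have "{v, P} \<in> {d \<in> edges G. v \<in> d}" "{v, Q} \<in> {d \<in> edges G. v \<in> d}" "{v, R} \<in> {d \<in> edges G. v \<in> d}"
          unfolding at3 P(1)[symmetric] by simp_all
        then show "{v, P} \<in> edges G" "{v, Q} \<in> edges G" "{v, R} \<in> edges G" by simp_all
      qed
      have l: "{v, Q} \<noteq> {v, R}" "{v, P} \<noteq> {v, Q}" "{v, P} \<noteq> {v, R}" using P(2) by (auto simp: doubleton_eq_iff)
      have PQ: "Q \<in> {a, b, c}" "R \<in> {a, b, c}" unfolding P(3)[symmetric] by simp_all
      obtain K1 where K1: "K1 \<in> \<C>" "{v, Q} \<in> edges K1" "{v, R} \<in> edges K1" using cover2[OF L(2,3) _ _ sh(1)] by blast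
      obtain K2 where K2: "K2 \<in> \<C>" "{v, R} \<in> edges K2" "j \<in> edges K2" using j(4)[OF PQ(2)] by blast
      obtain K3 where K3: "K3 \<in> \<C>" "{v, Q} \<in> edges K3" "j \<in> edges K3" using j(4)[OF PQ(1)] by blast
      have no': False if "C \<in> \<C>" "{v, Q} \<in> edges C" "{v, R} \<in> edges C" "j \<in> edges C" for C using nok that by blast
      have vi: "v \<in> {v, Q}" "v \<in> {v, R}" "v \<in> {v, P}" by simp_all
      have "{v, P} \<in> edges K2" "{v, P} \<in> edges K3"
        by (rule trinity_share(2,3)[OF K1 K2 K3 no' l(1) vi(1,2) L(1) vi(3) l(2,3)]; assumption)+
      then show ?thesis using K2 K3 by blast
    qed
    have p1: "{{v, b}, {v, a}, {v, c}} = {{v, a}, {v, b}, {v, c}}" "distinct [v, b, a, c]" "{b, a, c} = {a, b, c}" using abc by (auto simp: insert_commute)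
    have p2: "{{v, c}, {v, a}, {v, b}} = {{v, a}, {v, b}, {v, c}}" "distinct [v, c, a, b]" "{c, a, b} = {a, b, c}" using abc by (auto simp: insert_commute)
    have sy: "?ok P Q \<Longrightarrow> ?ok Q P" for P Q by blast
    show False
      using other[OF refl abc refl] center[OF refl abc refl] other[OF p1] center[OF p1] center[OF p2] sy[of b c] sy[of a c] by argo
    qed
  qed
qed

text \<open>With an end of the joining edge in \<open>F\<close> the framework alone is
  contradictory. Otherwise \<open>pentagon\<close> first provides a member containing the joining
  edge and \<open>g\<close>.\<close>

lemma joined:
  assumes at: "attachment \<eta> G B e" "attachment \<eta> G B f" "attachment \<eta> G B g" and d: "distinct [e, f, g]"
    and no: "\<And>C. C \<in> \<C> \<Longrightarrow> e \<in> edges C \<Longrightarrow> f \<in> edges C \<Longrightarrow> g \<in> edges C \<Longrightarrow> False"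
    and dj: "e \<inter> f = {}" "f \<inter> g = {}" "e \<inter> g = {}" and p: "p \<in> e" "q \<in> f" "{p, q} \<in> edges G" "{p, q} \<notin> edges F"
  shows False
proof -
  have ne: "e \<noteq> f" "e \<noteq> g" "f \<noteq> g" using d by auto
  obtain C1 where C1: "C1 \<in> \<C>" "e \<in> edges C1" "f \<in> edges C1" using pair[OF at(1,2) ne(1)] by blast
  obtain C2 where C2: "C2 \<in> \<C>" "f \<in> edges C2" "g \<in> edges C2" using pair[OF at(2,3) ne(3)] by blast
  obtain C3 where C3: "C3 \<in> \<C>" "e \<in> edges C3" "g \<in> edges C3" using pair[OF at(1,3) ne(2)] by blast
  have eG: "e \<in> edges G" "f \<in> edges G" "g \<in> edges G" using at by (simp_all add: attachment_def)
  have eF: "e \<notin> edges F" "f \<notin> edges F" "g \<notin> edges F" using mem(2)[OF C1(1)] mem(2)[OF C2(1)] C1 C2 by auto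
  consider "p \<in> verts F" | "q \<in> verts F" | "p \<notin> verts F" "q \<notin> verts F" by blast
  then show False
  proof cases
    case 1
    show ?thesis by (rule joined_in_F[OF C1 C2 C3 no dj(1,2) p 1])
  next
    case 2
    have p': "{q, p} \<in> edges G" "{q, p} \<notin> edges F" using p(3,4) by (simp_all add: insert_commute)
    have dj': "f \<inter> e = {}" using dj(1) by blast
    show ?thesis by (rule joined_in_F[OF C1(1,3,2) C3 C2 no dj' dj(3) p(2,1) p' 2])
  next
    case 3
    obtain p' where p': "e = {p, p'}" "p' \<noteq> p" using edge_pair[OF eG(1) p(1)] by blast
    obtain q' where q': "f = {q, q'}" "q' \<noteq> q" using edge_pair[OF eG(2) p(2)] by blast
    obtain x y z w where fr: "distinct [x, y, z, w]" "{x, y, z, w} \<inter> verts G = {}" by (rule fresh4)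
    obtain \<xi> where \<xi>: "hom_embedding \<xi> (claw G e f g x y z w) H" "extends \<xi> \<eta>F F" using three[OF at d fr] by blast
    have dd: "p \<noteq> q" "p \<noteq> q'" "p' \<noteq> q" "p \<notin> g" "q \<notin> g" using dj p' q' by blast+
    have "\<exists>C\<in>\<C>. {p, q} \<in> edges C \<and> g \<in> edges C"
      by (rule pentagon[OF \<xi>(1)[unfolded p'(1) q'(1)] \<xi>(2) fr]) (use eG eF p(3,4) p' q' dd 3 in simp_all)
    then obtain C4 where C4: "C4 \<in> \<C>" "{p, q} \<in> edges C4" "g \<in> edges C4" by blast
    show ?thesis by (rule joined_not_in_F[OF C1 C2 C3 no dj p 3 C4])
  qed
qed

text \<open>By \<open>share\<close> the three edges are disjoint, and by \<open>joined\<close> no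
  edge outside \<open>F\<close> joins two of them. This is a diverse trinity, so the claw
  contradicts (E3).\<close>

lemma no_three:
  assumes at: "attachment \<eta> G B e" "attachment \<eta> G B f" "attachment \<eta> G B g" and d: "distinct [e, f, g]"
    and no: "\<And>C. C \<in> \<C> \<Longrightarrow> e \<in> edges C \<Longrightarrow> f \<in> edges C \<Longrightarrow> g \<in> edges C \<Longrightarrow> False"
  shows False
proof -
  have ne: "e \<noteq> f" "e \<noteq> g" "f \<noteq> g" using d by auto
  have d2: "distinct [e, g, f]" "distinct [f, g, e]" using ne by auto
  have no2: False if "C \<in> \<C>" "e \<in> edges C" "g \<in> edges C" "f \<in> edges C" for C by (rule no[OF that(1,2,4,3)])
  have no3: False if "C \<in> \<C>" "f \<in> edges C" "g \<in> edges C" "e \<in> edges C" for C by (rule no[OF that(1,4,2,3)])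
  have s1: False if v: "v \<in> e" "v \<in> f" for v by (rule share[OF at d no v])
  have s2: False if v: "v \<in> e" "v \<in> g" for v by (rule share[OF at(1,3,2) d2(1) no2 v])
  have s3: False if v: "v \<in> f" "v \<in> g" for v by (rule share[OF at(2,3,1) d2(2) no3 v])
  have dj: "e \<inter> f = {}" "e \<inter> g = {}" "f \<inter> g = {}" using s1 s2 s3 by blast+
  have dj': "g \<inter> f = {}" "g \<inter> e = {}" "f \<inter> e = {}" using dj by auto
  have eG: "e \<in> edges G" "f \<in> edges G" "g \<in> edges G" using at by (simp_all add: attachment_def)
  have C: "\<exists>C\<in>\<C>. e \<in> edges C \<and> f \<in> edges C" "\<exists>C\<in>\<C>. e \<in> edges C \<and> g \<in> edges C" "\<exists>C\<in>\<C>. f \<in> edges C \<and> g \<in> edges C"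
    using pair[OF at(1,2) ne(1)] pair[OF at(1,3) ne(2)] pair[OF at(2,3) ne(3)] by auto
  have eF: "e \<notin> edges F" "f \<notin> edges F" "g \<notin> edges F" using C mem(2) by blast+
  have j1: "\<not> ({p, q} \<in> edges G \<and> {p, q} \<notin> edges F)" if pq: "p \<in> e" "q \<in> f" for p q
  proof
    assume "{p, q} \<in> edges G \<and> {p, q} \<notin> edges F"
    then have t: "p \<in> e" "q \<in> f" "{p, q} \<in> edges G" "{p, q} \<notin> edges F" using pq by simp_all
    show False by (rule joined[OF at d no dj(1,3,2) t])
  qed
  have j2: "\<not> ({p, q} \<in> edges G \<and> {p, q} \<notin> edges F)" if pq: "p \<in> e" "q \<in> g" for p q
  proof
    assume "{p, q} \<in> edges G \<and> {p, q} \<notin> edges F"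
    then have t: "p \<in> e" "q \<in> g" "{p, q} \<in> edges G" "{p, q} \<notin> edges F" using pq by simp_all
    show False by (rule joined[OF at(1,3,2) d2(1) no2 dj(2) dj'(1) dj(1) t])
  qed
  have j3: "\<not> ({p, q} \<in> edges G \<and> {p, q} \<notin> edges F)" if pq: "p \<in> f" "q \<in> g" for p q
  proof
    assume "{p, q} \<in> edges G \<and> {p, q} \<notin> edges F"
    then have t: "p \<in> f" "q \<in> g" "{p, q} \<in> edges G" "{p, q} \<notin> edges F" using pq by simp_all
    show False by (rule joined[OF at(2,3,1) d2(2) no3 dj(3) dj'(2) dj'(3) t])
  qed
  have di: "diverse (delete_edges G (edges F)) e f" "diverse (delete_edges G (edges F)) e g" "diverse (delete_edges G (edges F)) f g"
    unfolding diverse_def adjacent_def delete_edges_def graph.sel using eG eF dj j1 j2 j3 by simp_all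
  have "trinity G \<C> e f g" unfolding trinity_def using eG d C no by auto
  then have dt: "diverse_trinity G F \<C> e f g" unfolding diverse_trinity_def using di by simp
  obtain x y z w where fr: "distinct [x, y, z, w]" "{x, y, z, w} \<inter> verts G = {}" by (rule fresh4)
  obtain \<xi> where \<xi>: "hom_embedding \<xi> (claw G e f g x y z w) H" "extends \<xi> \<eta>F F" using three[OF at d fr] by blast
  have "plus3 G e f g (claw G e f g x y z w)"
    unfolding plus3_def claw_def using eG dj fr by blast
  then show False using e3[unfolded E3_def, rule_format, OF dt] \<xi> by blast
qed

text \<open>Since attachments are pairwise compatible, \<open>helly\<close> reduces a failure to
  three of them. That lemma needs a nonempty set, which \<open>bridge_no_attachment\<close>
  provides.\<close>

lemma common_member: "\<exists>C\<in>\<C>. \<forall>e. attachment \<eta> G B e \<longrightarrow> e \<in> edges C"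
proof (rule ccontr)
  assume n: "\<not> ?thesis"
  let ?Z = "{e. attachment \<eta> G B e}"
  have "?Z \<subseteq> edges G - edges F"
  proof
    fix e assume "e \<in> ?Z"
    then have "attachment \<eta> G B e" by simp
    then show "e \<in> edges G - edges F" by (rule feet) simp
  qed
  moreover have "?Z \<noteq> {}" using bridge_no_attachment[OF \<eta> G H(2) _ B] by simp
  moreover have "\<not> (\<exists>C\<in>\<C>. ?Z \<subseteq> edges C)" using n by blast
  ultimately have "\<exists>e\<in>?Z. \<exists>f\<in>?Z. \<exists>g\<in>?Z. distinct [e, f, g] \<and> \<not> (\<exists>C\<in>\<C>. {e, f, g} \<subseteq> edges C)"
    by (intro helly) (use pair in simp_all)
  then obtain e f g where efg: "attachment \<eta> G B e" "attachment \<eta> G B f" "attachment \<eta> G B g" "distinct [e, f, g]"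
      and none: "\<not> (\<exists>C\<in>\<C>. {e, f, g} \<subseteq> edges C)" by (elim bexE conjE) (simp only: mem_Collect_eq)
  show False
  proof (rule no_three[OF efg])
    fix C assume "C \<in> \<C>" "e \<in> edges C" "f \<in> edges C" "g \<in> edges C"
    then show False using none by simp
  qed
qed

end

theorem theorem4p6:
  fixes G F :: "'a::infinite graph" and \<C> :: "'a graph set"
    and H :: "'b graph" and \<eta>\<^sub>F \<eta> :: "('a, 'b) embedding" and B :: "'b graph"
  assumes "framework G F \<C>"
    and "hom_embedding \<eta>\<^sub>F F H"
    and "E1 F \<C> H \<eta>\<^sub>F"
    and "E2 G F \<C> H \<eta>\<^sub>F"
    and "E3 G F \<C> H \<eta>\<^sub>F"
    and "E4 G F \<C> H \<eta>\<^sub>F"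
    and "E5 G F \<C> H \<eta>\<^sub>F"
    and "E6 G F \<C> H \<eta>\<^sub>F"
    and "E7 G F \<C> H \<eta>\<^sub>F"
    and "hom_embedding \<eta> G H"
    and "extends \<eta> \<eta>\<^sub>F F"
    and "bridge \<eta> G H B"
  shows "\<exists>C\<in>\<C>. \<forall>e. attachment \<eta> G B e \<longrightarrow> e \<in> edges C"
proof -
  have "bridged G F \<C> H \<eta>\<^sub>F \<eta> B"
    unfolding bridged_def bridged_axioms_def setting_def setting_axioms_def frame_def by (intro conjI assms)
  then show ?thesis by (rule bridged.common_member)
qed

end
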